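(* Let $(A,\mathfrak m)$ be a Henselian Gorenstein local ring and let $(B,\mathfrak n)$ be another Gorenstein local ring (not necessarily Henselian). Let $\Psi\colon\underline{\mathrm{CM}}(A)\to\underline{\mathrm{CM}}(B)$ be a triangulated functor. Assume $\ker\Psi$ is a proper thick subcategory of $\underline{\mathrm{CM}}(A)$. Then $(\underline{\mathrm{CM}}(A),\ker\Psi)$ is a rigid pair.
   Context: All rings are commutative Noetherian. For a Gorenstein local ring $A$, $\underline{\mathrm{CM}}(A)$ is the stable category of finitely generated maximal Cohen-Macaulay (MCM) $A$-modules (zero included): morphisms are $A$-linear maps modulo those that factor through a finitely generated free module; it is triangulated with shift the co-syzygy functor $\Omega^{-1}$. If $A$ is Henselian, $\underline{\mathrm{CM}}(A)$ is a Krull-Remak-Schmidt (KRS) category. $\ker\Psi$ is the full subcategory of objects sent to zero. Rigid pairs: let $\mathcal C$ be a KRS triangulated category with shift $[1]$ and $\mathcal D$ a proper thick subcategory of $\mathcal C$. For $M\in\mathcal C$ write $M\cong M_1^{a_1}\oplus\cdots\oplus M_n^{a_n}$ with the $M_i$ indecomposable, pairwise non-isomorphic and $a_i\ge1$. Define $\alpha_{\mathcal C,\mathcal D}(M)=\sum_{i:\,M_i\notin\mathcal D}a_i$ (so it is $0$ if every $M_i\in\mathcal D$). Let $r(\mathcal C,\mathcal D,M)$ be the collection of triangles $N\to E\to M\to N[1]$ with $N\in\mathcal D$, and $l(\mathcal C,\mathcal D,M)$ the collection of triangles $M\to E\to N\to M[1]$ with $N\in\mathcal D$. For a triangle $t$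 in either collection with middle term $E$ put $\alpha_{\mathcal C,\mathcal D}(t)=\alpha_{\mathcal C,\mathcal D}(E)$. Set $r_0(\mathcal C,\mathcal D,M)=\sup\{\alpha_{\mathcal C,\mathcal D}(t)\mid t\in r(\mathcal C,\mathcal D,M)\}$ and $l_0(\mathcal C,\mathcal D,M)=\sup\{\alpha_{\mathcal C,\mathcal D}(t)\mid t\in l(\mathcal C,\mathcal D,M)\}$. The pair $(\mathcal C,\mathcal D)$ is rigid if $r_0(\mathcal C,\mathcal D,M)$ and $l_0(\mathcal C,\mathcal D,M)$ are finite for all $M\in\mathcal C$. *)

theory Defs
  imports "HOL-Algebra.Module" "HOL-Algebra.UnivPoly" "HOL-Algebra.Ring_Divisibility"
    "HOL-Library.Extended_Nat"
begin

section \<open>Modules over a commutative ring\<close>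

text \<open>All modules live in one fixed carrier type. It contains a copy of every finitely generated
  module: the quotient of $R^n$ by a submodule consists of cosets, that is, of sets of functions
  \<open>nat \<Rightarrow> 'a\<close> supported on $\{0, \dots, n-1\}$. It also has room for the injective
  hulls of such modules over a Noetherian ring.\<close>

type_synonym 'a umod = "('a, (nat \<Rightarrow> 'a) set) module"

type_synonym 'a umap = "(nat \<Rightarrow> 'a) set \<Rightarrow> (nat \<Rightarrow> 'a) set"

text \<open>Linear maps are not required to be extensional; two maps that agree on the carrier of the
  source are never distinguished below.\<close>

definition mod_hom ::
  "('a, 'r) ring_scheme \<Rightarrow> ('a, 'm) module \<Rightarrow> ('a, 'n) module \<Rightarrow> ('m \<Rightarrow> 'n) set" where
  "mod_hom R M N = {f \<in> carrier M \<rightarrow> carrier N.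
     (\<forall>x\<in>carrier M. \<forall>y\<in>carrier M. f (x \<oplus>\<^bsub>M\<^esub> y) = f x \<oplus>\<^bsub>N\<^esub> f y) \<and>
     (\<forall>a\<in>carrier R. \<forall>x\<in>carrier M. f (a \<odot>\<^bsub>M\<^esub> x) = a \<odot>\<^bsub>N\<^esub> f x)}"

definition short_exact :: "('a, 'r) ring_scheme \<Rightarrow> ('a, 'l) module \<Rightarrow> ('a, 'm) module \<Rightarrow>
    ('a, 'n) module \<Rightarrow> ('l \<Rightarrow> 'm) \<Rightarrow> ('m \<Rightarrow> 'n) \<Rightarrow> bool" where
  "short_exact R L M N f g \<longleftrightarrow>
     f \<in> mod_hom R L M \<and> g \<in> mod_hom R M N \<and> inj_on f (carrier L) \<and>
     f ` carrier L = {x \<in> carrier M. g x = \<zero>\<^bsub>N\<^esub>} \<and> g ` carrier M = carrier N"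

definition mod_span :: "('a, 'r) ring_scheme \<Rightarrow> ('a, 'm) module \<Rightarrow> 'm set \<Rightarrow> 'm set" where
  "mod_span R M S = \<Inter>{N. submodule N R M \<and> S \<subseteq> N}"

definition fin_gen :: "('a, 'r) ring_scheme \<Rightarrow> ('a, 'm) module \<Rightarrow> bool" where
  "fin_gen R M \<longleftrightarrow> (\<exists>S. finite S \<and> S \<subseteq> carrier M \<and> mod_span R M S = carrier M)"

definition fg_free :: "('a, 'r) ring_scheme \<Rightarrow> ('a, 'm) module \<Rightarrow> bool" where
  "fg_free R F \<longleftrightarrow> module R F \<and> (\<exists>B. finite B \<and> B \<subseteq> carrier F \<and>
     (\<forall>x\<in>carrier F. \<exists>!c. c \<in> B \<rightarrow>\<^sub>E carrier R \<and> x = (\<Oplus>\<^bsub>F\<^esub>b\<in>B. c b \<odot>\<^bsub>F\<^esub> b)))"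

definition regular_module :: "('a, 'r) ring_scheme \<Rightarrow> ('a, 'a) module" where
  "regular_module R = \<lparr>carrier = carrier R, monoid.mult = monoid.mult R, one = one R, ring.zero = ring.zero R,
     ring.add = ring.add R, smult = monoid.mult R\<rparr>"

text \<open>The test modules have the same carrier type as \<open>I\<close>. In the type \<open>'a umod\<close> this
  includes copies of the ideals of \<open>R\<close> and of \<open>R\<close> itself, so by Baer's criterion
  this is the usual notion.\<close>

definition injective_module :: "('a, 'r) ring_scheme \<Rightarrow> ('a, 'm) module \<Rightarrow> bool" where
  "injective_module R I \<longleftrightarrow> module R I \<and>
     (\<forall>(X :: ('a, 'm) module) (Y :: ('a, 'm) module) j f.
        module R X \<and> module R Y \<and> j \<in> mod_hom R X Y \<and> inj_on j (carrier X) \<and>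
        f \<in> mod_hom R X I \<longrightarrow>
        (\<exists>g\<in>mod_hom R Y I. \<forall>x\<in>carrier X. g (j x) = f x))"

text \<open>$0 \to M \to I_0 \to I_1 \to \cdots$ is exact with every $I_i$ injective and $I_i = 0$
  for $i > n$.\<close>

definition finite_injdim :: "('a, 'r) ring_scheme \<Rightarrow> ('a, 'm) module \<Rightarrow> bool" where
  "finite_injdim R M \<longleftrightarrow>
     (\<exists>(n :: nat) (I :: nat \<Rightarrow> 'a umod) \<epsilon> d.
        (\<forall>i. injective_module R (I i)) \<and> (\<forall>i>n. carrier (I i) = {\<zero>\<^bsub>I i\<^esub>}) \<and>
        \<epsilon> \<in> mod_hom R M (I 0) \<and> inj_on \<epsilon> (carrier M) \<and>
        \<epsilon> ` carrier M = {x \<in> carrier (I 0). d 0 x = \<zero>\<^bsub>I (Suc 0)\<^esub>} \<and>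
        (\<forall>i. d i \<in> mod_hom R (I i) (I (Suc i)) \<and>
             d i ` carrier (I i) =
               {x \<in> carrier (I (Suc i)). d (Suc i) x = \<zero>\<^bsub>I (Suc (Suc i))\<^esub>}))"


section \<open>Local rings\<close>

definition noetherian_local_ring :: "('a, 'r) ring_scheme \<Rightarrow> bool" where
  "noetherian_local_ring R \<longleftrightarrow>
     cring R \<and> noetherian_ring R \<and> (\<exists>!\<mm>. maximalideal \<mm> R)"

definition max_ideal :: "('a, 'r) ring_scheme \<Rightarrow> 'a set" where
  "max_ideal R = (THE \<mm>. maximalideal \<mm> R)"

definition gorenstein_local_ring :: "('a, 'r) ring_scheme \<Rightarrow> bool" where
  "gorenstein_local_ring R \<longleftrightarrow>
     noetherian_local_ring R \<and> finite_injdim R (regular_module R)"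

definition UP_deriv :: "('a, 'r) ring_scheme \<Rightarrow> (nat \<Rightarrow> 'a) \<Rightarrow> (nat \<Rightarrow> 'a)" where
  "UP_deriv R f = (\<lambda>n. add_pow R (Suc n) (f (Suc n)))"

text \<open>For a local ring: every simple root in the residue field of a monic polynomial over
  \<open>R\<close> lifts to a root in \<open>R\<close>.\<close>

definition henselian :: "('a, 'r) ring_scheme \<Rightarrow> bool" where
  "henselian R \<longleftrightarrow>
     (\<forall>f\<in>carrier (UP R). coeff (UP R) f (deg R f) = \<one>\<^bsub>R\<^esub> \<longrightarrow>
       (\<forall>a\<in>carrier R.
          eval R R id a f \<in> max_ideal R \<and> eval R R id a (UP_deriv R f) \<notin> max_ideal R \<longrightarrow>
          (\<exists>b\<in>carrier R. eval R R id b f = \<zero>\<^bsub>R\<^esub> \<and> b \<ominus>\<^bsub>R\<^esub> a \<in> max_ideal R)))"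

definition krull_dim :: "('a, 'r) ring_scheme \<Rightarrow> enat" where
  "krull_dim R = Sup {enat n | n. \<exists>P. (\<forall>i\<le>n. primeideal (P i) R) \<and> (\<forall>i<n. P i \<subset> P (Suc i))}"

definition seq_mult :: "('a, 'r) ring_scheme \<Rightarrow> ('a, 'm) module \<Rightarrow> 'a list \<Rightarrow> 'm set" where
  "seq_mult R M xs = mod_span R M {a \<odot>\<^bsub>M\<^esub> x | a x. a \<in> set xs \<and> x \<in> carrier M}"

definition regular_seq :: "('a, 'r) ring_scheme \<Rightarrow> ('a, 'm) module \<Rightarrow> 'a list \<Rightarrow> bool" where
  "regular_seq R M xs \<longleftrightarrow> set xs \<subseteq> carrier R \<and> seq_mult R M xs \<noteq> carrier M \<and>
     (\<forall>k<length xs. \<forall>x\<in>carrier M.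
        (xs ! k) \<odot>\<^bsub>M\<^esub> x \<in> seq_mult R M (take k xs) \<longrightarrow> x \<in> seq_mult R M (take k xs))"

definition depth :: "('a, 'r) ring_scheme \<Rightarrow> ('a, 'm) module \<Rightarrow> enat" where
  "depth R M = Sup {enat (length xs) | xs. set xs \<subseteq> max_ideal R \<and> regular_seq R M xs}"

definition MCM :: "('a, 'r) ring_scheme \<Rightarrow> ('a, 'm) module \<Rightarrow> bool" where
  "MCM R M \<longleftrightarrow> module R M \<and> fin_gen R M \<and>
     (carrier M = {\<zero>\<^bsub>M\<^esub>} \<or> depth R M = krull_dim R)"


section \<open>Additive categories with shift and triangles\<close>

text \<open>These records carry only the data of a (pre)additive and of a triangulated category.\<close>

record ('o, 'f) add_cat =
  Obj :: "'o set"
  Hom :: "'o \<Rightarrow> 'o \<Rightarrow> 'f set"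
  Ident :: "'o \<Rightarrow> 'f"
  Comp :: "'f \<Rightarrow> 'f \<Rightarrow> 'f" (infixl "\<bullet>\<index>" 70)
  Plus :: "'f \<Rightarrow> 'f \<Rightarrow> 'f"
  Null :: "'o \<Rightarrow> 'o \<Rightarrow> 'f"

record ('o, 'f) shift_cat = "('o, 'f) add_cat" +
  shift_obj :: "'o \<Rightarrow> 'o"
  shift_arr :: "'f \<Rightarrow> 'f"

text \<open>The tuple \<open>(X, Y, Z, u, v, w)\<close> stands for $X \to Y \to Z \to X[1]$.\<close>

type_synonym ('o, 'f) triangle = "'o \<times> 'o \<times> 'o \<times> 'f \<times> 'f \<times> 'f"

record ('o, 'f) tri_cat = "('o, 'f) shift_cat" +
  Tri :: "('o, 'f) triangle set"

definition is_iso :: "('o, 'f, 'x) add_cat_scheme \<Rightarrow> 'o \<Rightarrow> 'o \<Rightarrow> 'f \<Rightarrow> bool" where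
  "is_iso C X Y f \<longleftrightarrow> f \<in> Hom C X Y \<and>
     (\<exists>g\<in>Hom C Y X. g \<bullet>\<^bsub>C\<^esub> f = Ident C X \<and> f \<bullet>\<^bsub>C\<^esub> g = Ident C Y)"

definition isomorphic :: "('o, 'f, 'x) add_cat_scheme \<Rightarrow> 'o \<Rightarrow> 'o \<Rightarrow> bool" where
  "isomorphic C X Y \<longleftrightarrow> (\<exists>f. is_iso C X Y f)"

definition zero_object :: "('o, 'f, 'x) add_cat_scheme \<Rightarrow> 'o \<Rightarrow> bool" where
  "zero_object C Z \<longleftrightarrow> Z \<in> Obj C \<and>
     (\<forall>X\<in>Obj C. (\<exists>!f. f \<in> Hom C X Z) \<and> (\<exists>!f. f \<in> Hom C Z X))"

definition direct_sum :: "('o, 'f, 'x) add_cat_scheme \<Rightarrow> 'o list \<Rightarrow> 'o \<Rightarrow> bool" where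
  "direct_sum C Xs S \<longleftrightarrow> set Xs \<subseteq> Obj C \<and> S \<in> Obj C \<and>
     (\<exists>\<iota> \<pi>.
        (\<forall>k<length Xs. \<iota> k \<in> Hom C (Xs ! k) S \<and> \<pi> k \<in> Hom C S (Xs ! k) \<and>
           \<pi> k \<bullet>\<^bsub>C\<^esub> \<iota> k = Ident C (Xs ! k)) \<and>
        (\<forall>j<length Xs. \<forall>k<length Xs. j \<noteq> k \<longrightarrow> \<pi> j \<bullet>\<^bsub>C\<^esub> \<iota> k = Null C (Xs ! k) (Xs ! j)) \<and>
        foldr (Plus C) (map (\<lambda>k. \<iota> k \<bullet>\<^bsub>C\<^esub> \<pi> k) [0..<length Xs]) (Null C S S) = Ident C S)"

definition indecomposable :: "('o, 'f, 'x) add_cat_scheme \<Rightarrow> 'o \<Rightarrow> bool" where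
  "indecomposable C X \<longleftrightarrow> X \<in> Obj C \<and> \<not> zero_object C X \<and>
     (\<forall>Y Z. direct_sum C [Y, Z] X \<longrightarrow> zero_object C Y \<or> zero_object C Z)"

definition triangle_iso ::
  "('o, 'f, 'x) shift_cat_scheme \<Rightarrow> ('o, 'f) triangle \<Rightarrow> ('o, 'f) triangle \<Rightarrow> bool" where
  "triangle_iso C = (\<lambda>(X, Y, Z, u, v, w) (X', Y', Z', u', v', w').
     \<exists>a b c. is_iso C X X' a \<and> is_iso C Y Y' b \<and> is_iso C Z Z' c \<and>
       b \<bullet>\<^bsub>C\<^esub> u = u' \<bullet>\<^bsub>C\<^esub> a \<and> c \<bullet>\<^bsub>C\<^esub> v = v' \<bullet>\<^bsub>C\<^esub> b \<and>
       shift_arr C a \<bullet>\<^bsub>C\<^esub> w = w' \<bullet>\<^bsub>C\<^esub> c)"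

text \<open>A full subcategory is given by its set of objects.\<close>

definition thick :: "('o, 'f, 'x) tri_cat_scheme \<Rightarrow> 'o set \<Rightarrow> bool" where
  "thick C D \<longleftrightarrow> D \<subseteq> Obj C \<and> D \<noteq> {} \<and>
     (\<forall>X\<in>D. \<forall>Y\<in>Obj C. isomorphic C X Y \<longrightarrow> Y \<in> D) \<and>
     (\<forall>X\<in>Obj C. shift_obj C X \<in> D \<longleftrightarrow> X \<in> D) \<and>
     (\<forall>(X, Y, Z, u, v, w)\<in>Tri C.
        (X \<in> D \<and> Y \<in> D \<longrightarrow> Z \<in> D) \<and> (Y \<in> D \<and> Z \<in> D \<longrightarrow> X \<in> D) \<and>
        (X \<in> D \<and> Z \<in> D \<longrightarrow> Y \<in> D)) \<and>
     (\<forall>X Y S. direct_sum C [X, Y] S \<and> S \<in> D \<longrightarrow> X \<in> D \<and> Y \<in> D)"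

definition proper_thick :: "('o, 'f, 'x) tri_cat_scheme \<Rightarrow> 'o set \<Rightarrow> bool" where
  "proper_thick C D \<longleftrightarrow> thick C D \<and> D \<noteq> Obj C"

text \<open>A triangulated functor comes with a natural isomorphism $F(X[1]) \cong (FX)[1]$, the
  field \<open>fshift\<close>.\<close>

record ('o, 'f, 'p, 'g) tri_functor =
  fobj :: "'o \<Rightarrow> 'p"
  farr :: "'f \<Rightarrow> 'g"
  fshift :: "'o \<Rightarrow> 'g"

definition triangulated_functor :: "('o, 'f, 'x) tri_cat_scheme \<Rightarrow> ('p, 'g, 'y) tri_cat_scheme \<Rightarrow>
    ('o, 'f, 'p, 'g, 'z) tri_functor_scheme \<Rightarrow> bool" where
  "triangulated_functor C C' F \<longleftrightarrow>
     (\<forall>X\<in>Obj C. fobj F X \<in> Obj C' \<and> farr F (Ident C X) = Ident C' (fobj F X)) \<and>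
     (\<forall>X\<in>Obj C. \<forall>Y\<in>Obj C. \<forall>f\<in>Hom C X Y. farr F f \<in> Hom C' (fobj F X) (fobj F Y)) \<and>
     (\<forall>X\<in>Obj C. \<forall>Y\<in>Obj C. \<forall>Z\<in>Obj C. \<forall>f\<in>Hom C X Y. \<forall>g\<in>Hom C Y Z.
        farr F (g \<bullet>\<^bsub>C\<^esub> f) = farr F g \<bullet>\<^bsub>C'\<^esub> farr F f) \<and>
     (\<forall>X\<in>Obj C. \<forall>Y\<in>Obj C. \<forall>f\<in>Hom C X Y. \<forall>g\<in>Hom C X Y.
        farr F (Plus C f g) = Plus C' (farr F f) (farr F g)) \<and>
     (\<forall>X\<in>Obj C. is_iso C' (fobj F (shift_obj C X)) (shift_obj C' (fobj F X)) (fshift F X)) \<and>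
     (\<forall>X\<in>Obj C. \<forall>Y\<in>Obj C. \<forall>f\<in>Hom C X Y.
        fshift F Y \<bullet>\<^bsub>C'\<^esub> farr F (shift_arr C f) = shift_arr C' (farr F f) \<bullet>\<^bsub>C'\<^esub> fshift F X) \<and>
     (\<forall>(X, Y, Z, u, v, w)\<in>Tri C.
        (fobj F X, fobj F Y, fobj F Z, farr F u, farr F v, fshift F X \<bullet>\<^bsub>C'\<^esub> farr F w) \<in> Tri C')"

definition functor_ker :: "('o, 'f, 'x) tri_cat_scheme \<Rightarrow> ('p, 'g, 'y) tri_cat_scheme \<Rightarrow>
    ('o, 'f, 'p, 'g, 'z) tri_functor_scheme \<Rightarrow> 'o set" where
  "functor_ker C C' F = {X \<in> Obj C. zero_object C' (fobj F X)}"


section \<open>Rigid pairs\<close>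

text \<open>The list \<open>[(M\<^sub>1, a\<^sub>1), \<dots>, (M\<^sub>n, a\<^sub>n)]\<close> stands for
  $M \cong M_1^{a_1} \oplus \cdots \oplus M_n^{a_n}$.\<close>

definition decomposition ::
  "('o, 'f, 'x) add_cat_scheme \<Rightarrow> 'o \<Rightarrow> ('o \<times> nat) list \<Rightarrow> bool" where
  "decomposition C M ms \<longleftrightarrow>
     (\<forall>(X, a)\<in>set ms. indecomposable C X \<and> a \<ge> 1) \<and>
     (\<forall>i<length ms. \<forall>j<length ms. i \<noteq> j \<longrightarrow> \<not> isomorphic C (fst (ms ! i)) (fst (ms ! j))) \<and>
     direct_sum C (concat (map (\<lambda>(X, a). replicate a X) ms)) M"

text \<open>In a Krull-Remak-Schmidt category a decomposition exists and, for \<open>D\<close> closed under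
  isomorphism, the number below does not depend on it.\<close>

definition alpha :: "('o, 'f, 'x) add_cat_scheme \<Rightarrow> 'o set \<Rightarrow> 'o \<Rightarrow> nat" where
  "alpha C D M = (SOME n. \<exists>ms. decomposition C M ms \<and>
     n = (\<Sum>(X, a)\<leftarrow>ms. if X \<in> D then 0 else a))"

definition r_triangles :: "('o, 'f, 'x) tri_cat_scheme \<Rightarrow> 'o set \<Rightarrow> 'o \<Rightarrow> ('o, 'f) triangle set" where
  "r_triangles C D M = {(N, E, M', u, v, w). (N, E, M', u, v, w) \<in> Tri C \<and> N \<in> D \<and> M' = M}"

definition l_triangles :: "('o, 'f, 'x) tri_cat_scheme \<Rightarrow> 'o set \<Rightarrow> 'o \<Rightarrow> ('o, 'f) triangle set" where
  "l_triangles C D M = {(M', E, N, u, v, w). (M', E, N, u, v, w) \<in> Tri C \<and> N \<in> D \<and> M' = M}"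

definition alpha_tri :: "('o, 'f, 'x) tri_cat_scheme \<Rightarrow> 'o set \<Rightarrow> ('o, 'f) triangle \<Rightarrow> nat" where
  "alpha_tri C D = (\<lambda>(X, E, Y, u, v, w). alpha C D E)"

definition r0 :: "('o, 'f, 'x) tri_cat_scheme \<Rightarrow> 'o set \<Rightarrow> 'o \<Rightarrow> enat" where
  "r0 C D M = (SUP t\<in>r_triangles C D M. enat (alpha_tri C D t))"

definition l0 :: "('o, 'f, 'x) tri_cat_scheme \<Rightarrow> 'o set \<Rightarrow> 'o \<Rightarrow> enat" where
  "l0 C D M = (SUP t\<in>l_triangles C D M. enat (alpha_tri C D t))"

text \<open>Meaningful for a Krull-Remak-Schmidt triangulated category \<open>C\<close>.\<close>

definition rigid_pair :: "('o, 'f, 'x) tri_cat_scheme \<Rightarrow> 'o set \<Rightarrow> bool" where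
  "rigid_pair C D \<longleftrightarrow> proper_thick C D \<and>
     (\<forall>M\<in>Obj C. r0 C D M \<noteq> \<infinity> \<and> l0 C D M \<noteq> \<infinity>)"


section \<open>The stable category of maximal Cohen-Macaulay modules\<close>

text \<open>\<open>f - g\<close> factors through a finitely generated free module.\<close>

definition stably_equal ::
  "('a, 'r) ring_scheme \<Rightarrow> 'a umod \<Rightarrow> 'a umod \<Rightarrow> 'a umap \<Rightarrow> 'a umap \<Rightarrow> bool" where
  "stably_equal R M N f g \<longleftrightarrow>
     (\<exists>(F :: 'a umod) p q. fg_free R F \<and> p \<in> mod_hom R M F \<and> q \<in> mod_hom R F N \<and>
        (\<forall>x\<in>carrier M. f x \<ominus>\<^bsub>N\<^esub> g x = q (p x)))"

text \<open>An arrow records its source, its target and a class of linear maps modulo stable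
  equality.\<close>

type_synonym 'a stable_arr = "'a umod \<times> 'a umod \<times> 'a umap set"

definition stable_class :: "('a, 'r) ring_scheme \<Rightarrow> 'a umod \<Rightarrow> 'a umod \<Rightarrow> 'a umap \<Rightarrow> 'a stable_arr" where
  "stable_class R M N f = (M, N, {g \<in> mod_hom R M N. stably_equal R M N f g})"

definition stable_comp :: "('a, 'r) ring_scheme \<Rightarrow> 'a stable_arr \<Rightarrow> 'a stable_arr \<Rightarrow> 'a stable_arr" where
  "stable_comp R = (\<lambda>(_, P, \<psi>) (M, _, \<phi>).
     (M, P, {h \<in> mod_hom R M P. \<exists>g\<in>\<psi>. \<exists>f\<in>\<phi>. stably_equal R M P (g \<circ> f) h}))"

definition stable_plus :: "('a, 'r) ring_scheme \<Rightarrow> 'a stable_arr \<Rightarrow> 'a stable_arr \<Rightarrow> 'a stable_arr" where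
  "stable_plus R = (\<lambda>(M, N, \<phi>) (_, _, \<psi>).
     (M, N, {h \<in> mod_hom R M N. \<exists>f\<in>\<phi>. \<exists>g\<in>\<psi>. stably_equal R M N (\<lambda>x. f x \<oplus>\<^bsub>N\<^esub> g x) h}))"

text \<open>A chosen exact sequence $0 \to M \to F \to \Omega^{-1}M \to 0$ with \<open>F\<close> finitely
  generated free and the cokernel maximal Cohen-Macaulay; it exists for maximal Cohen-Macaulay
  \<open>M\<close> over a Gorenstein local ring.\<close>

definition cosyz_seq :: "('a, 'r) ring_scheme \<Rightarrow> 'a umod \<Rightarrow> 'a umod \<times> 'a umod \<times> 'a umap \<times> 'a umap" where
  "cosyz_seq R M = (SOME (F, T, i, p). fg_free R F \<and> MCM R T \<and> short_exact R M F T i p)"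

definition cosyz_free :: "('a, 'r) ring_scheme \<Rightarrow> 'a umod \<Rightarrow> 'a umod" where
  "cosyz_free R M = (case cosyz_seq R M of (F, T, i, p) \<Rightarrow> F)"

definition cosyz :: "('a, 'r) ring_scheme \<Rightarrow> 'a umod \<Rightarrow> 'a umod" where
  "cosyz R M = (case cosyz_seq R M of (F, T, i, p) \<Rightarrow> T)"

definition cosyz_incl :: "('a, 'r) ring_scheme \<Rightarrow> 'a umod \<Rightarrow> 'a umap" where
  "cosyz_incl R M = (case cosyz_seq R M of (F, T, i, p) \<Rightarrow> i)"

definition cosyz_proj :: "('a, 'r) ring_scheme \<Rightarrow> 'a umod \<Rightarrow> 'a umap" where
  "cosyz_proj R M = (case cosyz_seq R M of (F, T, i, p) \<Rightarrow> p)"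

text \<open>All maps \<open>g\<close> completing a representative \<open>f\<close> to a morphism of the chosen exact
  sequences; they form one full stable class.\<close>

definition cosyz_arr :: "('a, 'r) ring_scheme \<Rightarrow> 'a stable_arr \<Rightarrow> 'a stable_arr" where
  "cosyz_arr R = (\<lambda>(M, N, \<phi>). (cosyz R M, cosyz R N,
     {g \<in> mod_hom R (cosyz R M) (cosyz R N).
        \<exists>f\<in>\<phi>. \<exists>h\<in>mod_hom R (cosyz_free R M) (cosyz_free R N).
          (\<forall>x\<in>carrier M. h (cosyz_incl R M x) = cosyz_incl R N (f x)) \<and>
          (\<forall>y\<in>carrier (cosyz_free R M). g (cosyz_proj R M y) = cosyz_proj R N (h y))}))"

definition stable_shift_cat :: "('a, 'r) ring_scheme \<Rightarrow> ('a umod, 'a stable_arr) shift_cat" where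
  "stable_shift_cat R =
     \<lparr>Obj = {M. MCM R M},
      Hom = (\<lambda>M N. stable_class R M N ` mod_hom R M N),
      Ident = (\<lambda>M. stable_class R M M id),
      Comp = stable_comp R,
      Plus = stable_plus R,
      Null = (\<lambda>M N. stable_class R M N (\<lambda>_. \<zero>\<^bsub>N\<^esub>)),
      shift_obj = cosyz R,
      shift_arr = cosyz_arr R\<rparr>"

text \<open>The standard triangles are those of Happel for a Frobenius category: \<open>Z\<close> is the
  pushout of \<open>u\<close> along $X \to F$, that is, there is a commutative diagram with exact rows
  $0 \to X \to F \to \Omega^{-1}X \to 0$ and $0 \to Y \to Z \to \Omega^{-1}X \to 0$ that is
  \<open>u\<close> on the left and the identity on the right.\<close>

definition standard_triangles :: "('a, 'r) ring_scheme \<Rightarrow> ('a umod, 'a stable_arr) triangle set" where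
  "standard_triangles R =
     {(X, Y, Z, stable_class R X Y u, stable_class R Y Z v, stable_class R Z (cosyz R X) w)
       | X Y Z u v w. MCM R X \<and> MCM R Y \<and> MCM R Z \<and> u \<in> mod_hom R X Y \<and>
           short_exact R Y Z (cosyz R X) v w \<and>
           (\<exists>k\<in>mod_hom R (cosyz_free R X) Z.
              (\<forall>x\<in>carrier X. k (cosyz_incl R X x) = v (u x)) \<and>
              (\<forall>y\<in>carrier (cosyz_free R X). w (k y) = cosyz_proj R X y))}"

definition distinguished_triangles :: "('a, 'r) ring_scheme \<Rightarrow> ('a umod, 'a stable_arr) triangle set" where
  "distinguished_triangles R = (let C = stable_shift_cat R in
     {(X, Y, Z, u, v, w). X \<in> Obj C \<and> Y \<in> Obj C \<and> Z \<in> Obj C \<and>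
        u \<in> Hom C X Y \<and> v \<in> Hom C Y Z \<and> w \<in> Hom C Z (shift_obj C X) \<and>
        (\<exists>t\<in>standard_triangles R. triangle_iso C t (X, Y, Z, u, v, w))})"

definition stable_CM :: "('a, 'r) ring_scheme \<Rightarrow> ('a umod, 'a stable_arr) tri_cat" where
  "stable_CM R = shift_cat.extend (stable_shift_cat R) (tri_cat.fields (distinguished_triangles R))"

end

(*
  Let M be maximal Cohen-Macaulay over A and let N -> E -> M be a triangle with Psi N = 0. Then
  Psi E is a stable retract of Psi M; likewise for triangles M -> E -> N. A decomposition of E
  gives orthogonal idempotents of Psi E, stably nonzero for the summands outside the kernel, and the
  retract carries them to orthogonal idempotents f_i of Psi M. If Psi M has m generators, there are
  at most m^2 of them: otherwise elimination modulo the maximal ideal gives an index j, a unit v and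
  a map g with image in the maximal ideal times Psi M such that f_j g = v f_j stably, and f_j is
  stably zero because v - g is invertible. This bounds all decompositions of E at
  once, so their uniqueness plays no role.

  For M stably zero, the retract needs that the co-syzygy sequence 0 -> M -> F -> T -> 0 over B
  splits, which follows from Ext^1(T, B) = 0. With Ext computed from a finite injective resolution
  of B, comparing regular sequences with the vanishing of Ext shows that, as soon as there is a
  nonzero maximal Cohen-Macaulay module, dim B is the top degree of Ext into B, and that the maximal
  Cohen-Macaulay modules are then the M with Ext^i(M, B) = 0 for i > 0. Such an M is torsionless,
  and its embedding into a free module by generators of the dual has a cokernel of the same kind.
*)
theory Submission
  imports Defs
begin

section \<open>Submodules and linear maps\<close>

text \<open>Since B need not be Henselian, Psi M need not decompose in a unique way, so the summands
  of Psi E cannot simply be counted inside it, and stable idempotents need not lift to honest ones.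
  Elimination avoids both problems: it uses linear representatives, reads their values on m
  generators as m x m matrices over the residue field, and loses at most one index for each of the
  m^2 entries that it clears. The second obstacle is the choice in \<open>cosyz_seq\<close>. The
  standard triangles refer to a sequence picked by SOME, about which nothing is known until a
  sequence with maximal Cohen-Macaulay cokernel is shown to exist. As \<open>MCM\<close> is a
  condition on depth and dimension, while the Gorenstein condition is given by an injective
  resolution, this existence requires a translation between the two, and that is what most of the
  module theory is for. Ext is only present through cocycles and coboundaries, never as a module, so
  its Nakayama lemma has to descend through syzygies to modules of linear forms. The retracts
  themselves are explicit: the image of a triangle is isomorphic to a standard one, and there they
  are written down in the pushout diagram.\<close>

locale rmodule = module R M
  for R :: "('a, 'r) ring_scheme" (structure) and M :: "('a, 'm) module" (structure)
begin

lemma submoduleI':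
  assumes "H \<subseteq> carrier M" "\<zero>\<^bsub>M\<^esub> \<in> H" "\<And>a b. a \<in> H \<Longrightarrow> b \<in> H \<Longrightarrow> a \<oplus>\<^bsub>M\<^esub> b \<in> H"
    and sm: "\<And>a x. a \<in> carrier R \<Longrightarrow> x \<in> H \<Longrightarrow> a \<odot>\<^bsub>M\<^esub> x \<in> H"
  shows "submodule H R M"
proof (rule submoduleI)
  fix x assume x: "x \<in> H"
  then have "\<ominus>\<^bsub>M\<^esub> x = (\<ominus> \<one>) \<odot>\<^bsub>M\<^esub> x"
    using assms(1) by (subst smult_l_minus) auto
  then show "\<ominus>\<^bsub>M\<^esub> x \<in> H" using sm x by simp
qed (use assms in auto)

lemma submodule_zero: "submodule H R M \<Longrightarrow> \<zero>\<^bsub>M\<^esub> \<in> H"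
  using subgroup.one_closed[OF submodule.axioms(1)] by fastforce

lemma submodule_minus: "submodule H R M \<Longrightarrow> x \<in> H \<Longrightarrow> y \<in> H \<Longrightarrow> x \<ominus>\<^bsub>M\<^esub> y \<in> H"
  using submoduleE(3,5) by (auto simp: a_minus_def)

lemma zero_submodule: "submodule {\<zero>\<^bsub>M\<^esub>} R M"
  by (rule submoduleI') auto

lemma mod_span_least: "submodule N R M \<Longrightarrow> S \<subseteq> N \<Longrightarrow> mod_span R M S \<subseteq> N"
  by (auto simp: mod_span_def)

lemma mod_span_superset: "S \<subseteq> mod_span R M S"
  by (auto simp: mod_span_def)

lemma mod_span_base: "x \<in> S \<Longrightarrow> x \<in> mod_span R M S"
  by (auto simp: mod_span_def)

lemma mod_span_submodule:
  assumes "S \<subseteq> carrier M"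
  shows "submodule (mod_span R M S) R M"
proof (rule submoduleI')
  show "mod_span R M S \<subseteq> carrier M"
    by (rule mod_span_least[OF carrier_is_submodule assms])
qed (auto simp: mod_span_def submodule_zero submoduleE)

lemma mod_span_closed: "S \<subseteq> carrier M \<Longrightarrow> mod_span R M S \<subseteq> carrier M"
  by (rule mod_span_least[OF carrier_is_submodule])

lemma mod_span_mono: "S \<subseteq> T \<Longrightarrow> mod_span R M S \<subseteq> mod_span R M T"
  by (auto simp: mod_span_def)

lemma mod_span_induct [consumes 2, case_names base zero add smult]:
  assumes "x \<in> mod_span R M S" "S \<subseteq> carrier M" "\<And>x. x \<in> S \<Longrightarrow> P x" "P \<zero>\<^bsub>M\<^esub>"
    "\<And>x y. x \<in> carrier M \<Longrightarrow> y \<in> carrier M \<Longrightarrow> P x \<Longrightarrow> P y \<Longrightarrow> P (x \<oplus>\<^bsub>M\<^esub> y)"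
    "\<And>a x. a \<in> carrier R \<Longrightarrow> x \<in> carrier M \<Longrightarrow> P x \<Longrightarrow> P (a \<odot>\<^bsub>M\<^esub> x)"
  shows "P x"
proof -
  have "submodule {x \<in> carrier M. P x} R M"
    by (rule submoduleI') (use assms in auto)
  then have "mod_span R M S \<subseteq> {x \<in> carrier M. P x}"
    by (rule mod_span_least) (use assms in auto)
  then show ?thesis using assms(1) by auto
qed

lemma mod_span_eq: "submodule N R M \<Longrightarrow> mod_span R M N = N"
  using mod_span_least[of N N] mod_span_superset[of N] by auto

lemma mod_span_empty: "mod_span R M {} = {\<zero>\<^bsub>M\<^esub>}"
  using mod_span_least[OF zero_submodule] submodule_zero[OF mod_span_submodule[of "{}"]] by auto

lemma mod_span_Un:
  assumes "x \<in> mod_span R M (S \<union> T)" "S \<subseteq> carrier M" "T \<subseteq> carrier M"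
  obtains y z where "y \<in> mod_span R M S" "z \<in> mod_span R M T" "x = y \<oplus>\<^bsub>M\<^esub> z"
proof -
  let ?P = "\<lambda>x. \<exists>y\<in>mod_span R M S. \<exists>z\<in>mod_span R M T. x = y \<oplus>\<^bsub>M\<^esub> z"
  note s = mod_span_submodule[OF assms(2)] mod_span_submodule[OF assms(3)]
  note c = mod_span_closed[OF assms(2)] mod_span_closed[OF assms(3)]
  note e1 = submoduleE[OF s(1)] and e2 = submoduleE[OF s(2)]
  note z = submodule_zero[OF s(1)] submodule_zero[OF s(2)]
  have "?P x" using assms(1) Un_least[OF assms(2,3)]
  proof (induction rule: mod_span_induct)
    case (base x)
    then consider "x \<in> mod_span R M S" | "x \<in> mod_span R M T"
      using mod_span_superset by blast
    then show ?case
    proof cases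
      case 1
      then have "x = x \<oplus>\<^bsub>M\<^esub> \<zero>\<^bsub>M\<^esub>" using c by auto
      then show ?thesis using 1 z by blast
    next
      case 2
      then have "x = \<zero>\<^bsub>M\<^esub> \<oplus>\<^bsub>M\<^esub> x" using c by auto
      then show ?thesis using 2 z by blast
    qed
  next
    case zero
    then show ?case using z by (intro bexI[of _ "\<zero>\<^bsub>M\<^esub>"]) auto
  next
    case (add x y)
    then obtain p q r s where *: "p \<in> mod_span R M S" "q \<in> mod_span R M T" "x = p \<oplus>\<^bsub>M\<^esub> q"
      "r \<in> mod_span R M S" "s \<in> mod_span R M T" "y = r \<oplus>\<^bsub>M\<^esub> s" by blast
    then have "x \<oplus>\<^bsub>M\<^esub> y = (p \<oplus>\<^bsub>M\<^esub> r) \<oplus>\<^bsub>M\<^esub> (q \<oplus>\<^bsub>M\<^esub> s)"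
      using c by (simp add: M.a_ac subset_iff)
    moreover have "p \<oplus>\<^bsub>M\<^esub> r \<in> mod_span R M S" "q \<oplus>\<^bsub>M\<^esub> s \<in> mod_span R M T"
      using * e1(5) e2(5) by auto
    ultimately show ?case by blast
  next
    case (smult a x)
    then obtain p q where *: "p \<in> mod_span R M S" "q \<in> mod_span R M T" "x = p \<oplus>\<^bsub>M\<^esub> q" by blast
    then have "a \<odot>\<^bsub>M\<^esub> x = a \<odot>\<^bsub>M\<^esub> p \<oplus>\<^bsub>M\<^esub> a \<odot>\<^bsub>M\<^esub> q"
      using c smult by (simp add: smult_r_distr subset_iff)
    moreover have "a \<odot>\<^bsub>M\<^esub> p \<in> mod_span R M S" "a \<odot>\<^bsub>M\<^esub> q \<in> mod_span R M T"
      using * e1(4) e2(4) smult by auto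
    ultimately show ?case by blast
  qed
  then show ?thesis using that by blast
qed

text \<open>Multiples of one vector by the elements of an ideal already form a submodule, so a
  combination of them collapses to a single multiple. Used for the maximal ideal in Nakayama's lemma
  and for the unit ideal in \<open>mod_span_insert\<close>.\<close>

lemma mod_span_smults:
  assumes "x \<in> mod_span R M {a \<odot>\<^bsub>M\<^esub> w |a. a \<in> I}" "ideal I R" "w \<in> carrier M"
  obtains a where "a \<in> I" "x = a \<odot>\<^bsub>M\<^esub> w"
proof -
  interpret I: ideal I R by fact
  have "{a \<odot>\<^bsub>M\<^esub> w |a. a \<in> I} \<subseteq> carrier M"
    using assms(3) I.Icarr by auto
  with assms(1) have "\<exists>a\<in>I. x = a \<odot>\<^bsub>M\<^esub> w"
  proof (induction rule: mod_span_induct)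
    case zero
    then show ?case using assms(3) by (intro bexI[of _ \<zero>]) auto
  next
    case (add x y)
    then obtain a b where *: "a \<in> I" "b \<in> I" "x = a \<odot>\<^bsub>M\<^esub> w" "y = b \<odot>\<^bsub>M\<^esub> w" by blast
    then have "x \<oplus>\<^bsub>M\<^esub> y = (a \<oplus> b) \<odot>\<^bsub>M\<^esub> w" using assms(3) I.Icarr by (simp add: smult_l_distr)
    then show ?case using * I.a_closed by blast
  next
    case (smult a x)
    then obtain b where *: "b \<in> I" "x = b \<odot>\<^bsub>M\<^esub> w" by blast
    then have "a \<odot>\<^bsub>M\<^esub> x = (a \<otimes> b) \<odot>\<^bsub>M\<^esub> w" using assms(3) smult I.Icarr by (simp add: smult_assoc1)
    then show ?case using * I.I_l_closed smult by blast
  qed auto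
  then show ?thesis using that by blast
qed

lemma mod_span_insert:
  assumes "x \<in> mod_span R M (insert w S)" "w \<in> carrier M" "S \<subseteq> carrier M"
  obtains a y where "a \<in> carrier R" "y \<in> mod_span R M S" "x = a \<odot>\<^bsub>M\<^esub> w \<oplus>\<^bsub>M\<^esub> y"
proof -
  have "w \<in> {a \<odot>\<^bsub>M\<^esub> w |a. a \<in> carrier R}"
    using assms(2) by (auto intro!: exI[of _ \<one>])
  then have "x \<in> mod_span R M ({a \<odot>\<^bsub>M\<^esub> w |a. a \<in> carrier R} \<union> S)"
    using assms(1) mod_span_mono[of "insert w S" "{a \<odot>\<^bsub>M\<^esub> w |a. a \<in> carrier R} \<union> S"] by blast
  then obtain y z where 1: "y \<in> mod_span R M {a \<odot>\<^bsub>M\<^esub> w |a. a \<in> carrier R}" "z \<in> mod_span R M S"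
      "x = y \<oplus>\<^bsub>M\<^esub> z"
    by (rule mod_span_Un) (use assms in auto)
  from 1(1) R.oneideal assms(2) obtain a where "a \<in> carrier R" "y = a \<odot>\<^bsub>M\<^esub> w"
    by (rule mod_span_smults)
  then show ?thesis using 1 that by blast
qed

end

lemma mod_hom_closed: "f \<in> mod_hom R M N \<Longrightarrow> x \<in> carrier M \<Longrightarrow> f x \<in> carrier N"
  by (auto simp: mod_hom_def)

lemma mod_hom_add:
  "f \<in> mod_hom R M N \<Longrightarrow> x \<in> carrier M \<Longrightarrow> y \<in> carrier M \<Longrightarrow> f (x \<oplus>\<^bsub>M\<^esub> y) = f x \<oplus>\<^bsub>N\<^esub> f y"
  by (auto simp: mod_hom_def)

lemma mod_hom_smult:
  "f \<in> mod_hom R M N \<Longrightarrow> a \<in> carrier R \<Longrightarrow> x \<in> carrier M \<Longrightarrow> f (a \<odot>\<^bsub>M\<^esub> x) = a \<odot>\<^bsub>N\<^esub> f x"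
  by (auto simp: mod_hom_def)

lemma mod_homI:
  assumes "\<And>x. x \<in> carrier M \<Longrightarrow> f x \<in> carrier N"
    "\<And>x y. x \<in> carrier M \<Longrightarrow> y \<in> carrier M \<Longrightarrow> f (x \<oplus>\<^bsub>M\<^esub> y) = f x \<oplus>\<^bsub>N\<^esub> f y"
    "\<And>a x. a \<in> carrier R \<Longrightarrow> x \<in> carrier M \<Longrightarrow> f (a \<odot>\<^bsub>M\<^esub> x) = a \<odot>\<^bsub>N\<^esub> f x"
  shows "f \<in> mod_hom R M N"
  using assms by (auto simp: mod_hom_def)

lemma mod_hom_id: "id \<in> mod_hom R M M"
  by (auto simp: mod_hom_def)

lemma mod_hom_comp: "f \<in> mod_hom R M N \<Longrightarrow> g \<in> mod_hom R N P \<Longrightarrow> g \<circ> f \<in> mod_hom R M P"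
  by (auto simp: mod_hom_def Pi_def)

lemma mod_hom_zero:
  assumes "rmodule R M" "rmodule R N" "f \<in> mod_hom R M N"
  shows "f \<zero>\<^bsub>M\<^esub> = \<zero>\<^bsub>N\<^esub>"
proof -
  interpret M: rmodule R M by fact
  interpret N: rmodule R N by fact
  have "f \<zero>\<^bsub>M\<^esub> = f (\<zero>\<^bsub>R\<^esub> \<odot>\<^bsub>M\<^esub> \<zero>\<^bsub>M\<^esub>)" by simp
  also have "\<dots> = \<zero>\<^bsub>R\<^esub> \<odot>\<^bsub>N\<^esub> f \<zero>\<^bsub>M\<^esub>" by (rule mod_hom_smult[OF assms(3)]) auto
  finally show ?thesis using mod_hom_closed[OF assms(3)] by simp
qed

lemma mod_hom_neg:
  assumes "rmodule R M" "rmodule R N" "f \<in> mod_hom R M N" "x \<in> carrier M"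
  shows "f (\<ominus>\<^bsub>M\<^esub> x) = \<ominus>\<^bsub>N\<^esub> f x"
proof -
  interpret M: rmodule R M by fact
  interpret N: rmodule R N by fact
  have "f (\<ominus>\<^bsub>M\<^esub> x) = f ((\<ominus>\<^bsub>R\<^esub> \<one>\<^bsub>R\<^esub>) \<odot>\<^bsub>M\<^esub> x)"
    using assms(4) by (subst M.smult_l_minus) auto
  also have "\<dots> = (\<ominus>\<^bsub>R\<^esub> \<one>\<^bsub>R\<^esub>) \<odot>\<^bsub>N\<^esub> f x" by (rule mod_hom_smult[OF assms(3)]) (use assms in auto)
  also have "\<dots> = \<ominus>\<^bsub>N\<^esub> f x"
    using mod_hom_closed[OF assms(3,4)] by (subst N.smult_l_minus) auto
  finally show ?thesis .
qed

lemma mod_hom_minus: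
  assumes "rmodule R M" "rmodule R N" "f \<in> mod_hom R M N" "x \<in> carrier M" "y \<in> carrier M"
  shows "f (x \<ominus>\<^bsub>M\<^esub> y) = f x \<ominus>\<^bsub>N\<^esub> f y"
proof -
  interpret M: rmodule R M by fact
  show ?thesis
    using mod_hom_add[OF assms(3,4), of "\<ominus>\<^bsub>M\<^esub> y"] mod_hom_neg[OF assms(1-3)] assms(5)
    by (simp add: a_minus_def)
qed

lemma mod_hom_cong:
  assumes "rmodule R M" "f \<in> mod_hom R M N" "\<And>x. x \<in> carrier M \<Longrightarrow> g x = f x"
  shows "g \<in> mod_hom R M N"
proof -
  interpret M: rmodule R M by fact
  show ?thesis by (rule mod_homI) (use assms(2,3) in \<open>auto simp: mod_hom_closed mod_hom_add mod_hom_smult\<close>)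
qed

context rmodule
begin

lemma mod_hom_plus:
  assumes "rmodule R L" "f \<in> mod_hom R L M" "g \<in> mod_hom R L M"
  shows "(\<lambda>x. f x \<oplus>\<^bsub>M\<^esub> g x) \<in> mod_hom R L M"
proof -
  interpret L: rmodule R L by fact
  show ?thesis
    using assms(2,3)
    by (intro mod_homI)
      (auto simp: mod_hom_closed mod_hom_add mod_hom_smult smult_r_distr M.a_ac)
qed

lemma mod_hom_scale:
  assumes "rmodule R L" "f \<in> mod_hom R L M" "a \<in> carrier R"
  shows "(\<lambda>x. a \<odot>\<^bsub>M\<^esub> f x) \<in> mod_hom R L M"
  using assms(2,3)
  by (intro mod_homI)
    (auto simp: mod_hom_closed mod_hom_add mod_hom_smult smult_r_distr R.m_comm simp flip: smult_assoc1)

lemma mod_hom_diff: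
  assumes "rmodule R L" "f \<in> mod_hom R L M" "g \<in> mod_hom R L M"
  shows "(\<lambda>x. f x \<ominus>\<^bsub>M\<^esub> g x) \<in> mod_hom R L M"
proof -
  have "(\<lambda>x. f x \<oplus>\<^bsub>M\<^esub> (\<ominus> \<one>) \<odot>\<^bsub>M\<^esub> g x) \<in> mod_hom R L M"
    by (intro mod_hom_plus mod_hom_scale assms) auto
  moreover have "f x \<ominus>\<^bsub>M\<^esub> g x = f x \<oplus>\<^bsub>M\<^esub> (\<ominus> \<one>) \<odot>\<^bsub>M\<^esub> g x" if "x \<in> carrier L" for x
    using mod_hom_closed[OF assms(3) that] by (simp add: smult_l_minus a_minus_def)
  ultimately show ?thesis
    by (rule mod_hom_cong[OF assms(1)]) auto
qed

lemma mod_hom_null: "(\<lambda>_. \<zero>\<^bsub>M\<^esub>) \<in> mod_hom R L M"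
  by (auto simp: mod_hom_def)

lemma minus_self: "x \<in> carrier M \<Longrightarrow> x \<ominus>\<^bsub>M\<^esub> x = \<zero>\<^bsub>M\<^esub>"
  by (simp add: a_minus_def M.r_neg)

lemma minus_add_cancel:
  "x \<in> carrier M \<Longrightarrow> y \<in> carrier M \<Longrightarrow> (x \<ominus>\<^bsub>M\<^esub> y) \<oplus>\<^bsub>M\<^esub> y = x"
  by (simp add: a_minus_def M.a_assoc M.l_neg)

lemma add_minus_cancel:
  "x \<in> carrier M \<Longrightarrow> y \<in> carrier M \<Longrightarrow> (x \<oplus>\<^bsub>M\<^esub> y) \<ominus>\<^bsub>M\<^esub> y = x"
  by (simp add: a_minus_def M.a_assoc M.r_neg)

lemma eq_minus_iff:
  assumes "x \<in> carrier M" "y \<in> carrier M" "z \<in> carrier M"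
  shows "x = y \<ominus>\<^bsub>M\<^esub> z \<longleftrightarrow> x \<oplus>\<^bsub>M\<^esub> z = y"
  using assms by (auto simp: minus_add_cancel add_minus_cancel)

lemma minus_eq_iff:
  assumes "x \<in> carrier M" "y \<in> carrier M" "z \<in> carrier M"
  shows "y \<ominus>\<^bsub>M\<^esub> z = x \<longleftrightarrow> y = x \<oplus>\<^bsub>M\<^esub> z"
  using assms by (auto simp: minus_add_cancel add_minus_cancel)

lemma minus_eq_zero_iff:
  assumes "x \<in> carrier M" "y \<in> carrier M"
  shows "x \<ominus>\<^bsub>M\<^esub> y = \<zero>\<^bsub>M\<^esub> \<longleftrightarrow> x = y"
  using assms minus_eq_iff[of "\<zero>\<^bsub>M\<^esub>" x y] by simp

lemma smult_minus:
  assumes "a \<in> carrier R" "x \<in> carrier M" "y \<in> carrier M"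
  shows "a \<odot>\<^bsub>M\<^esub> (x \<ominus>\<^bsub>M\<^esub> y) = a \<odot>\<^bsub>M\<^esub> x \<ominus>\<^bsub>M\<^esub> a \<odot>\<^bsub>M\<^esub> y"
  using assms by (simp add: a_minus_def smult_r_distr smult_r_minus)

lemma smult_diff:
  assumes "a \<in> carrier R" "b \<in> carrier R" "x \<in> carrier M"
  shows "(a \<ominus> b) \<odot>\<^bsub>M\<^esub> x = a \<odot>\<^bsub>M\<^esub> x \<ominus>\<^bsub>M\<^esub> b \<odot>\<^bsub>M\<^esub> x"
  using assms by (simp add: a_minus_def smult_l_distr smult_l_minus)

end

lemma bij_mod_hom_inverse:
  assumes "rmodule R M" "rmodule R N" "f \<in> mod_hom R M N" "inj_on f (carrier M)" "f ` carrier M = carrier N"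
  shows "\<exists>g\<in>mod_hom R N M. (\<forall>x\<in>carrier M. g (f x) = x) \<and> (\<forall>y\<in>carrier N. f (g y) = y)"
proof -
  interpret M: rmodule R M by fact
  interpret N: rmodule R N by fact
  let ?g = "inv_into (carrier M) f"
  have gf: "?g (f x) = x" if "x \<in> carrier M" for x using assms(4) that by simp
  have fg: "f (?g y) = y" "?g y \<in> carrier M" if "y \<in> carrier N" for y
    using that assms(5) by (auto simp: f_inv_into_f inv_into_into)
  have "?g \<in> mod_hom R N M"
  proof (rule mod_homI)
    fix x y assume xy: "x \<in> carrier N" "y \<in> carrier N"
    show "?g (x \<oplus>\<^bsub>N\<^esub> y) = ?g x \<oplus>\<^bsub>M\<^esub> ?g y"
      using gf[of "?g x \<oplus>\<^bsub>M\<^esub> ?g y"] mod_hom_add[OF assms(3), of "?g x" "?g y"] fg xy by simp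
  next
    fix a y assume xy: "a \<in> carrier R" "y \<in> carrier N"
    show "?g (a \<odot>\<^bsub>N\<^esub> y) = a \<odot>\<^bsub>M\<^esub> ?g y"
      using gf[of "a \<odot>\<^bsub>M\<^esub> ?g y"] mod_hom_smult[OF assms(3), of a "?g y"] fg xy by simp
  qed (use fg in auto)
  then show ?thesis using gf fg by blast
qed

lemma mod_hom_span:
  assumes "rmodule R M" "rmodule R N" "f \<in> mod_hom R M N" "S \<subseteq> carrier M" "T \<subseteq> carrier N"
    and "\<And>x. x \<in> S \<Longrightarrow> f x \<in> mod_span R N T" and "x \<in> mod_span R M S"
  shows "f x \<in> mod_span R N T"
proof -
  interpret M: rmodule R M by fact
  interpret N: rmodule R N by fact
  note s = N.mod_span_submodule[OF assms(5)]
  show ?thesis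
    using assms(7,4)
  proof (induction rule: M.mod_span_induct)
    case zero
    then show ?case using N.submodule_zero[OF s] mod_hom_zero[OF assms(1-3)] by simp
  qed (use N.submoduleE[OF s] assms in \<open>auto simp: mod_hom_add mod_hom_smult\<close>)
qed

lemma mod_hom_image_submodule:
  assumes "rmodule R M" "rmodule R N" "f \<in> mod_hom R M N"
  shows "submodule (f ` carrier M) R N"
proof -
  interpret M: rmodule R M by fact
  interpret N: rmodule R N by fact
  show ?thesis
  proof (rule N.submoduleI')
    show "f ` carrier M \<subseteq> carrier N" using mod_hom_closed[OF assms(3)] by auto
    show "\<zero>\<^bsub>N\<^esub> \<in> f ` carrier M"
      using mod_hom_zero[OF assms] by (intro image_eqI[of _ _ "\<zero>\<^bsub>M\<^esub>"]) auto
  next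
    fix a b assume "a \<in> f ` carrier M" "b \<in> f ` carrier M"
    then obtain x y where "x \<in> carrier M" "y \<in> carrier M" "a = f x" "b = f y" by auto
    then show "a \<oplus>\<^bsub>N\<^esub> b \<in> f ` carrier M"
      by (intro image_eqI[of _ _ "x \<oplus>\<^bsub>M\<^esub> y"]) (auto simp: mod_hom_add[OF assms(3)])
  next
    fix a b assume "a \<in> carrier R" "b \<in> f ` carrier M"
    then obtain x where "x \<in> carrier M" "b = f x" by auto
    then show "a \<odot>\<^bsub>N\<^esub> b \<in> f ` carrier M"
      using \<open>a \<in> carrier R\<close>
      by (intro image_eqI[of _ _ "a \<odot>\<^bsub>M\<^esub> x"]) (auto simp: mod_hom_smult[OF assms(3)])
  qed
qed

section \<open>Noetherian local rings\<close>

lemma (in cring) cring_idealI: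
  assumes "I \<subseteq> carrier R" "\<zero> \<in> I" "\<And>a b. a \<in> I \<Longrightarrow> b \<in> I \<Longrightarrow> a \<oplus> b \<in> I"
    and smult: "\<And>a x. a \<in> I \<Longrightarrow> x \<in> carrier R \<Longrightarrow> x \<otimes> a \<in> I"
  shows "ideal I R"
proof (rule idealI)
  show "ring R" by (rule ring_axioms)
  show "subgroup I (add_monoid R)"
  proof (rule add.subgroupI)
    show "\<ominus> a \<in> I" if "a \<in> I" for a
      using smult[OF that, of "\<ominus> \<one>"] assms(1) that by (auto simp: l_minus)
  qed (use assms in auto)
  show "a \<otimes> x \<in> I" if "a \<in> I" "x \<in> carrier R" for a x
    using smult[OF that] m_comm[of a x] assms(1) that by auto
qed (rule smult)

locale noetherian_local =
  fixes R :: "('a, 'r) ring_scheme" (structure)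
  assumes noetherian_local_ring: "noetherian_local_ring R"

sublocale noetherian_local \<subseteq> cring R
  using noetherian_local_ring by (simp add: noetherian_local_ring_def)

sublocale noetherian_local \<subseteq> noetherian_ring R
  using noetherian_local_ring by (simp add: noetherian_local_ring_def)

context noetherian_local
begin

text \<open>Zorn's lemma applies because in a Noetherian ring the union of a nonempty chain of
  ideals is a member of the chain.\<close>

lemma noetherian_maximal:
  assumes "\<C> \<noteq> {}" "\<And>I. I \<in> \<C> \<Longrightarrow> ideal I R"
  shows "\<exists>I\<in>\<C>. \<forall>J\<in>\<C>. I \<subseteq> J \<longrightarrow> J = I"
proof (rule subset_Zorn_nonempty[OF assms(1)])
  fix \<K> assume *: "\<K> \<noteq> {}" "subset.chain \<C> \<K>"
  then have "subset.chain {I. ideal I R} \<K>"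
    using assms(2) by (auto simp: subset.chain_def)
  then have "\<Union>\<K> \<in> \<K>" using ideal_chain_is_trivial * by blast
  then show "\<Union>\<K> \<in> \<C>" using *(2) by (auto simp: subset.chain_def)
qed

lemma ascending_ideals_stable:
  fixes I :: "nat \<Rightarrow> 'a set"
  assumes "\<And>n. ideal (I n) R" "mono I"
  shows "\<exists>N. \<forall>n\<ge>N. I n = I N"
proof -
  obtain J where J: "J \<in> range I" "\<forall>K\<in>range I. J \<subseteq> K \<longrightarrow> K = J"
    using noetherian_maximal[of "range I"] assms(1) by blast
  then obtain N where N: "J = I N" by blast
  have "I n = I N" if "N \<le> n" for n
    using J(2) N monoD[OF assms(2) that] by blast
  then show ?thesis by blast
qed

abbreviation (input) \<mm> where "\<mm> \<equiv> max_ideal R"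

lemma max_ideal_maximal: "maximalideal \<mm> R"
  and max_ideal_unique: "maximalideal I R \<Longrightarrow> I = \<mm>"
proof -
  have "\<exists>!I. maximalideal I R"
    using noetherian_local_ring by (simp add: noetherian_local_ring_def)
  then show "maximalideal \<mm> R" unfolding max_ideal_def by (rule theI')
  then show "I = \<mm>" if "maximalideal I R"
    using that \<open>\<exists>!I. maximalideal I R\<close> by blast
qed

lemma max_ideal_ideal: "ideal \<mm> R"
  using max_ideal_maximal by (rule maximalideal.axioms)

lemma max_ideal_prime: "primeideal \<mm> R"
  using maximalideal_prime[OF max_ideal_maximal] .

lemma ideal_subset_max:
  assumes "ideal I R" "I \<noteq> carrier R"
  shows "I \<subseteq> \<mm>"
proof -
  let ?\<C> = "{J. ideal J R \<and> I \<subseteq> J \<and> J \<noteq> carrier R}"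
  obtain J where J: "J \<in> ?\<C>" "\<forall>K\<in>?\<C>. J \<subseteq> K \<longrightarrow> K = J"
    using noetherian_maximal[of ?\<C>] assms by blast
  then have "maximalideal J R" by (intro maximalidealI) auto
  then have "J = \<mm>" by (rule max_ideal_unique)
  then show ?thesis using J by blast
qed

lemma one_notin_max: "\<one> \<notin> \<mm>"
  using max_ideal_maximal ideal.one_imp_carrier[OF max_ideal_ideal] maximalideal.I_notcarr by metis

lemma one_neq_zero: "\<one> \<noteq> \<zero>"
  using one_notin_max additive_subgroup.zero_closed[OF ideal.axioms(1)[OF max_ideal_ideal]] by metis

lemma unit_if_notin_max:
  assumes "u \<in> carrier R" "u \<notin> \<mm>"
  shows "\<exists>v\<in>carrier R. v \<otimes> u = \<one>"
proof -
  have "PIdl u = carrier R"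
    using ideal_subset_max[OF cgenideal_ideal[OF assms(1)]] cgenideal_self[OF assms(1)] assms by blast
  then have "\<one> \<in> PIdl u" by simp
  then show ?thesis by (auto simp: cgenideal_def)
qed

lemma one_minus_unit:
  assumes "a \<in> \<mm>"
  shows "\<exists>v\<in>carrier R. v \<otimes> (\<one> \<ominus> a) = \<one>"
proof (rule unit_if_notin_max)
  interpret I: ideal \<mm> R by (rule max_ideal_ideal)
  have a: "a \<in> carrier R" using assms I.Icarr by auto
  then show "\<one> \<ominus> a \<in> carrier R" by simp
  have "(\<one> \<ominus> a) \<oplus> a = \<one>" using a by (simp add: a_minus_def a_assoc l_neg)
  then show "\<one> \<ominus> a \<notin> \<mm>" using I.a_closed assms one_notin_max by metis
qed

end

section \<open>Nakayama's lemma and chain conditions for finitely generated modules\<close>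

locale local_module = noetherian_local R + rmodule R M
  for R :: "('a, 'r) ring_scheme" (structure) and M :: "('a, 'm) module" (structure)
begin

lemma nakayama:
  assumes "finite S" "S \<subseteq> carrier M" "submodule U R M"
    "\<And>w. w \<in> S \<Longrightarrow> w \<in> mod_span R M (U \<union> {a \<odot>\<^bsub>M\<^esub> s |a s. a \<in> \<mm> \<and> s \<in> S})"
  shows "S \<subseteq> U"
  using assms(1,2,4)
proof (induction S)
  case (insert w S)
  interpret I: ideal \<mm> R by (rule max_ideal_ideal)
  let ?B = "{a \<odot>\<^bsub>M\<^esub> s |a s. a \<in> \<mm> \<and> s \<in> S}" and ?W = "{a \<odot>\<^bsub>M\<^esub> w |a. a \<in> \<mm>}"
  let ?N = "mod_span R M (U \<union> ?B)"
  have wS: "w \<in> carrier M" "S \<subseteq> carrier M" using insert by auto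
  have sub: "U \<union> ?B \<subseteq> carrier M" "?W \<subseteq> carrier M"
    using submoduleE(1)[OF assms(3)] wS I.Icarr by auto
  note N = mod_span_submodule[OF sub(1)]
  have eq: "U \<union> {a \<odot>\<^bsub>M\<^esub> s |a s. a \<in> \<mm> \<and> s \<in> insert w S} = ?W \<union> (U \<union> ?B)" by auto
  have "w \<in> mod_span R M (?W \<union> (U \<union> ?B))"
    using insert.prems(2)[of w] unfolding eq by simp
  then obtain p y where py: "p \<in> mod_span R M ?W" "y \<in> ?N" "w = p \<oplus>\<^bsub>M\<^esub> y"
    by (rule mod_span_Un) (use sub in auto)
  from py(1) max_ideal_ideal wS(1) obtain a where a: "a \<in> \<mm>" "p = a \<odot>\<^bsub>M\<^esub> w"
    by (rule mod_span_smults)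
  have yc: "y \<in> carrier M" using py(2) mod_span_closed[OF sub(1)] by auto
  have ac: "a \<in> carrier R" using a I.Icarr by auto
  obtain v where v: "v \<in> carrier R" "v \<otimes> (\<one> \<ominus> a) = \<one>" using one_minus_unit a by blast
  have "(\<one> \<ominus> a) \<odot>\<^bsub>M\<^esub> w = w \<ominus>\<^bsub>M\<^esub> a \<odot>\<^bsub>M\<^esub> w" using ac wS by (simp add: smult_diff)
  also have "\<dots> = y" using py(3) a ac yc wS by (subst minus_eq_iff) (auto simp: M.a_comm)
  finally have "(\<one> \<ominus> a) \<odot>\<^bsub>M\<^esub> w = y" .
  then have "v \<odot>\<^bsub>M\<^esub> y = (v \<otimes> (\<one> \<ominus> a)) \<odot>\<^bsub>M\<^esub> w"
    using v(1) ac wS(1) smult_assoc1[of v "\<one> \<ominus> a" w] by simp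
  then have wN: "w \<in> ?N" using v wS submoduleE(4)[OF N v(1) py(2)] by simp
  have "?W \<subseteq> ?N" using submoduleE(4)[OF N _ wN] I.Icarr by auto
  then have "?W \<union> (U \<union> ?B) \<subseteq> ?N" using mod_span_superset[of "U \<union> ?B"] by simp
  then have "mod_span R M (?W \<union> (U \<union> ?B)) \<subseteq> ?N" by (rule mod_span_least[OF N])
  then have "S \<subseteq> U"
    using insert.prems(2) unfolding eq by (intro insert.IH wS) blast
  moreover have "?N \<subseteq> U"
    using \<open>S \<subseteq> U\<close> submoduleE(4)[OF assms(3)] I.Icarr by (intro mod_span_least[OF assms(3)]) auto
  ultimately show ?case using wN by auto
qed auto

text \<open>The form in which Nakayama's lemma is applied: multiplying the whole span of S by the
  maximal ideal adds nothing to the multiples of the generators.\<close>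

lemma nakayama_span:
  assumes "finite S" "S \<subseteq> carrier M" "submodule U R M"
    "\<And>w. w \<in> S \<Longrightarrow> w \<in> mod_span R M (U \<union> {a \<odot>\<^bsub>M\<^esub> x |a x. a \<in> \<mm> \<and> x \<in> mod_span R M S})"
  shows "mod_span R M S \<subseteq> U"
proof -
  interpret I: ideal \<mm> R by (rule max_ideal_ideal)
  let ?B = "{a \<odot>\<^bsub>M\<^esub> s |a s. a \<in> \<mm> \<and> s \<in> S}"
  have sub: "U \<union> ?B \<subseteq> carrier M"
    using submoduleE(1)[OF assms(3)] assms(2) I.Icarr by auto
  note N = mod_span_submodule[OF sub]
  have "a \<odot>\<^bsub>M\<^esub> x \<in> mod_span R M (U \<union> ?B)" if "x \<in> mod_span R M S" "a \<in> \<mm>" for a x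
    using that(1) assms(2)
  proof (induction rule: mod_span_induct)
    case (base x)
    then have "a \<odot>\<^bsub>M\<^esub> x \<in> U \<union> ?B" using that(2) by auto
    then show ?case by (rule mod_span_base)
  next
    case zero
    then show ?case using submodule_zero[OF N] I.Icarr[OF that(2)] by simp
  next
    case (add x y)
    then show ?case using submoduleE(5)[OF N] I.Icarr[OF that(2)] by (simp add: smult_r_distr)
  next
    case (smult b x)
    have "a \<odot>\<^bsub>M\<^esub> (b \<odot>\<^bsub>M\<^esub> x) = b \<odot>\<^bsub>M\<^esub> (a \<odot>\<^bsub>M\<^esub> x)"
      using smult I.Icarr[OF that(2)] by (simp add: m_comm flip: smult_assoc1)
    then show ?case using submoduleE(4)[OF N] smult by simp
  qed
  then have "U \<union> {a \<odot>\<^bsub>M\<^esub> x |a x. a \<in> \<mm> \<and> x \<in> mod_span R M S} \<subseteq> mod_span R M (U \<union> ?B)"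
    using mod_span_superset[of "U \<union> ?B"] by auto
  then have "mod_span R M (U \<union> {a \<odot>\<^bsub>M\<^esub> x |a x. a \<in> \<mm> \<and> x \<in> mod_span R M S})
      \<subseteq> mod_span R M (U \<union> ?B)"
    by (rule mod_span_least[OF N])
  then have "w \<in> mod_span R M (U \<union> ?B)" if "w \<in> S" for w
    using assms(4)[OF that] by (rule subsetD)
  then have "S \<subseteq> U" by (rule nakayama[OF assms(1-3)])
  then show ?thesis using mod_span_least[OF assms(3)] by simp
qed

lemma ascending_submodules_stable:
  fixes K :: "nat \<Rightarrow> 'm set"
  assumes "finite S" "S \<subseteq> carrier M" "\<And>n. submodule (K n) R M" "mono K" "\<And>n. K n \<subseteq> mod_span R M S"
  shows "\<exists>N. \<forall>n\<ge>N. K n = K N"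
  using assms
proof (induction S arbitrary: K)
  case empty
  have "K n = {\<zero>\<^bsub>M\<^esub>}" for n
    using empty.prems(4)[of n] submodule_zero[OF empty.prems(2)[of n]] mod_span_empty by auto
  then show ?case by auto
next
  case (insert w S)
  have wS: "w \<in> carrier M" "S \<subseteq> carrier M" using insert by auto
  let ?T = "mod_span R M S"
  note T = mod_span_submodule[OF wS(2)]
  note K = insert.prems(2)
  \<comment> \<open>The coefficients of w that occur in K n modulo the remaining generators. Once
    these ideals and the intersections with \<open>?T\<close> are constant, so is K: an element r w
    + y of K n differs by an element of K n in \<open>?T\<close> from some r w + z of K N.\<close>
  define I where "I n = {r \<in> carrier R. \<exists>y\<in>?T. r \<odot>\<^bsub>M\<^esub> w \<oplus>\<^bsub>M\<^esub> y \<in> K n}" for n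
  have tc: "y \<in> carrier M" if "y \<in> ?T" for y using that submoduleE(1)[OF T] by auto
  have "ideal (I n) R" for n
  proof (rule cring_idealI)
    show "I n \<subseteq> carrier R" by (auto simp: I_def)
    have "\<zero> \<odot>\<^bsub>M\<^esub> w \<oplus>\<^bsub>M\<^esub> \<zero>\<^bsub>M\<^esub> \<in> K n" using wS submodule_zero[OF K] by simp
    then show "\<zero> \<in> I n" using submodule_zero[OF T] unfolding I_def by blast
    show "x \<otimes> a \<in> I n" if aI: "a \<in> I n" "x \<in> carrier R" for a x
    proof -
      obtain y where y: "y \<in> ?T" "a \<odot>\<^bsub>M\<^esub> w \<oplus>\<^bsub>M\<^esub> y \<in> K n" "a \<in> carrier R"
        using aI by (auto simp: I_def)
      have "(x \<otimes> a) \<odot>\<^bsub>M\<^esub> w \<oplus>\<^bsub>M\<^esub> x \<odot>\<^bsub>M\<^esub> y = x \<odot>\<^bsub>M\<^esub> (a \<odot>\<^bsub>M\<^esub> w \<oplus>\<^bsub>M\<^esub> y)"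
        using y tc aI wS by (simp add: smult_r_distr smult_assoc1)
      then show ?thesis
        using submoduleE(4)[OF K aI(2) y(2)] submoduleE(4)[OF T aI(2) y(1)] aI(2) y(3)
        by (auto simp: I_def intro!: bexI[of _ "x \<odot>\<^bsub>M\<^esub> y"])
    qed
    show "a \<oplus> b \<in> I n" if ab: "a \<in> I n" "b \<in> I n" for a b
    proof -
      obtain y z where y: "y \<in> ?T" "a \<odot>\<^bsub>M\<^esub> w \<oplus>\<^bsub>M\<^esub> y \<in> K n" "a \<in> carrier R"
        "z \<in> ?T" "b \<odot>\<^bsub>M\<^esub> w \<oplus>\<^bsub>M\<^esub> z \<in> K n" "b \<in> carrier R"
        using ab by (auto simp: I_def)
      have "(a \<oplus> b) \<odot>\<^bsub>M\<^esub> w \<oplus>\<^bsub>M\<^esub> (y \<oplus>\<^bsub>M\<^esub> z)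
          = (a \<odot>\<^bsub>M\<^esub> w \<oplus>\<^bsub>M\<^esub> y) \<oplus>\<^bsub>M\<^esub> (b \<odot>\<^bsub>M\<^esub> w \<oplus>\<^bsub>M\<^esub> z)"
        using y tc wS by (simp add: smult_l_distr M.a_ac)
      then show ?thesis
        using submoduleE(5)[OF K y(2,5)] submoduleE(5)[OF T y(1,4)] y(3,6)
        by (auto simp: I_def intro!: bexI[of _ "y \<oplus>\<^bsub>M\<^esub> z"])
    qed
  qed
  moreover have "mono I"
    using insert.prems(3) by (fastforce simp: mono_def I_def)
  ultimately obtain N1 where N1: "\<forall>n\<ge>N1. I n = I N1" using ascending_ideals_stable by blast
  have "submodule (K n \<inter> ?T) R M" for n
    using submoduleE[OF K[of n]] submoduleE[OF T] submodule_zero[OF K[of n]] submodule_zero[OF T]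
    by (intro submoduleI') auto
  then have "\<exists>N. \<forall>n\<ge>N. K n \<inter> ?T = K N \<inter> ?T"
    using insert.prems(3) by (intro insert.IH[OF wS(2)]) (auto simp: mono_def)
  then obtain N2 where N2: "\<forall>n\<ge>N2. K n \<inter> ?T = K N2 \<inter> ?T" by blast
  define N where "N = max N1 N2"
  have "x \<in> K N" if n: "n \<ge> N" and x: "x \<in> K n" for n x
  proof -
    have "x \<in> mod_span R M (insert w S)" using insert.prems(4) x by blast
    from this wS obtain r y where ry: "r \<in> carrier R" "y \<in> ?T" "x = r \<odot>\<^bsub>M\<^esub> w \<oplus>\<^bsub>M\<^esub> y"
      by (rule mod_span_insert)
    have "r \<in> I n" using ry x by (auto simp: I_def)
    moreover have "I n = I N" using N1 n by (metis N_def max.bounded_iff nle_le order_trans)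
    ultimately obtain z where z: "z \<in> ?T" "r \<odot>\<^bsub>M\<^esub> w \<oplus>\<^bsub>M\<^esub> z \<in> K N" by (auto simp: I_def)
    have "K N \<subseteq> K n" using insert.prems(3) n by (auto dest: monoD)
    then have "x \<ominus>\<^bsub>M\<^esub> (r \<odot>\<^bsub>M\<^esub> w \<oplus>\<^bsub>M\<^esub> z) \<in> K n"
      using x z submodule_minus[OF K] by blast
    moreover have "x \<ominus>\<^bsub>M\<^esub> (r \<odot>\<^bsub>M\<^esub> w \<oplus>\<^bsub>M\<^esub> z) = y \<ominus>\<^bsub>M\<^esub> z"
      using ry z tc wS by (subst minus_eq_iff) (auto simp: M.a_ac M.r_neg1 M.r_neg2 a_minus_def M.l_neg M.r_neg)
    moreover have "y \<ominus>\<^bsub>M\<^esub> z \<in> ?T" using ry z submodule_minus[OF T] by blast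
    moreover have "K n \<inter> ?T = K N \<inter> ?T" using N2 n by (metis N_def max.bounded_iff nle_le order_trans)
    ultimately have "x \<ominus>\<^bsub>M\<^esub> (r \<odot>\<^bsub>M\<^esub> w \<oplus>\<^bsub>M\<^esub> z) \<in> K N" by auto
    then have "(x \<ominus>\<^bsub>M\<^esub> (r \<odot>\<^bsub>M\<^esub> w \<oplus>\<^bsub>M\<^esub> z)) \<oplus>\<^bsub>M\<^esub> (r \<odot>\<^bsub>M\<^esub> w \<oplus>\<^bsub>M\<^esub> z) \<in> K N"
      using z submoduleE(5)[OF K] by blast
    then show ?thesis
      using ry z tc wS by (subst (asm) minus_add_cancel) auto
  qed
  moreover have "K N \<subseteq> K n" if "n \<ge> N" for n using insert.prems(3) that by (auto dest: monoD)
  ultimately show ?case by blast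
qed

text \<open>The kernels of the powers of f become constant at some N. If f x = 0, write x = f^N y;
  then y lies in the kernel of f^(N+1), hence in that of f^N, and x = 0.\<close>

lemma surjective_endo_injective:
  assumes "fin_gen R M" "f \<in> mod_hom R M M" "f ` carrier M = carrier M"
  shows "inj_on f (carrier M)"
proof -
  obtain S where S: "finite S" "S \<subseteq> carrier M" "mod_span R M S = carrier M"
    using assms(1) by (auto simp: fin_gen_def)
  have M: "rmodule R M" by (rule rmodule_axioms)
  have pow: "(f ^^ n) \<in> mod_hom R M M" for n
    by (induction n) (simp_all only: funpow.simps mod_hom_id mod_hom_comp[OF _ assms(2)])
  have surj: "\<exists>y\<in>carrier M. (f ^^ n) y = x" if "x \<in> carrier M" for n x
    using that
  proof (induction n arbitrary: x)
    case (Suc n)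
    then have "x \<in> f ` carrier M" using assms(3) by simp
    then obtain z where z: "z \<in> carrier M" "f z = x" by auto
    from Suc.IH[OF z(1)] obtain y where "y \<in> carrier M" "(f ^^ n) y = z" by auto
    then show ?case using z by auto
  qed auto
  define K where "K n = {x \<in> carrier M. (f ^^ n) x = \<zero>\<^bsub>M\<^esub>}" for n
  note z = mod_hom_zero[OF M M]
  have "submodule (K n) R M" for n
    using pow[of n] z[OF pow[of n]]
    by (intro submoduleI') (auto simp: K_def mod_hom_add mod_hom_smult)
  moreover have "mono K"
    by (rule mono_iff_le_Suc[THEN iffD2]) (use z[OF assms(2)] in \<open>auto simp: K_def\<close>)
  moreover have "K n \<subseteq> mod_span R M S" for n using S by (auto simp: K_def)
  ultimately obtain N where N: "\<forall>n\<ge>N. K n = K N"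
    using ascending_submodules_stable[OF S(1,2), of K] by auto
  have ker: "x = \<zero>\<^bsub>M\<^esub>" if x: "x \<in> carrier M" "f x = \<zero>\<^bsub>M\<^esub>" for x
  proof -
    obtain y where y: "y \<in> carrier M" "(f ^^ N) y = x" using surj x by blast
    then have "y \<in> K (Suc N)" using x by (simp add: K_def)
    then have "y \<in> K N" using N[rule_format, of "Suc N"] by simp
    then show ?thesis using y by (simp add: K_def)
  qed
  show ?thesis
  proof (rule inj_onI)
    fix x y assume xy: "x \<in> carrier M" "y \<in> carrier M" "f x = f y"
    then have "f (x \<ominus>\<^bsub>M\<^esub> y) = \<zero>\<^bsub>M\<^esub>"
      using mod_hom_minus[OF M M assms(2)] mod_hom_closed[OF assms(2)] by (simp add: minus_self)
    then have "x \<ominus>\<^bsub>M\<^esub> y = \<zero>\<^bsub>M\<^esub>" using ker[of "x \<ominus>\<^bsub>M\<^esub> y"] xy by simp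
    then show "x = y" using xy by (simp add: minus_eq_zero_iff)
  qed
qed

end

text \<open>Any set of scalars is allowed, so that the notion covers both the maximal ideal times M
  and, in \<open>seq_mult_ideal_smult\<close>, the submodule generated by a sequence.\<close>

definition ideal_smult :: "('a, 'r) ring_scheme \<Rightarrow> ('a, 'm) module \<Rightarrow> 'a set \<Rightarrow> 'm set" where
  "ideal_smult R M A = mod_span R M {a \<odot>\<^bsub>M\<^esub> x |a x. a \<in> A \<and> x \<in> carrier M}"

context rmodule
begin

lemma ideal_smult_gens: "A \<subseteq> carrier R \<Longrightarrow> {a \<odot>\<^bsub>M\<^esub> x |a x. a \<in> A \<and> x \<in> carrier M} \<subseteq> carrier M"
  by auto

lemma ideal_smult_submodule: "A \<subseteq> carrier R \<Longrightarrow> submodule (ideal_smult R M A) R M"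
  unfolding ideal_smult_def by (rule mod_span_submodule[OF ideal_smult_gens])

lemma ideal_smult_closed: "A \<subseteq> carrier R \<Longrightarrow> x \<in> ideal_smult R M A \<Longrightarrow> x \<in> carrier M"
  using submoduleE(1)[OF ideal_smult_submodule] by auto

lemma ideal_smultI: "a \<in> A \<Longrightarrow> x \<in> carrier M \<Longrightarrow> a \<odot>\<^bsub>M\<^esub> x \<in> ideal_smult R M A"
  unfolding ideal_smult_def by (intro mod_span_base) auto

lemma ideal_smult_mono: "A \<subseteq> B \<Longrightarrow> ideal_smult R M A \<subseteq> ideal_smult R M B"
  unfolding ideal_smult_def by (rule mod_span_mono) auto

lemma ideal_smult_induct [consumes 2, case_names base zero add smult]:
  assumes "x \<in> ideal_smult R M A" "A \<subseteq> carrier R"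
    "\<And>a x. a \<in> A \<Longrightarrow> x \<in> carrier M \<Longrightarrow> P (a \<odot>\<^bsub>M\<^esub> x)" "P \<zero>\<^bsub>M\<^esub>"
    "\<And>x y. x \<in> carrier M \<Longrightarrow> y \<in> carrier M \<Longrightarrow> P x \<Longrightarrow> P y \<Longrightarrow> P (x \<oplus>\<^bsub>M\<^esub> y)"
    "\<And>a x. a \<in> carrier R \<Longrightarrow> x \<in> carrier M \<Longrightarrow> P x \<Longrightarrow> P (a \<odot>\<^bsub>M\<^esub> x)"
  shows "P x"
  using assms(1)[unfolded ideal_smult_def] ideal_smult_gens[OF assms(2)]
  by (induction rule: mod_span_induct) (use assms(3-) in auto)

end

lemma mod_hom_ideal_smult:
  assumes "rmodule R M" "rmodule R N" "f \<in> mod_hom R M N" "A \<subseteq> carrier R" "x \<in> ideal_smult R M A"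
  shows "f x \<in> ideal_smult R N A"
proof -
  interpret M: rmodule R M by fact
  interpret N: rmodule R N by fact
  note N = N.ideal_smult_submodule[OF assms(4)]
  show ?thesis using assms(5,4)
  proof (induction rule: M.ideal_smult_induct)
    case (base a x)
    then show ?case
      using assms(3,4) by (auto simp: mod_hom_smult mod_hom_closed subset_iff intro!: N.ideal_smultI)
  next
    case zero
    then show ?case using N.submodule_zero[OF N] mod_hom_zero[OF assms(1-3)] by simp
  qed (use N.submoduleE[OF N] assms in \<open>auto simp: mod_hom_add mod_hom_smult\<close>)
qed

context local_module
begin

text \<open>Because x = (1 - g) x + g x, the image of 1 - g generates M modulo the maximal ideal, so
  1 - g is onto by Nakayama's lemma and injective by
  \<open>surjective_endo_injective\<close>.\<close>

lemma one_minus_invertible: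
  assumes "fin_gen R M" "g \<in> mod_hom R M M"
    "\<And>x. x \<in> carrier M \<Longrightarrow> g x \<in> ideal_smult R M \<mm>"
  shows "\<exists>h\<in>mod_hom R M M. (\<forall>x\<in>carrier M. h (x \<ominus>\<^bsub>M\<^esub> g x) = x) \<and> (\<forall>x\<in>carrier M. h x \<ominus>\<^bsub>M\<^esub> g (h x) = x)"
proof -
  have M: "rmodule R M" by (rule rmodule_axioms)
  obtain S where S: "finite S" "S \<subseteq> carrier M" "mod_span R M S = carrier M"
    using assms(1) by (auto simp: fin_gen_def)
  let ?f = "\<lambda>x. id x \<ominus>\<^bsub>M\<^esub> g x"
  have f: "?f \<in> mod_hom R M M" by (intro mod_hom_diff M mod_hom_id assms)
  have sub: "submodule (?f ` carrier M) R M"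
    by (rule mod_hom_image_submodule[OF M M f])
  have "mod_span R M S \<subseteq> ?f ` carrier M"
  proof (rule nakayama_span[OF S(1,2) sub])
    fix w assume "w \<in> S"
    then have w: "w \<in> carrier M" using S by auto
    let ?U = "?f ` carrier M \<union> {a \<odot>\<^bsub>M\<^esub> x |a x. a \<in> \<mm> \<and> x \<in> mod_span R M S}"
    have Uc: "?U \<subseteq> carrier M"
      using submoduleE(1)[OF sub] ideal.Icarr[OF max_ideal_ideal] unfolding S(3) by auto
    have "?f w \<in> mod_span R M ?U" using w by (intro mod_span_base) auto
    moreover have "g w \<in> mod_span R M ?U"
      using assms(3)[OF w] unfolding ideal_smult_def S(3)
      by (rule rev_subsetD[OF _ mod_span_mono]) auto
    ultimately have "?f w \<oplus>\<^bsub>M\<^esub> g w \<in> mod_span R M ?U"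
      using submoduleE(5)[OF mod_span_submodule[OF Uc]] by blast
    then show "w \<in> mod_span R M ?U"
      using minus_add_cancel[OF w mod_hom_closed[OF assms(2) w]] by simp
  qed
  then have surj: "?f ` carrier M = carrier M" using S submoduleE(1)[OF sub] by auto
  from bij_mod_hom_inverse[OF M M f surjective_endo_injective[OF assms(1) f surj] surj]
  show ?thesis by simp
qed

end

section \<open>Maps that factor through finitely generated free modules\<close>

lemma regular_module_simps [simp]:
  "carrier (regular_module R) = carrier R"
  "\<zero>\<^bsub>regular_module R\<^esub> = \<zero>\<^bsub>R\<^esub>"
  "x \<oplus>\<^bsub>regular_module R\<^esub> y = x \<oplus>\<^bsub>R\<^esub> y"
  "a \<odot>\<^bsub>regular_module R\<^esub> x = a \<otimes>\<^bsub>R\<^esub> x"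
  by (simp_all add: regular_module_def)

lemma rmodule_regular_module:
  assumes "cring R"
  shows "rmodule R (regular_module R)"
proof -
  interpret cring R by fact
  show ?thesis
    unfolding rmodule_def
  proof (rule moduleI)
    show "abelian_group (regular_module R)"
      by (rule abelian_groupI) (auto simp: a_ac intro: bexI[of _ "\<ominus>\<^bsub>R\<^esub> _"] l_neg)
  qed (auto simp: assms l_distr r_distr m_assoc)
qed

text \<open>Finite sums of maps that send x to \<phi> x times y, with \<phi> a linear form. These
  are the maps that factor through a finitely generated free module, see
  \<open>stably_equal_iff\<close>. In the inductive form their closure properties follow by rule
  induction without choosing free modules, and the carrier types of source and target stay
  arbitrary.\<close>

inductive_set triv_maps ::
  "('a, 'r) ring_scheme \<Rightarrow> ('a, 'm) module \<Rightarrow> ('a, 'n) module \<Rightarrow> ('m \<Rightarrow> 'n) set"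
  for R M N where
  zero: "\<forall>x\<in>carrier M. h x = \<zero>\<^bsub>N\<^esub> \<Longrightarrow> h \<in> triv_maps R M N"
| step: "f \<in> triv_maps R M N \<Longrightarrow> \<phi> \<in> mod_hom R M (regular_module R) \<Longrightarrow> y \<in> carrier N \<Longrightarrow>
    \<forall>x\<in>carrier M. h x = f x \<oplus>\<^bsub>N\<^esub> \<phi> x \<odot>\<^bsub>N\<^esub> y \<Longrightarrow> h \<in> triv_maps R M N"

lemma triv_maps_cong:
  "f \<in> triv_maps R M N \<Longrightarrow> (\<And>x. x \<in> carrier M \<Longrightarrow> g x = f x) \<Longrightarrow> g \<in> triv_maps R M N"
  by (induction arbitrary: g rule: triv_maps.induct)
    (auto intro: triv_maps.zero triv_maps.step)

locale rmodule2 = M: rmodule R M + N: rmodule R N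
  for R :: "('a, 'r) ring_scheme" (structure) and M :: "('a, 'm) module" and N :: "('a, 'n) module"
begin

lemma rM: "rmodule R M" and rN: "rmodule R N" and rR: "rmodule R (regular_module R)"
  by (rule M.rmodule_axioms N.rmodule_axioms rmodule_regular_module M.is_cring)+

lemma smult_vector_hom:
  assumes "\<phi> \<in> mod_hom R M (regular_module R)" "y \<in> carrier N"
  shows "(\<lambda>x. \<phi> x \<odot>\<^bsub>N\<^esub> y) \<in> mod_hom R M N"
proof (rule mod_homI)
  fix x assume x: "x \<in> carrier M"
  note c = mod_hom_closed[OF assms(1), simplified]
  show "\<phi> x \<odot>\<^bsub>N\<^esub> y \<in> carrier N" using c[OF x] assms(2) by simp
  show "\<phi> (x \<oplus>\<^bsub>M\<^esub> x') \<odot>\<^bsub>N\<^esub> y = \<phi> x \<odot>\<^bsub>N\<^esub> y \<oplus>\<^bsub>N\<^esub> \<phi> x' \<odot>\<^bsub>N\<^esub> y" if "x' \<in> carrier M" for x'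
    using mod_hom_add[OF assms(1) x that] c[OF x] c[OF that] assms(2) by (simp add: N.smult_l_distr)
  show "\<phi> (a \<odot>\<^bsub>M\<^esub> x) \<odot>\<^bsub>N\<^esub> y = a \<odot>\<^bsub>N\<^esub> (\<phi> x \<odot>\<^bsub>N\<^esub> y)" if "a \<in> carrier R" for a
    using mod_hom_smult[OF assms(1) that x] c[OF x] that assms(2) by (simp add: N.smult_assoc1)
qed

lemma triv_maps_hom:
  assumes "h \<in> triv_maps R M N"
  shows "h \<in> mod_hom R M N"
  using assms
proof induction
  case (zero h)
  then show ?case by (intro mod_hom_cong[OF rM N.mod_hom_null]) auto
next
  case (step f \<phi> y h)
  have "(\<lambda>x. f x \<oplus>\<^bsub>N\<^esub> \<phi> x \<odot>\<^bsub>N\<^esub> y) \<in> mod_hom R M N"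
    by (intro N.mod_hom_plus rM step smult_vector_hom)
  then show ?case by (rule mod_hom_cong[OF rM]) (use step in auto)
qed

lemma triv_maps_add:
  assumes "f \<in> triv_maps R M N" "g \<in> triv_maps R M N"
  shows "(\<lambda>x. f x \<oplus>\<^bsub>N\<^esub> g x) \<in> triv_maps R M N"
  using assms(2)
proof induction
  case (zero h)
  then show ?case
    by (intro triv_maps_cong[OF assms(1)]) (auto simp: mod_hom_closed[OF triv_maps_hom[OF assms(1)]])
next
  case (step g \<phi> y h)
  have "f x \<oplus>\<^bsub>N\<^esub> h x = f x \<oplus>\<^bsub>N\<^esub> g x \<oplus>\<^bsub>N\<^esub> \<phi> x \<odot>\<^bsub>N\<^esub> y" if "x \<in> carrier M" for x
    using that step mod_hom_closed[OF triv_maps_hom[OF assms(1)] that]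
      mod_hom_closed[OF triv_maps_hom[OF step.hyps(1)] that]
      mod_hom_closed[OF smult_vector_hom[OF step.hyps(2,3)] that]
    by (simp add: N.a_assoc)
  then show ?case using step by (intro triv_maps.step[OF step.IH step.hyps(2,3)]) auto
qed

lemma triv_maps_zero: "(\<lambda>_. \<zero>\<^bsub>N\<^esub>) \<in> triv_maps R M N"
  by (rule triv_maps.zero) simp

lemma triv_maps_comp_left:
  assumes "h \<in> triv_maps R M N" "g \<in> mod_hom R N P" "rmodule R P"
  shows "g \<circ> h \<in> triv_maps R M P"
  using assms(1)
proof induction
  case (zero h)
  then show ?case using mod_hom_zero[OF rN assms(3,2)] by (intro triv_maps.zero) auto
next
  case (step f \<phi> y h)
  have "(g \<circ> h) x = (g \<circ> f) x \<oplus>\<^bsub>P\<^esub> \<phi> x \<odot>\<^bsub>P\<^esub> g y" if "x \<in> carrier M" for x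
    using that step.hyps(4) mod_hom_closed[OF triv_maps_hom[OF step.hyps(1)] that]
      mod_hom_closed[OF smult_vector_hom[OF step.hyps(2,3)] that]
      mod_hom_closed[OF step.hyps(2) that] step.hyps(3)
    by (simp add: mod_hom_add[OF assms(2)] mod_hom_smult[OF assms(2)])
  then show ?case
    by (intro triv_maps.step[OF step.IH step.hyps(2) mod_hom_closed[OF assms(2) step.hyps(3)]]) auto
qed

lemma triv_maps_comp_right:
  assumes "h \<in> triv_maps R M N" "g \<in> mod_hom R L M"
  shows "h \<circ> g \<in> triv_maps R L N"
  using assms(1)
proof induction
  case (zero h)
  then show ?case using mod_hom_closed[OF assms(2)] by (intro triv_maps.zero) auto
next
  case (step f \<phi> y h)
  then show ?case using mod_hom_closed[OF assms(2)]
    by (intro triv_maps.step[OF step.IH mod_hom_comp[OF assms(2) step.hyps(2)] step.hyps(3)]) auto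
qed

lemma triv_maps_scale:
  assumes "h \<in> triv_maps R M N" "a \<in> carrier R"
  shows "(\<lambda>x. a \<odot>\<^bsub>N\<^esub> h x) \<in> triv_maps R M N"
proof -
  have "(\<lambda>y. a \<odot>\<^bsub>N\<^esub> id y) \<in> mod_hom R N N" by (intro N.mod_hom_scale rN mod_hom_id assms)
  from triv_maps_comp_left[OF assms(1) this rN] show ?thesis by (simp add: o_def)
qed

lemma triv_maps_diff:
  assumes "f \<in> triv_maps R M N" "g \<in> triv_maps R M N"
  shows "(\<lambda>x. f x \<ominus>\<^bsub>N\<^esub> g x) \<in> triv_maps R M N"
proof -
  have "(\<lambda>x. f x \<oplus>\<^bsub>N\<^esub> (\<ominus> \<one>) \<odot>\<^bsub>N\<^esub> g x) \<in> triv_maps R M N"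
    using assms by (intro triv_maps_add triv_maps_scale) auto
  then show ?thesis
    by (rule triv_maps_cong)
      (auto simp: N.smult_l_minus mod_hom_closed[OF triv_maps_hom[OF assms(2)]] a_minus_def)
qed

text \<open>Collects the steps of a derivation into a family of forms and vectors, the data of a
  factorization through \<open>free_mod R n\<close>.\<close>

lemma triv_maps_finsum:
  assumes "h \<in> triv_maps R M N"
  shows "\<exists>(n :: nat) \<phi> y. (\<forall>i<n. \<phi> i \<in> mod_hom R M (regular_module R) \<and> y i \<in> carrier N) \<and>
    (\<forall>x\<in>carrier M. h x = (\<Oplus>\<^bsub>N\<^esub>i\<in>{..<n}. \<phi> i x \<odot>\<^bsub>N\<^esub> y i))"
  using assms
proof induction
  case (zero h)
  then show ?case by (intro exI[of _ 0]) auto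
next
  case (step f \<psi> z h)
  then obtain n :: nat and \<phi> y where *: "\<forall>i<n. \<phi> i \<in> mod_hom R M (regular_module R) \<and> y i \<in> carrier N"
    "\<forall>x\<in>carrier M. f x = (\<Oplus>\<^bsub>N\<^esub>i\<in>{..<n}. \<phi> i x \<odot>\<^bsub>N\<^esub> y i)" by auto
  let ?\<phi> = "\<phi>(n := \<psi>)" and ?y = "y(n := z)"
  have "h x = (\<Oplus>\<^bsub>N\<^esub>i\<in>{..<Suc n}. ?\<phi> i x \<odot>\<^bsub>N\<^esub> ?y i)" if x: "x \<in> carrier M" for x
  proof -
    have c: "\<phi> i x \<in> carrier R" "y i \<in> carrier N" if "i < n" for i
      using *(1) mod_hom_closed[of "\<phi> i" R M "regular_module R"] x that by auto
    have d: "\<psi> x \<in> carrier R" using mod_hom_closed[OF step.hyps(2) x] by simp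
    have "(\<Oplus>\<^bsub>N\<^esub>i\<in>{..<Suc n}. ?\<phi> i x \<odot>\<^bsub>N\<^esub> ?y i)
        = \<psi> x \<odot>\<^bsub>N\<^esub> z \<oplus>\<^bsub>N\<^esub> (\<Oplus>\<^bsub>N\<^esub>i\<in>{..<n}. ?\<phi> i x \<odot>\<^bsub>N\<^esub> ?y i)"
      unfolding lessThan_Suc using c d step.hyps(3)
      by (subst N.finsum_insert) (auto simp: Pi_def)
    also have "(\<Oplus>\<^bsub>N\<^esub>i\<in>{..<n}. ?\<phi> i x \<odot>\<^bsub>N\<^esub> ?y i) = (\<Oplus>\<^bsub>N\<^esub>i\<in>{..<n}. \<phi> i x \<odot>\<^bsub>N\<^esub> y i)"
      using c by (intro N.finsum_cong') auto
    finally show ?thesis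
      using *(2) x step.hyps(3,4) d mod_hom_closed[OF triv_maps_hom[OF step.hyps(1)] x]
      by (simp add: N.a_comm)
  qed
  moreover have "\<forall>i<Suc n. ?\<phi> i \<in> mod_hom R M (regular_module R) \<and> ?y i \<in> carrier N"
    using *(1) step.hyps(2,3) by (auto simp: less_Suc_eq)
  ultimately show ?case by blast
qed

end

text \<open>The identity is the sum over the basis of the maps that send x to (coordinate of x at b)
  times b. The coordinates are linear because the expansion in a basis is unique.\<close>

lemma fg_free_id_triv:
  assumes "fg_free R F"
  shows "id \<in> triv_maps R F F"
proof -
  interpret rmodule R F using assms by (simp add: fg_free_def rmodule_def)
  interpret FF: rmodule2 R F F by intro_locales
  from conjunct2[OF assms[unfolded fg_free_def]]
  obtain B where B0: "finite B \<and> B \<subseteq> carrier F \<and>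
    (\<forall>x\<in>carrier F. \<exists>!c. c \<in> B \<rightarrow>\<^sub>E carrier R \<and> x = (\<Oplus>\<^bsub>F\<^esub>b\<in>B. c b \<odot>\<^bsub>F\<^esub> b))"
    by (rule exE)
  note B = conjunct1[OF B0] conjunct1[OF conjunct2[OF B0]] bspec[OF conjunct2[OF conjunct2[OF B0]]]
  define c where "c x = (THE c. c \<in> B \<rightarrow>\<^sub>E carrier R \<and> x = (\<Oplus>\<^bsub>F\<^esub>b\<in>B. c b \<odot>\<^bsub>F\<^esub> b))" for x
  have c: "c x \<in> B \<rightarrow>\<^sub>E carrier R" "x = (\<Oplus>\<^bsub>F\<^esub>b\<in>B. c x b \<odot>\<^bsub>F\<^esub> b)" if "x \<in> carrier F" for x
    using theI'[OF B(3)[OF that]] unfolding c_def by auto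
  have cR: "c x b \<in> carrier R" if "x \<in> carrier F" "b \<in> B" for x b using c(1)[OF that(1)] that(2) by auto
  have bF: "b \<in> carrier F" if "b \<in> B" for b using B that by auto
  have uniq: "c x = d" if "x \<in> carrier F" "d \<in> B \<rightarrow>\<^sub>E carrier R" "x = (\<Oplus>\<^bsub>F\<^esub>b\<in>B. d b \<odot>\<^bsub>F\<^esub> b)" for x d
    unfolding c_def by (rule the1_equality[OF B(3)[OF that(1)]]) (use that in auto)
  have form: "(\<lambda>x. c x b) \<in> mod_hom R F (regular_module R)" if b: "b \<in> B" for b
  proof (rule mod_homI)
    fix x y assume xy: "x \<in> carrier F" "y \<in> carrier F"
    let ?d = "\<lambda>b\<in>B. c x b \<oplus>\<^bsub>R\<^esub> c y b"
    have "(\<Oplus>\<^bsub>F\<^esub>b\<in>B. ?d b \<odot>\<^bsub>F\<^esub> b) = (\<Oplus>\<^bsub>F\<^esub>b\<in>B. c x b \<odot>\<^bsub>F\<^esub> b \<oplus>\<^bsub>F\<^esub> c y b \<odot>\<^bsub>F\<^esub> b)"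
      using cR[OF xy(1)] cR[OF xy(2)] bF by (intro M.finsum_cong') (auto simp: smult_l_distr)
    also have "\<dots> = (\<Oplus>\<^bsub>F\<^esub>b\<in>B. c x b \<odot>\<^bsub>F\<^esub> b) \<oplus>\<^bsub>F\<^esub> (\<Oplus>\<^bsub>F\<^esub>b\<in>B. c y b \<odot>\<^bsub>F\<^esub> b)"
      using cR[OF xy(1)] cR[OF xy(2)] bF by (intro M.finsum_addf) auto
    also have "\<dots> = x \<oplus>\<^bsub>F\<^esub> y" using c(2)[OF xy(1)] c(2)[OF xy(2)] by simp
    finally have "c (x \<oplus>\<^bsub>F\<^esub> y) = ?d"
      using xy cR by (intro uniq) auto
    then show "c (x \<oplus>\<^bsub>F\<^esub> y) b = c x b \<oplus>\<^bsub>regular_module R\<^esub> c y b" using b by simp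
  next
    fix a x assume ax: "a \<in> carrier R" "x \<in> carrier F"
    let ?d = "\<lambda>b\<in>B. a \<otimes>\<^bsub>R\<^esub> c x b"
    have "(\<Oplus>\<^bsub>F\<^esub>b\<in>B. ?d b \<odot>\<^bsub>F\<^esub> b) = (\<Oplus>\<^bsub>F\<^esub>b\<in>B. a \<odot>\<^bsub>F\<^esub> (c x b \<odot>\<^bsub>F\<^esub> b))"
      using cR[OF ax(2)] bF ax by (intro M.finsum_cong') (auto simp: smult_assoc1)
    also have "\<dots> = a \<odot>\<^bsub>F\<^esub> (\<Oplus>\<^bsub>F\<^esub>b\<in>B. c x b \<odot>\<^bsub>F\<^esub> b)"
      using cR[OF ax(2)] bF ax B(1) by (intro finsum_smult_ldistr[symmetric]) auto
    also have "\<dots> = a \<odot>\<^bsub>F\<^esub> x" using c(2)[OF ax(2)] by simp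
    finally have "c (a \<odot>\<^bsub>F\<^esub> x) = ?d"
      using ax cR by (intro uniq) auto
    then show "c (a \<odot>\<^bsub>F\<^esub> x) b = a \<odot>\<^bsub>regular_module R\<^esub> c x b" using b by simp
  qed (use b cR in auto)
  have "(\<lambda>x. \<Oplus>\<^bsub>F\<^esub>b\<in>B'. c x b \<odot>\<^bsub>F\<^esub> b) \<in> triv_maps R F F" if "B' \<subseteq> B" for B'
    using finite_subset[OF that B(1)] that
  proof (induction B')
    case (insert b B')
    then have "b \<in> B" "B' \<subseteq> B" by auto
    let ?f = "\<lambda>x b. c x b \<odot>\<^bsub>F\<^esub> b"
    have "finsum F (?f x) (insert b B') = finsum F (?f x) B' \<oplus>\<^bsub>F\<^esub> ?f x b"
      if x: "x \<in> carrier F" for x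
    proof -
      have cl: "?f x \<in> B' \<rightarrow> carrier F" "?f x b \<in> carrier F"
        using cR[OF x] bF \<open>b \<in> B\<close> \<open>B' \<subseteq> B\<close> by auto
      show ?thesis
        using M.finsum_insert[OF insert.hyps(1,2) cl] M.a_comm[OF M.finsum_closed[OF cl(1)] cl(2)]
        by simp
    qed
    then show ?case
      by (intro triv_maps.step[OF insert.IH[OF \<open>B' \<subseteq> B\<close>] form[OF \<open>b \<in> B\<close>] bF[OF \<open>b \<in> B\<close>]] ballI)
  qed (auto intro: triv_maps.zero)
  from this[OF order_refl] show ?thesis
    by (rule triv_maps_cong) (use c(2) in auto)
qed

text \<open>The elements of an \<open>'a umod\<close> are sets of functions, thought of as cosets. A
  vector of R^n is a coset of the zero submodule, hence a singleton.\<close>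

definition free_mod :: "('a, 'r) ring_scheme \<Rightarrow> nat \<Rightarrow> 'a umod" where
  "free_mod R n = \<lparr>carrier = (\<lambda>f. {f}) ` {f. (\<forall>i<n. f i \<in> carrier R) \<and> (\<forall>i\<ge>n. f i = \<zero>\<^bsub>R\<^esub>)},
     monoid.mult = undefined, one = undefined, ring.zero = {\<lambda>_. \<zero>\<^bsub>R\<^esub>},
     ring.add = (\<lambda>u v. {\<lambda>i. the_elem u i \<oplus>\<^bsub>R\<^esub> the_elem v i}),
     smult = (\<lambda>a u. {\<lambda>i. a \<otimes>\<^bsub>R\<^esub> the_elem u i})\<rparr>"

lemma free_mod_simps [simp]:
  "\<zero>\<^bsub>free_mod R n\<^esub> = {\<lambda>_. \<zero>\<^bsub>R\<^esub>}"
  "u \<oplus>\<^bsub>free_mod R n\<^esub> v = {\<lambda>i. the_elem u i \<oplus>\<^bsub>R\<^esub> the_elem v i}"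
  "a \<odot>\<^bsub>free_mod R n\<^esub> u = {\<lambda>i. a \<otimes>\<^bsub>R\<^esub> the_elem u i}"
  by (simp_all add: free_mod_def)

lemma free_mod_carrier:
  "{f} \<in> carrier (free_mod R n) \<longleftrightarrow> (\<forall>i<n. f i \<in> carrier R) \<and> (\<forall>i\<ge>n. f i = \<zero>\<^bsub>R\<^esub>)"
  by (auto simp: free_mod_def)

lemma free_mod_cases:
  assumes "u \<in> carrier (free_mod R n)"
  obtains f where "u = {f}" "\<forall>i<n. f i \<in> carrier R" "\<forall>i\<ge>n. f i = \<zero>\<^bsub>R\<^esub>"
proof -
  have "u \<in> (\<lambda>f. {f}) ` {f. (\<forall>i<n. f i \<in> carrier R) \<and> (\<forall>i\<ge>n. f i = \<zero>\<^bsub>R\<^esub>)}"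
    using assms by (simp add: free_mod_def)
  then show ?thesis
  proof (rule imageE)
    fix f assume "u = {f}" "f \<in> {f. (\<forall>i<n. f i \<in> carrier R) \<and> (\<forall>i\<ge>n. f i = \<zero>\<^bsub>R\<^esub>)}"
    then show ?thesis by (intro that[of f]) auto
  qed
qed

context cring
begin

lemma free_mod_coord:
  assumes "u \<in> carrier (free_mod R n)"
  shows "the_elem u i \<in> carrier R"
  using assms by (cases "i < n") (auto simp: free_mod_def)

lemma rmodule_free_mod: "rmodule R (free_mod R n)"
  unfolding rmodule_def
proof (rule moduleI)
  show "abelian_group (free_mod R n)"
  proof (rule abelian_groupI)
    fix u assume u: "u \<in> carrier (free_mod R n)"
    then obtain f where f: "u = {f}" "\<forall>i<n. f i \<in> carrier R" "\<forall>i\<ge>n. f i = \<zero>"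
      by (rule free_mod_cases)
    then have "f i \<in> carrier R" for i by (cases "i < n") auto
    then show "\<exists>v\<in>carrier (free_mod R n). v \<oplus>\<^bsub>free_mod R n\<^esub> u = \<zero>\<^bsub>free_mod R n\<^esub>"
      using f by (intro bexI[of _ "{\<lambda>i. \<ominus> f i}"]) (auto simp: free_mod_carrier l_neg)
  qed (auto elim!: free_mod_cases simp: free_mod_carrier free_mod_coord a_ac fun_eq_iff)
qed (auto elim!: free_mod_cases simp: free_mod_carrier free_mod_coord is_cring l_distr r_distr m_assoc fun_eq_iff)

end

definition unit_vec :: "('a, 'r) ring_scheme \<Rightarrow> nat \<Rightarrow> (nat \<Rightarrow> 'a) set" where
  "unit_vec R i = {\<lambda>j. if j = i then \<one>\<^bsub>R\<^esub> else \<zero>\<^bsub>R\<^esub>}"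

context cring
begin

lemma unit_vec_carrier: "i < n \<Longrightarrow> unit_vec R i \<in> carrier (free_mod R n)"
  by (auto simp: unit_vec_def free_mod_carrier)

lemma free_mod_finsum:
  assumes "A \<subseteq> {..<n}" "c \<in> A \<rightarrow> carrier R"
  shows "(\<Oplus>\<^bsub>free_mod R n\<^esub>i\<in>A. c i \<odot>\<^bsub>free_mod R n\<^esub> unit_vec R i) = {\<lambda>i. if i \<in> A then c i else \<zero>}"
proof -
  interpret F: rmodule R "free_mod R n" by (rule rmodule_free_mod)
  show ?thesis
    using finite_subset[OF assms(1) finite_lessThan] assms
  proof (induction A)
    case (insert k A)
    let ?f = "\<lambda>i. c i \<odot>\<^bsub>free_mod R n\<^esub> unit_vec R i"
    have cl: "?f \<in> A \<rightarrow> carrier (free_mod R n)" "?f k \<in> carrier (free_mod R n)"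
      using insert.prems by (auto intro!: F.smult_closed unit_vec_carrier simp del: free_mod_simps)
    have c: "c k \<in> carrier R" "\<forall>i\<in>A. c i \<in> carrier R" using insert.prems by auto
    have IH: "finsum (free_mod R n) ?f A = {\<lambda>i. if i \<in> A then c i else \<zero>}"
      using insert.prems by (intro insert.IH) auto
    have "finsum (free_mod R n) ?f (insert k A) = ?f k \<oplus>\<^bsub>free_mod R n\<^esub> {\<lambda>i. if i \<in> A then c i else \<zero>}"
      unfolding IH[symmetric] by (rule F.M.finsum_insert[OF insert.hyps(1,2) cl])
    also have "\<dots> = {\<lambda>i. if i \<in> insert k A then c i else \<zero>}"
      using c insert.hyps(2) by (auto simp: unit_vec_def fun_eq_iff)
    finally show ?case .
  qed simp
qed

text \<open>A basis is a set in \<open>fg_free\<close>, so the unit vectors have to be distinct;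
  this is where one must differ from zero.\<close>

lemma fg_free_free_mod:
  assumes "\<one> \<noteq> \<zero>"
  shows "fg_free R (free_mod R n)"
proof -
  interpret F: rmodule R "free_mod R n" by (rule rmodule_free_mod)
  let ?B = "unit_vec R ` {..<n}" and ?F = "free_mod R n"
  have inj: "inj_on (unit_vec R) {..<n}"
    using assms by (intro inj_onI) (auto simp: unit_vec_def fun_eq_iff split: if_splits)
  have sum: "(\<Oplus>\<^bsub>?F\<^esub>b\<in>?B. c b \<odot>\<^bsub>?F\<^esub> b) = {\<lambda>i. if i < n then c (unit_vec R i) else \<zero>}"
    if c: "c \<in> ?B \<rightarrow> carrier R" for c
  proof -
    have "(\<lambda>b. c b \<odot>\<^bsub>?F\<^esub> b) \<in> ?B \<rightarrow> carrier ?F"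
      using c by (auto intro!: F.smult_closed unit_vec_carrier simp del: free_mod_simps)
    then have "(\<Oplus>\<^bsub>?F\<^esub>b\<in>?B. c b \<odot>\<^bsub>?F\<^esub> b) = (\<Oplus>\<^bsub>?F\<^esub>i\<in>{..<n}. c (unit_vec R i) \<odot>\<^bsub>?F\<^esub> unit_vec R i)"
      by (rule F.M.finsum_reindex[OF _ inj])
    also have "\<dots> = {\<lambda>i. if i \<in> {..<n} then c (unit_vec R i) else \<zero>}"
      using c by (intro free_mod_finsum) auto
    finally show ?thesis by simp
  qed
  have "\<exists>!c. c \<in> ?B \<rightarrow>\<^sub>E carrier R \<and> u = (\<Oplus>\<^bsub>?F\<^esub>b\<in>?B. c b \<odot>\<^bsub>?F\<^esub> b)" if u: "u \<in> carrier ?F" for u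
  proof -
    obtain f where f: "u = {f}" "\<forall>i<n. f i \<in> carrier R" "\<forall>i\<ge>n. f i = \<zero>"
      using u by (rule free_mod_cases)
    let ?c = "\<lambda>b\<in>?B. f (the_inv_into {..<n} (unit_vec R) b)"
    have ci: "?c (unit_vec R i) = f i" if "i < n" for i
      using that the_inv_into_f_f[OF inj, of i] by simp
    have cE: "?c \<in> ?B \<rightarrow>\<^sub>E carrier R"
      using the_inv_into_f_f[OF inj] f(2) by auto
    show ?thesis
    proof (rule ex1I[of _ ?c])
      have "u = {\<lambda>i. if i < n then ?c (unit_vec R i) else \<zero>}"
        unfolding f(1) using ci f(3) by (auto simp: fun_eq_iff simp del: restrict_apply)
      moreover have "?c \<in> ?B \<rightarrow> carrier R" using cE unfolding PiE_def by (rule IntD1)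
      ultimately show "?c \<in> ?B \<rightarrow>\<^sub>E carrier R \<and> u = (\<Oplus>\<^bsub>?F\<^esub>b\<in>?B. ?c b \<odot>\<^bsub>?F\<^esub> b)"
        using cE sum[of ?c] by simp
    next
      fix d assume d: "d \<in> ?B \<rightarrow>\<^sub>E carrier R \<and> u = (\<Oplus>\<^bsub>?F\<^esub>b\<in>?B. d b \<odot>\<^bsub>?F\<^esub> b)"
      then have "{f} = {\<lambda>i. if i < n then d (unit_vec R i) else \<zero>}"
        using sum[of d] f(1) by (simp add: PiE_def)
      then have "f i = d (unit_vec R i)" if "i < n" for i using that by (auto dest: fun_cong[of _ _ i])
      then have "d b = ?c b" if "b \<in> ?B" for b using that ci by (auto simp del: restrict_apply)
      then show "d = ?c" using d cE by (intro PiE_ext[of d ?B _ ?c]) auto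
    qed
  qed
  moreover have "?B \<subseteq> carrier ?F" by (auto intro: unit_vec_carrier)
  ultimately show ?thesis
    using F.module_axioms unfolding fg_free_def by (intro conjI exI[of _ ?B]) auto
qed

end

lemma (in rmodule) free_mod_hom:
  fixes y :: "nat \<Rightarrow> 'm"
  assumes y: "\<And>i. i < n \<Longrightarrow> y i \<in> carrier M"
  shows "(\<lambda>u. \<Oplus>\<^bsub>M\<^esub>i\<in>{..<n}. the_elem u i \<odot>\<^bsub>M\<^esub> y i) \<in> mod_hom R (free_mod R n) M"
    (is "?q \<in> _")
proof (rule mod_homI)
  let ?F = "free_mod R n"
  fix u assume u: "u \<in> carrier ?F"
  note uc = R.free_mod_coord[OF u]
  show "?q u \<in> carrier M" using uc y by (intro M.finsum_closed) auto
  show "?q (u \<oplus>\<^bsub>?F\<^esub> v) = ?q u \<oplus>\<^bsub>M\<^esub> ?q v" if v: "v \<in> carrier ?F" for v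
  proof -
    note vc = R.free_mod_coord[OF v]
    have "?q (u \<oplus>\<^bsub>?F\<^esub> v) = (\<Oplus>\<^bsub>M\<^esub>i\<in>{..<n}. the_elem u i \<odot>\<^bsub>M\<^esub> y i \<oplus>\<^bsub>M\<^esub> the_elem v i \<odot>\<^bsub>M\<^esub> y i)"
      using uc vc y by (intro M.finsum_cong') (auto simp: smult_l_distr)
    also have "\<dots> = ?q u \<oplus>\<^bsub>M\<^esub> ?q v" using uc vc y by (intro M.finsum_addf) auto
    finally show ?thesis .
  qed
  show "?q (a \<odot>\<^bsub>?F\<^esub> u) = a \<odot>\<^bsub>M\<^esub> ?q u" if a: "a \<in> carrier R" for a
  proof -
    have "?q (a \<odot>\<^bsub>?F\<^esub> u) = (\<Oplus>\<^bsub>M\<^esub>i\<in>{..<n}. a \<odot>\<^bsub>M\<^esub> (the_elem u i \<odot>\<^bsub>M\<^esub> y i))"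
      using uc y a by (intro M.finsum_cong') (auto simp: smult_assoc1)
    also have "\<dots> = a \<odot>\<^bsub>M\<^esub> ?q u" using uc y a by (intro finsum_smult_ldistr[symmetric]) auto
    finally show ?thesis .
  qed
qed

lemma (in rmodule) free_mod_hom_unit_vec:
  fixes y :: "nat \<Rightarrow> 'm"
  assumes y: "\<And>i. i < n \<Longrightarrow> y i \<in> carrier M" and k: "k < n"
  shows "(\<Oplus>\<^bsub>M\<^esub>i\<in>{..<n}. the_elem (unit_vec R k) i \<odot>\<^bsub>M\<^esub> y i) = y k"
proof -
  have "(\<Oplus>\<^bsub>M\<^esub>i\<in>{..<n}. the_elem (unit_vec R k) i \<odot>\<^bsub>M\<^esub> y i)
      = (\<Oplus>\<^bsub>M\<^esub>i\<in>{..<n}. if k = i then y i else \<zero>\<^bsub>M\<^esub>)"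
    using y by (intro M.finsum_cong') (auto simp: unit_vec_def)
  also have "\<dots> = y k" using y k by (intro M.finsum_singleton) auto
  finally show ?thesis .
qed

text \<open>The counterpart of \<open>stably_equal\<close> for arbitrary carrier types, expressed by
  \<open>triv_maps\<close>.\<close>

definition stably_eq ::
  "('a, 'r) ring_scheme \<Rightarrow> ('a, 'm) module \<Rightarrow> ('a, 'n) module \<Rightarrow> ('m \<Rightarrow> 'n) \<Rightarrow> ('m \<Rightarrow> 'n) \<Rightarrow> bool" where
  "stably_eq R M N f g \<longleftrightarrow> (\<lambda>x. f x \<ominus>\<^bsub>N\<^esub> g x) \<in> triv_maps R M N"

context noetherian_local
begin

text \<open>If f - g factors through a free module, the identity of that module may be inserted, and
  it is a sum of rank one maps. Conversely a sum of n rank one maps factors through R^n: its forms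
  are the coordinates of the first map and its vectors the images of the unit vectors under the
  second.\<close>

lemma stably_equal_iff:
  fixes M N :: "'a umod"
  assumes "rmodule R M" "rmodule R N"
  shows "stably_equal R M N f g \<longleftrightarrow> stably_eq R M N f g"
proof
  assume "stably_equal R M N f g"
  then obtain F :: "'a umod" and p q where *: "fg_free R F" "p \<in> mod_hom R M F" "q \<in> mod_hom R F N"
    "\<forall>x\<in>carrier M. f x \<ominus>\<^bsub>N\<^esub> g x = q (p x)" by (auto simp: stably_equal_def)
  interpret N: rmodule R N by fact
  interpret M: rmodule R M by fact
  interpret F: rmodule R F using *(1) by (simp add: fg_free_def rmodule_def)
  interpret FF: rmodule2 R F F by intro_locales
  interpret FN: rmodule2 R F N by intro_locales
  have "q \<circ> id \<in> triv_maps R F N"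
    by (intro FF.triv_maps_comp_left fg_free_id_triv * assms)
  then have "(q \<circ> id) \<circ> p \<in> triv_maps R M N" by (rule FN.triv_maps_comp_right[OF _ *(2)])
  then show "stably_eq R M N f g"
    unfolding stably_eq_def by (rule triv_maps_cong) (use *(4) in simp)
next
  assume "stably_eq R M N f g"
  interpret N: rmodule R N by fact
  interpret M: rmodule R M by fact
  interpret MN: rmodule2 R M N by intro_locales
  obtain n :: nat and \<phi> y where *: "\<forall>i<n. \<phi> i \<in> mod_hom R M (regular_module R) \<and> y i \<in> carrier N"
    "\<forall>x\<in>carrier M. f x \<ominus>\<^bsub>N\<^esub> g x = (\<Oplus>\<^bsub>N\<^esub>i\<in>{..<n}. \<phi> i x \<odot>\<^bsub>N\<^esub> y i)"
    using MN.triv_maps_finsum[OF \<open>stably_eq R M N f g\<close>[unfolded stably_eq_def]] by blast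
  let ?F = "free_mod R n"
  let ?p = "\<lambda>x. {\<lambda>i. if i < n then \<phi> i x else \<zero>}"
  let ?q = "\<lambda>u. \<Oplus>\<^bsub>N\<^esub>i\<in>{..<n}. the_elem u i \<odot>\<^bsub>N\<^esub> y i"
  have \<phi>: "\<phi> i \<in> mod_hom R M (regular_module R)" and y: "y i \<in> carrier N" if "i < n" for i
    using *(1) that by auto
  have c: "\<phi> i x \<in> carrier R" if "i < n" "x \<in> carrier M" for i x
    using mod_hom_closed[OF \<phi>[OF that(1)] that(2)] by simp
  have "?p \<in> mod_hom R M ?F"
    using c mod_hom_add[OF \<phi>] mod_hom_smult[OF \<phi>]
    by (intro mod_homI) (auto simp: free_mod_carrier fun_eq_iff)
  moreover have "?q \<in> mod_hom R ?F N" by (rule N.free_mod_hom[OF y])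
  moreover have "f x \<ominus>\<^bsub>N\<^esub> g x = ?q (?p x)" if x: "x \<in> carrier M" for x
  proof -
    have "?q (?p x) = (\<Oplus>\<^bsub>N\<^esub>i\<in>{..<n}. \<phi> i x \<odot>\<^bsub>N\<^esub> y i)"
      using c[OF _ x] y by (intro N.M.finsum_cong') auto
    then show ?thesis using *(2) x by simp
  qed
  ultimately show "stably_equal R M N f g"
    unfolding stably_equal_def using fg_free_free_mod[OF one_neq_zero, of n] by blast
qed

end

context rmodule2
begin

lemma stably_eq_refl:
  assumes "f \<in> mod_hom R M N"
  shows "stably_eq R M N f f"
  unfolding stably_eq_def
  by (rule triv_maps.zero) (use mod_hom_closed[OF assms] in \<open>auto simp: N.minus_self\<close>)

lemma stably_eq_sym:
  assumes "f \<in> mod_hom R M N" "g \<in> mod_hom R M N" "stably_eq R M N f g"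
  shows "stably_eq R M N g f"
proof -
  have "(\<lambda>x. \<zero>\<^bsub>N\<^esub> \<ominus>\<^bsub>N\<^esub> (f x \<ominus>\<^bsub>N\<^esub> g x)) \<in> triv_maps R M N"
    using assms(3) unfolding stably_eq_def by (rule triv_maps_diff[OF triv_maps_zero])
  then show ?thesis
    unfolding stably_eq_def
    by (rule triv_maps_cong)
      (use mod_hom_closed[OF assms(1)] mod_hom_closed[OF assms(2)] in
        \<open>auto simp: a_minus_def N.minus_add N.a_ac\<close>)
qed

lemma stably_eq_trans:
  assumes "f \<in> mod_hom R M N" "g \<in> mod_hom R M N" "h \<in> mod_hom R M N"
    "stably_eq R M N f g" "stably_eq R M N g h"
  shows "stably_eq R M N f h"
proof -
  have "(\<lambda>x. (f x \<ominus>\<^bsub>N\<^esub> g x) \<oplus>\<^bsub>N\<^esub> (g x \<ominus>\<^bsub>N\<^esub> h x)) \<in> triv_maps R M N"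
    using assms(4,5) unfolding stably_eq_def by (rule triv_maps_add)
  then show ?thesis
    unfolding stably_eq_def
  proof (rule triv_maps_cong)
    fix x assume "x \<in> carrier M"
    then have "f x \<in> carrier N" "g x \<in> carrier N" "h x \<in> carrier N"
      using mod_hom_closed assms(1-3) by metis+
    then show "f x \<ominus>\<^bsub>N\<^esub> h x = (f x \<ominus>\<^bsub>N\<^esub> g x) \<oplus>\<^bsub>N\<^esub> (g x \<ominus>\<^bsub>N\<^esub> h x)"
      by (simp add: a_minus_def N.a_assoc N.r_neg1)
  qed
qed

lemma stably_eq_add:
  assumes "f \<in> mod_hom R M N" "g \<in> mod_hom R M N" "f' \<in> mod_hom R M N" "g' \<in> mod_hom R M N"
    "stably_eq R M N f f'" "stably_eq R M N g g'"
  shows "stably_eq R M N (\<lambda>x. f x \<oplus>\<^bsub>N\<^esub> g x) (\<lambda>x. f' x \<oplus>\<^bsub>N\<^esub> g' x)"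
proof -
  have "(\<lambda>x. (f x \<ominus>\<^bsub>N\<^esub> f' x) \<oplus>\<^bsub>N\<^esub> (g x \<ominus>\<^bsub>N\<^esub> g' x)) \<in> triv_maps R M N"
    using assms(5,6) unfolding stably_eq_def by (rule triv_maps_add)
  then show ?thesis
    unfolding stably_eq_def
  proof (rule triv_maps_cong)
    fix x assume "x \<in> carrier M"
    then have "f x \<in> carrier N" "g x \<in> carrier N" "f' x \<in> carrier N" "g' x \<in> carrier N"
      using mod_hom_closed assms(1-4) by metis+
    then show "f x \<oplus>\<^bsub>N\<^esub> g x \<ominus>\<^bsub>N\<^esub> (f' x \<oplus>\<^bsub>N\<^esub> g' x) = (f x \<ominus>\<^bsub>N\<^esub> f' x) \<oplus>\<^bsub>N\<^esub> (g x \<ominus>\<^bsub>N\<^esub> g' x)"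
      by (simp add: a_minus_def N.a_ac N.minus_add)
  qed
qed

lemma stably_eq_zero_iff:
  assumes "f \<in> mod_hom R M N"
  shows "stably_eq R M N f (\<lambda>_. \<zero>\<^bsub>N\<^esub>) \<longleftrightarrow> f \<in> triv_maps R M N"
  unfolding stably_eq_def
  by (rule iffI; erule triv_maps_cong)
    (use mod_hom_closed[OF assms] in \<open>auto simp: a_minus_def\<close>)

lemma stably_eq_comp_left:
  assumes "f \<in> mod_hom R M N" "f' \<in> mod_hom R M N" "g \<in> mod_hom R N P" "rmodule R P"
    "stably_eq R M N f f'"
  shows "stably_eq R M P (g \<circ> f) (g \<circ> f')"
proof -
  have "g \<circ> (\<lambda>x. f x \<ominus>\<^bsub>N\<^esub> f' x) \<in> triv_maps R M P"
    using assms(5) unfolding stably_eq_def by (rule triv_maps_comp_left[OF _ assms(3,4)])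
  then show ?thesis
    unfolding stably_eq_def
    by (rule triv_maps_cong)
      (use mod_hom_minus[OF rN assms(4,3)] mod_hom_closed[OF assms(1)] mod_hom_closed[OF assms(2)] in simp)
qed

lemma stably_eq_comp_right:
  assumes "g \<in> mod_hom R L M" "stably_eq R M N f f'"
  shows "stably_eq R L N (f \<circ> g) (f' \<circ> g)"
  using triv_maps_comp_right[OF assms(2)[unfolded stably_eq_def] assms(1)]
  by (simp add: stably_eq_def o_def)

end

lemma stably_eq_comp:
  assumes "rmodule R L" "rmodule R M" "rmodule R N"
    "f \<in> mod_hom R L M" "f' \<in> mod_hom R L M" "g \<in> mod_hom R M N" "g' \<in> mod_hom R M N"
    "stably_eq R L M f f'" "stably_eq R M N g g'"
  shows "stably_eq R L N (g \<circ> f) (g' \<circ> f')"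
proof -
  interpret LM: rmodule2 R L M using assms by (simp add: rmodule2_def)
  interpret MN: rmodule2 R M N using assms by (simp add: rmodule2_def)
  interpret LN: rmodule2 R L N using assms by (simp add: rmodule2_def)
  show ?thesis
    by (rule LN.stably_eq_trans[OF _ _ _ LM.stably_eq_comp_left[OF assms(4,5,6,3,8)]
          MN.stably_eq_comp_right[OF assms(5,9)]])
      (rule mod_hom_comp; fact)+
qed

section \<open>Elimination modulo the maximal ideal, and the bound for orthogonal stable
  idempotents\<close>

context local_module
begin

text \<open>Bookkeeping for one row operation in \<open>orthogonal_elimination\<close>: x and y are
  the values of f j on two rows, d and 0 their expected values, and the defect of the combination is
  the combination of the defects.\<close>

lemma minus_rearrange:
  assumes "a \<in> carrier R" "b \<in> carrier R" "x \<in> carrier M" "y \<in> carrier M" "d \<in> carrier M"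
  shows "a \<odot>\<^bsub>M\<^esub> x \<ominus>\<^bsub>M\<^esub> b \<odot>\<^bsub>M\<^esub> y \<ominus>\<^bsub>M\<^esub> a \<odot>\<^bsub>M\<^esub> d = a \<odot>\<^bsub>M\<^esub> (x \<ominus>\<^bsub>M\<^esub> d) \<ominus>\<^bsub>M\<^esub> b \<odot>\<^bsub>M\<^esub> (y \<ominus>\<^bsub>M\<^esub> \<zero>\<^bsub>M\<^esub>)"
proof -
  have "y \<ominus>\<^bsub>M\<^esub> \<zero>\<^bsub>M\<^esub> = y" using assms by (subst minus_eq_iff) auto
  then show ?thesis
    using assms by (simp add: smult_minus) (simp add: a_minus_def M.a_ac)
qed

text \<open>Gaussian elimination over the residue field. Each h i is read as a matrix with rows and
  columns indexed by S, and T is the set of entries that may still be nonzero modulo the maximal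
  ideal. Clearing an entry removes at most one index from K, so K is not exhausted before T is. The
  unit u i records by how much h i has been rescaled: f j after h i stays stably u i f i for i = j
  and zero otherwise. When T is empty, any remaining j gives the required g = h j.\<close>

lemma orthogonal_elimination:
  assumes "finite T" "finite K" "card T < card K" "S \<subseteq> carrier M" "T \<subseteq> S \<times> S"
    "\<And>i. i \<in> K \<Longrightarrow> h i \<in> mod_hom R M M" "\<And>i. i \<in> K \<Longrightarrow> f i \<in> mod_hom R M M"
    "\<And>i. i \<in> K \<Longrightarrow> u i \<in> carrier R - \<mm>"
    "\<And>i j. i \<in> K \<Longrightarrow> j \<in> K \<Longrightarrow>
       (\<lambda>x. f j (h i x) \<ominus>\<^bsub>M\<^esub> (if i = j then u i \<odot>\<^bsub>M\<^esub> f i x else \<zero>\<^bsub>M\<^esub>)) \<in> triv_maps R M M"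
    "\<And>i a. i \<in> K \<Longrightarrow> a \<in> S \<Longrightarrow> h i a \<in> mod_span R M ({b. (a, b) \<in> T} \<union> ideal_smult R M \<mm>)"
  shows "\<exists>j\<in>K. \<exists>g\<in>mod_hom R M M. \<exists>v\<in>carrier R - \<mm>.
    (\<lambda>x. f j (g x) \<ominus>\<^bsub>M\<^esub> v \<odot>\<^bsub>M\<^esub> f j x) \<in> triv_maps R M M \<and> (\<forall>a\<in>S. g a \<in> ideal_smult R M \<mm>)"
  using assms
proof (induction T arbitrary: K h u)
  case empty
  then obtain j where j: "j \<in> K" by fastforce
  have "\<mm> \<subseteq> carrier R" using ideal.Icarr[OF max_ideal_ideal] by auto
  then have "h j a \<in> ideal_smult R M \<mm>" if "a \<in> S" for a
    using empty.prems(9)[OF j that] mod_span_eq[OF ideal_smult_submodule] by simp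
  then show ?case
    using empty.prems(5)[OF j] empty.prems(7)[OF j] empty.prems(8)[OF j j] j by auto
next
  case (insert t T)
  interpret I: ideal \<mm> R by (rule max_ideal_ideal)
  interpret P: primeideal \<mm> R by (rule max_ideal_prime)
  interpret MM: rmodule2 R M M by intro_locales
  note M = rmodule_axioms
  obtain a0 b0 where t: "t = (a0, b0)" by fastforce
  have ab: "a0 \<in> S" "b0 \<in> carrier M" "T \<subseteq> S \<times> S" using insert.prems(3,4) t by auto
  have sub: "\<mm> \<subseteq> carrier R" using I.Icarr by auto
  let ?G = "\<lambda>a. {b. (a, b) \<in> T} \<union> ideal_smult R M \<mm>"
  have G: "?G a \<subseteq> carrier M" for a
    using ab(3) insert.prems(3) ideal_smult_closed[OF sub] by auto
  note sG = mod_span_submodule[OF G] and hh = insert.prems(5) and ff = insert.prems(6)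
  have "\<exists>r y. r \<in> carrier R \<and> y \<in> mod_span R M (?G a0) \<and> h i a0 = r \<odot>\<^bsub>M\<^esub> b0 \<oplus>\<^bsub>M\<^esub> y" if i: "i \<in> K" for i
  proof -
    have "{b. (a0, b) \<in> insert t T} \<union> ideal_smult R M \<mm> = insert b0 (?G a0)" using t by auto
    then have "h i a0 \<in> mod_span R M (insert b0 (?G a0))"
      using insert.prems(9)[OF i ab(1)] by simp
    from this ab(2) G[of a0] show ?thesis by (rule mod_span_insert) blast
  qed
  then obtain r y where ry: "\<And>i. i \<in> K \<Longrightarrow> r i \<in> carrier R"
    "\<And>i. i \<in> K \<Longrightarrow> y i \<in> mod_span R M (?G a0)"
    "\<And>i. i \<in> K \<Longrightarrow> h i a0 = r i \<odot>\<^bsub>M\<^esub> b0 \<oplus>\<^bsub>M\<^esub> y i" by metis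
  have other: "h i a \<in> mod_span R M (?G a)" if "i \<in> K" "a \<in> S" "a \<noteq> a0" for i a
  proof -
    have "{b. (a, b) \<in> insert t T} = {b. (a, b) \<in> T}" using t that(3) by auto
    then show ?thesis using insert.prems(9)[OF that(1,2)] by simp
  qed
  show ?case
  proof (cases "\<forall>i\<in>K. r i \<in> \<mm>")
    case True
    have "h i a \<in> mod_span R M (?G a)" if i: "i \<in> K" and a: "a \<in> S" for i a
    proof (cases "a = a0")
      case True
      have "r i \<odot>\<^bsub>M\<^esub> b0 \<in> ?G a0" using \<open>\<forall>i\<in>K. r i \<in> \<mm>\<close> i ab(2) ideal_smultI by auto
      then have "r i \<odot>\<^bsub>M\<^esub> b0 \<in> mod_span R M (?G a0)" by (rule mod_span_base)
      then show ?thesis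
        using submoduleE(5)[OF sG _ ry(2)[OF i]] ry(3)[OF i] True by simp
    qed (use other i a in blast)
    moreover have "card T < card K" using insert.prems(2) insert.hyps by simp
    ultimately show ?thesis
      using insert.prems(1,3-8) ab(3) by (intro insert.IH[where h = h and u = u]) auto
  next
    case False
    then obtain p where p: "p \<in> K" "r p \<notin> \<mm>" by blast
    note rp = ry(1)[OF p(1)]
    let ?K = "K - {p}"
    \<comment> \<open>At position t the entries cancel: r p r i - r i r p = 0. The pivot row is
      given up, and for the remaining j the map f j stably kills h p, so the new rows satisfy the
      relations with u i multiplied by the unit r p.\<close>
    let ?h = "\<lambda>i x. r p \<odot>\<^bsub>M\<^esub> h i x \<ominus>\<^bsub>M\<^esub> r i \<odot>\<^bsub>M\<^esub> h p x"
    let ?u = "\<lambda>i. r p \<otimes> u i"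
    have "\<exists>j\<in>?K. \<exists>g\<in>mod_hom R M M. \<exists>v\<in>carrier R - \<mm>.
      (\<lambda>x. f j (g x) \<ominus>\<^bsub>M\<^esub> v \<odot>\<^bsub>M\<^esub> f j x) \<in> triv_maps R M M \<and> (\<forall>a\<in>S. g a \<in> ideal_smult R M \<mm>)"
    proof (rule insert.IH[where h = ?h and u = ?u])
      show "finite ?K" using insert.prems(1) by simp
      show "card T < card ?K" using insert.prems(1,2) insert.hyps p(1) by simp
      show "?h i \<in> mod_hom R M M" if "i \<in> ?K" for i
        using that p(1) ry(1) hh by (intro mod_hom_diff mod_hom_scale M) auto
      show "?u i \<in> carrier R - \<mm>" if "i \<in> ?K" for i
        using that insert.prems(7)[of i] p rp P.I_prime[of "r p" "u i"] by auto
      show "(\<lambda>x. f j (?h i x) \<ominus>\<^bsub>M\<^esub> (if i = j then ?u i \<odot>\<^bsub>M\<^esub> f i x else \<zero>\<^bsub>M\<^esub>)) \<in> triv_maps R M M"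
        if ij: "i \<in> ?K" "j \<in> ?K" for i j
      proof -
        have iK: "i \<in> K" "j \<in> K" "p \<noteq> j" using ij by auto
        let ?d = "\<lambda>x. if i = j then u i \<odot>\<^bsub>M\<^esub> f i x else \<zero>\<^bsub>M\<^esub>"
        have "(\<lambda>x. r p \<odot>\<^bsub>M\<^esub> (f j (h i x) \<ominus>\<^bsub>M\<^esub> ?d x) \<ominus>\<^bsub>M\<^esub> r i \<odot>\<^bsub>M\<^esub> (f j (h p x) \<ominus>\<^bsub>M\<^esub> \<zero>\<^bsub>M\<^esub>)) \<in> triv_maps R M M"
          using insert.prems(8)[OF p(1) iK(2)] iK(3)
          by (intro MM.triv_maps_diff[OF MM.triv_maps_scale MM.triv_maps_scale]
              insert.prems(8)[OF iK(1,2)] rp ry(1)[OF iK(1)]) simp_all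
        then show ?thesis
        proof (rule triv_maps_cong)
          fix x assume x: "x \<in> carrier M"
          note hc = mod_hom_closed[OF hh x] and fc = mod_hom_closed[OF ff]
          have c: "f j (h i x) \<in> carrier M" "f j (h p x) \<in> carrier M" "?d x \<in> carrier M" "u i \<in> carrier R"
            "r i \<in> carrier R" "r p \<in> carrier R" "h i x \<in> carrier M" "h p x \<in> carrier M" "f i x \<in> carrier M"
            using hc[OF iK(1)] hc[OF p(1)] fc[OF iK(2)] fc[OF iK(1) x] insert.prems(7)[OF iK(1)] ry(1)[OF iK(1)] rp
            by auto
          have "f j (?h i x) = r p \<odot>\<^bsub>M\<^esub> f j (h i x) \<ominus>\<^bsub>M\<^esub> r i \<odot>\<^bsub>M\<^esub> f j (h p x)"
            using c by (simp add: mod_hom_minus[OF M M ff[OF iK(2)]] mod_hom_smult[OF ff[OF iK(2)]])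
          moreover have "(if i = j then ?u i \<odot>\<^bsub>M\<^esub> f i x else \<zero>\<^bsub>M\<^esub>) = r p \<odot>\<^bsub>M\<^esub> ?d x"
            using c smult_assoc1[of "r p" "u i" "f i x"] by auto
          ultimately show "f j (?h i x) \<ominus>\<^bsub>M\<^esub> (if i = j then ?u i \<odot>\<^bsub>M\<^esub> f i x else \<zero>\<^bsub>M\<^esub>)
              = r p \<odot>\<^bsub>M\<^esub> (f j (h i x) \<ominus>\<^bsub>M\<^esub> ?d x) \<ominus>\<^bsub>M\<^esub> r i \<odot>\<^bsub>M\<^esub> (f j (h p x) \<ominus>\<^bsub>M\<^esub> \<zero>\<^bsub>M\<^esub>)"
            using minus_rearrange[OF c(6,5,1,2,3)] by simp
        qed
      qed
      show "?h i a \<in> mod_span R M (?G a)" if i: "i \<in> ?K" and a: "a \<in> S" for i a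
      proof (cases "a = a0")
        case True
        have iK: "i \<in> K" using i by simp
        have yc: "y i \<in> carrier M" "y p \<in> carrier M"
          using ry(2)[OF iK] ry(2)[OF p(1)] submoduleE(1)[OF sG] by auto
        have rb: "r p \<odot>\<^bsub>M\<^esub> (r i \<odot>\<^bsub>M\<^esub> b0) = r i \<odot>\<^bsub>M\<^esub> (r p \<odot>\<^bsub>M\<^esub> b0)"
          using rp ry(1)[OF iK] ab(2) m_comm[of "r p" "r i"] by (simp flip: smult_assoc1)
        define z where "z = r i \<odot>\<^bsub>M\<^esub> (r p \<odot>\<^bsub>M\<^esub> b0)"
        have zc: "z \<in> carrier M" using rp ry(1)[OF iK] ab(2) by (simp add: z_def)
        have "?h i a0 = (z \<oplus>\<^bsub>M\<^esub> r p \<odot>\<^bsub>M\<^esub> y i) \<ominus>\<^bsub>M\<^esub> (z \<oplus>\<^bsub>M\<^esub> r i \<odot>\<^bsub>M\<^esub> y p)"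
          using rp ry(1)[OF iK] yc ab(2) by (simp add: ry(3)[OF iK] ry(3)[OF p(1)] smult_r_distr rb z_def)
        also have "\<dots> = r p \<odot>\<^bsub>M\<^esub> y i \<ominus>\<^bsub>M\<^esub> r i \<odot>\<^bsub>M\<^esub> y p"
          using rp ry(1)[OF iK] yc zc
          by (simp add: a_minus_def M.minus_add M.a_assoc M.a_lcomm[of "r p \<odot>\<^bsub>M\<^esub> y i"] M.r_neg2 M.r_neg1)
        finally show ?thesis
          using submodule_minus[OF sG] submoduleE(4)[OF sG] ry(1)[OF iK] rp ry(2)[OF iK] ry(2)[OF p(1)] True
          by simp
      next
        case False
        have iK: "i \<in> K" using i by simp
        show ?thesis
          by (intro submodule_minus[OF sG] submoduleE(4)[OF sG] other iK p(1) a False rp ry(1)[OF iK])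
      qed
    qed (use insert.prems(3,6) ab in auto)
    then show ?thesis by blast
  qed
qed

text \<open>The bound is the number of matrix entries for a generating set S. Elimination starts
  with h = f, u = 1 and T = S x S, for which the condition on the values of h is empty because S
  generates M.\<close>

lemma orthogonal_idempotents_bounded:
  assumes "fin_gen R M"
  shows "\<exists>n. \<forall>(K :: 'i set) f. finite K \<and> (\<forall>i\<in>K. f i \<in> mod_hom R M M) \<and>
    (\<forall>i\<in>K. stably_eq R M M (f i \<circ> f i) (f i)) \<and>
    (\<forall>i\<in>K. \<forall>j\<in>K. i \<noteq> j \<longrightarrow> stably_eq R M M (f j \<circ> f i) (\<lambda>_. \<zero>\<^bsub>M\<^esub>)) \<and>
    (\<forall>i\<in>K. f i \<notin> triv_maps R M M) \<longrightarrow> card K \<le> n"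
proof -
  note M = rmodule_axioms
  interpret I: ideal \<mm> R by (rule max_ideal_ideal)
  interpret MM: rmodule2 R M M by intro_locales
  have sub: "\<mm> \<subseteq> carrier R" using I.Icarr by auto
  obtain S where S: "finite S" "S \<subseteq> carrier M" "mod_span R M S = carrier M"
    using assms by (auto simp: fin_gen_def)
  have bound: "card K \<le> card (S \<times> S)"
    if K: "finite K" "\<And>i. i \<in> K \<Longrightarrow> f i \<in> mod_hom R M M"
      "\<And>i. i \<in> K \<Longrightarrow> stably_eq R M M (f i \<circ> f i) (f i)"
      "\<And>i j. i \<in> K \<Longrightarrow> j \<in> K \<Longrightarrow> i \<noteq> j \<Longrightarrow> stably_eq R M M (f j \<circ> f i) (\<lambda>_. \<zero>\<^bsub>M\<^esub>)"
      "\<And>i. i \<in> K \<Longrightarrow> f i \<notin> triv_maps R M M" for K :: "'i set" and f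
  proof (rule ccontr)
    assume "\<not> card K \<le> card (S \<times> S)"
    then have less: "card (S \<times> S) < card K" by simp
    note ff = K(2)
    have "\<exists>j\<in>K. \<exists>g\<in>mod_hom R M M. \<exists>v\<in>carrier R - \<mm>.
      (\<lambda>x. f j (g x) \<ominus>\<^bsub>M\<^esub> v \<odot>\<^bsub>M\<^esub> f j x) \<in> triv_maps R M M \<and> (\<forall>a\<in>S. g a \<in> ideal_smult R M \<mm>)"
    proof (rule orthogonal_elimination[where T = "S \<times> S" and u = "\<lambda>_. \<one>" and h = f])
      show "(\<lambda>x. f j (f i x) \<ominus>\<^bsub>M\<^esub> (if i = j then \<one> \<odot>\<^bsub>M\<^esub> f i x else \<zero>\<^bsub>M\<^esub>)) \<in> triv_maps R M M"
        if ij: "i \<in> K" "j \<in> K" for i j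
      proof (cases "i = j")
        case True
        show ?thesis
          by (rule triv_maps_cong[OF K(3)[OF ij(1), unfolded stably_eq_def]])
            (use True mod_hom_closed[OF ff[OF ij(1)]] in simp)
      next
        case False
        show ?thesis
          by (rule triv_maps_cong[OF K(4)[OF ij False, unfolded stably_eq_def]]) (use False in simp)
      qed
      show "f i a \<in> mod_span R M ({b. (a, b) \<in> S \<times> S} \<union> ideal_smult R M \<mm>)" if "i \<in> K" "a \<in> S" for i a
      proof -
        have "f i a \<in> mod_span R M S" using mod_hom_closed[OF ff[OF that(1)]] S that(2) by auto
        then show ?thesis by (rule rev_subsetD[OF _ mod_span_mono]) (use that in auto)
      qed
    qed (use S K less one_notin_max in auto)
    then obtain j g v where j: "j \<in> K" and g: "g \<in> mod_hom R M M" "\<forall>a\<in>S. g a \<in> ideal_smult R M \<mm>"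
      and v: "v \<in> carrier R" "v \<notin> \<mm>" and tr: "(\<lambda>x. f j (g x) \<ominus>\<^bsub>M\<^esub> v \<odot>\<^bsub>M\<^esub> f j x) \<in> triv_maps R M M"
      by auto
    obtain w where w: "w \<in> carrier R" "w \<otimes> v = \<one>" using unit_if_notin_max v by blast
    note fj = ff[OF j]
    let ?g = "\<lambda>x. w \<odot>\<^bsub>M\<^esub> g x"
    have g': "?g \<in> mod_hom R M M" using w g by (intro mod_hom_scale M)
    have "g x \<in> ideal_smult R M \<mm>" if "x \<in> carrier M" for x
    proof -
      have "g x \<in> mod_span R M (ideal_smult R M \<mm>)"
        by (rule mod_hom_span[OF M M g(1) S(2)])
          (use ideal_smult_closed[OF sub] g(2) that S(3) mod_span_base in auto)
      then show ?thesis by (simp add: mod_span_eq[OF ideal_smult_submodule[OF sub]])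
    qed
    then have "?g x \<in> ideal_smult R M \<mm>" if "x \<in> carrier M" for x
      using submoduleE(4)[OF ideal_smult_submodule[OF sub]] w that by simp
    from one_minus_invertible[OF assms g' this]
    obtain h where h: "h \<in> mod_hom R M M" "\<forall>x\<in>carrier M. h x \<ominus>\<^bsub>M\<^esub> ?g (h x) = x" by blast
    \<comment> \<open>Since w v = 1, the map f j (1 - w g) equals - w (f j g - v f j), which is
      stably trivial. Composing with h, the inverse of 1 - w g, leaves f j.\<close>
    have "(\<lambda>x. \<zero>\<^bsub>M\<^esub> \<ominus>\<^bsub>M\<^esub> w \<odot>\<^bsub>M\<^esub> (f j (g x) \<ominus>\<^bsub>M\<^esub> v \<odot>\<^bsub>M\<^esub> f j x)) \<circ> h \<in> triv_maps R M M"
      by (intro MM.triv_maps_comp_right[OF _ h(1)] MM.triv_maps_diff MM.triv_maps_zero MM.triv_maps_scale tr w)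
    then have "f j \<in> triv_maps R M M"
    proof (rule triv_maps_cong)
      fix x assume x: "x \<in> carrier M"
      note hx = mod_hom_closed[OF h(1) x]
      note c = mod_hom_closed[OF fj hx] mod_hom_closed[OF fj mod_hom_closed[OF g(1) hx]] mod_hom_closed[OF g(1) hx]
      have "w \<odot>\<^bsub>M\<^esub> (f j (g (h x)) \<ominus>\<^bsub>M\<^esub> v \<odot>\<^bsub>M\<^esub> f j (h x)) = w \<odot>\<^bsub>M\<^esub> f j (g (h x)) \<ominus>\<^bsub>M\<^esub> f j (h x)"
        using c w v by (simp add: smult_minus flip: smult_assoc1)
      moreover have "f j x = f j (h x \<ominus>\<^bsub>M\<^esub> ?g (h x))" using h(2) x by simp
      moreover have "f j (h x \<ominus>\<^bsub>M\<^esub> ?g (h x)) = f j (h x) \<ominus>\<^bsub>M\<^esub> w \<odot>\<^bsub>M\<^esub> f j (g (h x))"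
        using c hx w by (simp add: mod_hom_minus[OF M M fj] mod_hom_smult[OF fj])
      ultimately show "f j x = ((\<lambda>x. \<zero>\<^bsub>M\<^esub> \<ominus>\<^bsub>M\<^esub> w \<odot>\<^bsub>M\<^esub> (f j (g x) \<ominus>\<^bsub>M\<^esub> v \<odot>\<^bsub>M\<^esub> f j x)) \<circ> h) x"
        using c w by (simp add: a_minus_def M.minus_add M.a_comm)
    qed
    then show False using K(5)[OF j] by simp
  qed
  show ?thesis
  proof (intro exI[of _ "card (S \<times> S)"] allI impI, elim conjE)
    fix K :: "'i set" and f
    assume "finite K" "\<forall>i\<in>K. f i \<in> mod_hom R M M" "\<forall>i\<in>K. stably_eq R M M (f i \<circ> f i) (f i)"
      "\<forall>i\<in>K. \<forall>j\<in>K. i \<noteq> j \<longrightarrow> stably_eq R M M (f j \<circ> f i) (\<lambda>_. \<zero>\<^bsub>M\<^esub>)"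
      "\<forall>i\<in>K. f i \<notin> triv_maps R M M"
    then show "card K \<le> card (S \<times> S)" by (intro bound[of K f]) simp_all
  qed
qed

end

section \<open>Regular sequences and primes\<close>

lemma (in rmodule) smult_left_comm:
  assumes "a \<in> carrier R" "b \<in> carrier R" "x \<in> carrier M"
  shows "a \<odot>\<^bsub>M\<^esub> (b \<odot>\<^bsub>M\<^esub> x) = b \<odot>\<^bsub>M\<^esub> (a \<odot>\<^bsub>M\<^esub> x)"
  using assms by (simp add: R.m_comm flip: smult_assoc1)

context noetherian_local
begin

lemma ideal_plus_principal:
  assumes "ideal I R" "a \<in> carrier R"
  shows "ideal {q \<oplus> r \<otimes> a |q r. q \<in> I \<and> r \<in> carrier R} R" (is "ideal ?J R")
proof (rule cring_idealI)
  interpret I: ideal I R by fact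
  show "?J \<subseteq> carrier R" using I.Icarr assms(2) by auto
  have "\<zero> = \<zero> \<oplus> \<zero> \<otimes> a" using assms(2) by simp
  then show "\<zero> \<in> ?J" using I.zero_closed by blast
  show "x \<oplus> y \<in> ?J" if xy: "x \<in> ?J" "y \<in> ?J" for x y
  proof -
    obtain q r q' r' where *: "x = q \<oplus> r \<otimes> a" "q \<in> I" "r \<in> carrier R" "y = q' \<oplus> r' \<otimes> a" "q' \<in> I" "r' \<in> carrier R"
      using xy by auto
    then have "x \<oplus> y = (q \<oplus> q') \<oplus> (r \<oplus> r') \<otimes> a"
      using I.Icarr assms(2) by (simp add: l_distr a_ac)
    then show ?thesis using * I.a_closed by blast
  qed
  show "y \<otimes> x \<in> ?J" if x: "x \<in> ?J" and y: "y \<in> carrier R" for x y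
  proof -
    obtain q r where *: "x = q \<oplus> r \<otimes> a" "q \<in> I" "r \<in> carrier R" using x by auto
    then have "y \<otimes> x = y \<otimes> q \<oplus> (y \<otimes> r) \<otimes> a"
      using I.Icarr assms(2) y by (simp add: r_distr m_assoc)
    moreover have "y \<otimes> q \<in> I" "y \<otimes> r \<in> carrier R" using * y I.I_l_closed by auto
    ultimately show ?thesis by blast
  qed
qed

text \<open>An ideal Q maximal among those that contain I and avoid T is prime: if a and b lie
  outside Q, then Q + (a) and Q + (b) both meet T, and for a b in Q the product of two such elements
  would lie in Q and in T.\<close>

lemma prime_disjoint:
  assumes "ideal I R" "I \<inter> T = {}" "T \<subseteq> carrier R" "\<one> \<in> T" "\<And>s t. s \<in> T \<Longrightarrow> t \<in> T \<Longrightarrow> s \<otimes> t \<in> T"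
  shows "\<exists>Q. primeideal Q R \<and> I \<subseteq> Q \<and> Q \<inter> T = {}"
proof -
  let ?\<C> = "{J. ideal J R \<and> I \<subseteq> J \<and> J \<inter> T = {}}"
  have "?\<C> \<noteq> {}" using assms(1,2) by blast
  then have "\<exists>Q\<in>?\<C>. \<forall>J\<in>?\<C>. Q \<subseteq> J \<longrightarrow> J = Q" by (rule noetherian_maximal) simp
  then obtain Q where QC: "Q \<in> ?\<C>" and max': "\<forall>J\<in>?\<C>. Q \<subseteq> J \<longrightarrow> J = Q" by (rule bexE)
  have Q: "ideal Q R" "I \<subseteq> Q" "Q \<inter> T = {}" using QC by simp_all
  have max: "J = Q" if "ideal J R" "I \<subseteq> J" "J \<inter> T = {}" "Q \<subseteq> J" for J
    using max' that by simp
  interpret Q: ideal Q R by (rule Q)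
  have extend: "\<exists>q\<in>Q. \<exists>r\<in>carrier R. q \<oplus> r \<otimes> a \<in> T" if a: "a \<in> carrier R" "a \<notin> Q" for a
  proof (rule ccontr)
    assume *: "\<not> ?thesis"
    let ?J = "{q \<oplus> r \<otimes> a |q r. q \<in> Q \<and> r \<in> carrier R}"
    have "?J \<inter> T = {}" using * by auto
    have sub: "q \<in> ?J" if "q \<in> Q" for q
    proof -
      have "q = q \<oplus> \<zero> \<otimes> a" using a Q.Icarr[OF that] by simp
      then show ?thesis using that by blast
    qed
    then have "?J = Q"
      using Q(2) \<open>?J \<inter> T = {}\<close> by (intro max ideal_plus_principal Q a) auto
    moreover have "a = \<zero> \<oplus> \<one> \<otimes> a" using a by simp
    then have "a \<in> ?J" using Q.zero_closed by blast
    ultimately show False using a by simp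
  qed
  have "primeideal Q R"
  proof (rule primeidealI[OF Q(1) is_cring])
    show "carrier R \<noteq> Q" using Q(3) assms(4) by auto
    fix a b assume ab: "a \<in> carrier R" "b \<in> carrier R" "a \<otimes> b \<in> Q"
    show "a \<in> Q \<or> b \<in> Q"
    proof (rule ccontr)
      assume "\<not> (a \<in> Q \<or> b \<in> Q)"
      then obtain q r q' r' where *: "q \<in> Q" "r \<in> carrier R" "q \<oplus> r \<otimes> a \<in> T"
        "q' \<in> Q" "r' \<in> carrier R" "q' \<oplus> r' \<otimes> b \<in> T"
        using extend[OF ab(1)] extend[OF ab(2)] by auto
      have c: "q \<in> carrier R" "q' \<in> carrier R" using * Q.Icarr by auto
      have "(q \<oplus> r \<otimes> a) \<otimes> (q' \<oplus> r' \<otimes> b) = (q' \<oplus> r' \<otimes> b) \<otimes> q \<oplus> ((r \<otimes> a) \<otimes> q' \<oplus> (r \<otimes> r') \<otimes> (a \<otimes> b))"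
        using * ab c by (simp add: l_distr r_distr m_ac a_ac)
      also have "\<dots> \<in> Q"
        by (rule Q.a_closed[OF Q.I_l_closed Q.a_closed[OF Q.I_l_closed Q.I_l_closed]]) (use * ab c in auto)
      finally show False using assms(5)[OF *(3,6)] Q(3) by auto
    qed
  qed
  then show ?thesis using Q by blast
qed

text \<open>Take a prime above I that avoids all x^n s with s outside P. The case n = 0 puts it
  inside P, and x itself is avoided. The ideal I avoids these products because x may be cancelled
  modulo I and I lies in P.\<close>

lemma prime_below_avoiding:
  assumes "ideal I R" "primeideal P R" "I \<subseteq> P" "x \<in> carrier R"
    and reg: "\<And>r. r \<in> carrier R \<Longrightarrow> x \<otimes> r \<in> I \<Longrightarrow> r \<in> I"
  shows "\<exists>Q. primeideal Q R \<and> I \<subseteq> Q \<and> Q \<subseteq> P \<and> x \<notin> Q"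
proof -
  interpret P: primeideal P R by fact
  interpret I: ideal I R by fact
  have one: "\<one> \<in> carrier R - P" using P.I_notcarr P.one_imp_carrier by auto
  let ?T = "{x [^] (n :: nat) \<otimes> s |n s. s \<in> carrier R - P}"
  have regn: "r \<in> I" if "r \<in> carrier R" "x [^] (n :: nat) \<otimes> r \<in> I" for n r
    using that
  proof (induction n)
    case (Suc n)
    have "x [^] Suc n \<otimes> r = x \<otimes> (x [^] n \<otimes> r)"
      using Suc.prems(1) assms(4) by (simp add: m_assoc m_lcomm[of "x [^] n" x])
    with Suc.prems(2) have "x \<otimes> (x [^] n \<otimes> r) \<in> I" by (simp only:)
    then have "x [^] n \<otimes> r \<in> I" by (rule reg[rotated]) (use Suc.prems(1) assms(4) in auto)
    then show ?case by (rule Suc.IH[OF Suc.prems(1)])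
  qed (use assms(4) in auto)
  have "\<exists>Q. primeideal Q R \<and> I \<subseteq> Q \<and> Q \<inter> ?T = {}"
  proof (rule prime_disjoint[OF assms(1)])
    show "I \<inter> ?T = {}" using regn assms(3) by blast
    show "?T \<subseteq> carrier R" using assms(4) by auto
    have "\<one> = x [^] (0 :: nat) \<otimes> \<one>" by simp
    then show "\<one> \<in> ?T" using one by blast
    show "s \<otimes> t \<in> ?T" if st: "s \<in> ?T" "t \<in> ?T" for s t
    proof -
      obtain n a m b where *: "s = x [^] (n :: nat) \<otimes> a" "a \<in> carrier R - P" "t = x [^] (m :: nat) \<otimes> b" "b \<in> carrier R - P"
        using st by auto
      have "s \<otimes> t = x [^] (n + m) \<otimes> (a \<otimes> b)"
        using * assms(4) by (simp add: nat_pow_mult[symmetric] m_assoc m_lcomm[of a])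
      moreover have "a \<otimes> b \<in> carrier R - P" using * P.I_prime[of a b] by auto
      ultimately show ?thesis by blast
    qed
  qed
  then obtain Q where Q: "primeideal Q R" "I \<subseteq> Q" "Q \<inter> ?T = {}" by blast
  have "q \<in> P" if "q \<in> Q" for q
  proof (rule ccontr)
    assume "q \<notin> P"
    have "q \<in> carrier R" using ideal.Icarr[OF primeideal.axioms(1)[OF Q(1)] that] .
    then have "q = x [^] (0 :: nat) \<otimes> q" "q \<in> carrier R - P" using \<open>q \<notin> P\<close> by auto
    then have "q \<in> ?T" by blast
    then show False using Q(3) that by auto
  qed
  moreover have "x = x [^] (1 :: nat) \<otimes> \<one>" using assms(4) by (simp add: nat_pow_eone)
  then have "x \<in> ?T" using one by blast
  ultimately show ?thesis using Q by blast
qed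

text \<open>Multiply an element of I outside P by one such element of every Q; the product lies in
  all these ideals, and primality of P keeps it outside P.\<close>

lemma prime_not_contains_Inter:
  assumes "finite \<Q>" "primeideal P R" "\<And>Q. Q \<in> \<Q> \<Longrightarrow> ideal Q R \<and> \<not> Q \<subseteq> P" "ideal I R" "\<not> I \<subseteq> P"
  shows "\<exists>b\<in>I - P. \<forall>Q\<in>\<Q>. b \<in> Q"
  using assms(1,3)
proof (induction \<Q>)
  case empty
  then show ?case using assms(5) by blast
next
  case (insert Q \<Q>)
  interpret P: primeideal P R by fact
  obtain b where b: "b \<in> I" "b \<notin> P" "\<forall>Q\<in>\<Q>. b \<in> Q" using insert by blast
  obtain q where q: "q \<in> Q" "q \<notin> P" using insert.prems by blast
  have Q: "ideal Q R" using insert.prems by blast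
  have c: "b \<in> carrier R" "q \<in> carrier R" using ideal.Icarr[OF assms(4) b(1)] ideal.Icarr[OF Q q(1)] .
  have "b \<otimes> q \<notin> P" using P.I_prime[OF c] b(2) q(2) by blast
  moreover have "b \<otimes> q \<in> I" by (rule ideal.I_r_closed[OF assms(4) b(1) c(2)])
  moreover have "b \<otimes> q \<in> Q" by (rule ideal.I_l_closed[OF Q q(1) c(1)])
  moreover have "b \<otimes> q \<in> Q'" if "Q' \<in> \<Q>" for Q'
    using ideal.I_r_closed[of Q' R b q] b(3) c insert.prems that by blast
  ultimately show ?case by blast
qed

text \<open>If the element a found for the smaller family lies in the new prime P, it is corrected
  by an element of I that lies in all the other primes but not in P. Incomparability of the primes
  is what provides such an element.\<close>

lemma prime_avoidance:
  assumes "finite \<P>" "\<And>P. P \<in> \<P> \<Longrightarrow> primeideal P R"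
    "\<And>P Q. P \<in> \<P> \<Longrightarrow> Q \<in> \<P> \<Longrightarrow> P \<subseteq> Q \<Longrightarrow> P = Q"
    "ideal I R" "\<And>P. P \<in> \<P> \<Longrightarrow> \<not> I \<subseteq> P"
  shows "\<exists>a\<in>I. \<forall>P\<in>\<P>. a \<notin> P"
  using assms(1,2,3,5)
proof (induction \<P>)
  case empty
  then show ?case using additive_subgroup.zero_closed[OF ideal.axioms(1)[OF assms(4)]] by blast
next
  case (insert P \<P>)
  have "\<exists>a\<in>I. \<forall>P\<in>\<P>. a \<notin> P" by (rule insert.IH) (use insert.prems in auto)
  then obtain a where a: "a \<in> I" "\<forall>P\<in>\<P>. a \<notin> P" by blast
  have P: "primeideal P R" using insert.prems(1) by simp
  show ?case
  proof (cases "a \<in> P")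
    case True
    have "\<exists>b\<in>I - P. \<forall>Q\<in>\<P>. b \<in> Q"
    proof (rule prime_not_contains_Inter[OF insert.hyps(1) P _ assms(4)])
      show "\<not> I \<subseteq> P" using insert.prems(3) by simp
      fix Q assume Q: "Q \<in> \<P>"
      then have "Q \<noteq> P" using insert.hyps(2) by blast
      then have "\<not> Q \<subseteq> P" using insert.prems(2)[of Q P] Q by auto
      moreover have "ideal Q R" by (rule primeideal.axioms(1)[OF insert.prems(1)]) (use Q in simp)
      ultimately show "ideal Q R \<and> \<not> Q \<subseteq> P" by simp
    qed
    then obtain b where b: "b \<in> I" "b \<notin> P" "\<forall>Q\<in>\<P>. b \<in> Q" by blast
    have c: "a \<in> carrier R" "b \<in> carrier R" using ideal.Icarr[OF assms(4)] a(1) b(1) by auto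
    have cancel: "a \<in> J" if "ideal J R" "b \<in> J" "a \<oplus> b \<in> J" for J
    proof -
      interpret J: ideal J R by fact
      have "(a \<oplus> b) \<oplus> (\<ominus> \<one>) \<otimes> b \<in> J" by (rule J.a_closed[OF that(3) J.I_l_closed[OF that(2)]]) simp
      moreover have "(a \<oplus> b) \<oplus> (\<ominus> \<one>) \<otimes> b = a" using c by algebra
      ultimately show ?thesis by simp
    qed
    have "a \<oplus> b \<notin> Q" if "Q \<in> \<P>" for Q
      using cancel[of Q] a(2) b(3) that insert.prems(1) primeideal.axioms(1) by blast
    moreover have "a \<oplus> b \<notin> P"
    proof
      interpret P: primeideal P R by (rule P)
      assume "a \<oplus> b \<in> P"
      then have "(a \<oplus> b) \<oplus> (\<ominus> \<one>) \<otimes> a \<in> P" by (rule P.a_closed[OF _ P.I_l_closed[OF True]]) simp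
      moreover have "(a \<oplus> b) \<oplus> (\<ominus> \<one>) \<otimes> a = b" using c by algebra
      ultimately show False using b(2) by simp
    qed
    moreover have "a \<oplus> b \<in> I" using a(1) b(1) additive_subgroup.a_closed[OF ideal.axioms(1)[OF assms(4)]] by blast
    ultimately show ?thesis by blast
  qed (use a in blast)
qed

end

lemma seq_mult_ideal_smult: "seq_mult R M xs = ideal_smult R M (set xs)"
  by (simp add: seq_mult_def ideal_smult_def)

section \<open>Regular sequences and chains of primes; zero divisors and annihilators\<close>

context local_module
begin

text \<open>The chain of primes is built downwards from the maximal ideal. A prime above the
  annihilator of M/(x_0, ..., x_k)M contains x_k, and as x_k is regular modulo the previous
  annihilator, \<open>prime_below_avoiding\<close> gives a smaller prime that contains this
  annihilator but not x_k.\<close>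

lemma regular_seq_le_krull_dim:
  assumes "regular_seq R M xs" "set xs \<subseteq> \<mm>"
  shows "enat (length xs) \<le> krull_dim R"
proof -
  interpret Mx: ideal \<mm> R by (rule max_ideal_ideal)
  let ?t = "length xs"
  have xc: "set (take k xs) \<subseteq> carrier R" for k
    using assms(2) Mx.Icarr by (auto dest: in_set_takeD)
  define S where "S k = ideal_smult R M (set (take k xs))" for k
  have S: "submodule (S k) R M" for k unfolding S_def by (rule ideal_smult_submodule[OF xc])
  \<comment> \<open>The annihilator of M modulo the first k elements of the sequence. It is proper
    for the whole sequence because a regular sequence does not generate all of M.\<close>
  define I where "I k = {r \<in> carrier R. \<forall>z\<in>carrier M. r \<odot>\<^bsub>M\<^esub> z \<in> S k}" for k
  have Iid: "ideal (I k) R" for k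
    by (rule cring_idealI)
      (use submodule_zero[OF S] submoduleE(4,5)[OF S] in \<open>auto simp: I_def smult_l_distr smult_assoc1\<close>)
  have top: "S ?t \<noteq> carrier M"
    using assms(1) by (simp add: S_def regular_seq_def seq_mult_ideal_smult)
  have It: "I ?t \<subseteq> \<mm>"
  proof (rule ideal_subset_max[OF Iid])
    show "I ?t \<noteq> carrier R"
    proof
      assume "I ?t = carrier R"
      then have "\<one> \<in> I ?t" by simp
      then have "carrier M \<subseteq> S ?t" by (auto simp: I_def)
      then show False using top submoduleE(1)[OF S] by blast
    qed
  qed
  have "\<exists>P. (\<forall>i\<in>{k..?t}. primeideal (P i) R) \<and> (\<forall>i\<in>{k..<?t}. P i \<subset> P (Suc i)) \<and> I k \<subseteq> P k"
    if "k \<le> ?t" for k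
    using that
  proof (induction k rule: inc_induct)
    case base
    show ?case using max_ideal_prime It by (intro exI[of _ "\<lambda>_. \<mm>"]) auto
  next
    case (step k)
    then obtain P where P: "\<forall>i\<in>{Suc k..?t}. primeideal (P i) R" "\<forall>i\<in>{Suc k..<?t}. P i \<subset> P (Suc i)"
      "I (Suc k) \<subseteq> P (Suc k)" by blast
    have tk: "set (take (Suc k) xs) = insert (xs ! k) (set (take k xs))"
      using step(2) by (simp add: take_Suc_conv_app_nth)
    have xkc: "xs ! k \<in> carrier R" using Mx.Icarr[OF subsetD[OF assms(2) nth_mem]] step(2) by blast
    have "S k \<subseteq> S (Suc k)" unfolding S_def tk by (rule ideal_smult_mono) auto
    then have mono: "I k \<subseteq> I (Suc k)" by (auto simp: I_def)
    have xk: "xs ! k \<in> I (Suc k)"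
      using xkc by (auto simp: I_def S_def tk intro!: ideal_smultI)
    have reg: "r \<in> I k" if r: "r \<in> carrier R" "xs ! k \<otimes> r \<in> I k" for r
    proof -
      have "r \<odot>\<^bsub>M\<^esub> z \<in> S k" if z: "z \<in> carrier M" for z
      proof -
        have "(xs ! k \<otimes> r) \<odot>\<^bsub>M\<^esub> z \<in> S k" using r(2) z by (simp add: I_def)
        then have "xs ! k \<odot>\<^bsub>M\<^esub> (r \<odot>\<^bsub>M\<^esub> z) \<in> S k" using xkc r(1) z by (simp add: smult_assoc1)
        then show ?thesis
          using assms(1) step(2) r(1) z by (simp add: S_def regular_seq_def seq_mult_ideal_smult)
      qed
      then show ?thesis using r(1) by (simp add: I_def)
    qed
    have "primeideal (P (Suc k)) R" using P(1) step(2) by simp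
    then obtain Q where Q: "primeideal Q R" "I k \<subseteq> Q" "Q \<subseteq> P (Suc k)" "xs ! k \<notin> Q"
      using prime_below_avoiding[OF Iid _ _ xkc reg, of "P (Suc k)"] P(3) mono by blast
    have "Q \<subset> P (Suc k)" using Q xk P(3) by auto
    then show ?case
      using P(1,2) Q(1,2) step(2) by (intro exI[of _ "P(k := Q)"]) auto
  qed
  from this[OF le0] obtain P
    where "\<forall>i\<in>{0..?t}. primeideal (P i) R" "\<forall>i\<in>{0..<?t}. P i \<subset> P (Suc i)" by blast
  then have "\<forall>i\<le>?t. primeideal (P i) R" "\<forall>i<?t. P i \<subset> P (Suc i)" by auto
  then show ?thesis
    unfolding krull_dim_def by (intro Sup_upper) blast
qed

lemma maximal_submodule:
  assumes "fin_gen R M" "\<C> \<noteq> {}" "\<And>N. N \<in> \<C> \<Longrightarrow> submodule N R M"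
  shows "\<exists>N\<in>\<C>. \<forall>L\<in>\<C>. N \<subseteq> L \<longrightarrow> L = N"
proof (rule ccontr)
  assume *: "\<not> ?thesis"
  obtain S where S: "finite S" "S \<subseteq> carrier M" "mod_span R M S = carrier M"
    using assms(1) by (auto simp: fin_gen_def)
  obtain N0 where "N0 \<in> \<C>" using assms(2) by blast
  then have "\<exists>K. \<forall>n. K n \<in> \<C> \<and> K n \<subset> K (Suc n)"
    using * by (intro dependent_nat_choice) blast+
  then obtain K where K: "\<And>n. K n \<in> \<C>" "\<And>n. K n \<subset> K (Suc n)" by blast
  have "mono K" by (rule mono_iff_le_Suc[THEN iffD2]) (use K(2) in blast)
  then have "\<exists>N. \<forall>n\<ge>N. K n = K N"
    using submoduleE(1)[OF assms(3)[OF K(1)]] S(3)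
    by (intro ascending_submodules_stable[OF S(1,2) assms(3)[OF K(1)]]) auto
  then obtain n where "K (Suc n) = K n" by (metis le_Suc_eq nle_le)
  then show False using K(2)[of n] by simp
qed

text \<open>A maximal span of a finite subset of A contains A, for otherwise one more element could
  be added. The finite set comes from A itself, so its members keep the properties that define
  A.\<close>

lemma submodule_finite_span:
  assumes "fin_gen R M" "A \<subseteq> carrier M"
  shows "\<exists>S. finite S \<and> S \<subseteq> A \<and> A \<subseteq> mod_span R M S"
proof -
  let ?\<C> = "mod_span R M ` {S. finite S \<and> S \<subseteq> A}"
  have ne: "?\<C> \<noteq> {}" by auto
  have sub: "submodule N R M" if "N \<in> ?\<C>" for N
    using that assms(2) by (auto intro!: mod_span_submodule)
  have "\<exists>N\<in>?\<C>. \<forall>L\<in>?\<C>. N \<subseteq> L \<longrightarrow> L = N" by (rule maximal_submodule[OF assms(1) ne sub])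
  then obtain S where S: "finite S" "S \<subseteq> A"
    "\<And>S'. finite S' \<Longrightarrow> S' \<subseteq> A \<Longrightarrow> mod_span R M S \<subseteq> mod_span R M S' \<Longrightarrow> mod_span R M S' = mod_span R M S"
    by auto
  have "a \<in> mod_span R M S" if "a \<in> A" for a
  proof -
    have "mod_span R M S \<subseteq> mod_span R M (insert a S)" by (rule mod_span_mono) auto
    then have "mod_span R M (insert a S) = mod_span R M S" using S that by (intro S(3)) auto
    then show ?thesis using mod_span_base[of a "insert a S"] by auto
  qed
  then show ?thesis using S(1,2) by blast
qed

definition ann where "ann z = {r \<in> carrier R. r \<odot>\<^bsub>M\<^esub> z = \<zero>\<^bsub>M\<^esub>}"

lemma ann_iff: "r \<in> carrier R \<Longrightarrow> r \<in> ann z \<longleftrightarrow> r \<odot>\<^bsub>M\<^esub> z = \<zero>\<^bsub>M\<^esub>"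
  by (simp add: ann_def)

lemma ann_ideal: "z \<in> carrier M \<Longrightarrow> ideal (ann z) R"
  by (rule cring_idealI) (auto simp: ann_def smult_l_distr smult_assoc1)

text \<open>If a b kills z but b does not, then a kills the nonzero element b z, whose annihilator
  contains that of z and so equals it by maximality.\<close>

lemma maximal_ann_prime:
  assumes z: "z \<in> carrier M" "z \<noteq> \<zero>\<^bsub>M\<^esub>"
    and max: "\<And>y. y \<in> carrier M \<Longrightarrow> y \<noteq> \<zero>\<^bsub>M\<^esub> \<Longrightarrow> ann z \<subseteq> ann y \<Longrightarrow> ann y = ann z"
  shows "primeideal (ann z) R"
proof (rule primeidealI[OF ann_ideal[OF z(1)] is_cring])
  have "\<one> \<notin> ann z" using z by (simp add: ann_def)
  then show "carrier R \<noteq> ann z" by auto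
  fix a b assume ab: "a \<in> carrier R" "b \<in> carrier R" "a \<otimes> b \<in> ann z"
  show "a \<in> ann z \<or> b \<in> ann z"
  proof (rule disjCI)
    assume "b \<notin> ann z"
    then have bz: "b \<odot>\<^bsub>M\<^esub> z \<in> carrier M" "b \<odot>\<^bsub>M\<^esub> z \<noteq> \<zero>\<^bsub>M\<^esub>" using ab z by (auto simp: ann_def)
    have "ann z \<subseteq> ann (b \<odot>\<^bsub>M\<^esub> z)"
    proof
      fix r assume r: "r \<in> ann z"
      then have "r \<odot>\<^bsub>M\<^esub> (b \<odot>\<^bsub>M\<^esub> z) = b \<odot>\<^bsub>M\<^esub> (r \<odot>\<^bsub>M\<^esub> z)"
        using ab z by (intro smult_left_comm) (simp_all add: ann_def)
      then show "r \<in> ann (b \<odot>\<^bsub>M\<^esub> z)" using r ab by (simp add: ann_def)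
    qed
    then have "ann (b \<odot>\<^bsub>M\<^esub> z) = ann z" by (rule max[OF bz])
    moreover have "a \<in> ann (b \<odot>\<^bsub>M\<^esub> z)" using ab z by (simp add: ann_def smult_assoc1)
    ultimately show "a \<in> ann z" by simp
  qed
qed

text \<open>The maximal annihilators of nonzero elements are finitely many incomparable primes covering
  the zero divisors.\<close>

lemma regular_element_or_socle:
  assumes "fin_gen R M" and nosocle: "\<And>z. z \<in> carrier M \<Longrightarrow> z \<noteq> \<zero>\<^bsub>M\<^esub> \<Longrightarrow> ann z \<noteq> \<mm>"
  shows "\<exists>x\<in>\<mm>. \<forall>z\<in>carrier M. x \<odot>\<^bsub>M\<^esub> z = \<zero>\<^bsub>M\<^esub> \<longrightarrow> z = \<zero>\<^bsub>M\<^esub>"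
proof -
  let ?NZ = "carrier M - {\<zero>\<^bsub>M\<^esub>}"
  define mx where "mx z \<longleftrightarrow> z \<in> ?NZ \<and> (\<forall>y\<in>?NZ. ann z \<subseteq> ann y \<longrightarrow> ann y = ann z)" for z
  have prime: "primeideal (ann z) R" if "mx z" for z
    using that by (intro maximal_ann_prime) (auto simp: mx_def)
  have dominated: "\<exists>z. mx z \<and> ann y \<subseteq> ann z" if y: "y \<in> ?NZ" for y
  proof -
    let ?\<C> = "{ann z |z. z \<in> ?NZ \<and> ann y \<subseteq> ann z}"
    have "\<exists>J\<in>?\<C>. \<forall>K\<in>?\<C>. J \<subseteq> K \<longrightarrow> K = J"
      by (rule noetherian_maximal) (use y in \<open>auto intro!: ann_ideal\<close>)
    then obtain z where z: "z \<in> ?NZ" "ann y \<subseteq> ann z" "\<forall>K\<in>?\<C>. ann z \<subseteq> K \<longrightarrow> K = ann z" by blast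
    have "ann w = ann z" if "w \<in> ?NZ" "ann z \<subseteq> ann w" for w
      using z that by blast
    then show ?thesis using z(1,2) unfolding mx_def by blast
  qed
  obtain S where S: "finite S" "S \<subseteq> {z. mx z}" "{z. mx z} \<subseteq> mod_span R M S"
    using submodule_finite_span[OF assms(1), of "{z. mx z}"] by (auto simp: mx_def)
  have Sc: "S \<subseteq> carrier M" using S(2) by (auto simp: mx_def)
  let ?\<P> = "ann ` S"
  \<comment> \<open>Why finitely many suffice: if ann z is not among the annihilators of the
    elements of S, some b outside the prime ann z lies in all of these. Then b kills the span of S,
    which contains z.\<close>
  have cover: "ann z \<in> ?\<P>" if z: "mx z" for z
  proof (rule ccontr)
    assume n: "ann z \<notin> ?\<P>"
    interpret P: primeideal "ann z" R by (rule prime[OF z])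
    have "\<exists>b\<in>carrier R - ann z. \<forall>Q\<in>?\<P>. b \<in> Q"
    proof (rule prime_not_contains_Inter[OF _ P.primeideal _ oneideal])
      show "\<not> carrier R \<subseteq> ann z" using P.I_notcarr P.a_subset by blast
      show "finite ?\<P>" using S(1) by simp
      fix Q assume Q: "Q \<in> ?\<P>"
      then obtain s where s: "s \<in> S" "Q = ann s" by blast
      then have ms: "mx s" using S(2) by blast
      have "\<not> Q \<subseteq> ann z"
      proof
        assume "Q \<subseteq> ann z"
        then have "ann z = Q" using ms z s(2) unfolding mx_def by blast
        then show False using n Q by simp
      qed
      then show "ideal Q R \<and> \<not> Q \<subseteq> ann z" using s Sc ann_ideal by blast
    qed
    then obtain b where b: "b \<in> carrier R" "b \<notin> ann z" "\<forall>s\<in>S. b \<in> ann s" by blast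
    have "z \<in> mod_span R M S" using S(3) z by blast
    then have "b \<odot>\<^bsub>M\<^esub> z = \<zero>\<^bsub>M\<^esub>" using Sc
    proof (induction rule: mod_span_induct)
      case (base x)
      show ?case using bspec[OF b(3) base(1)] unfolding ann_iff[OF b(1)] .
    next
      case (smult a x)
      show ?case using smult_left_comm[OF b(1) smult(1,2)] smult by simp
    qed (use b(1) in \<open>simp_all add: smult_r_distr\<close>)
    then show False using b(2) unfolding ann_iff[OF b(1)] by blast
  qed
  \<comment> \<open>A maximal annihilator that contains the maximal ideal would equal it, which
    \<open>nosocle\<close> excludes; hence prime avoidance applies to the maximal ideal.\<close>
  have "\<exists>x\<in>\<mm>. \<forall>P\<in>?\<P>. x \<notin> P"
  proof (rule prime_avoidance[OF _ _ _ max_ideal_ideal])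
    show "finite ?\<P>" using S(1) by simp
    show "primeideal P R" if "P \<in> ?\<P>" for P using that prime S(2) by blast
    show "P = Q" if PQ: "P \<in> ?\<P>" "Q \<in> ?\<P>" "P \<subseteq> Q" for P Q
    proof -
      obtain s t where st: "mx s" "mx t" "P = ann s" "Q = ann t" using PQ(1,2) S(2) by blast
      then show ?thesis using PQ(3) unfolding mx_def by blast
    qed
    show "\<not> \<mm> \<subseteq> P" if P: "P \<in> ?\<P>" for P
    proof
      assume "\<mm> \<subseteq> P"
      obtain s where s: "mx s" "P = ann s" using P S(2) by blast
      interpret P: primeideal P R using prime[OF s(1)] s(2) by simp
      have "P \<subseteq> \<mm>" by (rule ideal_subset_max[OF P.is_ideal P.I_notcarr[symmetric]])
      then have "ann s = \<mm>" using \<open>\<mm> \<subseteq> P\<close> s(2) by simp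
      then show False using nosocle s(1) by (auto simp: mx_def)
    qed
  qed
  then obtain x where x: "x \<in> \<mm>" "\<forall>s\<in>S. x \<notin> ann s" by blast
  have xc: "x \<in> carrier R" using ideal.Icarr[OF max_ideal_ideal x(1)] .
  have "z = \<zero>\<^bsub>M\<^esub>" if z: "z \<in> carrier M" "x \<odot>\<^bsub>M\<^esub> z = \<zero>\<^bsub>M\<^esub>" for z
  proof (rule ccontr)
    assume "z \<noteq> \<zero>\<^bsub>M\<^esub>"
    then obtain y where y: "mx y" "ann z \<subseteq> ann y" using dominated[of z] z(1) by blast
    have "x \<in> ann y" using y(2) z xc by (auto simp: ann_def)
    moreover obtain s where "s \<in> S" "ann s = ann y" using cover[OF y(1)] by auto
    ultimately show False using x(2) by auto
  qed
  then show ?thesis using x(1) by blast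
qed

end

section \<open>Finitely generated modules\<close>

lemma (in rmodule) minus_minus_self:
  assumes "x \<in> carrier M" "y \<in> carrier M"
  shows "(x \<ominus>\<^bsub>M\<^esub> y) \<ominus>\<^bsub>M\<^esub> x = \<zero>\<^bsub>M\<^esub> \<ominus>\<^bsub>M\<^esub> y"
  using assms by (simp add: a_minus_def M.a_assoc M.a_comm[of "\<ominus>\<^bsub>M\<^esub> y"] M.r_neg1 M.r_neg2)

lemma (in rmodule) zero_minus_minus:
  assumes "x \<in> carrier M" "y \<in> carrier M"
  shows "\<zero>\<^bsub>M\<^esub> \<ominus>\<^bsub>M\<^esub> (x \<ominus>\<^bsub>M\<^esub> y) = y \<ominus>\<^bsub>M\<^esub> x"
  using assms by (simp add: a_minus_def M.minus_add M.a_comm)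

lemma factor_through_surjection:
  assumes "rmodule R M" "rmodule R N" "rmodule R P" "p \<in> mod_hom R M N" "p ` carrier M = carrier N"
    "e \<in> mod_hom R M P" "\<And>x. x \<in> carrier M \<Longrightarrow> p x = \<zero>\<^bsub>N\<^esub> \<Longrightarrow> e x = \<zero>\<^bsub>P\<^esub>"
  shows "\<exists>s\<in>mod_hom R N P. \<forall>x\<in>carrier M. s (p x) = e x"
proof -
  interpret M: rmodule R M by fact
  interpret N: rmodule R N by fact
  interpret P: rmodule R P by fact
  note ec = mod_hom_closed[OF assms(6)] and pc = mod_hom_closed[OF assms(4)]
  have eq: "e x = e y" if xy: "x \<in> carrier M" "y \<in> carrier M" "p x = p y" for x y
  proof -
    have "p (x \<ominus>\<^bsub>M\<^esub> y) = \<zero>\<^bsub>N\<^esub>"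
      using mod_hom_minus[OF assms(1,2,4) xy(1,2)] xy(3) pc[OF xy(2)] by (simp add: N.minus_self)
    then have "e (x \<ominus>\<^bsub>M\<^esub> y) = \<zero>\<^bsub>P\<^esub>" using assms(7)[of "x \<ominus>\<^bsub>M\<^esub> y"] xy(1,2) by simp
    then show ?thesis
      using mod_hom_minus[OF assms(1,3,6) xy(1,2)] P.minus_eq_zero_iff[OF ec[OF xy(1)] ec[OF xy(2)]] by simp
  qed
  define s where "s y = e (inv_into (carrier M) p y)" for y
  have sp: "s (p x) = e x" if "x \<in> carrier M" for x
    unfolding s_def using that pc[OF that] assms(5)
    by (intro eq inv_into_into f_inv_into_f) auto
  have cov: "\<exists>x\<in>carrier M. y = p x" if "y \<in> carrier N" for y
    using that assms(5) by blast
  have "s \<in> mod_hom R N P"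
  proof (rule mod_homI)
    fix y assume "y \<in> carrier N"
    then obtain x where x: "x \<in> carrier M" "y = p x" using cov by blast
    then show "s y \<in> carrier P" using sp ec by simp
    show "s (y \<oplus>\<^bsub>N\<^esub> y') = s y \<oplus>\<^bsub>P\<^esub> s y'" if y': "y' \<in> carrier N" for y'
    proof -
      obtain x' where x': "x' \<in> carrier M" "y' = p x'" using cov[OF y'] by blast
      have "s (y \<oplus>\<^bsub>N\<^esub> y') = s (p (x \<oplus>\<^bsub>M\<^esub> x'))" using x x' mod_hom_add[OF assms(4)] by simp
      also have "\<dots> = e x \<oplus>\<^bsub>P\<^esub> e x'" using sp x(1) x'(1) mod_hom_add[OF assms(6)] by simp
      finally show ?thesis using sp x x' by simp
    qed
    show "s (a \<odot>\<^bsub>N\<^esub> y) = a \<odot>\<^bsub>P\<^esub> s y" if a: "a \<in> carrier R" for a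
    proof -
      have "s (a \<odot>\<^bsub>N\<^esub> y) = s (p (a \<odot>\<^bsub>M\<^esub> x))" using x a mod_hom_smult[OF assms(4)] by simp
      also have "\<dots> = a \<odot>\<^bsub>P\<^esub> e x" using sp x(1) a mod_hom_smult[OF assms(6)] by simp
      finally show ?thesis using sp x by simp
    qed
  qed
  then show ?thesis using sp by blast
qed

lemma factor_through_injection:
  assumes "rmodule R L" "rmodule R M" "rmodule R N" "i \<in> mod_hom R L M" "inj_on i (carrier L)"
    "e \<in> mod_hom R N M" "\<And>x. x \<in> carrier N \<Longrightarrow> e x \<in> i ` carrier L"
  shows "\<exists>t\<in>mod_hom R N L. \<forall>x\<in>carrier N. i (t x) = e x"
proof -
  interpret L: rmodule R L by fact
  interpret N: rmodule R N by fact
  define t where "t x = inv_into (carrier L) i (e x)" for x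
  have t: "t x \<in> carrier L" "i (t x) = e x" if "x \<in> carrier N" for x
    unfolding t_def using assms(7)[OF that] by (auto intro: inv_into_into f_inv_into_f)
  have eqI: "x = y" if "x \<in> carrier L" "y \<in> carrier L" "i x = i y" for x y
    using inj_onD[OF assms(5)] that by blast
  have "t \<in> mod_hom R N L"
  proof (rule mod_homI)
    fix x assume x: "x \<in> carrier N"
    show "t x \<in> carrier L" by (rule t[OF x])
    show "t (x \<oplus>\<^bsub>N\<^esub> y) = t x \<oplus>\<^bsub>L\<^esub> t y" if y: "y \<in> carrier N" for y
      by (rule eqI) (use x y t in \<open>simp_all add: mod_hom_add[OF assms(4)] mod_hom_add[OF assms(6)]\<close>)
    show "t (a \<odot>\<^bsub>N\<^esub> x) = a \<odot>\<^bsub>L\<^esub> t x" if a: "a \<in> carrier R" for a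
      by (rule eqI) (use x a t in \<open>simp_all add: mod_hom_smult[OF assms(4)] mod_hom_smult[OF assms(6)]\<close>)
  qed
  then show ?thesis using t by blast
qed


lemma (in rmodule) submodule_finsum:
  assumes "submodule H R M" "finite B" "\<And>b. b \<in> B \<Longrightarrow> f b \<in> H"
  shows "(\<Oplus>\<^bsub>M\<^esub>b\<in>B. f b) \<in> H"
  using assms(2,3)
proof (induction B)
  case empty
  then show ?case using submodule_zero[OF assms(1)] by simp
next
  case (insert b B)
  then show ?case
    using submoduleE(1)[OF assms(1)] submoduleE(5)[OF assms(1)]
    by (subst M.finsum_insert) (auto simp: subset_iff)
qed

lemma fg_free_rmodule: "fg_free R F \<Longrightarrow> rmodule R F"
  by (simp add: fg_free_def rmodule_def)

lemma fg_free_fin_gen: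
  assumes "fg_free R F"
  shows "fin_gen R F"
proof -
  interpret rmodule R F by (rule fg_free_rmodule[OF assms])
  from conjunct2[OF assms[unfolded fg_free_def]]
  obtain B where B: "finite B \<and> B \<subseteq> carrier F \<and>
    (\<forall>x\<in>carrier F. \<exists>!c. c \<in> B \<rightarrow>\<^sub>E carrier R \<and> x = (\<Oplus>\<^bsub>F\<^esub>b\<in>B. c b \<odot>\<^bsub>F\<^esub> b))"
    by (rule exE)
  have Bc: "B \<subseteq> carrier F" using B by (rule conjunct2[THEN conjunct1])
  note s = mod_span_submodule[OF Bc]
  have "x \<in> mod_span R F B" if x: "x \<in> carrier F" for x
  proof -
    from ex1_implies_ex[OF bspec[OF conjunct2[OF conjunct2[OF B]] x]]
    obtain c where c: "c \<in> B \<rightarrow>\<^sub>E carrier R" "x = (\<Oplus>\<^bsub>F\<^esub>b\<in>B. c b \<odot>\<^bsub>F\<^esub> b)" by (elim exE conjE)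
    show ?thesis
      unfolding c(2)
      by (rule submodule_finsum[OF s conjunct1[OF B]])
        (rule submoduleE(4)[OF s PiE_mem[OF c(1)] mod_span_base])
  qed
  then show ?thesis
    unfolding fin_gen_def using B mod_span_closed[OF Bc] by blast
qed

lemma fin_gen_image:
  assumes "rmodule R M" "rmodule R N" "p \<in> mod_hom R M N" "p ` carrier M = carrier N" "fin_gen R M"
  shows "fin_gen R N"
proof -
  interpret M: rmodule R M by fact
  interpret N: rmodule R N by fact
  obtain S where S: "finite S" "S \<subseteq> carrier M" "mod_span R M S = carrier M"
    using assms(5) by (auto simp: fin_gen_def)
  have pS: "p ` S \<subseteq> carrier N" using S(2) mod_hom_closed[OF assms(3)] by auto
  have "p x \<in> mod_span R N (p ` S)" if "x \<in> carrier M" for x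
    by (rule mod_hom_span[OF assms(1-3) S(2) pS]) (use that S(3) N.mod_span_base in auto)
  then have "carrier N \<subseteq> mod_span R N (p ` S)" unfolding assms(4)[symmetric] by auto
  then have "mod_span R N (p ` S) = carrier N" using N.mod_span_closed[OF pS] by (rule subset_antisym[rotated])
  then show ?thesis unfolding fin_gen_def using S(1) pS by (intro exI[of _ "p ` S"]) auto
qed

lemma kernel_submodule:
  assumes "rmodule R M" "rmodule R N" "p \<in> mod_hom R M N"
  shows "submodule {x \<in> carrier M. p x = \<zero>\<^bsub>N\<^esub>} R M"
proof -
  interpret M: rmodule R M by fact
  interpret N: rmodule R N by fact
  show ?thesis
    by (rule M.submoduleI')
      (use assms in \<open>auto simp: mod_hom_zero mod_hom_add[OF assms(3)] mod_hom_smult[OF assms(3)]\<close>)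
qed

context rmodule
begin

lemma restrict_rmodule: "submodule H R M \<Longrightarrow> rmodule R (M\<lparr>carrier := H\<rparr>)"
  unfolding rmodule_def by (rule submodule.submodule_is_module[OF _ module_axioms])

lemma restrict_inclusion: "submodule H R M \<Longrightarrow> id \<in> mod_hom R (M\<lparr>carrier := H\<rparr>) M"
  by (auto simp: mod_hom_def dest: subsetD[OF submoduleE(1)])

lemma restrict_short_exact:
  assumes "submodule H R M" "p \<in> mod_hom R M N" "p ` carrier M = carrier N"
    "\<And>x. x \<in> carrier M \<Longrightarrow> p x = \<zero>\<^bsub>N\<^esub> \<longleftrightarrow> x \<in> H"
  shows "short_exact R (M\<lparr>carrier := H\<rparr>) M N id p"
  unfolding short_exact_def
  using restrict_inclusion[OF assms(1)] assms(2-4) submoduleE(1)[OF assms(1)] by auto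

end

context local_module
begin

lemma submodule_fin_gen:
  assumes "fin_gen R M" "submodule H R M"
  shows "fin_gen R (M\<lparr>carrier := H\<rparr>)"
proof -
  let ?H = "M\<lparr>carrier := H\<rparr>"
  interpret H: rmodule R ?H by (rule restrict_rmodule[OF assms(2)])
  obtain S where S: "finite S" "S \<subseteq> H" "H \<subseteq> mod_span R M S"
    using submodule_finite_span[OF assms(1) submoduleE(1)[OF assms(2)]] by blast
  have SH: "S \<subseteq> carrier ?H" using S(2) by simp
  have Sc: "S \<subseteq> carrier M" using S(2) submoduleE(1)[OF assms(2)] by blast
  note s = H.mod_span_submodule[OF SH]
  have "x \<in> mod_span R ?H S" if "x \<in> mod_span R M S" for x
    using that Sc
  proof (induction rule: mod_span_induct)
    case (base x)
    then show ?case by (rule H.mod_span_base)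
  next
    case zero
    then show ?case using H.submodule_zero[OF s] by simp
  next
    case (add x y)
    then show ?case using H.submoduleE(5)[OF s] by simp
  next
    case (smult a x)
    then show ?case using H.submoduleE(4)[OF s] by simp
  qed
  then have "mod_span R ?H S = carrier ?H" using S(3) H.mod_span_closed[OF SH] by auto
  then show ?thesis unfolding fin_gen_def using S(1) SH by blast
qed

lemma free_cover:
  assumes "fin_gen R M"
  shows "\<exists>n. \<exists>q\<in>mod_hom R (free_mod R n) M. q ` carrier (free_mod R n) = carrier M"
proof -
  obtain S where S: "finite S" "S \<subseteq> carrier M" "mod_span R M S = carrier M"
    using assms by (auto simp: fin_gen_def)
  obtain y and n :: nat where y: "S = y ` {i. i < n}"
    using finite_imp_nat_seg_image_inj_on[OF S(1)] by blast
  have yc: "y i \<in> carrier M" if "i < n" for i using y S(2) that by auto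
  let ?q = "\<lambda>u. \<Oplus>\<^bsub>M\<^esub>i\<in>{..<n}. the_elem u i \<odot>\<^bsub>M\<^esub> y i"
  have q: "?q \<in> mod_hom R (free_mod R n) M" by (rule free_mod_hom[OF yc])
  have sub: "submodule (?q ` carrier (free_mod R n)) R M"
    by (rule mod_hom_image_submodule[OF rmodule_free_mod rmodule_axioms q])
  have "S \<subseteq> ?q ` carrier (free_mod R n)"
  proof
    fix s assume "s \<in> S"
    then obtain k where k: "k < n" "s = y k" using y by auto
    show "s \<in> ?q ` carrier (free_mod R n)"
      by (rule image_eqI[OF _ unit_vec_carrier[OF k(1)]])
        (simp only: k(2) free_mod_hom_unit_vec[OF yc k(1)])
  qed
  then have "carrier M \<subseteq> ?q ` carrier (free_mod R n)"
    using mod_span_least[OF sub] unfolding S(3)[symmetric] by blast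
  then have "?q ` carrier (free_mod R n) = carrier M" using submoduleE(1)[OF sub] by blast
  then show ?thesis using q by blast
qed

end

text \<open>The carrier of the quotient is the range of any map that separates exactly the cosets of
  K. This leaves the carrier type of the quotient free.\<close>

lemma quotient_by_classifier:
  fixes M :: "('a, 'm) module" and cl :: "'m \<Rightarrow> 'q"
  assumes "rmodule R M" "submodule K R M"
    "\<And>x y. x \<in> carrier M \<Longrightarrow> y \<in> carrier M \<Longrightarrow> cl x = cl y \<longleftrightarrow> x \<ominus>\<^bsub>M\<^esub> y \<in> K"
  shows "\<exists>Q :: ('a, 'q) module. rmodule R Q \<and> cl \<in> mod_hom R M Q \<and> cl ` carrier M = carrier Q \<and>
    (\<forall>x\<in>carrier M. cl x = \<zero>\<^bsub>Q\<^esub> \<longleftrightarrow> x \<in> K)"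
proof -
  interpret M: rmodule R M by fact
  define rep where "rep = inv_into (carrier M) cl"
  have rep: "rep (cl x) \<in> carrier M" "cl (rep (cl x)) = cl x" if "x \<in> carrier M" for x
    unfolding rep_def using that by (auto intro: inv_into_into f_inv_into_f)
  define Q :: "('a, 'q) module" where
    "Q = \<lparr>carrier = cl ` carrier M, monoid.mult = undefined, one = undefined, ring.zero = cl \<zero>\<^bsub>M\<^esub>,
      ring.add = (\<lambda>U V. cl (rep U \<oplus>\<^bsub>M\<^esub> rep V)), smult = (\<lambda>a U. cl (a \<odot>\<^bsub>M\<^esub> rep U))\<rparr>"
  have add: "cl x \<oplus>\<^bsub>Q\<^esub> cl y = cl (x \<oplus>\<^bsub>M\<^esub> y)" if xy: "x \<in> carrier M" "y \<in> carrier M" for x y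
  proof -
    have "rep (cl x) \<ominus>\<^bsub>M\<^esub> x \<in> K" "rep (cl y) \<ominus>\<^bsub>M\<^esub> y \<in> K"
      using assms(3)[OF rep(1)[OF xy(1)] xy(1)] assms(3)[OF rep(1)[OF xy(2)] xy(2)] rep xy by auto
    then have "(rep (cl x) \<ominus>\<^bsub>M\<^esub> x) \<oplus>\<^bsub>M\<^esub> (rep (cl y) \<ominus>\<^bsub>M\<^esub> y) \<in> K" by (rule M.submoduleE(5)[OF assms(2)])
    moreover have "(rep (cl x) \<ominus>\<^bsub>M\<^esub> x) \<oplus>\<^bsub>M\<^esub> (rep (cl y) \<ominus>\<^bsub>M\<^esub> y) = (rep (cl x) \<oplus>\<^bsub>M\<^esub> rep (cl y)) \<ominus>\<^bsub>M\<^esub> (x \<oplus>\<^bsub>M\<^esub> y)"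
      using rep(1)[OF xy(1)] rep(1)[OF xy(2)] xy by (simp add: a_minus_def M.M.minus_add M.M.a_ac)
    ultimately show ?thesis
      using assms(3)[of "rep (cl x) \<oplus>\<^bsub>M\<^esub> rep (cl y)" "x \<oplus>\<^bsub>M\<^esub> y"] rep(1)[OF xy(1)] rep(1)[OF xy(2)] xy
      by (simp add: Q_def)
  qed
  have smult: "a \<odot>\<^bsub>Q\<^esub> cl x = cl (a \<odot>\<^bsub>M\<^esub> x)" if ax: "a \<in> carrier R" "x \<in> carrier M" for a x
  proof -
    have "rep (cl x) \<ominus>\<^bsub>M\<^esub> x \<in> K" using assms(3)[OF rep(1)[OF ax(2)] ax(2)] rep ax by auto
    then have "a \<odot>\<^bsub>M\<^esub> (rep (cl x) \<ominus>\<^bsub>M\<^esub> x) \<in> K" by (rule M.submoduleE(4)[OF assms(2) ax(1)])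
    then have "a \<odot>\<^bsub>M\<^esub> rep (cl x) \<ominus>\<^bsub>M\<^esub> a \<odot>\<^bsub>M\<^esub> x \<in> K"
      using rep(1)[OF ax(2)] ax by (simp add: M.smult_minus)
    then show ?thesis
      using assms(3)[of "a \<odot>\<^bsub>M\<^esub> rep (cl x)" "a \<odot>\<^bsub>M\<^esub> x"] rep(1)[OF ax(2)] ax by (simp add: Q_def)
  qed
  have carr: "carrier Q = cl ` carrier M" and zero: "\<zero>\<^bsub>Q\<^esub> = cl \<zero>\<^bsub>M\<^esub>" by (simp_all add: Q_def)
  have "module R Q"
  proof (rule moduleI)
    show "abelian_group Q"
    proof (rule abelian_groupI)
      fix U assume "U \<in> carrier Q"
      then obtain x where x: "x \<in> carrier M" "U = cl x" unfolding carr by blast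
      have "cl (\<ominus>\<^bsub>M\<^esub> x) \<oplus>\<^bsub>Q\<^esub> U = \<zero>\<^bsub>Q\<^esub>" using x add by (simp add: zero M.M.l_neg)
      then show "\<exists>V\<in>carrier Q. V \<oplus>\<^bsub>Q\<^esub> U = \<zero>\<^bsub>Q\<^esub>" unfolding carr using x(1) by blast
    qed (auto simp: carr zero add M.M.a_ac)
  qed (auto simp: carr add smult M.is_cring M.smult_l_distr M.smult_r_distr M.smult_assoc1)
  then have "rmodule R Q" by (simp add: rmodule_def)
  moreover have "cl \<in> mod_hom R M Q" by (rule mod_homI) (auto simp: carr add smult)
  moreover have "cl x = \<zero>\<^bsub>Q\<^esub> \<longleftrightarrow> x \<in> K" if "x \<in> carrier M" for x
  proof -
    have "x \<ominus>\<^bsub>M\<^esub> \<zero>\<^bsub>M\<^esub> = x" using that by (subst M.minus_eq_iff) auto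
    then show ?thesis using assms(3)[OF that M.M.zero_closed] by (simp add: zero)
  qed
  ultimately show ?thesis using carr by blast
qed

context local_module
begin

text \<open>Cosets of L as sets of elements of M would have the wrong type. Through a free cover of
  M, the coset of x becomes the set of all vectors that are sent into it, which is an element of the
  carrier type of \<open>'a umod\<close>.\<close>

lemma quotient_exists:
  assumes "fin_gen R M" "submodule L R M"
  shows "\<exists>(Q :: 'a umod) \<pi>. rmodule R Q \<and> \<pi> \<in> mod_hom R M Q \<and> \<pi> ` carrier M = carrier Q \<and>
    (\<forall>x\<in>carrier M. \<pi> x = \<zero>\<^bsub>Q\<^esub> \<longleftrightarrow> x \<in> L)"
proof -
  obtain n q where q: "q \<in> mod_hom R (free_mod R n) M" "q ` carrier (free_mod R n) = carrier M"
    using free_cover[OF assms(1)] by blast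
  let ?G = "free_mod R n"
  define cl where "cl x = {f. {f} \<in> carrier ?G \<and> q {f} \<ominus>\<^bsub>M\<^esub> x \<in> L}" for x
  note qc = mod_hom_closed[OF q(1)]
  have shift: "z \<ominus>\<^bsub>M\<^esub> y \<in> L" if "z \<in> carrier M" "x \<in> carrier M" "y \<in> carrier M" "z \<ominus>\<^bsub>M\<^esub> x \<in> L" "x \<ominus>\<^bsub>M\<^esub> y \<in> L" for x y z
  proof -
    have "(z \<ominus>\<^bsub>M\<^esub> x) \<oplus>\<^bsub>M\<^esub> (x \<ominus>\<^bsub>M\<^esub> y) \<in> L" using that(4,5) by (rule submoduleE(5)[OF assms(2)])
    moreover have "(z \<ominus>\<^bsub>M\<^esub> x) \<oplus>\<^bsub>M\<^esub> (x \<ominus>\<^bsub>M\<^esub> y) = z \<ominus>\<^bsub>M\<^esub> y"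
      using that(1-3) by (simp add: a_minus_def M.a_assoc M.r_neg1)
    ultimately show ?thesis by simp
  qed
  have neg: "y \<ominus>\<^bsub>M\<^esub> x \<in> L" if "x \<in> carrier M" "y \<in> carrier M" "x \<ominus>\<^bsub>M\<^esub> y \<in> L" for x y
    using submodule_minus[OF assms(2) submodule_zero[OF assms(2)] that(3)] that by (simp add: zero_minus_minus)
  have "cl x = cl y \<longleftrightarrow> x \<ominus>\<^bsub>M\<^esub> y \<in> L" if xy: "x \<in> carrier M" "y \<in> carrier M" for x y
  proof
    assume "x \<ominus>\<^bsub>M\<^esub> y \<in> L"
    then show "cl x = cl y"
      using shift[OF qc xy] shift[OF qc xy(2,1)] neg[OF xy] by (auto simp: cl_def)
  next
    assume eq: "cl x = cl y"
    have "x \<in> q ` carrier ?G" using q(2) xy(1) by simp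
    then obtain u where u: "u \<in> carrier ?G" "x = q u" by blast
    obtain f where f: "u = {f}" using u(1) by (rule free_mod_cases)
    have "f \<in> cl x" using u f submodule_zero[OF assms(2)] xy(1) by (simp add: cl_def minus_self)
    then show "x \<ominus>\<^bsub>M\<^esub> y \<in> L" unfolding eq using u f by (simp add: cl_def)
  qed
  from quotient_by_classifier[OF rmodule_axioms assms(2) this] show ?thesis by blast
qed

end

section \<open>Cohomology of a finite injective resolution\<close>

context local_module
begin

text \<open>Nakayama's lemma for the dual of M modulo the forms in U. Linear maps are not
  extensional, so the dual is replaced by its image in R^n under evaluation at n generators of M;
  this image is a Noetherian module, and equality there is agreement on the carrier of M.\<close>

lemma hom_nakayama:
  assumes "fin_gen R M" "x \<in> \<mm>" and H: "H = mod_hom R M (regular_module R)"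
    and U: "U \<subseteq> H" "(\<lambda>_. \<zero>) \<in> U"
      "\<And>\<phi> \<psi>. \<phi> \<in> U \<Longrightarrow> \<psi> \<in> U \<Longrightarrow> (\<lambda>z. \<phi> z \<oplus> \<psi> z) \<in> U"
      "\<And>a \<phi>. a \<in> carrier R \<Longrightarrow> \<phi> \<in> U \<Longrightarrow> (\<lambda>z. a \<otimes> \<phi> z) \<in> U"
    and step: "\<And>\<phi>. \<phi> \<in> H \<Longrightarrow> \<exists>\<phi>'\<in>H. \<exists>\<psi>\<in>U. \<forall>z\<in>carrier M. \<phi> z = x \<otimes> \<phi>' z \<oplus> \<psi> z"
    and "\<phi> \<in> H"
  shows "\<exists>\<psi>\<in>U. \<forall>z\<in>carrier M. \<phi> z = \<psi> z"
proof -
  obtain S where S: "finite S" "S \<subseteq> carrier M" "mod_span R M S = carrier M"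
    using assms(1) by (auto simp: fin_gen_def)
  obtain y and n :: nat where y: "S = y ` {i. i < n}"
    using finite_imp_nat_seg_image_inj_on[OF S(1)] by blast
  have yc: "y i \<in> carrier M" if "i < n" for i using y S(2) that by auto
  let ?G = "free_mod R n"
  interpret G: local_module R ?G
    by (intro local_module.intro noetherian_local_axioms rmodule_free_mod)
  define ev where "ev \<phi> = {\<lambda>i. if i < n then \<phi> (y i) else \<zero>}" for \<phi>
  have Hc: "\<phi> z \<in> carrier R" if "\<phi> \<in> H" "z \<in> carrier M" for \<phi> z
    using mod_hom_closed[of \<phi> R M "regular_module R" z] that H by simp
  have evc: "ev \<phi> \<in> carrier ?G" if "\<phi> \<in> H" for \<phi>
    using Hc[OF that] yc by (simp add: ev_def free_mod_carrier)
  have ev_add: "ev \<phi> \<oplus>\<^bsub>?G\<^esub> ev \<psi> = ev (\<lambda>z. \<phi> z \<oplus> \<psi> z)" for \<phi> \<psi>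
    by (auto simp: ev_def fun_eq_iff)
  have ev_smult: "a \<odot>\<^bsub>?G\<^esub> ev \<phi> = ev (\<lambda>z. a \<otimes> \<phi> z)" if "a \<in> carrier R" for a \<phi>
    using that by (auto simp: ev_def fun_eq_iff)
  have ev_zero: "\<zero>\<^bsub>?G\<^esub> = ev (\<lambda>_. \<zero>)"
    by (auto simp: ev_def fun_eq_iff)
  have sU: "submodule (ev ` U) R ?G"
  proof (rule G.submoduleI')
    show "ev ` U \<subseteq> carrier ?G" using evc U(1) by auto
    show "\<zero>\<^bsub>?G\<^esub> \<in> ev ` U" unfolding ev_zero by (rule imageI[OF U(2)])
    show "a \<oplus>\<^bsub>?G\<^esub> b \<in> ev ` U" if "a \<in> ev ` U" "b \<in> ev ` U" for a b
    proof -
      from that obtain \<phi> \<psi> where "\<phi> \<in> U" "\<psi> \<in> U" "a = ev \<phi>" "b = ev \<psi>" by blast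
      then show ?thesis using imageI[OF U(3), of \<phi> \<psi> ev] by (simp only: ev_add)
    qed
    show "a \<odot>\<^bsub>?G\<^esub> b \<in> ev ` U" if a: "a \<in> carrier R" and b: "b \<in> ev ` U" for a b
    proof -
      from b obtain \<phi> where "\<phi> \<in> U" "b = ev \<phi>" by blast
      then show ?thesis using imageI[OF U(4)[OF a], of \<phi> ev] by (simp only: ev_smult[OF a])
    qed
  qed
  have fgG: "fin_gen R ?G" by (rule fg_free_fin_gen[OF fg_free_free_mod[OF one_neq_zero]])
  have evH: "ev ` H \<subseteq> carrier ?G" using evc by auto
  obtain T where T: "finite T" "T \<subseteq> ev ` H" "ev ` H \<subseteq> mod_span R ?G T"
    using G.submodule_finite_span[OF fgG evH] by blast
  have Tc: "T \<subseteq> carrier ?G" using T(2) evH by blast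
  have "mod_span R ?G T \<subseteq> ev ` U"
  proof (rule G.nakayama_span[OF T(1) Tc sU])
    fix w assume "w \<in> T"
    then obtain \<phi> where \<phi>: "\<phi> \<in> H" "w = ev \<phi>" using T(2) by blast
    obtain \<phi>' \<psi> where *: "\<phi>' \<in> H" "\<psi> \<in> U" "\<forall>z\<in>carrier M. \<phi> z = x \<otimes> \<phi>' z \<oplus> \<psi> z"
      using step[OF \<phi>(1)] by blast
    have xc: "x \<in> carrier R" using ideal.Icarr[OF max_ideal_ideal assms(2)] .
    let ?W = "ev ` U \<union> {a \<odot>\<^bsub>?G\<^esub> v |a v. a \<in> \<mm> \<and> v \<in> mod_span R ?G T}"
    have Wc: "?W \<subseteq> carrier ?G"
    proof
      fix v assume "v \<in> ?W"
      then consider "v \<in> ev ` U" | a v' where "v = a \<odot>\<^bsub>?G\<^esub> v'" "a \<in> \<mm>" "v' \<in> mod_span R ?G T" by blast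
      then show "v \<in> carrier ?G"
      proof cases
        case 1
        then show ?thesis using U(1) evc by blast
      next
        case 2
        have "a \<in> carrier R" using ideal.Icarr[OF max_ideal_ideal 2(2)] .
        moreover have "v' \<in> carrier ?G" using G.mod_span_closed[OF Tc] 2(3) by blast
        ultimately show ?thesis unfolding 2(1) by (rule G.smult_closed)
      qed
    qed
    note sW = G.mod_span_submodule[OF Wc]
    have "x \<odot>\<^bsub>?G\<^esub> ev \<phi>' \<in> ?W"
      using assms(2) T(3) *(1) by blast
    then have 1: "x \<odot>\<^bsub>?G\<^esub> ev \<phi>' \<in> mod_span R ?G ?W" by (rule G.mod_span_base)
    have 2: "ev \<psi> \<in> mod_span R ?G ?W" using *(2) by (intro G.mod_span_base) auto
    have "w = x \<odot>\<^bsub>?G\<^esub> ev \<phi>' \<oplus>\<^bsub>?G\<^esub> ev \<psi>"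
      unfolding \<phi>(2) ev_smult[OF xc] ev_add using *(3) yc by (auto simp: ev_def fun_eq_iff)
    then show "w \<in> mod_span R ?G ?W" using G.submoduleE(5)[OF sW 1 2] by (simp only:)
  qed
  then have "ev \<phi> \<in> ev ` U" using T(3) assms(9) by blast
  then obtain \<psi> where \<psi>: "\<psi> \<in> U" "ev \<phi> = ev \<psi>" by auto
  have gens: "\<phi> s = \<psi> s" if sS: "s \<in> S" for s
  proof -
    obtain i where "i < n" "s = y i" using sS y by auto
    moreover have "(\<lambda>i. if i < n then \<phi> (y i) else \<zero>) = (\<lambda>i. if i < n then \<psi> (y i) else \<zero>)"
      using \<psi>(2) by (simp add: ev_def)
    ultimately show ?thesis by (auto dest: fun_cong[of _ _ i])
  qed
  have hom: "\<phi> \<in> mod_hom R M (regular_module R)" "\<psi> \<in> mod_hom R M (regular_module R)"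
    using assms(9) \<psi>(1) U(1) H by auto
  have "\<phi> z = \<psi> z" if "z \<in> mod_span R M S" for z
    using that S(2)
  proof (induction rule: mod_span_induct)
    case zero
    have "rmodule R (regular_module R)" by (rule rmodule_regular_module[OF is_cring])
    then show ?case using mod_hom_zero[OF rmodule_axioms _ hom(1)] mod_hom_zero[OF rmodule_axioms _ hom(2)] by simp
  qed (use gens in \<open>simp_all add: mod_hom_add[OF hom(1)] mod_hom_add[OF hom(2)]
      mod_hom_smult[OF hom(1)] mod_hom_smult[OF hom(2)]\<close>)
  then show ?thesis using \<psi>(1) S(3) by auto
qed

end

locale injective_resolution = noetherian_local R for R :: "('a, 'r) ring_scheme" (structure) +
  fixes n :: nat and I :: "nat \<Rightarrow> 'a umod" and \<epsilon> d
  assumes injective: "\<And>i. injective_module R (I i)"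
    and bounded: "\<And>i. i > n \<Longrightarrow> carrier (I i) = {\<zero>\<^bsub>I i\<^esub>}"
    and aug: "\<epsilon> \<in> mod_hom R (regular_module R) (I 0)" "inj_on \<epsilon> (carrier R)"
      "\<epsilon> ` carrier R = {x \<in> carrier (I 0). d 0 x = \<zero>\<^bsub>I (Suc 0)\<^esub>}"
    and diff: "\<And>i. d i \<in> mod_hom R (I i) (I (Suc i))"
    and exact: "\<And>i. d i ` carrier (I i) = {x \<in> carrier (I (Suc i)). d (Suc i) x = \<zero>\<^bsub>I (Suc (Suc i))\<^esub>}"
begin

lemma rI: "rmodule R (I i)"
  using injective[of i] by (simp add: injective_module_def rmodule_def)

sublocale Im: rmodule R "I i" for i
  by (rule rI)

lemmas dc = mod_hom_closed[OF diff]

lemma dd: "u \<in> carrier (I i) \<Longrightarrow> d (Suc i) (d i u) = \<zero>\<^bsub>I (Suc (Suc i))\<^esub>"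
  using exact[of i] by blast

lemma extend:
  fixes X Y :: "'a umod"
  assumes "rmodule R X" "rmodule R Y" "j \<in> mod_hom R X Y" "inj_on j (carrier X)" "f \<in> mod_hom R X (I s)"
  obtains g where "g \<in> mod_hom R Y (I s)" "\<And>x. x \<in> carrier X \<Longrightarrow> g (j x) = f x"
proof -
  have "\<exists>g\<in>mod_hom R Y (I s). \<forall>x\<in>carrier X. g (j x) = f x"
    using conjunct2[OF injective[of s, unfolded injective_module_def]] assms unfolding rmodule_def
    by (elim allE impE) (intro conjI; assumption)
  then show ?thesis using that by blast
qed

text \<open>Cocycles of the complex Hom(N, I) without the augmentation; \<open>cob\<close> gives its
  coboundaries, which in degree 0 are just the zero maps. Vanishing of Ext is a statement about
  single maps, so no quotient of a set of maps has to be formed.\<close>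

definition coc where
  "coc s N g \<longleftrightarrow> g \<in> mod_hom R N (I s) \<and> (\<forall>z\<in>carrier N. d s (g z) = \<zero>\<^bsub>I (Suc s)\<^esub>)"

definition cob where
  "cob s N g \<longleftrightarrow> (case s of 0 \<Rightarrow> \<forall>z\<in>carrier N. g z = \<zero>\<^bsub>I 0\<^esub>
    | Suc j \<Rightarrow> \<exists>h\<in>mod_hom R N (I j). \<forall>z\<in>carrier N. g z = d j (h z))"

text \<open>\<open>Van s N\<close> says that $\mathrm{Ext}^s(N, R) = 0$.\<close>

definition Van :: "nat \<Rightarrow> 'a umod \<Rightarrow> bool" where
  "Van s N \<longleftrightarrow> (\<forall>g. coc s N g \<longrightarrow> cob s N g)"

lemma coc_hom: "coc s N g \<Longrightarrow> g \<in> mod_hom R N (I s)"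
  and coc_d: "coc s N g \<Longrightarrow> z \<in> carrier N \<Longrightarrow> d s (g z) = \<zero>\<^bsub>I (Suc s)\<^esub>"
  by (auto simp: coc_def)

lemma coc_comp: "coc s N g \<Longrightarrow> i \<in> mod_hom R L N \<Longrightarrow> coc s L (g \<circ> i)"
  using mod_hom_comp[of i R L N g "I s"] mod_hom_closed[of i R L N] by (auto simp: coc_def)

lemma cob_comp: "cob s N g \<Longrightarrow> i \<in> mod_hom R L N \<Longrightarrow> cob s L (g \<circ> i)"
proof (cases s)
  case (Suc j)
  assume "cob s N g" and i: "i \<in> mod_hom R L N"
  then obtain h where "h \<in> mod_hom R N (I j)" "\<forall>z\<in>carrier N. g z = d j (h z)"
    using Suc by (auto simp: cob_def)
  then show ?thesis
    using mod_hom_comp[OF i, of h] mod_hom_closed[OF i] Suc by (auto simp: cob_def intro!: bexI[of _ "h \<circ> i"])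
qed (auto simp: cob_def mod_hom_closed)

lemma cob_cong: "cob s N g \<Longrightarrow> (\<And>z. z \<in> carrier N \<Longrightarrow> g' z = g z) \<Longrightarrow> cob s N g'"
  by (cases s) (auto simp: cob_def)

lemma cob_add:
  assumes "rmodule R N" "cob s N g" "cob s N g'"
  shows "cob s N (\<lambda>z. g z \<oplus>\<^bsub>I s\<^esub> g' z)"
proof (cases s)
  case (Suc j)
  then obtain h h' where h: "h \<in> mod_hom R N (I j)" "\<forall>z\<in>carrier N. g z = d j (h z)"
    "h' \<in> mod_hom R N (I j)" "\<forall>z\<in>carrier N. g' z = d j (h' z)"
    using assms(2,3) by (auto simp: cob_def)
  have "(\<lambda>z. h z \<oplus>\<^bsub>I j\<^esub> h' z) \<in> mod_hom R N (I j)" by (rule Im.mod_hom_plus[OF assms(1) h(1,3)])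
  then show ?thesis
    using h(2,4) mod_hom_closed[OF h(1)] mod_hom_closed[OF h(3)] Suc
    by (auto simp: cob_def mod_hom_add[OF diff] intro!: bexI[of _ "\<lambda>z. h z \<oplus>\<^bsub>I j\<^esub> h' z"])
qed (use assms in \<open>auto simp: cob_def\<close>)

text \<open>The cochain that bounds g extends along i by injectivity, and the differential of its
  extension restricts to g.\<close>

lemma cob_extend:
  fixes L N :: "'a umod"
  assumes "rmodule R L" "rmodule R N" "i \<in> mod_hom R L N" "inj_on i (carrier L)" "cob s L g"
  obtains e where "coc s N e" "cob s N e" "\<And>x. x \<in> carrier L \<Longrightarrow> e (i x) = g x"
proof (cases s)
  case 0
  have "coc s N (\<lambda>_. \<zero>\<^bsub>I s\<^esub>)" "cob s N (\<lambda>_. \<zero>\<^bsub>I s\<^esub>)"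
    using Im.mod_hom_null[where L = N] mod_hom_zero[OF rI rI diff] 0 by (auto simp: coc_def cob_def)
  then show ?thesis using that assms(5) 0 by (auto simp: cob_def)
next
  case (Suc j)
  then obtain h where h: "h \<in> mod_hom R L (I j)" "\<forall>z\<in>carrier L. g z = d j (h z)"
    using assms(5) by (auto simp: cob_def)
  obtain h' where h': "h' \<in> mod_hom R N (I j)" "\<And>x. x \<in> carrier L \<Longrightarrow> h' (i x) = h x"
    by (rule extend[OF assms(1-4) h(1)]) blast
  have "coc s N (d j \<circ> h')"
    using mod_hom_comp[OF h'(1) diff] dd[OF mod_hom_closed[OF h'(1)]] Suc by (simp add: coc_def)
  moreover have "cob s N (d j \<circ> h')" using h'(1) Suc by (auto simp: cob_def)
  ultimately show ?thesis by (rule that) (use h h' in simp)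
qed

lemma coc_diff:
  assumes "rmodule R N" "coc s N g" "coc s N g'"
  shows "coc s N (\<lambda>z. g z \<ominus>\<^bsub>I s\<^esub> g' z)"
  unfolding coc_def
proof (intro conjI ballI)
  show "(\<lambda>z. g z \<ominus>\<^bsub>I s\<^esub> g' z) \<in> mod_hom R N (I s)"
    by (rule Im.mod_hom_diff[OF assms(1) coc_hom[OF assms(2)] coc_hom[OF assms(3)]])
  fix z assume z: "z \<in> carrier N"
  show "d s (g z \<ominus>\<^bsub>I s\<^esub> g' z) = \<zero>\<^bsub>I (Suc s)\<^esub>"
    using mod_hom_minus[OF rI rI diff mod_hom_closed[OF coc_hom[OF assms(2)] z] mod_hom_closed[OF coc_hom[OF assms(3)] z]]
      coc_d[OF assms(2) z] coc_d[OF assms(3) z] by (simp add: Im.minus_self)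
qed

lemma descend:
  assumes "rmodule R L" "rmodule R N" "rmodule R Q" "short_exact R L N Q i \<pi>" "g \<in> mod_hom R N (I s)"
    "\<And>x. x \<in> carrier L \<Longrightarrow> g (i x) = \<zero>\<^bsub>I s\<^esub>"
  obtains c where "c \<in> mod_hom R Q (I s)" "\<And>x. x \<in> carrier N \<Longrightarrow> c (\<pi> x) = g x"
proof -
  have ex: "\<pi> \<in> mod_hom R N Q" "\<pi> ` carrier N = carrier Q" "i ` carrier L = {x \<in> carrier N. \<pi> x = \<zero>\<^bsub>Q\<^esub>}"
    using assms(4) by (auto simp: short_exact_def)
  have "g x = \<zero>\<^bsub>I s\<^esub>" if "x \<in> carrier N" "\<pi> x = \<zero>\<^bsub>Q\<^esub>" for x
  proof -
    have "x \<in> i ` carrier L" unfolding ex(3) using that by simp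
    then show ?thesis using assms(6) by auto
  qed
  from factor_through_surjection[OF assms(2,3) rI ex(1,2) assms(5) this]
  show ?thesis using that by blast
qed

lemma coc_descend:
  assumes "\<pi> ` carrier N = carrier Q" "c \<in> mod_hom R Q (I s)" "coc s N g" "\<And>x. x \<in> carrier N \<Longrightarrow> c (\<pi> x) = g x"
  shows "coc s Q c"
  unfolding coc_def
proof (intro conjI ballI)
  fix z assume "z \<in> carrier Q"
  then have "z \<in> \<pi> ` carrier N" using assms(1) by simp
  then obtain x where "x \<in> carrier N" "z = \<pi> x" by auto
  then show "d s (c z) = \<zero>\<^bsub>I (Suc s)\<^esub>" using coc_d[OF assms(3)] assms(4) by simp
qed (rule assms(2))

end

section \<open>The long exact sequence of Ext in terms of cocycles\<close>

locale res_sequence = injective_resolution R n I \<epsilon> d + L: rmodule R L + N: rmodule R N + Q: rmodule R Q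
  for R :: "('a, 'r) ring_scheme" (structure) and n :: nat and I :: "nat \<Rightarrow> 'a umod" and \<epsilon> d
    and L N Q :: "'a umod" +
  fixes i \<pi>
  assumes seq: "short_exact R L N Q i \<pi>"
begin

lemma rm: "rmodule R L" "rmodule R N" "rmodule R Q"
  by (rule L.rmodule_axioms N.rmodule_axioms Q.rmodule_axioms)+

lemma ex: "i \<in> mod_hom R L N" "\<pi> \<in> mod_hom R N Q" "inj_on i (carrier L)"
  "i ` carrier L = {x \<in> carrier N. \<pi> x = \<zero>\<^bsub>Q\<^esub>}" "\<pi> ` carrier N = carrier Q"
  using seq by (auto simp: short_exact_def)

lemma pi_i: "x \<in> carrier L \<Longrightarrow> \<pi> (i x) = \<zero>\<^bsub>Q\<^esub>"
  using ex(4) by blast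

lemma coc_split:
  assumes "coc s N g" "coc s N e" "\<And>x. x \<in> carrier L \<Longrightarrow> g (i x) = e (i x)"
  obtains c where "coc s Q c" "\<And>x. x \<in> carrier N \<Longrightarrow> g x = e x \<oplus>\<^bsub>I s\<^esub> c (\<pi> x)"
proof -
  note cg = mod_hom_closed[OF coc_hom[OF assms(1)]] and ce = mod_hom_closed[OF coc_hom[OF assms(2)]]
  have ge: "coc s N (\<lambda>z. g z \<ominus>\<^bsub>I s\<^esub> e z)" by (rule coc_diff[OF rm(2) assms(1,2)])
  have "g (i x) \<ominus>\<^bsub>I s\<^esub> e (i x) = \<zero>\<^bsub>I s\<^esub>" if "x \<in> carrier L" for x
    using assms(3)[OF that] ce[OF mod_hom_closed[OF ex(1) that]] by (simp add: Im.minus_self)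
  then obtain c where c: "c \<in> mod_hom R Q (I s)" "\<And>x. x \<in> carrier N \<Longrightarrow> c (\<pi> x) = g x \<ominus>\<^bsub>I s\<^esub> e x"
    by (rule descend[OF rm seq coc_hom[OF ge]]) blast+
  have "coc s Q c" by (rule coc_descend[OF ex(5) c(1) ge c(2)])
  moreover have "g x = e x \<oplus>\<^bsub>I s\<^esub> c (\<pi> x)" if x: "x \<in> carrier N" for x
    using c(2)[OF x] cg[OF x] ce[OF x] Im.minus_add_cancel[OF cg[OF x] ce[OF x]] by (simp add: Im.M.a_comm)
  ultimately show ?thesis by (rule that)
qed

text \<open>The connecting map of the long exact sequence. The cochain g on N extends a cocycle of
  L, so its differential vanishes on L and comes from Q.\<close>

lemma connecting:
  assumes g: "g \<in> mod_hom R N (I s)" and "coc s L (g \<circ> i)"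
  obtains c where "coc (Suc s) Q c" "\<And>x. x \<in> carrier N \<Longrightarrow> c (\<pi> x) = d s (g x)"
proof -
  have dg: "d s \<circ> g \<in> mod_hom R N (I (Suc s))" by (rule mod_hom_comp[OF g diff])
  have "(d s \<circ> g) (i x) = \<zero>\<^bsub>I (Suc s)\<^esub>" if "x \<in> carrier L" for x
    using coc_d[OF assms(2) that] by simp
  then obtain c where c: "c \<in> mod_hom R Q (I (Suc s))" "\<And>x. x \<in> carrier N \<Longrightarrow> c (\<pi> x) = (d s \<circ> g) x"
    by (rule descend[OF rm seq dg]) blast+
  have "coc (Suc s) N (d s \<circ> g)" using dg dd[OF mod_hom_closed[OF g]] by (simp add: coc_def)
  then have "coc (Suc s) Q c" by (rule coc_descend[OF ex(5) c(1) _ c(2)])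
  then show ?thesis by (rule that) (use c(2) in simp)
qed

text \<open>Subtracting from g a cocycle on N with the same restriction to L leaves a cochain that
  descends to Q, and its differential is still c.\<close>

lemma cob_connecting:
  assumes "g \<in> mod_hom R N (I s)" "cob s L (g \<circ> i)" "\<And>x. x \<in> carrier N \<Longrightarrow> c (\<pi> x) = d s (g x)"
  shows "cob (Suc s) Q c"
proof -
  obtain e where e: "coc s N e" "cob s N e" "\<And>x. x \<in> carrier L \<Longrightarrow> e (i x) = (g \<circ> i) x"
    by (rule cob_extend[OF rm(1,2) ex(1,3) assms(2)]) blast
  note cg = mod_hom_closed[OF assms(1)] and ce = mod_hom_closed[OF coc_hom[OF e(1)]]
  have ge: "(\<lambda>z. g z \<ominus>\<^bsub>I s\<^esub> e z) \<in> mod_hom R N (I s)"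
    by (rule Im.mod_hom_diff[OF rm(2) assms(1) coc_hom[OF e(1)]])
  have "g (i x) \<ominus>\<^bsub>I s\<^esub> e (i x) = \<zero>\<^bsub>I s\<^esub>" if "x \<in> carrier L" for x
    using e(3)[OF that] cg[OF mod_hom_closed[OF ex(1) that]] by (simp add: Im.minus_self)
  then obtain h where h: "h \<in> mod_hom R Q (I s)" "\<And>x. x \<in> carrier N \<Longrightarrow> h (\<pi> x) = g x \<ominus>\<^bsub>I s\<^esub> e x"
    by (rule descend[OF rm seq ge]) blast+
  have "c z = d s (h z)" if "z \<in> carrier Q" for z
  proof -
    have "z \<in> \<pi> ` carrier N" using that ex(5) by simp
    then obtain x where x: "x \<in> carrier N" "z = \<pi> x" by auto
    have "d s (g x \<ominus>\<^bsub>I s\<^esub> e x) = d s (g x)"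
      using mod_hom_minus[OF rI rI diff cg[OF x(1)] ce[OF x(1)]] coc_d[OF e(1) x(1)] dc[OF cg[OF x(1)]]
      by (simp add: Im.minus_eq_iff)
    then show ?thesis using assms(3)[OF x(1)] h(2)[OF x(1)] x(2) by simp
  qed
  then show ?thesis using h(1) by (auto simp: cob_def)
qed

lemma Van_middle:
  assumes "Van s L" "Van s Q"
  shows "Van s N"
  unfolding Van_def
proof (intro allI impI)
  fix g assume g: "coc s N g"
  have "cob s L (g \<circ> i)" using assms(1) coc_comp[OF g ex(1)] by (simp add: Van_def)
  then obtain e where e: "coc s N e" "cob s N e" "\<And>x. x \<in> carrier L \<Longrightarrow> e (i x) = (g \<circ> i) x"
    by (rule cob_extend[OF rm(1,2) ex(1,3)]) blast
  obtain c where c: "coc s Q c" "\<And>x. x \<in> carrier N \<Longrightarrow> g x = e x \<oplus>\<^bsub>I s\<^esub> c (\<pi> x)"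
    by (rule coc_split[OF g e(1)]) (use e(3) in auto)
  have "cob s N (c \<circ> \<pi>)" using assms(2) c(1) cob_comp[OF _ ex(2)] by (simp add: Van_def)
  from cob_add[OF rm(2) e(2) this] show "cob s N g" by (rule cob_cong) (use c(2) in simp)
qed

text \<open>Extend g to a cochain on N. Its connecting class on Q is the differential of some l, and
  subtracting the pullback of l turns the extension into a cocycle without changing it on L.\<close>

lemma coc_extends:
  assumes "Van (Suc s) Q" and g: "coc s L g"
  obtains h where "coc s N h" "\<And>z. z \<in> carrier L \<Longrightarrow> h (i z) = g z"
proof -
  obtain g' where g': "g' \<in> mod_hom R N (I s)" "\<And>x. x \<in> carrier L \<Longrightarrow> g' (i x) = g x"
    by (rule extend[OF rm(1,2) ex(1,3) coc_hom[OF g]]) blast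
  have "g' \<circ> i \<in> mod_hom R L (I s)" by (rule mod_hom_comp[OF ex(1) g'(1)])
  then have "coc s L (g' \<circ> i)" using g g'(2) by (simp add: coc_def)
  then obtain c where c: "coc (Suc s) Q c" "\<And>x. x \<in> carrier N \<Longrightarrow> c (\<pi> x) = d s (g' x)"
    by (rule connecting[OF g'(1)]) blast
  have "cob (Suc s) Q c" using assms(1) c(1) by (simp add: Van_def)
  then obtain l where l: "l \<in> mod_hom R Q (I s)" "\<forall>z\<in>carrier Q. c z = d s (l z)" by (auto simp: cob_def)
  let ?h = "\<lambda>z. g' z \<ominus>\<^bsub>I s\<^esub> (l \<circ> \<pi>) z"
  have lp: "l \<circ> \<pi> \<in> mod_hom R N (I s)" by (rule mod_hom_comp[OF ex(2) l(1)])
  have "d s (?h z) = \<zero>\<^bsub>I (Suc s)\<^esub>" if z: "z \<in> carrier N" for z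
  proof -
    have "d s (l (\<pi> z)) = d s (g' z)" using l(2) c(2)[OF z] mod_hom_closed[OF ex(2) z] by simp
    then show ?thesis
      using mod_hom_minus[OF rI rI diff mod_hom_closed[OF g'(1) z] mod_hom_closed[OF lp z]]
        dc[OF mod_hom_closed[OF g'(1) z]] by (simp add: Im.minus_self)
  qed
  then have "coc s N ?h" using Im.mod_hom_diff[OF rm(2) g'(1) lp] by (simp add: coc_def)
  moreover have "?h (i z) = g z" if z: "z \<in> carrier L" for z
  proof -
    have "l (\<pi> (i z)) = \<zero>\<^bsub>I s\<^esub>" using pi_i[OF z] mod_hom_zero[OF rm(3) rI l(1)] by simp
    then show ?thesis
      using g'(2)[OF z] mod_hom_closed[OF coc_hom[OF g] z] by (simp add: Im.minus_eq_iff)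
  qed
  ultimately show ?thesis by (rule that)
qed

lemma Van_left:
  assumes "Van s N" "Van (Suc s) Q"
  shows "Van s L"
  unfolding Van_def
proof (intro allI impI)
  fix g assume "coc s L g"
  then obtain h where h: "coc s N h" "\<And>z. z \<in> carrier L \<Longrightarrow> h (i z) = g z"
    by (rule coc_extends[OF assms(2)]) blast
  have "cob s N h" using assms(1) h(1) by (simp add: Van_def)
  then have "cob s L (h \<circ> i)" by (rule cob_comp[OF _ ex(1)])
  then show "cob s L g" by (rule cob_cong) (use h(2) in simp)
qed

text \<open>Pulled back to N, the cocycle c bounds some g. The restriction of g to L is a cocycle,
  because c vanishes there after pullback; hence it is a coboundary and
  \<open>cob_connecting\<close> applies.\<close>

lemma Van_right:
  assumes "Van s L" "Van (Suc s) N"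
  shows "Van (Suc s) Q"
  unfolding Van_def
proof (intro allI impI)
  fix c assume c: "coc (Suc s) Q c"
  have "cob (Suc s) N (c \<circ> \<pi>)" using assms(2) coc_comp[OF c ex(2)] by (simp add: Van_def)
  then obtain g where g: "g \<in> mod_hom R N (I s)" "\<forall>z\<in>carrier N. (c \<circ> \<pi>) z = d s (g z)" by (auto simp: cob_def)
  have "coc s L (g \<circ> i)"
    unfolding coc_def
  proof (intro conjI ballI)
    show "g \<circ> i \<in> mod_hom R L (I s)" by (rule mod_hom_comp[OF ex(1) g(1)])
    fix z assume z: "z \<in> carrier L"
    have "d s (g (i z)) = c (\<pi> (i z))" using g(2) mod_hom_closed[OF ex(1) z] by simp
    then show "d s ((g \<circ> i) z) = \<zero>\<^bsub>I (Suc s)\<^esub>"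
      using pi_i[OF z] mod_hom_zero[OF rm(3) rI coc_hom[OF c]] by simp
  qed
  then have "cob s L (g \<circ> i)" using assms(1) by (simp add: Van_def)
  then show "cob (Suc s) Q c" by (rule cob_connecting[OF g(1)]) (use g(2) in simp)
qed

end

section \<open>Vanishing of Ext for projective modules, dimension shifting and Nakayama's
  lemma\<close>

context injective_resolution
begin

lemma Van_bounded:
  assumes "n < s"
  shows "Van s N"
  unfolding Van_def
proof (intro allI impI)
  fix g assume "coc s N g"
  then have g: "g z = \<zero>\<^bsub>I s\<^esub>" if "z \<in> carrier N" for z
    using mod_hom_closed[OF coc_hom that] bounded[OF assms] by auto
  obtain j where "s = Suc j" using assms by (cases s) auto
  then show "cob s N g"
    using g mod_hom_zero[OF rI rI diff[of j]] Im.mod_hom_null[where L = N]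
    by (auto simp: cob_def intro!: bexI[of _ "\<lambda>_. \<zero>\<^bsub>I j\<^esub>"])
qed

text \<open>The hypothesis on the identity is the dual basis property of a finitely generated
  projective module. For f in \<open>triv_maps\<close>, the cocycle g after f is a coboundary: a
  summand \<phi> z times y is sent to \<phi> z times g y, and g y is the differential of some u by
  exactness of the resolution.\<close>

lemma Van_projective:
  fixes P :: "'a umod"
  assumes "rmodule R P" "id \<in> triv_maps R P P"
  shows "Van (Suc s) P"
  unfolding Van_def
proof (intro allI impI)
  fix g assume g: "coc (Suc s) P g"
  interpret P: rmodule R P by fact
  interpret PP: rmodule2 R P P by intro_locales
  note gh = coc_hom[OF g]
  have "\<exists>h\<in>mod_hom R P (I s). \<forall>z\<in>carrier P. g (f z) = d s (h z)" if "f \<in> triv_maps R P P" for f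
    using that
  proof induction
    case (zero f)
    then show ?case
      using mod_hom_zero[OF assms(1) rI gh] mod_hom_zero[OF rI rI diff[of s]]
      by (intro bexI[of _ "\<lambda>_. \<zero>\<^bsub>I s\<^esub>"] Im.mod_hom_null) auto
  next
    case (step f \<phi> y f')
    then obtain h where h: "h \<in> mod_hom R P (I s)" "\<forall>z\<in>carrier P. g (f z) = d s (h z)" by blast
    have "g y \<in> d s ` carrier (I s)"
      unfolding exact using mod_hom_closed[OF gh step.hyps(3)] coc_d[OF g step.hyps(3)] by simp
    then obtain u where u: "u \<in> carrier (I s)" "g y = d s u" by auto
    interpret PI: rmodule2 R P "I s" by (simp add: rmodule2_def assms(1) rI)
    have hom: "(\<lambda>z. h z \<oplus>\<^bsub>I s\<^esub> \<phi> z \<odot>\<^bsub>I s\<^esub> u) \<in> mod_hom R P (I s)"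
      by (intro Im.mod_hom_plus assms(1) h(1) PI.smult_vector_hom step.hyps(2) u(1))
    have "g (f' z) = d s (h z \<oplus>\<^bsub>I s\<^esub> \<phi> z \<odot>\<^bsub>I s\<^esub> u)" if z: "z \<in> carrier P" for z
    proof -
      have c: "\<phi> z \<in> carrier R" "f z \<in> carrier P" "h z \<in> carrier (I s)"
        using mod_hom_closed[OF step.hyps(2) z] mod_hom_closed[OF PP.triv_maps_hom[OF step.hyps(1)] z]
          mod_hom_closed[OF h(1) z] by auto
      have "g (f' z) = g (f z) \<oplus>\<^bsub>I (Suc s)\<^esub> \<phi> z \<odot>\<^bsub>I (Suc s)\<^esub> g y"
        using step.hyps(3,4) z c by (simp add: mod_hom_add[OF gh] mod_hom_smult[OF gh])
      also have "\<dots> = d s (h z) \<oplus>\<^bsub>I (Suc s)\<^esub> d s (\<phi> z \<odot>\<^bsub>I s\<^esub> u)"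
        using h(2) z u c by (simp add: mod_hom_smult[OF diff])
      also have "\<dots> = d s (h z \<oplus>\<^bsub>I s\<^esub> \<phi> z \<odot>\<^bsub>I s\<^esub> u)"
        using c u by (simp add: mod_hom_add[OF diff])
      finally show ?thesis .
    qed
    then show ?case by (intro rev_bexI[OF hom] ballI)
  qed
  from this[OF assms(2)] show "cob (Suc s) P g" by (auto simp: cob_def)
qed

lemma Van_free_mod: "Van (Suc s) (free_mod R k)"
  by (rule Van_projective[OF rmodule_free_mod fg_free_id_triv[OF fg_free_free_mod[OF one_neq_zero]]])

text \<open>The augmentation identifies R with the kernel of the first differential, so cocycles in
  degree 0 are linear forms on N.\<close>

lemma coc_0_form:
  assumes "rmodule R N" "coc 0 N g"
  obtains \<phi> where "\<phi> \<in> mod_hom R N (regular_module R)" "\<And>z. z \<in> carrier N \<Longrightarrow> \<epsilon> (\<phi> z) = g z"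
proof -
  have r: "rmodule R (regular_module R)" by (rule rmodule_regular_module[OF is_cring])
  have "g z \<in> \<epsilon> ` carrier (regular_module R)" if "z \<in> carrier N" for z
    using aug(3) mod_hom_closed[OF coc_hom[OF assms(2)] that] coc_d[OF assms(2) that] by simp
  moreover have "inj_on \<epsilon> (carrier (regular_module R))" using aug(2) by simp
  ultimately have "\<exists>\<phi>\<in>mod_hom R N (regular_module R). \<forall>z\<in>carrier N. \<epsilon> (\<phi> z) = g z"
    by (intro factor_through_injection[OF r rI assms(1) aug(1) _ coc_hom[OF assms(2)]])
  then obtain \<phi> where "\<phi> \<in> mod_hom R N (regular_module R)" "\<forall>z\<in>carrier N. \<epsilon> (\<phi> z) = g z" by (rule bexE)
  then show ?thesis by (intro that[of \<phi>]) simp_all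
qed

lemma form_coc_0:
  assumes "\<phi> \<in> mod_hom R N (regular_module R)"
  shows "coc 0 N (\<epsilon> \<circ> \<phi>)"
proof -
  have "d 0 (\<epsilon> r) = \<zero>\<^bsub>I (Suc 0)\<^esub>" if "r \<in> carrier R" for r using aug(3) that by blast
  then show ?thesis
    using mod_hom_comp[OF assms aug(1)] mod_hom_closed[OF assms] by (simp add: coc_def)
qed

end

context noetherian_local
begin

lemma syzygy:
  fixes N :: "'a umod"
  assumes "rmodule R N" "fin_gen R N"
  obtains k q and K :: "'a umod" where "rmodule R K" "fin_gen R K" "short_exact R K (free_mod R k) N id q"
proof -
  interpret N: local_module R N by (intro local_module.intro noetherian_local_axioms assms)
  obtain k q where q: "q \<in> mod_hom R (free_mod R k) N" "q ` carrier (free_mod R k) = carrier N"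
    using N.free_cover[OF assms(2)] by blast
  interpret G: local_module R "free_mod R k"
    by (intro local_module.intro noetherian_local_axioms rmodule_free_mod)
  let ?H = "{x \<in> carrier (free_mod R k). q x = \<zero>\<^bsub>N\<^esub>}"
  have s: "submodule ?H R (free_mod R k)" by (rule kernel_submodule[OF rmodule_free_mod assms(1) q(1)])
  show ?thesis
  proof (rule that)
    show "rmodule R (free_mod R k\<lparr>carrier := ?H\<rparr>)" by (rule G.restrict_rmodule[OF s])
    show "fin_gen R (free_mod R k\<lparr>carrier := ?H\<rparr>)"
      by (rule G.submodule_fin_gen[OF fg_free_fin_gen[OF fg_free_free_mod[OF one_neq_zero]] s])
    show "short_exact R (free_mod R k\<lparr>carrier := ?H\<rparr>) (free_mod R k) N id q"
      by (rule G.restrict_short_exact[OF s q]) auto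
  qed
qed

end

context injective_resolution
begin

lemma res_sequenceI:
  assumes "rmodule R L" "rmodule R N" "rmodule R Q" "short_exact R L N Q i \<pi>"
  shows "res_sequence R n I \<epsilon> d L N Q i \<pi>"
  using assms by (intro res_sequence.intro res_sequence_axioms.intro injective_resolution_axioms)

text \<open>Nakayama's lemma for the cohomology modules, which are finitely generated because they can
  be computed from syzygies.\<close>

lemma Van_nakayama:
  assumes "rmodule R N" "fin_gen R N" and x: "x \<in> \<mm>"
    and "\<And>g. coc s N g \<Longrightarrow> \<exists>g'. coc s N g' \<and> cob s N (\<lambda>z. g z \<ominus>\<^bsub>I s\<^esub> x \<odot>\<^bsub>I s\<^esub> g' z)"
  shows "Van s N"
  using assms(1,2,4)
proof (induction s arbitrary: N)
  case (0 N)
  have r: "rmodule R (regular_module R)" by (rule rmodule_regular_module[OF is_cring])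
  have xc: "x \<in> carrier R" using ideal.Icarr[OF max_ideal_ideal x] .
  interpret N: local_module R N by (intro local_module.intro noetherian_local_axioms 0)
  show ?case
    unfolding Van_def
  proof (intro allI impI)
    fix g assume "coc 0 N g"
    then obtain \<phi> where \<phi>: "\<phi> \<in> mod_hom R N (regular_module R)" "\<And>z. z \<in> carrier N \<Longrightarrow> \<epsilon> (\<phi> z) = g z"
      by (rule coc_0_form[OF 0(1)]) blast
    \<comment> \<open>In degree 0 there are no nonzero coboundaries, so Nakayama's lemma is applied
      with U consisting of the zero form only.\<close>
    have "\<exists>\<psi>\<in>{\<lambda>_. \<zero>}. \<forall>z\<in>carrier N. \<phi> z = \<psi> z"
    proof (rule N.hom_nakayama[OF 0(2) x refl _ _ _ _ _ \<phi>(1)])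
      show "{\<lambda>_. \<zero>} \<subseteq> mod_hom R N (regular_module R)"
        using rmodule.mod_hom_null[OF r] by simp
      fix \<phi> assume p: "\<phi> \<in> mod_hom R N (regular_module R)"
      obtain g' where g': "coc 0 N g'" "cob 0 N (\<lambda>z. (\<epsilon> \<circ> \<phi>) z \<ominus>\<^bsub>I 0\<^esub> x \<odot>\<^bsub>I 0\<^esub> g' z)"
        using 0(3)[OF form_coc_0[OF p]] by blast
      obtain \<phi>' where \<phi>': "\<phi>' \<in> mod_hom R N (regular_module R)" "\<And>z. z \<in> carrier N \<Longrightarrow> \<epsilon> (\<phi>' z) = g' z"
        by (rule coc_0_form[OF 0(1) g'(1)]) blast
      have "\<phi> z = x \<otimes> \<phi>' z \<oplus> (\<lambda>_. \<zero>) z" if z: "z \<in> carrier N" for z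
      proof -
        have c: "\<phi> z \<in> carrier R" "\<phi>' z \<in> carrier R"
          using mod_hom_closed[OF p z] mod_hom_closed[OF \<phi>'(1) z] by auto
        note e = mod_hom_closed[OF aug(1), simplified]
        have "\<epsilon> (\<phi> z) \<ominus>\<^bsub>I 0\<^esub> x \<odot>\<^bsub>I 0\<^esub> g' z = \<zero>\<^bsub>I 0\<^esub>" using g'(2) z by (simp add: cob_def)
        then have "\<epsilon> (\<phi> z) = x \<odot>\<^bsub>I 0\<^esub> \<epsilon> (\<phi>' z)"
          using \<phi>'(2)[OF z] e[OF c(1)] e[OF c(2)] xc Im.minus_eq_zero_iff[of "\<epsilon> (\<phi> z)" 0 "x \<odot>\<^bsub>I 0\<^esub> \<epsilon> (\<phi>' z)"]
          by simp
        also have "\<dots> = \<epsilon> (x \<otimes> \<phi>' z)" using mod_hom_smult[OF aug(1) xc, of "\<phi>' z"] c by simp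
        finally have "\<phi> z = x \<otimes> \<phi>' z" by (rule inj_onD[OF aug(2)]) (use c xc in simp_all)
        then show ?thesis using c xc by simp
      qed
      then show "\<exists>\<phi>'\<in>mod_hom R N (regular_module R). \<exists>\<psi>\<in>{\<lambda>_. \<zero>}. \<forall>z\<in>carrier N. \<phi> z = x \<otimes> \<phi>' z \<oplus> \<psi> z"
        by (intro rev_bexI[OF \<phi>'(1)] bexI[of _ "\<lambda>_. \<zero>"] ballI) simp_all
    qed auto
    then have "g z = \<zero>\<^bsub>I 0\<^esub>" if "z \<in> carrier N" for z
      using \<phi>(2)[OF that] that mod_hom_zero[OF r rI aug(1)] by auto
    then show "cob 0 N g" by (simp add: cob_def)
  qed
next
  case (Suc j N)
  have r: "rmodule R (regular_module R)" by (rule rmodule_regular_module[OF is_cring])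
  have xc: "x \<in> carrier R" using ideal.Icarr[OF max_ideal_ideal x] .
  obtain k q and K :: "'a umod" where K: "rmodule R K" "fin_gen R K" "short_exact R K (free_mod R k) N id q"
    using syzygy[OF Suc.prems(1,2)] .
  let ?G = "free_mod R k"
  note rG = rmodule_free_mod[of k]
  interpret S: res_sequence R n I \<epsilon> d K ?G N id q
    by (rule res_sequenceI[OF K(1) rG Suc.prems(1) K(3)])
  interpret K: local_module R K by (intro local_module.intro noetherian_local_axioms K)
  note q = S.ex(2) and qc = mod_hom_closed[OF S.ex(2)]
  have KG: "z \<in> carrier ?G" "q z = \<zero>\<^bsub>N\<^esub>" if "z \<in> carrier K" for z
    using mod_hom_closed[OF S.ex(1) that] S.pi_i[OF that] by auto
  have res: "coc j K g" if "g \<in> mod_hom R ?G (I j)" "\<And>z. z \<in> carrier ?G \<Longrightarrow> d j (g z) = c (q z)"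
    "c \<in> mod_hom R N (I (Suc j))" for g c
    unfolding coc_def
  proof (intro conjI ballI)
    show "g \<in> mod_hom R K (I j)" using mod_hom_comp[OF S.ex(1) that(1)] by simp
    fix z assume "z \<in> carrier K"
    then show "d j (g z) = \<zero>\<^bsub>I (Suc j)\<^esub>"
      using that(2) KG mod_hom_zero[OF Suc.prems(1) rI that(3)] by simp
  qed
  have lift: "\<exists>g\<in>mod_hom R ?G (I j). \<forall>z\<in>carrier ?G. c (q z) = d j (g z)" if c: "coc (Suc j) N c" for c
  proof -
    have "cob (Suc j) ?G (c \<circ> q)" using Van_free_mod coc_comp[OF c q] by (simp add: Van_def)
    then show ?thesis by (simp add: cob_def)
  qed
  \<comment> \<open>The hypothesis on N is moved to its syzygy K. The connecting class c of g is x
    c' plus the differential of l. If g1 extends g and the differential of g2 is c' pulled back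
    along q, then g1 - x g2 - l q is a cocycle on the free module, and l q vanishes on K.\<close>
  have transfer: "\<exists>g' e. coc j K g' \<and> coc j ?G e \<and> (\<forall>z\<in>carrier K. g z = x \<odot>\<^bsub>I j\<^esub> g' z \<oplus>\<^bsub>I j\<^esub> e z)"
    if g: "coc j K g" for g
  proof -
    obtain g1 where g1: "g1 \<in> mod_hom R ?G (I j)" "\<And>z. z \<in> carrier K \<Longrightarrow> g1 (id z) = g z"
      by (rule extend[OF K(1) rG S.ex(1,3) coc_hom[OF g]]) blast
    have "g1 \<circ> id \<in> mod_hom R K (I j)" by (rule mod_hom_comp[OF S.ex(1) g1(1)])
    then have "coc j K (g1 \<circ> id)" using g g1(2) by (simp add: coc_def)
    then obtain c where c: "coc (Suc j) N c" "\<And>z. z \<in> carrier ?G \<Longrightarrow> c (q z) = d j (g1 z)"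
      by (rule S.connecting[OF g1(1)]) blast
    obtain c' where c': "coc (Suc j) N c'" "cob (Suc j) N (\<lambda>z. c z \<ominus>\<^bsub>I (Suc j)\<^esub> x \<odot>\<^bsub>I (Suc j)\<^esub> c' z)"
      using Suc.prems(3)[OF c(1)] by blast
    then obtain l where l: "l \<in> mod_hom R N (I j)"
      "\<forall>z\<in>carrier N. c z \<ominus>\<^bsub>I (Suc j)\<^esub> x \<odot>\<^bsub>I (Suc j)\<^esub> c' z = d j (l z)" by (auto simp: cob_def)
    obtain g2 where g2: "g2 \<in> mod_hom R ?G (I j)" "\<forall>z\<in>carrier ?G. c' (q z) = d j (g2 z)"
      using lift[OF c'(1)] by blast
    have lq: "l \<circ> q \<in> mod_hom R ?G (I j)" by (rule mod_hom_comp[OF q l(1)])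
    have xg: "(\<lambda>z. x \<odot>\<^bsub>I j\<^esub> g2 z) \<in> mod_hom R ?G (I j)" by (rule Im.mod_hom_scale[OF rG g2(1) xc])
    let ?e1 = "\<lambda>z. g1 z \<ominus>\<^bsub>I j\<^esub> x \<odot>\<^bsub>I j\<^esub> g2 z"
    have e1: "?e1 \<in> mod_hom R ?G (I j)" by (rule Im.mod_hom_diff[OF rG g1(1) xg])
    let ?e = "\<lambda>z. ?e1 z \<ominus>\<^bsub>I j\<^esub> (l \<circ> q) z"
    have e: "?e \<in> mod_hom R ?G (I j)" by (rule Im.mod_hom_diff[OF rG e1 lq])
    have "d j (?e z) = \<zero>\<^bsub>I (Suc j)\<^esub>" if z: "z \<in> carrier ?G" for z
    proof -
      have "d j (?e z) = d j (?e1 z) \<ominus>\<^bsub>I (Suc j)\<^esub> d j (l (q z))"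
        using mod_hom_minus[OF rI rI diff mod_hom_closed[OF e1 z] mod_hom_closed[OF lq z]] by simp
      also have "d j (?e1 z) = d j (g1 z) \<ominus>\<^bsub>I (Suc j)\<^esub> x \<odot>\<^bsub>I (Suc j)\<^esub> d j (g2 z)"
        using mod_hom_minus[OF rI rI diff mod_hom_closed[OF g1(1) z] mod_hom_closed[OF xg z]]
          mod_hom_smult[OF diff xc mod_hom_closed[OF g2(1) z]] by simp
      also have "\<dots> = d j (l (q z))"
        using bspec[OF l(2) qc[OF z]] c(2)[OF z] bspec[OF g2(2) z] by (simp only:)
      finally show ?thesis using dc[OF mod_hom_closed[OF lq z]] by (simp add: Im.minus_self)
    qed
    then have ce: "coc j ?G ?e" using e by (simp add: coc_def)
    have cg: "coc j K g2" by (rule res[OF g2(1) _ coc_hom[OF c'(1)]]) (use g2(2) in simp)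
    have "g z = x \<odot>\<^bsub>I j\<^esub> g2 z \<oplus>\<^bsub>I j\<^esub> ?e z" if z: "z \<in> carrier K" for z
    proof -
      have c: "g z \<in> carrier (I j)" "x \<odot>\<^bsub>I j\<^esub> g2 z \<in> carrier (I j)"
        using mod_hom_closed[OF coc_hom[OF g] z] mod_hom_closed[OF xg KG(1)[OF z]] .
      have "?e z = g z \<ominus>\<^bsub>I j\<^esub> x \<odot>\<^bsub>I j\<^esub> g2 z"
        using g1(2)[OF z] KG[OF z] mod_hom_zero[OF Suc.prems(1) rI l(1)] c by (simp add: Im.minus_eq_iff)
      then show ?thesis using c Im.minus_add_cancel[OF c] by (simp add: Im.M.a_comm)
    qed
    then show ?thesis using cg ce by blast
  qed
  \<comment> \<open>This says that Ext^j of the free module maps onto Ext^j(K); the cokernel of that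
    map is Ext^(j+1)(N). For j > 0 the induction hypothesis makes Ext^j(K) itself vanish, and for j
    = 0 the statement is about linear forms.\<close>
  have approx: "\<exists>e. coc j ?G e \<and> cob j K (\<lambda>z. g z \<ominus>\<^bsub>I j\<^esub> e z)" if g: "coc j K g" for g
  proof (cases j)
    case 0
    have g0: "coc 0 K g" using g 0 by simp
    obtain \<phi> where \<phi>: "\<phi> \<in> mod_hom R K (regular_module R)" "\<And>z. z \<in> carrier K \<Longrightarrow> \<epsilon> (\<phi> z) = g z"
      by (rule coc_0_form[OF K(1) g0]) blast
    let ?H = "mod_hom R K (regular_module R)"
    \<comment> \<open>The forms on K that extend to the free module. In degree 0 the Ext of the free
      module does not vanish in general, so Nakayama's lemma is applied modulo these
      restrictions.\<close>
    let ?U = "{\<psi> \<in> ?H. \<exists>e\<in>mod_hom R ?G (regular_module R). \<forall>z\<in>carrier K. \<psi> z = e z}"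
    have "\<exists>\<psi>\<in>?U. \<forall>z\<in>carrier K. \<phi> z = \<psi> z"
    proof (rule K.hom_nakayama[OF K(2) x refl _ _ _ _ _ \<phi>(1)])
      show "(\<lambda>_. \<zero>) \<in> ?U"
        using rmodule.mod_hom_null[OF r, of K] rmodule.mod_hom_null[OF r, of ?G] by auto
      show "(\<lambda>z. \<psi> z \<oplus> \<psi>' z) \<in> ?U" if "\<psi> \<in> ?U" "\<psi>' \<in> ?U" for \<psi> \<psi>'
      proof -
        obtain e e' where "e \<in> mod_hom R ?G (regular_module R)" "\<forall>z\<in>carrier K. \<psi> z = e z"
          "e' \<in> mod_hom R ?G (regular_module R)" "\<forall>z\<in>carrier K. \<psi>' z = e' z" "\<psi> \<in> ?H" "\<psi>' \<in> ?H"
          using \<open>\<psi> \<in> ?U\<close> \<open>\<psi>' \<in> ?U\<close> by blast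
        then show ?thesis
          using rmodule.mod_hom_plus[OF r K(1), of \<psi> \<psi>'] rmodule.mod_hom_plus[OF r rG, of e e']
          by (intro CollectI conjI bexI[of _ "\<lambda>z. e z \<oplus>\<^bsub>regular_module R\<^esub> e' z"]) simp_all
      qed
      show "(\<lambda>z. a \<otimes> \<psi> z) \<in> ?U" if a: "a \<in> carrier R" and "\<psi> \<in> ?U" for a \<psi>
      proof -
        obtain e where "e \<in> mod_hom R ?G (regular_module R)" "\<forall>z\<in>carrier K. \<psi> z = e z" "\<psi> \<in> ?H"
          using \<open>\<psi> \<in> ?U\<close> by blast
        then show ?thesis
          using rmodule.mod_hom_scale[OF r K(1), of \<psi> a] rmodule.mod_hom_scale[OF r rG, of e a] a
          by (intro CollectI conjI bexI[of _ "\<lambda>z. a \<odot>\<^bsub>regular_module R\<^esub> e z"]) simp_all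
      qed
      fix \<phi> assume p: "\<phi> \<in> ?H"
      have "coc j K (\<epsilon> \<circ> \<phi>)" using form_coc_0[OF p] 0 by simp
      then obtain g' e where ge: "coc 0 K g'" "coc 0 ?G e"
        "\<forall>z\<in>carrier K. (\<epsilon> \<circ> \<phi>) z = x \<odot>\<^bsub>I 0\<^esub> g' z \<oplus>\<^bsub>I 0\<^esub> e z"
        using transfer[of "\<epsilon> \<circ> \<phi>"] 0 by auto
      obtain \<phi>' where \<phi>': "\<phi>' \<in> ?H" "\<And>z. z \<in> carrier K \<Longrightarrow> \<epsilon> (\<phi>' z) = g' z"
        by (rule coc_0_form[OF K(1) ge(1)]) blast
      obtain \<psi> where \<psi>: "\<psi> \<in> mod_hom R ?G (regular_module R)" "\<And>z. z \<in> carrier ?G \<Longrightarrow> \<epsilon> (\<psi> z) = e z"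
        by (rule coc_0_form[OF rG ge(2)]) blast
      have "\<phi> z = x \<otimes> \<phi>' z \<oplus> \<psi> z" if z: "z \<in> carrier K" for z
      proof -
        have c: "\<phi> z \<in> carrier R" "\<phi>' z \<in> carrier R" "\<psi> z \<in> carrier R"
          using mod_hom_closed[OF p z] mod_hom_closed[OF \<phi>'(1) z] mod_hom_closed[OF \<psi>(1) KG(1)[OF z]] by auto
        have "\<epsilon> (\<phi> z) = x \<odot>\<^bsub>I 0\<^esub> \<epsilon> (\<phi>' z) \<oplus>\<^bsub>I 0\<^esub> \<epsilon> (\<psi> z)"
          using ge(3) z \<phi>'(2)[OF z] \<psi>(2)[OF KG(1)[OF z]] by simp
        also have "\<dots> = \<epsilon> (x \<otimes> \<phi>' z \<oplus> \<psi> z)"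
          using mod_hom_smult[OF aug(1) xc, of "\<phi>' z"] mod_hom_add[OF aug(1), of "x \<otimes> \<phi>' z" "\<psi> z"] c xc by simp
        finally show ?thesis by (rule inj_onD[OF aug(2)]) (use c xc in simp_all)
      qed
      moreover have "\<psi> \<in> ?H" using mod_hom_comp[OF S.ex(1) \<psi>(1)] by simp
      then have "\<psi> \<in> ?U" using \<psi>(1) by blast
      ultimately show "\<exists>\<phi>'\<in>?H. \<exists>\<psi>\<in>?U. \<forall>z\<in>carrier K. \<phi> z = x \<otimes> \<phi>' z \<oplus> \<psi> z"
        by (intro rev_bexI[OF \<phi>'(1)] bexI[of _ \<psi>] ballI)
    qed blast
    then obtain e where e: "e \<in> mod_hom R ?G (regular_module R)" "\<forall>z\<in>carrier K. \<phi> z = e z" by auto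
    have "g z \<ominus>\<^bsub>I 0\<^esub> (\<epsilon> \<circ> e) z = \<zero>\<^bsub>I 0\<^esub>" if "z \<in> carrier K" for z
      using \<phi>(2)[OF that] e(2) that mod_hom_closed[OF coc_hom[OF g0] that] by (simp add: Im.minus_self)
    then show ?thesis using form_coc_0[OF e(1)] 0 by (intro exI[of _ "\<epsilon> \<circ> e"]) (simp add: cob_def)
  next
    case (Suc i)
    have "Van j K"
    proof (rule Suc.IH[OF K(1,2)])
      fix g assume g: "coc j K g"
      obtain g' e where ge: "coc j K g'" "coc j ?G e" "\<forall>z\<in>carrier K. g z = x \<odot>\<^bsub>I j\<^esub> g' z \<oplus>\<^bsub>I j\<^esub> e z"
        using transfer[OF g] by blast
      have "cob j ?G e" using Van_free_mod ge(2) Suc by (simp add: Van_def)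
      then have "cob j K (e \<circ> id)" by (rule cob_comp[OF _ S.ex(1)])
      then have "cob j K (\<lambda>z. g z \<ominus>\<^bsub>I j\<^esub> x \<odot>\<^bsub>I j\<^esub> g' z)"
      proof (rule cob_cong)
        fix z assume z: "z \<in> carrier K"
        have "x \<odot>\<^bsub>I j\<^esub> g' z \<in> carrier (I j)" "e z \<in> carrier (I j)"
          using mod_hom_closed[OF coc_hom[OF ge(1)] z] mod_hom_closed[OF coc_hom[OF ge(2)] KG(1)[OF z]] xc by auto
        then show "g z \<ominus>\<^bsub>I j\<^esub> x \<odot>\<^bsub>I j\<^esub> g' z = (e \<circ> id) z"
          using ge(3) z by (simp add: Im.minus_eq_iff Im.M.a_comm)
      qed
      then show "\<exists>g'. coc j K g' \<and> cob j K (\<lambda>z. g z \<ominus>\<^bsub>I j\<^esub> x \<odot>\<^bsub>I j\<^esub> g' z)" using ge(1) by blast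
    qed
    then have "cob j K g" using g by (simp add: Van_def)
    then have "cob j K (\<lambda>z. g z \<ominus>\<^bsub>I j\<^esub> (\<lambda>_. \<zero>\<^bsub>I j\<^esub>) z)"
      by (rule cob_cong) (use mod_hom_closed[OF coc_hom[OF g]] in \<open>simp add: Im.minus_eq_iff\<close>)
    moreover have "coc j ?G (\<lambda>_. \<zero>\<^bsub>I j\<^esub>)"
      using Im.mod_hom_null mod_hom_zero[OF rI rI diff] by (simp add: coc_def)
    ultimately show ?thesis by blast
  qed
  show ?case
    unfolding Van_def
  proof (intro allI impI)
    fix c assume c: "coc (Suc j) N c"
    obtain g where g: "g \<in> mod_hom R ?G (I j)" "\<forall>z\<in>carrier ?G. c (q z) = d j (g z)"
      using lift[OF c] by blast
    have "coc j K g" by (rule res[OF g(1) _ coc_hom[OF c]]) (use g(2) in simp)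
    then obtain e where e: "coc j ?G e" "cob j K (\<lambda>z. g z \<ominus>\<^bsub>I j\<^esub> e z)" using approx by blast
    let ?h = "\<lambda>z. g z \<ominus>\<^bsub>I j\<^esub> e z"
    have h: "?h \<in> mod_hom R ?G (I j)" by (rule Im.mod_hom_diff[OF rG g(1) coc_hom[OF e(1)]])
    have hid: "cob j K (?h \<circ> id)" using e(2) by (simp add: o_def)
    show "cob (Suc j) N c"
    proof (rule S.cob_connecting[OF h hid])
      fix z assume z: "z \<in> carrier ?G"
      have "d j (?h z) = d j (g z)"
        using mod_hom_minus[OF rI rI diff mod_hom_closed[OF g(1) z] mod_hom_closed[OF coc_hom[OF e(1)] z]]
          coc_d[OF e(1) z] dc[OF mod_hom_closed[OF g(1) z]] by (simp add: Im.minus_eq_iff)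
      then show "c (q z) = d j (?h z)" using g(2) z by simp
    qed
  qed
qed

text \<open>In the long exact sequence, multiplication by x on Ext^s(N) is onto because Ext^(s+1)(Q)
  = 0. Concretely g extends along x to a cocycle h, which means g = x h, and Nakayama's lemma
  finishes.\<close>

lemma Van_of_regular:
  assumes "rmodule R N" "fin_gen R N" "rmodule R Q" "x \<in> \<mm>"
    "short_exact R N N Q (\<lambda>z. x \<odot>\<^bsub>N\<^esub> z) \<pi>" "Van (Suc s) Q"
  shows "Van s N"
proof (rule Van_nakayama[OF assms(1,2,4)])
  fix g assume g: "coc s N g"
  interpret S: res_sequence R n I \<epsilon> d N N Q "\<lambda>z. x \<odot>\<^bsub>N\<^esub> z" \<pi>
    by (rule res_sequenceI[OF assms(1,1,3,5)])
  have xc: "x \<in> carrier R" using ideal.Icarr[OF max_ideal_ideal assms(4)] .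
  obtain h where h: "coc s N h" "\<And>z. z \<in> carrier N \<Longrightarrow> h (x \<odot>\<^bsub>N\<^esub> z) = g z"
    by (rule S.coc_extends[OF assms(6) g]) blast
  have "g z \<ominus>\<^bsub>I s\<^esub> x \<odot>\<^bsub>I s\<^esub> h z = \<zero>\<^bsub>I s\<^esub>" if z: "z \<in> carrier N" for z
    using h(2)[OF z] mod_hom_smult[OF coc_hom[OF h(1)] xc z] mod_hom_closed[OF coc_hom[OF g] z]
    by (simp add: Im.minus_self)
  moreover have "cob s N (\<lambda>_. \<zero>\<^bsub>I s\<^esub>)"
  proof (cases s)
    case (Suc j)
    then show ?thesis
      using Im.mod_hom_null[where L = N] mod_hom_zero[OF rI rI diff[of j]]
      by (auto simp: cob_def intro!: bexI[of _ "\<lambda>_. \<zero>\<^bsub>I j\<^esub>"])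
  qed (simp add: cob_def)
  ultimately have "cob s N (\<lambda>z. g z \<ominus>\<^bsub>I s\<^esub> x \<odot>\<^bsub>I s\<^esub> h z)" by (rule cob_cong[rotated])
  then show "\<exists>g'. coc s N g' \<and> cob s N (\<lambda>z. g z \<ominus>\<^bsub>I s\<^esub> x \<odot>\<^bsub>I s\<^esub> g' z)" using h(1) by blast
qed

end

section \<open>Depth and the vanishing of cohomology\<close>

lemma (in rmodule) ideal_smult_insert:
  assumes "x \<in> ideal_smult R M (insert a A)" "a \<in> carrier R" "A \<subseteq> carrier R"
  obtains y z where "y \<in> ideal_smult R M A" "z \<in> carrier M" "x = y \<oplus>\<^bsub>M\<^esub> a \<odot>\<^bsub>M\<^esub> z"
proof -
  let ?s = "\<lambda>z. a \<odot>\<^bsub>M\<^esub> id z"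
  have M: "rmodule R M" by (rule rmodule_axioms)
  have "?s \<in> mod_hom R M M" by (intro mod_hom_scale M mod_hom_id assms)
  then have s: "submodule (?s ` carrier M) R M" by (rule mod_hom_image_submodule[OF M M])
  have "{b \<odot>\<^bsub>M\<^esub> x |b x. b \<in> insert a A \<and> x \<in> carrier M}
      = {b \<odot>\<^bsub>M\<^esub> x |b x. b \<in> A \<and> x \<in> carrier M} \<union> ?s ` carrier M" by auto
  with assms(1) have "x \<in> mod_span R M ({b \<odot>\<^bsub>M\<^esub> x |b x. b \<in> A \<and> x \<in> carrier M} \<union> ?s ` carrier M)"
    by (simp add: ideal_smult_def)
  then obtain y w where "y \<in> ideal_smult R M A" "w \<in> mod_span R M (?s ` carrier M)" "x = y \<oplus>\<^bsub>M\<^esub> w"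
    unfolding ideal_smult_def
    by (rule mod_span_Un[OF _ ideal_smult_gens[OF assms(3)] submoduleE(1)[OF s]])
  then show ?thesis using that unfolding mod_span_eq[OF s] by auto
qed

lemma surj_ideal_smult:
  assumes "rmodule R M" "rmodule R N" "p \<in> mod_hom R M N" "p ` carrier M = carrier N" "A \<subseteq> carrier R"
    "t \<in> ideal_smult R N A"
  shows "\<exists>y\<in>ideal_smult R M A. p y = t"
proof -
  interpret M: rmodule R M by fact
  interpret N: rmodule R N by fact
  note s = M.ideal_smult_submodule[OF assms(5)]
  note cl = M.ideal_smult_closed[OF assms(5)]
  show ?thesis
    using assms(6,5)
  proof (induction rule: N.ideal_smult_induct)
    case (base a x)
    then have "x \<in> p ` carrier M" using assms(4) by simp
    then obtain y where "y \<in> carrier M" "p y = x" by auto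
    then show ?case
      using base assms(5) by (intro bexI[of _ "a \<odot>\<^bsub>M\<^esub> y"]) (auto simp: mod_hom_smult[OF assms(3)] M.ideal_smultI)
  next
    case zero
    then show ?case using mod_hom_zero[OF assms(1-3)] M.submodule_zero[OF s] by blast
  next
    case (add x y)
    then obtain u v where "u \<in> ideal_smult R M A" "p u = x" "v \<in> ideal_smult R M A" "p v = y" by auto
    then show ?case
      using cl M.submoduleE(5)[OF s] by (intro bexI[of _ "u \<oplus>\<^bsub>M\<^esub> v"]) (auto simp: mod_hom_add[OF assms(3)])
  next
    case (smult a x)
    then obtain u where "u \<in> ideal_smult R M A" "p u = x" by auto
    then show ?case
      using smult cl M.submoduleE(4)[OF s] by (intro bexI[of _ "a \<odot>\<^bsub>M\<^esub> u"]) (auto simp: mod_hom_smult[OF assms(3)])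
  qed
qed

text \<open>An element of N lies in (x, A) N exactly if its image lies in A Q, so all later
  conditions on the two sequences correspond; the condition on x itself is the injectivity in the
  short exact sequence.\<close>

lemma (in cring) regular_seq_Cons:
  assumes "rmodule R N" "rmodule R Q" "x \<in> carrier R" "short_exact R N N Q (\<lambda>z. x \<odot>\<^bsub>N\<^esub> z) \<pi>"
  shows "regular_seq R N (x # xs) \<longleftrightarrow> regular_seq R Q xs"
proof -
  interpret N: rmodule R N by fact
  interpret Q: rmodule R Q by fact
  have p: "\<pi> \<in> mod_hom R N Q" "\<pi> ` carrier N = carrier Q" "inj_on (\<lambda>z. x \<odot>\<^bsub>N\<^esub> z) (carrier N)"
    and ker: "(\<lambda>z. x \<odot>\<^bsub>N\<^esub> z) ` carrier N = {z \<in> carrier N. \<pi> z = \<zero>\<^bsub>Q\<^esub>}"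
    using assms(4) by (auto simp: short_exact_def)
  note pc = mod_hom_closed[OF p(1)]
  have px: "\<pi> (x \<odot>\<^bsub>N\<^esub> z) = \<zero>\<^bsub>Q\<^esub>" if "z \<in> carrier N" for z
    using ker that by blast
  have key: "z \<in> ideal_smult R N (insert x A) \<longleftrightarrow> \<pi> z \<in> ideal_smult R Q A"
    if z: "z \<in> carrier N" and A: "A \<subseteq> carrier R" for z A
  proof
    assume "z \<in> ideal_smult R N (insert x A)"
    then obtain y v where *: "y \<in> ideal_smult R N A" "v \<in> carrier N" "z = y \<oplus>\<^bsub>N\<^esub> x \<odot>\<^bsub>N\<^esub> v"
      by (rule N.ideal_smult_insert[OF _ assms(3) A])
    have y: "y \<in> carrier N" by (rule N.ideal_smult_closed[OF A *(1)])
    have "\<pi> z = \<pi> y" using *(3) y *(2) pc[OF y] assms(3) by (simp add: mod_hom_add[OF p(1)] px)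
    then show "\<pi> z \<in> ideal_smult R Q A"
      using mod_hom_ideal_smult[OF assms(1,2) p(1) A *(1)] by simp
  next
    assume "\<pi> z \<in> ideal_smult R Q A"
    then obtain y where y: "y \<in> ideal_smult R N A" "\<pi> y = \<pi> z"
      using surj_ideal_smult[OF assms(1,2) p(1,2) A] by blast
    have yc: "y \<in> carrier N" by (rule N.ideal_smult_closed[OF A y(1)])
    have "\<pi> (z \<ominus>\<^bsub>N\<^esub> y) = \<zero>\<^bsub>Q\<^esub>"
      using mod_hom_minus[OF assms(1,2) p(1) z yc] y(2) pc[OF z] by (simp add: Q.minus_self)
    then have "z \<ominus>\<^bsub>N\<^esub> y \<in> (\<lambda>z. x \<odot>\<^bsub>N\<^esub> z) ` carrier N" unfolding ker using z yc by simp
    then obtain v where v: "v \<in> carrier N" "z \<ominus>\<^bsub>N\<^esub> y = x \<odot>\<^bsub>N\<^esub> v" by auto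
    have sub: "submodule (ideal_smult R N (insert x A)) R N"
      using A assms(3) by (intro N.ideal_smult_submodule) simp
    have 1: "z \<ominus>\<^bsub>N\<^esub> y \<in> ideal_smult R N (insert x A)"
      unfolding v(2) by (rule N.ideal_smultI[OF insertI1 v(1)])
    have "ideal_smult R N A \<subseteq> ideal_smult R N (insert x A)" by (rule N.ideal_smult_mono) auto
    then have "y \<in> ideal_smult R N (insert x A)" using y(1) by blast
    from N.submoduleE(5)[OF sub 1 this] show "z \<in> ideal_smult R N (insert x A)"
      by (simp only: N.minus_add_cancel[OF z yc])
  qed
  have all: "(\<forall>z\<in>carrier N. P (\<pi> z)) \<longleftrightarrow> (\<forall>q\<in>carrier Q. P q)" for P
    unfolding p(2)[symmetric] by simp
  show ?thesis
  proof (cases "set xs \<subseteq> carrier R")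
    case True
    have proper: "ideal_smult R N (insert x (set xs)) \<noteq> carrier N \<longleftrightarrow> ideal_smult R Q (set xs) \<noteq> carrier Q"
    proof -
      have "insert x (set xs) \<subseteq> carrier R" using True assms(3) by simp
      then have "ideal_smult R N (insert x (set xs)) = carrier N
        \<longleftrightarrow> (\<forall>z\<in>carrier N. z \<in> ideal_smult R N (insert x (set xs)))"
        using N.ideal_smult_closed by blast
      also have "\<dots> \<longleftrightarrow> (\<forall>z\<in>carrier N. \<pi> z \<in> ideal_smult R Q (set xs))"
        using key True by simp
      also have "\<dots> \<longleftrightarrow> (\<forall>q\<in>carrier Q. q \<in> ideal_smult R Q (set xs))" by (rule all)
      also have "\<dots> \<longleftrightarrow> ideal_smult R Q (set xs) = carrier Q"
        using Q.ideal_smult_closed[OF True] by blast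
      finally show ?thesis by simp
    qed
    have first: "\<forall>z\<in>carrier N. x \<odot>\<^bsub>N\<^esub> z \<in> ideal_smult R N {} \<longrightarrow> z \<in> ideal_smult R N {}"
    proof (intro ballI impI)
      fix z assume z: "z \<in> carrier N" "x \<odot>\<^bsub>N\<^esub> z \<in> ideal_smult R N {}"
      have e: "ideal_smult R N {} = {\<zero>\<^bsub>N\<^esub>}" by (simp add: ideal_smult_def N.mod_span_empty)
      have "x \<odot>\<^bsub>N\<^esub> z = x \<odot>\<^bsub>N\<^esub> \<zero>\<^bsub>N\<^esub>" using z(2) e assms(3) by simp
      then have "z = \<zero>\<^bsub>N\<^esub>" using inj_onD[OF p(3)] z(1) by blast
      then show "z \<in> ideal_smult R N {}" using e by simp
    qed
    have rest: "(\<forall>z\<in>carrier N. xs ! j \<odot>\<^bsub>N\<^esub> z \<in> ideal_smult R N (insert x (set (take j xs)))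
          \<longrightarrow> z \<in> ideal_smult R N (insert x (set (take j xs))))
      \<longleftrightarrow> (\<forall>q\<in>carrier Q. xs ! j \<odot>\<^bsub>Q\<^esub> q \<in> ideal_smult R Q (set (take j xs))
          \<longrightarrow> q \<in> ideal_smult R Q (set (take j xs)))" if j: "j < length xs" for j
    proof -
      have r: "xs ! j \<in> carrier R" using True j by (auto simp: subset_iff)
      have A: "set (take j xs) \<subseteq> carrier R" using True by (auto dest: in_set_takeD)
      have *: "xs ! j \<odot>\<^bsub>N\<^esub> z \<in> ideal_smult R N (insert x (set (take j xs)))
        \<longleftrightarrow> xs ! j \<odot>\<^bsub>Q\<^esub> \<pi> z \<in> ideal_smult R Q (set (take j xs))" if "z \<in> carrier N" for z
        using key[OF N.smult_closed[OF r that] A] mod_hom_smult[OF p(1) r that] by simp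
      show ?thesis
        unfolding all[of "\<lambda>q. xs ! j \<odot>\<^bsub>Q\<^esub> q \<in> ideal_smult R Q (set (take j xs))
          \<longrightarrow> q \<in> ideal_smult R Q (set (take j xs))", symmetric]
        by (intro ball_cong refl) (simp only: * key[OF _ A])
    qed
    show ?thesis
      unfolding regular_seq_def seq_mult_ideal_smult
      using proper first rest True assms(3) by (simp add: All_less_Suc2)
  qed (simp add: regular_seq_def)
qed

context noetherian_local
begin

text \<open>The quotient is N/xN. It is nonzero by Nakayama's lemma because x lies in the maximal
  ideal.\<close>

lemma regular_quotient:
  fixes N :: "'a umod"
  assumes "rmodule R N" "fin_gen R N" "carrier N \<noteq> {\<zero>\<^bsub>N\<^esub>}" and x: "x \<in> \<mm>"
    and reg: "\<And>z. z \<in> carrier N \<Longrightarrow> x \<odot>\<^bsub>N\<^esub> z = \<zero>\<^bsub>N\<^esub> \<Longrightarrow> z = \<zero>\<^bsub>N\<^esub>"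
  obtains Q :: "'a umod" and \<pi> where "rmodule R Q" "fin_gen R Q" "carrier Q \<noteq> {\<zero>\<^bsub>Q\<^esub>}"
    "short_exact R N N Q (\<lambda>z. x \<odot>\<^bsub>N\<^esub> z) \<pi>"
proof -
  interpret N: local_module R N by (intro local_module.intro noetherian_local_axioms assms)
  have xc: "x \<in> carrier R" using ideal.Icarr[OF max_ideal_ideal x] .
  let ?s = "\<lambda>z. x \<odot>\<^bsub>N\<^esub> id z"
  have s: "?s \<in> mod_hom R N N" by (rule N.mod_hom_scale[OF assms(1) mod_hom_id xc])
  have sub: "submodule (?s ` carrier N) R N" by (rule mod_hom_image_submodule[OF assms(1,1) s])
  obtain Q :: "'a umod" and \<pi> where Q: "rmodule R Q" "\<pi> \<in> mod_hom R N Q" "\<pi> ` carrier N = carrier Q"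
    "\<forall>z\<in>carrier N. \<pi> z = \<zero>\<^bsub>Q\<^esub> \<longleftrightarrow> z \<in> ?s ` carrier N"
    using N.quotient_exists[OF assms(2) sub] by (elim exE conjE) (rule that; assumption)
  have inj: "inj_on ?s (carrier N)"
  proof (rule inj_onI)
    fix a b assume ab: "a \<in> carrier N" "b \<in> carrier N" "?s a = ?s b"
    then have "?s (a \<ominus>\<^bsub>N\<^esub> b) = \<zero>\<^bsub>N\<^esub>"
      using mod_hom_minus[OF assms(1,1) s ab(1,2)] mod_hom_closed[OF s ab(2)] by (simp add: N.minus_self)
    then have "a \<ominus>\<^bsub>N\<^esub> b = \<zero>\<^bsub>N\<^esub>" using reg ab by simp
    then show "a = b" using ab N.minus_eq_zero_iff by simp
  qed
  have kereq: "?s ` carrier N = {z \<in> carrier N. \<pi> z = \<zero>\<^bsub>Q\<^esub>}"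
  proof
    show "?s ` carrier N \<subseteq> {z \<in> carrier N. \<pi> z = \<zero>\<^bsub>Q\<^esub>}"
      using Q(4) N.submoduleE(1)[OF sub] by (intro subsetI CollectI conjI) (auto dest: subsetD)
    show "{z \<in> carrier N. \<pi> z = \<zero>\<^bsub>Q\<^esub>} \<subseteq> ?s ` carrier N"
    proof
      fix z assume "z \<in> {z \<in> carrier N. \<pi> z = \<zero>\<^bsub>Q\<^esub>}"
      then show "z \<in> ?s ` carrier N" using bspec[OF Q(4), of z] by simp
    qed
  qed
  have "short_exact R N N Q ?s \<pi>"
    unfolding short_exact_def by (intro conjI s Q inj kereq)
  moreover have "fin_gen R Q" by (rule fin_gen_image[OF assms(1) Q(1-3) assms(2)])
  moreover have "carrier Q \<noteq> {\<zero>\<^bsub>Q\<^esub>}"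
  proof
    assume z: "carrier Q = {\<zero>\<^bsub>Q\<^esub>}"
    obtain S where S: "finite S" "S \<subseteq> carrier N" "mod_span R N S = carrier N"
      using assms(2) by (auto simp: fin_gen_def)
    have "mod_span R N S \<subseteq> {\<zero>\<^bsub>N\<^esub>}"
    proof (rule N.nakayama_span[OF S(1,2) N.zero_submodule])
      fix w assume "w \<in> S"
      then have w: "w \<in> carrier N" using S(2) by blast
      then have "w \<in> ?s ` carrier N" using Q(4) mod_hom_closed[OF Q(2) w] z by simp
      then obtain v where "v \<in> carrier N" "w = x \<odot>\<^bsub>N\<^esub> v" by auto
      then have "w \<in> {a \<odot>\<^bsub>N\<^esub> y |a y. a \<in> \<mm> \<and> y \<in> mod_span R N S}" using x S(3) by blast
      then show "w \<in> mod_span R N ({\<zero>\<^bsub>N\<^esub>} \<union> {a \<odot>\<^bsub>N\<^esub> y |a y. a \<in> \<mm> \<and> y \<in> mod_span R N S})"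
        by (intro N.mod_span_base) simp
    qed
    then show False using S(3) assms(3) N.M.zero_closed by (metis empty_iff subset_singletonD)
  qed
  ultimately show ?thesis using that Q(1) by simp
qed

text \<open>Any copy of the residue field. A predicate is convenient because such copies arise as
  submodules generated by elements with maximal annihilator.\<close>

definition residue_module :: "'a umod \<Rightarrow> bool" where
  "residue_module N \<longleftrightarrow> rmodule R N \<and> (\<exists>w\<in>carrier N. carrier N = {r \<odot>\<^bsub>N\<^esub> w |r. r \<in> carrier R} \<and>
     {r \<in> carrier R. r \<odot>\<^bsub>N\<^esub> w = \<zero>\<^bsub>N\<^esub>} = \<mm>)"

text \<open>Both modules are images of R under multiplication of a generator, and the assumption on
  annihilators lets the second map factor through the first.\<close>

lemma cyclic_hom:
  fixes N N' :: "'a umod"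
  assumes "rmodule R N" "rmodule R N'" "w \<in> carrier N" "w' \<in> carrier N'"
    "carrier N = {r \<odot>\<^bsub>N\<^esub> w |r. r \<in> carrier R}"
    "\<And>r. r \<in> carrier R \<Longrightarrow> r \<odot>\<^bsub>N\<^esub> w = \<zero>\<^bsub>N\<^esub> \<Longrightarrow> r \<odot>\<^bsub>N'\<^esub> w' = \<zero>\<^bsub>N'\<^esub>"
  shows "\<exists>f\<in>mod_hom R N N'. \<forall>r\<in>carrier R. f (r \<odot>\<^bsub>N\<^esub> w) = r \<odot>\<^bsub>N'\<^esub> w'"
proof -
  have r: "rmodule R (regular_module R)" by (rule rmodule_regular_module[OF is_cring])
  interpret N: rmodule R N by fact
  interpret N': rmodule R N' by fact
  interpret rN: rmodule2 R "regular_module R" N using r assms(1) by (simp add: rmodule2_def)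
  interpret rN': rmodule2 R "regular_module R" N' using r assms(2) by (simp add: rmodule2_def)
  have p: "(\<lambda>a. id a \<odot>\<^bsub>N\<^esub> w) \<in> mod_hom R (regular_module R) N"
    by (rule rN.smult_vector_hom[OF mod_hom_id assms(3)])
  have p': "(\<lambda>a. id a \<odot>\<^bsub>N'\<^esub> w') \<in> mod_hom R (regular_module R) N'"
    by (rule rN'.smult_vector_hom[OF mod_hom_id assms(4)])
  have "(\<lambda>a. id a \<odot>\<^bsub>N\<^esub> w) ` carrier (regular_module R) = carrier N"
    unfolding assms(5) by (auto simp: image_def)
  from factor_through_surjection[OF r assms(1,2) p this p'] assms(6) show ?thesis by simp
qed

lemma cyclic_submodule:
  assumes "rmodule R N" "w \<in> carrier N"
  shows "submodule {r \<odot>\<^bsub>N\<^esub> w |r. r \<in> carrier R} R N"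
proof -
  have r: "rmodule R (regular_module R)" by (rule rmodule_regular_module[OF is_cring])
  interpret rN: rmodule2 R "regular_module R" N using r assms(1) by (simp add: rmodule2_def)
  have "(\<lambda>a. id a \<odot>\<^bsub>N\<^esub> w) \<in> mod_hom R (regular_module R) N"
    by (rule rN.smult_vector_hom[OF mod_hom_id assms(2)])
  from mod_hom_image_submodule[OF r assms(1) this] show ?thesis by (simp add: image_def Bex_def setcompr_eq_image)
qed

lemma cyclic_fin_gen:
  assumes "rmodule R N" "w \<in> carrier N" "carrier N = {r \<odot>\<^bsub>N\<^esub> w |r. r \<in> carrier R}"
  shows "fin_gen R N"
proof -
  interpret N: rmodule R N by fact
  have w: "{w} \<subseteq> carrier N" using assms(2) by simp
  have *: "r \<odot>\<^bsub>N\<^esub> w \<in> mod_span R N {w}" if "r \<in> carrier R" for r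
    using N.submoduleE(4)[OF N.mod_span_submodule[OF w] that] N.mod_span_base by simp
  have "carrier N \<subseteq> mod_span R N {w}" unfolding assms(3) using * by auto
  then have "mod_span R N {w} = carrier N" by (intro equalityI N.mod_span_closed[OF w])
  then show ?thesis using w unfolding fin_gen_def by (intro exI[of _ "{w}"]) simp
qed

end

section \<open>Reduction of the vanishing of Ext to the residue field, and the top degree\<close>

context injective_resolution
begin

lemma cob_null: "cob s N (\<lambda>_. \<zero>\<^bsub>I s\<^esub>)"
proof (cases s)
  case (Suc j)
  then show ?thesis
    using Im.mod_hom_null[where L = N] mod_hom_zero[OF rI rI diff[of j]]
    by (auto simp: cob_def intro!: bexI[of _ "\<lambda>_. \<zero>\<^bsub>I j\<^esub>"])
qed (simp add: cob_def)

lemma Van_zero_module: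
  assumes "rmodule R N" "carrier N = {\<zero>\<^bsub>N\<^esub>}"
  shows "Van s N"
  unfolding Van_def
proof (intro allI impI)
  fix g assume "coc s N g"
  then have "g \<zero>\<^bsub>N\<^esub> = \<zero>\<^bsub>I s\<^esub>" by (intro mod_hom_zero[OF assms(1) rI] coc_hom)
  then show "cob s N g" using assms(2) by (intro cob_cong[OF cob_null]) simp
qed

lemma Van_retract:
  assumes "f \<in> mod_hom R N N'" "p \<in> mod_hom R N' N" "\<And>z. z \<in> carrier N' \<Longrightarrow> f (p z) = z" "Van s N"
  shows "Van s N'"
  unfolding Van_def
proof (intro allI impI)
  fix g assume "coc s N' g"
  then have "cob s N (g \<circ> f)" using assms(4) coc_comp[OF _ assms(1)] by (simp add: Van_def)
  then have "cob s N' (g \<circ> f \<circ> p)" by (rule cob_comp[OF _ assms(2)])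
  then show "cob s N' g" by (rule cob_cong) (simp add: assms(3))
qed

lemma Van_residue_module:
  assumes "residue_module N" "residue_module N'" "Van s N"
  shows "Van s N'"
proof -
  obtain w where N: "rmodule R N" and w: "w \<in> carrier N" "carrier N = {r \<odot>\<^bsub>N\<^esub> w |r. r \<in> carrier R}"
    "{r \<in> carrier R. r \<odot>\<^bsub>N\<^esub> w = \<zero>\<^bsub>N\<^esub>} = \<mm>"
    using assms(1) unfolding residue_module_def by (elim conjE bexE) (rule that)
  obtain w' where N': "rmodule R N'" and w': "w' \<in> carrier N'" "carrier N' = {r \<odot>\<^bsub>N'\<^esub> w' |r. r \<in> carrier R}"
    "{r \<in> carrier R. r \<odot>\<^bsub>N'\<^esub> w' = \<zero>\<^bsub>N'\<^esub>} = \<mm>"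
    using assms(2) unfolding residue_module_def by (elim conjE bexE) (rule that)
  have *: "r \<odot>\<^bsub>N\<^esub> w = \<zero>\<^bsub>N\<^esub> \<longleftrightarrow> r \<odot>\<^bsub>N'\<^esub> w' = \<zero>\<^bsub>N'\<^esub>" if "r \<in> carrier R" for r
  proof -
    have "r \<in> {r \<in> carrier R. r \<odot>\<^bsub>N\<^esub> w = \<zero>\<^bsub>N\<^esub>} \<longleftrightarrow>
      r \<in> {r \<in> carrier R. r \<odot>\<^bsub>N'\<^esub> w' = \<zero>\<^bsub>N'\<^esub>}" unfolding w(3) w'(3) by (rule refl)
    then show ?thesis using that by simp
  qed
  have "\<exists>f\<in>mod_hom R N N'. \<forall>r\<in>carrier R. f (r \<odot>\<^bsub>N\<^esub> w) = r \<odot>\<^bsub>N'\<^esub> w'"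
    by (rule cyclic_hom[OF N N' w(1) w'(1) w(2)]) (simp add: *)
  then obtain f where f: "f \<in> mod_hom R N N'" "\<forall>r\<in>carrier R. f (r \<odot>\<^bsub>N\<^esub> w) = r \<odot>\<^bsub>N'\<^esub> w'"
    by (elim bexE) (rule that)
  have "\<exists>f\<in>mod_hom R N' N. \<forall>r\<in>carrier R. f (r \<odot>\<^bsub>N'\<^esub> w') = r \<odot>\<^bsub>N\<^esub> w"
    by (rule cyclic_hom[OF N' N w'(1) w(1) w'(2)]) (simp add: *)
  then obtain p where p: "p \<in> mod_hom R N' N" "\<forall>r\<in>carrier R. p (r \<odot>\<^bsub>N'\<^esub> w') = r \<odot>\<^bsub>N\<^esub> w"
    by (elim bexE) (rule that)
  show ?thesis
  proof (rule Van_retract[OF f(1) p(1) _ assms(3)])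
    fix z assume "z \<in> carrier N'"
    then obtain r where "r \<in> carrier R" "z = r \<odot>\<^bsub>N'\<^esub> w'" unfolding w'(2) by auto
    then show "f (p z) = z" using f(2) p(2) by simp
  qed
qed

text \<open>A counterexample with maximal annihilator a is studied. Maximality makes a prime; it is
  neither R nor the maximal ideal, so some x in the maximal ideal lies outside a and is regular on
  N. As Ext^(s+1)(N/xN) = 0 by assumption, \<open>Van_of_regular\<close> gives a
  contradiction.\<close>

lemma Van_of_residue_cyclic:
  assumes top: "\<And>N. rmodule R N \<Longrightarrow> fin_gen R N \<Longrightarrow> Van (Suc s) N"
    and residue: "\<And>N. residue_module N \<Longrightarrow> Van s N"
    and "rmodule R N" "w \<in> carrier N" "carrier N = {r \<odot>\<^bsub>N\<^esub> w |r. r \<in> carrier R}"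
  shows "Van s N"
proof (rule ccontr)
  define bad where "bad a N w \<longleftrightarrow> rmodule R N \<and> w \<in> carrier N \<and> carrier N = {r \<odot>\<^bsub>N\<^esub> w |r. r \<in> carrier R} \<and>
    a = {r \<in> carrier R. r \<odot>\<^bsub>N\<^esub> w = \<zero>\<^bsub>N\<^esub>} \<and> \<not> Van s N" for a w and N :: "'a umod"
  let ?C = "{a. \<exists>N w. bad a N w}"
  assume "\<not> Van s N"
  then have "bad {r \<in> carrier R. r \<odot>\<^bsub>N\<^esub> w = \<zero>\<^bsub>N\<^esub>} N w" unfolding bad_def by (intro conjI assms refl)
  then have "?C \<noteq> {}" by blast
  moreover have "ideal a R" if "bad a N w" for a N w
  proof -
    interpret N: local_module R N
      using that unfolding bad_def by (intro local_module.intro noetherian_local_axioms) simp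
    have "w \<in> carrier N" "a = N.ann w" using that unfolding bad_def N.ann_def by blast+
    then show ?thesis using N.ann_ideal by simp
  qed
  then have "ideal a R" if "a \<in> ?C" for a using that by blast
  ultimately obtain a where a: "a \<in> ?C" "\<forall>J\<in>?C. a \<subseteq> J \<longrightarrow> J = a" and ai: "ideal a R"
    using noetherian_maximal[of ?C] by blast
  obtain N w where b: "bad a N w" using a(1) by blast
  note b' = b[unfolded bad_def]
  note N = conjunct1[OF b'] and w = conjunct1[OF conjunct2[OF b']]
    and cyc = conjunct1[OF conjunct2[OF conjunct2[OF b']]]
    and ann = conjunct1[OF conjunct2[OF conjunct2[OF conjunct2[OF b']]]]
    and nV = conjunct2[OF conjunct2[OF conjunct2[OF conjunct2[OF b']]]]
  have max: "J = a" if "bad J N' w'" "a \<subseteq> J" for J N' w' using a(2) that by blast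
  interpret N: local_module R N by (intro local_module.intro noetherian_local_axioms N)
  note fgN = cyclic_fin_gen[OF N w cyc]
  \<comment> \<open>For x outside a, the quotient of N by R x w has an annihilator strictly larger
    than a, so its Ext^s vanishes. The submodule R x w is then a counterexample as well, and its
    annihilator contains a; so it equals a.\<close>
  have prime: "r \<in> a" if x: "x \<in> carrier R" "x \<notin> a" and r: "r \<in> carrier R" "r \<odot>\<^bsub>N\<^esub> (x \<odot>\<^bsub>N\<^esub> w) = \<zero>\<^bsub>N\<^esub>" for x r
  proof -
    define v where "v = x \<odot>\<^bsub>N\<^esub> w"
    have v: "v \<in> carrier N" using x w by (simp add: v_def)
    let ?L = "{r \<odot>\<^bsub>N\<^esub> v |r. r \<in> carrier R}"
    note sub = cyclic_submodule[OF N v]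
    let ?N1 = "N\<lparr>carrier := ?L\<rparr>"
    note N1 = N.restrict_rmodule[OF sub]
    have vL: "v \<in> ?L" using N.smult_one[OF v] by (intro CollectI exI[of _ \<one>]) simp
    obtain Q :: "'a umod" and \<pi> where Q: "rmodule R Q" "\<pi> \<in> mod_hom R N Q" "\<pi> ` carrier N = carrier Q"
      "\<forall>z\<in>carrier N. \<pi> z = \<zero>\<^bsub>Q\<^esub> \<longleftrightarrow> z \<in> ?L"
      using N.quotient_exists[OF fgN sub] by (elim exE conjE) (rule that; assumption)
    interpret Q: rmodule R Q by fact
    have \<pi>r: "\<pi> (r \<odot>\<^bsub>N\<^esub> w) = r \<odot>\<^bsub>Q\<^esub> \<pi> w" if "r \<in> carrier R" for r by (rule mod_hom_smult[OF Q(2) that w])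
    have VQ: "Van s Q"
    proof (rule ccontr)
      assume "\<not> Van s Q"
      moreover have "carrier Q = {r \<odot>\<^bsub>Q\<^esub> \<pi> w |r. r \<in> carrier R}"
        unfolding Q(3)[symmetric] cyc using \<pi>r by (auto simp: image_def)
      ultimately have "bad {r \<in> carrier R. r \<odot>\<^bsub>Q\<^esub> \<pi> w = \<zero>\<^bsub>Q\<^esub>} Q (\<pi> w)"
        using Q(1) mod_hom_closed[OF Q(2) w] by (simp add: bad_def)
      moreover have "a \<subseteq> {r \<in> carrier R. r \<odot>\<^bsub>Q\<^esub> \<pi> w = \<zero>\<^bsub>Q\<^esub>}"
        unfolding ann using \<pi>r[symmetric] mod_hom_zero[OF N Q(1,2)] by (intro Collect_mono) simp
      ultimately have "{r \<in> carrier R. r \<odot>\<^bsub>Q\<^esub> \<pi> w = \<zero>\<^bsub>Q\<^esub>} = a" by (rule max)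
      moreover have "x \<odot>\<^bsub>Q\<^esub> \<pi> w = \<zero>\<^bsub>Q\<^esub>"
        using bspec[OF Q(4) v] vL \<pi>r[OF x(1)] by (simp add: v_def)
      ultimately show False using x by auto
    qed
    have S: "res_sequence R n I \<epsilon> d ?N1 N Q id \<pi>"
      by (intro res_sequenceI N1 N Q(1) N.restrict_short_exact[OF sub Q(2,3)] bspec[OF Q(4)])
    have "\<not> Van s ?N1"
    proof
      assume "Van s ?N1"
      from res_sequence.Van_middle[OF S this VQ] show False using nV by simp
    qed
    then have "bad {r \<in> carrier R. r \<odot>\<^bsub>N\<^esub> v = \<zero>\<^bsub>N\<^esub>} ?N1 v"
      using N1 vL by (simp add: bad_def)
    moreover have "a \<subseteq> {r \<in> carrier R. r \<odot>\<^bsub>N\<^esub> v = \<zero>\<^bsub>N\<^esub>}"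
    proof
      fix r assume "r \<in> a"
      then have r: "r \<in> carrier R" "r \<odot>\<^bsub>N\<^esub> w = \<zero>\<^bsub>N\<^esub>" unfolding ann by blast+
      then have "r \<odot>\<^bsub>N\<^esub> v = \<zero>\<^bsub>N\<^esub>" unfolding v_def N.smult_left_comm[OF r(1) x(1) w] using x(1) by simp
      then show "r \<in> {r \<in> carrier R. r \<odot>\<^bsub>N\<^esub> v = \<zero>\<^bsub>N\<^esub>}" using r(1) by simp
    qed
    ultimately have "{r \<in> carrier R. r \<odot>\<^bsub>N\<^esub> v = \<zero>\<^bsub>N\<^esub>} = a" by (rule max)
    moreover have "r \<in> {r \<in> carrier R. r \<odot>\<^bsub>N\<^esub> v = \<zero>\<^bsub>N\<^esub>}" using r by (simp add: v_def)
    ultimately show ?thesis by (simp only:)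
  qed
  have "a \<noteq> \<mm>"
  proof
    assume "a = \<mm>"
    then have "residue_module N"
      unfolding residue_module_def by (intro conjI N bexI[OF _ w] cyc) (simp add: ann)
    then show False using residue nV by blast
  qed
  moreover have "a \<noteq> carrier R"
  proof
    assume *: "a = carrier R"
    have "carrier N = {\<zero>\<^bsub>N\<^esub>}"
    proof
      show "carrier N \<subseteq> {\<zero>\<^bsub>N\<^esub>}"
      proof
        fix z assume "z \<in> carrier N"
        then obtain r where "r \<in> carrier R" "z = r \<odot>\<^bsub>N\<^esub> w" unfolding cyc by auto
        then show "z \<in> {\<zero>\<^bsub>N\<^esub>}" using * unfolding ann by auto
      qed
    qed simp
    then show False using Van_zero_module[OF N] nV by blast
  qed
  ultimately obtain x where x: "x \<in> \<mm>" "x \<notin> a" using ideal_subset_max[OF ai] by blast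
  have xc: "x \<in> carrier R" using ideal.Icarr[OF max_ideal_ideal x(1)] .
  have reg: "z = \<zero>\<^bsub>N\<^esub>" if z: "z \<in> carrier N" "x \<odot>\<^bsub>N\<^esub> z = \<zero>\<^bsub>N\<^esub>" for z
  proof -
    obtain r where r: "r \<in> carrier R" "z = r \<odot>\<^bsub>N\<^esub> w" using z(1) unfolding cyc by auto
    then have "r \<odot>\<^bsub>N\<^esub> (x \<odot>\<^bsub>N\<^esub> w) = \<zero>\<^bsub>N\<^esub>" using z(2) N.smult_left_comm[OF r(1) xc w] by simp
    then show ?thesis using prime[OF xc x(2) r(1)] r(2) unfolding ann by simp
  qed
  have "carrier N \<noteq> {\<zero>\<^bsub>N\<^esub>}" using Van_zero_module[OF N] nV by blast
  then obtain Q :: "'a umod" and \<pi> where Q: "rmodule R Q" "fin_gen R Q"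
    "short_exact R N N Q (\<lambda>z. x \<odot>\<^bsub>N\<^esub> z) \<pi>"
    by (rule regular_quotient[OF N fgN _ x(1) reg])
  show False
    using Van_of_regular[OF N fgN Q(1) x(1) Q(3) top[OF Q(1,2)]] nV by blast
qed

text \<open>Take a maximal submodule L of N with Ext^s(L) = 0. Adjoining one more element w gives a
  module whose quotient by L is cyclic, so Ext^s vanishes for it too, and w was already in
  L.\<close>

lemma Van_of_residue:
  fixes N :: "'a umod"
  assumes top: "\<And>N. rmodule R N \<Longrightarrow> fin_gen R N \<Longrightarrow> Van (Suc s) N"
    and residue: "\<And>N. residue_module N \<Longrightarrow> Van s N"
    and "rmodule R N" "fin_gen R N"
  shows "Van s N"
proof -
  interpret N: local_module R N by (intro local_module.intro noetherian_local_axioms assms)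
  let ?C = "{L. submodule L R N \<and> Van s (N\<lparr>carrier := L\<rparr>)}"
  have "{\<zero>\<^bsub>N\<^esub>} \<in> ?C"
    using N.zero_submodule Van_zero_module[OF N.restrict_rmodule[OF N.zero_submodule]] by simp
  then have ne: "?C \<noteq> {}" by blast
  obtain L where L: "submodule L R N" "Van s (N\<lparr>carrier := L\<rparr>)" "\<forall>H\<in>?C. L \<subseteq> H \<longrightarrow> H = L"
    using N.maximal_submodule[OF assms(4) ne] by blast
  have "carrier N \<subseteq> L"
  proof
    fix w assume w: "w \<in> carrier N"
    note Lc = N.submoduleE(1)[OF L(1)]
    define H where "H = mod_span R N (insert w L)"
    have wL: "insert w L \<subseteq> carrier N" using w Lc by simp
    have H: "submodule H R N" unfolding H_def by (rule N.mod_span_submodule[OF wL])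
    have wH: "w \<in> H" and LH: "L \<subseteq> H" unfolding H_def using N.mod_span_base by auto
    let ?M = "N\<lparr>carrier := H\<rparr>"
    note M = N.restrict_rmodule[OF H] and fgM = N.submodule_fin_gen[OF assms(4) H]
    interpret M: local_module R ?M by (intro local_module.intro noetherian_local_axioms M)
    have LM: "submodule L R ?M"
      by (rule M.submoduleI') (use LH N.submodule_zero[OF L(1)] N.submoduleE(4,5)[OF L(1)] in auto)
    obtain Q :: "'a umod" and \<pi> where Q: "rmodule R Q" "\<pi> \<in> mod_hom R ?M Q" "\<pi> ` carrier ?M = carrier Q"
      "\<forall>z\<in>carrier ?M. \<pi> z = \<zero>\<^bsub>Q\<^esub> \<longleftrightarrow> z \<in> L"
      using M.quotient_exists[OF fgM LM] by (elim exE conjE) (rule that; assumption)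
    interpret Q: rmodule R Q by fact
    have wM: "w \<in> carrier ?M" using wH by simp
    have pw: "\<pi> w \<in> carrier Q" by (rule mod_hom_closed[OF Q(2) wM])
    have "carrier Q = {r \<odot>\<^bsub>Q\<^esub> \<pi> w |r. r \<in> carrier R}"
    proof
      show "carrier Q \<subseteq> {r \<odot>\<^bsub>Q\<^esub> \<pi> w |r. r \<in> carrier R}"
      proof
        fix q assume "q \<in> carrier Q"
        then have "q \<in> \<pi> ` H" using Q(3) by simp
        then obtain z where z: "z \<in> H" "q = \<pi> z" by auto
        obtain a y where ay: "a \<in> carrier R" "y \<in> mod_span R N L" "z = a \<odot>\<^bsub>N\<^esub> w \<oplus>\<^bsub>N\<^esub> y"
          using z(1) unfolding H_def by (rule N.mod_span_insert[OF _ w Lc])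
        have yL: "y \<in> L" using ay(2) N.mod_span_eq[OF L(1)] by simp
        then have yH: "y \<in> carrier ?M" using LH by auto
        have "q = \<pi> (a \<odot>\<^bsub>?M\<^esub> w) \<oplus>\<^bsub>Q\<^esub> \<pi> y"
          using mod_hom_add[OF Q(2) M.smult_closed[OF ay(1) wM] yH] ay(3) z(2) by simp
        also have "\<dots> = a \<odot>\<^bsub>Q\<^esub> \<pi> w"
          using bspec[OF Q(4) yH] yL mod_hom_smult[OF Q(2) ay(1) wM] ay(1) pw by simp
        finally show "q \<in> {r \<odot>\<^bsub>Q\<^esub> \<pi> w |r. r \<in> carrier R}" using ay(1) by blast
      qed
      show "{r \<odot>\<^bsub>Q\<^esub> \<pi> w |r. r \<in> carrier R} \<subseteq> carrier Q" using pw by auto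
    qed
    from Van_of_residue_cyclic[OF top residue Q(1) pw this]
    have VQ: "Van s Q" .
    have "short_exact R (?M\<lparr>carrier := L\<rparr>) ?M Q id \<pi>"
      by (intro M.restrict_short_exact[OF LM Q(2,3)] bspec[OF Q(4)])
    then have "res_sequence R n I \<epsilon> d (N\<lparr>carrier := L\<rparr>) ?M Q id \<pi>"
      by (intro res_sequenceI N.restrict_rmodule[OF L(1)] M Q(1)) simp
    from res_sequence.Van_middle[OF this L(2) VQ] have "H \<in> ?C" using H by simp
    then have "H = L" using L(3) LH by blast
    then show "w \<in> L" using wH by simp
  qed
  then have "L = carrier N" using N.submoduleE(1)[OF L(1)] by blast
  then show ?thesis using L(2) by simp
qed

text \<open>The number r is the largest degree in which some finitely generated module has nonzero
  Ext; it is at most the length of the resolution. If Ext^r vanished for one copy of the residue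
  field, it would vanish for all copies and, by \<open>Van_of_residue\<close>, for all finitely
  generated modules.\<close>

lemma top_degree_exists:
  "\<exists>r. (\<forall>s>r. \<forall>N. rmodule R N \<and> fin_gen R N \<longrightarrow> Van s N) \<and> (\<forall>N. residue_module N \<longrightarrow> \<not> Van r N)"
proof -
  define P where "P s \<longleftrightarrow> (\<forall>N. rmodule R N \<and> fin_gen R N \<longrightarrow> Van s N)" for s
  have r: "rmodule R (regular_module R)" by (rule rmodule_regular_module[OF is_cring])
  \<comment> \<open>Hom(R, R) is nonzero, so a degree with nonzero Ext exists. The module R is taken
    as \<open>free_mod R 1\<close> to have the carrier type of \<open>'a umod\<close>; its
    coordinate is the nonzero form.\<close>
  have "\<not> Van 0 (free_mod R 1)"
  proof
    assume V: "Van 0 (free_mod R 1)"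
    have c: "(\<lambda>x. the_elem x 0) \<in> mod_hom R (free_mod R 1) (regular_module R)"
      by (rule mod_homI) (simp_all add: free_mod_coord)
    let ?u = "{\<lambda>i::nat. if i < 1 then \<one> else \<zero>}"
    have u: "?u \<in> carrier (free_mod R 1)" by (simp add: free_mod_carrier)
    have "cob 0 (free_mod R 1) (\<epsilon> \<circ> (\<lambda>x. the_elem x 0))" using V form_coc_0[OF c] by (simp add: Van_def)
    then have "(\<epsilon> \<circ> (\<lambda>x. the_elem x 0)) ?u = \<zero>\<^bsub>I 0\<^esub>" using u unfolding cob_def by (simp only: nat.case)
    then have "\<epsilon> \<one> = \<epsilon> \<zero>" using mod_hom_zero[OF r rI aug(1)] by simp
    then show False using inj_onD[OF aug(2)] one_neq_zero by blast
  qed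
  then have "\<not> P 0"
    unfolding P_def using rmodule_free_mod fg_free_fin_gen[OF fg_free_free_mod[OF one_neq_zero]] by blast
  moreover have le: "s \<le> n" if "\<not> P s" for s
    using that Van_bounded unfolding P_def by (meson not_le)
  ultimately have g: "\<not> P (GREATEST s. \<not> P s)" by (rule GreatestI_nat)
  have "s \<le> (GREATEST s. \<not> P s)" if "\<not> P s" for s using that le by (rule Greatest_le_nat)
  then have top: "P s" if "(GREATEST s. \<not> P s) < s" for s using that leD by blast
  have "\<not> Van (GREATEST s. \<not> P s) N" if N: "residue_module N" for N
  proof
    assume "Van (GREATEST s. \<not> P s) N"
    then have "P (GREATEST s. \<not> P s)"
      unfolding P_def
      using Van_of_residue[of "GREATEST s. \<not> P s"] top[OF lessI] Van_residue_module[OF N]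
      unfolding P_def by blast
    then show False using g by blast
  qed
  then show ?thesis using top unfolding P_def by blast
qed

end

text \<open>The number r is the injective dimension of R. The length n of the given resolution is
  only an upper bound for it.\<close>

locale top_degree = injective_resolution +
  fixes r :: nat
  assumes Van_above: "\<And>s N. rmodule R N \<Longrightarrow> fin_gen R N \<Longrightarrow> r < s \<Longrightarrow> Van s N"
    and residue_not_Van: "\<And>N. residue_module N \<Longrightarrow> \<not> Van r N"
begin

text \<open>An element annihilated exactly by the maximal ideal generates a copy of the residue
  field. Degree r + 1 vanishes for the quotient, so Ext^r(N) maps onto the nonzero Ext^r of that
  copy.\<close>

lemma socle_not_Van:
  assumes N: "rmodule R N" "fin_gen R N" and z: "z \<in> carrier N"
    and ann: "{x \<in> carrier R. x \<odot>\<^bsub>N\<^esub> z = \<zero>\<^bsub>N\<^esub>} = \<mm>"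
  shows "\<not> Van r N"
proof
  assume V: "Van r N"
  interpret N: local_module R N by (intro local_module.intro noetherian_local_axioms N)
  let ?L = "{a \<odot>\<^bsub>N\<^esub> z |a. a \<in> carrier R}"
  note sub = cyclic_submodule[OF N(1) z]
  let ?N1 = "N\<lparr>carrier := ?L\<rparr>"
  have zL: "z \<in> ?L" using N.smult_one[OF z] by (intro CollectI exI[of _ \<one>]) simp
  obtain Q :: "'a umod" and \<pi> where Q: "rmodule R Q" "\<pi> \<in> mod_hom R N Q" "\<pi> ` carrier N = carrier Q"
    "\<forall>z\<in>carrier N. \<pi> z = \<zero>\<^bsub>Q\<^esub> \<longleftrightarrow> z \<in> ?L"
    using N.quotient_exists[OF N(2) sub] by (elim exE conjE) (rule that; assumption)
  have fgQ: "fin_gen R Q" by (rule fin_gen_image[OF N(1) Q(1-3) N(2)])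
  have S: "res_sequence R n I \<epsilon> d ?N1 N Q id \<pi>"
    by (intro res_sequenceI N.restrict_rmodule[OF sub] N Q(1) N.restrict_short_exact[OF sub Q(2,3)] bspec[OF Q(4)])
  have "Van (Suc r) Q" by (rule Van_above[OF Q(1) fgQ lessI])
  from res_sequence.Van_left[OF S V this] have "Van r ?N1" .
  moreover have "residue_module ?N1"
    unfolding residue_module_def using N.restrict_rmodule[OF sub] zL ann by (intro conjI bexI[of _ z]) auto
  ultimately show False using residue_not_Van by blast
qed

lemma Van_regular_element:
  assumes "rmodule R N" "fin_gen R N" "Van r N"
  shows "\<exists>x\<in>\<mm>. \<forall>z\<in>carrier N. x \<odot>\<^bsub>N\<^esub> z = \<zero>\<^bsub>N\<^esub> \<longrightarrow> z = \<zero>\<^bsub>N\<^esub>"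
proof -
  interpret N: local_module R N by (intro local_module.intro noetherian_local_axioms assms)
  show ?thesis
    by (rule N.regular_element_or_socle[OF assms(2)])
      (use socle_not_Van[OF assms(1,2)] assms(3) in \<open>auto simp: N.ann_def\<close>)
qed

lemma Van_quotient:
  assumes "rmodule R N" "rmodule R Q" "short_exact R N N Q i \<pi>" "\<And>s. Van s N"
  shows "Van s Q"
proof (cases s)
  case 0
  have p: "\<pi> \<in> mod_hom R N Q" "\<pi> ` carrier N = carrier Q" using assms(3) by (auto simp: short_exact_def)
  have "g q = \<zero>\<^bsub>I 0\<^esub>" if g: "coc 0 Q g" and q: "q \<in> carrier Q" for g q
  proof -
    have "cob 0 N (g \<circ> \<pi>)" using assms(4) coc_comp[OF g p(1)] by (simp add: Van_def)
    then have *: "\<forall>z\<in>carrier N. (g \<circ> \<pi>) z = \<zero>\<^bsub>I 0\<^esub>" unfolding cob_def by (simp only: nat.case)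
    have "q \<in> \<pi> ` carrier N" using q p(2) by simp
    then show ?thesis using * by auto
  qed
  then show ?thesis unfolding 0 Van_def cob_def by simp
next
  case (Suc j)
  show ?thesis
    unfolding Suc by (rule res_sequence.Van_right[OF res_sequenceI[OF assms(1,1,2,3)] assms(4,4)])
qed

text \<open>If all Ext vanish and N is nonzero, N has a regular element x by
  \<open>Van_regular_element\<close>, and N/xN is nonzero with all Ext zero again. This cannot be
  repeated forever in a Noetherian module.\<close>

lemma Van_all_imp_zero:
  fixes N :: "'a umod"
  assumes "rmodule R N" "fin_gen R N" "\<And>s. Van s N"
  shows "carrier N = {\<zero>\<^bsub>N\<^esub>}"
proof (rule ccontr)
  assume nz: "carrier N \<noteq> {\<zero>\<^bsub>N\<^esub>}"
  interpret N: local_module R N by (intro local_module.intro noetherian_local_axioms assms)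
  \<comment> \<open>The nonzero quotients of N without any Ext, recorded by their kernels L. For a
    maximal kernel, passing to Q/xQ does not enlarge it, so x Q = 0; as x is regular on Q, this
    forces Q = 0.\<close>
  define quot where "quot L Q \<pi> \<longleftrightarrow> rmodule R Q \<and> \<pi> \<in> mod_hom R N Q \<and> \<pi> ` carrier N = carrier Q \<and>
    L = {z \<in> carrier N. \<pi> z = \<zero>\<^bsub>Q\<^esub>} \<and> (\<forall>s. Van s Q) \<and> carrier Q \<noteq> {\<zero>\<^bsub>Q\<^esub>}" for L \<pi> and Q :: "'a umod"
  let ?C = "{L. \<exists>Q \<pi>. quot L Q \<pi>}"
  have "quot {z \<in> carrier N. id z = \<zero>\<^bsub>N\<^esub>} N id"
    unfolding quot_def using assms nz mod_hom_id by simp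
  then have ne: "?C \<noteq> {}" by blast
  have sub: "submodule L R N" if LC: "L \<in> ?C" for L
  proof -
    obtain Q :: "'a umod" and \<pi> where q: "quot L Q \<pi>" using LC by blast
    then have "rmodule R Q" "\<pi> \<in> mod_hom R N Q" "L = {z \<in> carrier N. \<pi> z = \<zero>\<^bsub>Q\<^esub>}"
      unfolding quot_def by simp_all
    then show ?thesis using kernel_submodule[OF assms(1)] by simp
  qed
  obtain L where L: "L \<in> ?C" "\<forall>H\<in>?C. L \<subseteq> H \<longrightarrow> H = L"
    using N.maximal_submodule[OF assms(2) ne sub] by blast
  obtain Q :: "'a umod" and \<pi> where q: "quot L Q \<pi>" using L(1) by blast
  then have Q: "rmodule R Q" "\<pi> \<in> mod_hom R N Q" "\<pi> ` carrier N = carrier Q" and VQ: "\<And>s. Van s Q"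
    and LQ: "L = {z \<in> carrier N. \<pi> z = \<zero>\<^bsub>Q\<^esub>}" and nQ: "carrier Q \<noteq> {\<zero>\<^bsub>Q\<^esub>}"
    unfolding quot_def by simp_all
  have fgQ: "fin_gen R Q" by (rule fin_gen_image[OF assms(1) Q assms(2)])
  obtain x where x: "x \<in> \<mm>" "\<forall>z\<in>carrier Q. x \<odot>\<^bsub>Q\<^esub> z = \<zero>\<^bsub>Q\<^esub> \<longrightarrow> z = \<zero>\<^bsub>Q\<^esub>"
    using Van_regular_element[OF Q(1) fgQ VQ] by blast
  interpret Q: rmodule R Q by fact
  have xc: "x \<in> carrier R" using ideal.Icarr[OF max_ideal_ideal x(1)] .
  obtain T :: "'a umod" and \<rho> where T: "rmodule R T" "fin_gen R T" "carrier T \<noteq> {\<zero>\<^bsub>T\<^esub>}"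
    "short_exact R Q Q T (\<lambda>z. x \<odot>\<^bsub>Q\<^esub> z) \<rho>"
    using regular_quotient[OF Q(1) fgQ nQ x(1)] x(2) by blast
  have \<rho>: "\<rho> \<in> mod_hom R Q T" "\<rho> ` carrier Q = carrier T"
    "(\<lambda>z. x \<odot>\<^bsub>Q\<^esub> z) ` carrier Q = {z \<in> carrier Q. \<rho> z = \<zero>\<^bsub>T\<^esub>}"
    using T(4) by (auto simp: short_exact_def)
  let ?H = "{z \<in> carrier N. (\<rho> \<circ> \<pi>) z = \<zero>\<^bsub>T\<^esub>}"
  have "(\<rho> \<circ> \<pi>) ` carrier N = carrier T" unfolding image_comp[symmetric] Q(3) by (rule \<rho>(2))
  then have "quot ?H T (\<rho> \<circ> \<pi>)"
    unfolding quot_def using T(1,3) mod_hom_comp[OF Q(2) \<rho>(1)] Van_quotient[OF Q(1) T(1,4) VQ] by simp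
  moreover have "L \<subseteq> ?H" unfolding LQ using mod_hom_zero[OF Q(1) T(1) \<rho>(1)] by auto
  ultimately have HL: "?H = L" using L(2) by blast
  have inj: "q = \<zero>\<^bsub>Q\<^esub>" if "q \<in> carrier Q" "\<rho> q = \<zero>\<^bsub>T\<^esub>" for q
  proof -
    have "q \<in> \<pi> ` carrier N" using that(1) Q(3) by simp
    then obtain z where z: "z \<in> carrier N" "q = \<pi> z" by auto
    then have "z \<in> ?H" using that(2) by simp
    then show ?thesis unfolding HL LQ using z(2) by simp
  qed
  have "q = \<zero>\<^bsub>Q\<^esub>" if q: "q \<in> carrier Q" for q
  proof -
    have "x \<odot>\<^bsub>Q\<^esub> q \<in> {z \<in> carrier Q. \<rho> z = \<zero>\<^bsub>T\<^esub>}" unfolding \<rho>(3)[symmetric] using q by (rule imageI)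
    then have "x \<odot>\<^bsub>Q\<^esub> q = \<zero>\<^bsub>Q\<^esub>" using inj by blast
    then show ?thesis using x(2) q by blast
  qed
  then show False using nQ by (auto intro: Q.M.zero_closed)
qed

lemma regular_seq_ne: "rmodule R N \<Longrightarrow> regular_seq R N xs \<Longrightarrow> carrier N \<noteq> {\<zero>\<^bsub>N\<^esub>}"
proof
  assume N: "rmodule R N" and xs: "regular_seq R N xs" and z: "carrier N = {\<zero>\<^bsub>N\<^esub>}"
  interpret N: rmodule R N by fact
  have A: "set xs \<subseteq> carrier R" and ne: "ideal_smult R N (set xs) \<noteq> carrier N"
    using xs by (simp_all add: regular_seq_def seq_mult_ideal_smult)
  note s = N.ideal_smult_submodule[OF A]
  have "ideal_smult R N (set xs) = {\<zero>\<^bsub>N\<^esub>}" using N.submoduleE(1)[OF s] N.submodule_zero[OF s] z by auto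
  then show False using ne z by simp
qed

text \<open>Each element of the sequence lowers the degree from which Ext vanishes by one: induction
  passes to N/xN in degree s + 1 and returns with \<open>Van_of_regular\<close>.\<close>

lemma Van_of_regular_seq:
  fixes N :: "'a umod"
  assumes "rmodule R N" "fin_gen R N" "set xs \<subseteq> \<mm>" "regular_seq R N xs" "r < s + length xs"
  shows "Van s N"
  using assms
proof (induction xs arbitrary: N s)
  case Nil
  then show ?case using Van_above by simp
next
  case (Cons x xs)
  interpret N: rmodule R N by fact
  have x: "x \<in> \<mm>" and xs: "set xs \<subseteq> \<mm>" using Cons.prems(3) by auto
  have first: "\<forall>z\<in>carrier N. x \<odot>\<^bsub>N\<^esub> z \<in> {\<zero>\<^bsub>N\<^esub>} \<longrightarrow> z \<in> {\<zero>\<^bsub>N\<^esub>}"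
    using Cons.prems(4) by (simp add: regular_seq_def All_less_Suc2 seq_mult_def N.mod_span_empty)
  obtain Q :: "'a umod" and \<pi> where Q: "rmodule R Q" "fin_gen R Q" "carrier Q \<noteq> {\<zero>\<^bsub>Q\<^esub>}"
    "short_exact R N N Q (\<lambda>z. x \<odot>\<^bsub>N\<^esub> z) \<pi>"
    using regular_quotient[OF Cons.prems(1,2) regular_seq_ne[OF Cons.prems(1,4)] x] first by blast
  have xc: "x \<in> carrier R" using ideal.Icarr[OF max_ideal_ideal x] .
  have "regular_seq R Q xs" using regular_seq_Cons[OF Cons.prems(1) Q(1) xc Q(4)] Cons.prems(4) by blast
  then have "Van (Suc s) Q" using Cons.IH[OF Q(1,2) xs] Cons.prems(5) by simp
  then show ?case by (rule Van_of_regular[OF Cons.prems(1,2) Q(1) x Q(4)])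
qed

text \<open>A longer sequence would make Ext vanish in every degree, degree 0 included, and force N
  = 0.\<close>

lemma regular_seq_length_le:
  fixes N :: "'a umod"
  assumes "rmodule R N" "fin_gen R N" "set xs \<subseteq> \<mm>" "regular_seq R N xs"
  shows "length xs \<le> r"
proof (rule ccontr)
  assume "\<not> length xs \<le> r"
  then have "Van s N" for s by (intro Van_of_regular_seq[OF assms]) simp
  then show False using Van_all_imp_zero[OF assms(1,2)] regular_seq_ne[OF assms(1,4)] by blast
qed

text \<open>As long as c < r, the vanishing of Ext^r(N) gives a regular element, and for the
  quotient the vanishing starts one degree later. So r - c elements can be found before c reaches
  r.\<close>

lemma regular_seq_exists:
  fixes N :: "'a umod"
  assumes "rmodule R N" "fin_gen R N" "carrier N \<noteq> {\<zero>\<^bsub>N\<^esub>}" "\<And>s. c < s \<Longrightarrow> Van s N" "c + t \<le> r"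
  shows "\<exists>xs. length xs = t \<and> set xs \<subseteq> \<mm> \<and> regular_seq R N xs"
  using assms
proof (induction t arbitrary: N c)
  case 0
  interpret N: rmodule R N by fact
  show ?case using 0(3) N.mod_span_empty by (auto simp: regular_seq_def seq_mult_def)
next
  case (Suc t)
  have "Van r N" using Suc.prems(4,5) by simp
  then obtain x where x: "x \<in> \<mm>" "\<forall>z\<in>carrier N. x \<odot>\<^bsub>N\<^esub> z = \<zero>\<^bsub>N\<^esub> \<longrightarrow> z = \<zero>\<^bsub>N\<^esub>"
    using Van_regular_element[OF Suc.prems(1,2)] by blast
  obtain Q :: "'a umod" and \<pi> where Q: "rmodule R Q" "fin_gen R Q" "carrier Q \<noteq> {\<zero>\<^bsub>Q\<^esub>}"
    "short_exact R N N Q (\<lambda>z. x \<odot>\<^bsub>N\<^esub> z) \<pi>"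
    using regular_quotient[OF Suc.prems(1-3) x(1)] x(2) by blast
  have S: "res_sequence R n I \<epsilon> d N N Q (\<lambda>z. x \<odot>\<^bsub>N\<^esub> z) \<pi>"
    by (rule res_sequenceI[OF Suc.prems(1,1) Q(1,4)])
  have V: "Van s Q" if s: "Suc c < s" for s
  proof -
    obtain j where j: "s = Suc j" "c < j" using s by (cases s) auto
    show ?thesis unfolding j(1) by (rule res_sequence.Van_right[OF S]) (use j(2) Suc.prems(4) in simp_all)
  qed
  have "\<exists>xs. length xs = t \<and> set xs \<subseteq> \<mm> \<and> regular_seq R Q xs"
    by (rule Suc.IH[OF Q(1-3), of "Suc c"]) (erule V, use Suc.prems(5) in simp)
  then obtain xs where xs: "length xs = t" "set xs \<subseteq> \<mm>" "regular_seq R Q xs" by blast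
  have xc: "x \<in> carrier R" using ideal.Icarr[OF max_ideal_ideal x(1)] .
  have "regular_seq R N (x # xs)" using regular_seq_Cons[OF Suc.prems(1) Q(1) xc Q(4)] xs(3) by blast
  then show ?case using xs x(1) by (intro exI[of _ "x # xs"]) simp
qed

text \<open>For R itself Ext vanishes in all positive degrees, so c = 0 is allowed and R has a
  regular sequence of length r, which is at most dim R long.\<close>

lemma top_le_krull_dim: "enat r \<le> krull_dim R"
proof -
  let ?G = "free_mod R 1"
  interpret G: local_module R ?G by (intro local_module.intro noetherian_local_axioms rmodule_free_mod)
  let ?u = "{\<lambda>i::nat. if i < 1 then \<one> else \<zero>}"
  have u: "?u \<in> carrier ?G" by (simp add: free_mod_carrier)
  have ne: "carrier ?G \<noteq> {\<zero>\<^bsub>?G\<^esub>}"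
  proof
    assume "carrier ?G = {\<zero>\<^bsub>?G\<^esub>}"
    then have "?u = \<zero>\<^bsub>?G\<^esub>" using u by (simp only: singleton_iff)
    then show False using one_neq_zero by (auto dest: fun_cong[of _ _ 0])
  qed
  have V: "Van s ?G" if "0 < s" for s using that Van_free_mod by (cases s) (simp, simp only:)
  have "\<exists>xs. length xs = r \<and> set xs \<subseteq> \<mm> \<and> regular_seq R ?G xs"
    by (rule regular_seq_exists[OF rmodule_free_mod fg_free_fin_gen[OF fg_free_free_mod[OF one_neq_zero]] ne, of 0 r])
      (erule V, simp)
  then obtain xs where "length xs = r" "set xs \<subseteq> \<mm>" "regular_seq R ?G xs" by blast
  then show ?thesis using G.regular_seq_le_krull_dim by blast
qed

text \<open>The inequalities depth M \<le> r \<le> dim R become equalities because depth M = dim R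
  for a nonzero maximal Cohen-Macaulay module. This is how r is identified with the Krull
  dimension.\<close>

lemma MCM_krull_dim:
  fixes M :: "'a umod"
  assumes "MCM R M" "carrier M \<noteq> {\<zero>\<^bsub>M\<^esub>}"
  obtains xs where "set xs \<subseteq> \<mm>" "regular_seq R M xs" "length xs = r" "krull_dim R = enat r"
proof -
  have M: "rmodule R M" "fin_gen R M" "depth R M = krull_dim R"
    using assms by (auto simp: MCM_def rmodule_def)
  interpret M: rmodule R M by fact
  let ?L = "{enat (length xs) |xs. set xs \<subseteq> \<mm> \<and> regular_seq R M xs}"
  \<comment> \<open>Lengths of regular sequences are at most r, so the supremum in
    \<open>depth\<close> runs over a finite nonempty set and is attained.\<close>
  have "?L \<subseteq> enat ` {..r}" using regular_seq_length_le[OF M(1,2)] by auto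
  then have fin: "finite ?L" by (rule finite_subset) simp
  have "regular_seq R M []"
    using assms(2) M.mod_span_empty by (simp add: regular_seq_def seq_mult_def)
  then have ne: "?L \<noteq> {}" by (auto intro!: exI[of _ "[]"])
  have "depth R M = Max ?L" unfolding depth_def Sup_enat_def by (simp only: ne fin if_True if_False)
  then have "depth R M \<in> ?L" using Max_in[OF fin ne] by simp
  then obtain xs where xs: "depth R M = enat (length xs)" "set xs \<subseteq> \<mm>" "regular_seq R M xs" by auto
  have "length xs = r"
    using regular_seq_length_le[OF M(1,2) xs(2,3)] top_le_krull_dim xs(1) M(3) by simp
  then show ?thesis using that xs M(3) by simp
qed

lemma MCM_Van:
  fixes M :: "'a umod"
  assumes "MCM R M"
  shows "Van (Suc s) M"
proof (cases "carrier M = {\<zero>\<^bsub>M\<^esub>}")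
  case True
  then show ?thesis using Van_zero_module assms by (simp add: MCM_def rmodule_def)
next
  case False
  have M: "rmodule R M" "fin_gen R M" using assms by (auto simp: MCM_def rmodule_def)
  obtain xs where xs: "set xs \<subseteq> \<mm>" "regular_seq R M xs" "length xs = r"
    using MCM_krull_dim[OF assms False] by blast
  show ?thesis by (rule Van_of_regular_seq[OF M xs(1,2)]) (simp add: xs(3))
qed

text \<open>With c = 0 there is a regular sequence of length r = dim R, and no regular sequence is
  longer than r.\<close>

lemma MCM_of_Van:
  fixes M :: "'a umod"
  assumes "krull_dim R = enat r" "rmodule R M" "fin_gen R M" "\<And>s. Van (Suc s) M"
  shows "MCM R M"
  unfolding MCM_def
proof (intro conjI disjCI)
  assume "depth R M \<noteq> krull_dim R"
  show "carrier M = {\<zero>\<^bsub>M\<^esub>}"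
  proof (rule ccontr)
    assume ne: "carrier M \<noteq> {\<zero>\<^bsub>M\<^esub>}"
    have V: "Van s M" if "0 < s" for s using that assms(4) by (cases s) (simp, simp only:)
    have "\<exists>xs. length xs = r \<and> set xs \<subseteq> \<mm> \<and> regular_seq R M xs"
      by (rule regular_seq_exists[OF assms(2,3) ne, of 0 r]) (erule V, simp)
    then obtain xs where "length xs = r" "set xs \<subseteq> \<mm>" "regular_seq R M xs" by blast
    then have "enat r \<le> depth R M" unfolding depth_def by (auto intro!: Sup_upper)
    moreover have "depth R M \<le> enat r"
      unfolding depth_def by (rule Sup_least) (use regular_seq_length_le[OF assms(2,3)] in auto)
    ultimately show False using \<open>depth R M \<noteq> krull_dim R\<close> assms(1) by simp
  qed
qed (use assms in \<open>simp_all add: rmodule_def\<close>)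

end

section \<open>Duality and co-syzygies\<close>

context cring
begin

text \<open>The standard pairing on R^k, which identifies R^k with its dual
  (\<open>form_dot\<close>). The operations of \<open>regular_module R\<close> are used so that
  \<open>free_mod_hom\<close> yields linearity directly.\<close>

definition dot :: "nat \<Rightarrow> (nat \<Rightarrow> 'a) set \<Rightarrow> (nat \<Rightarrow> 'a) set \<Rightarrow> 'a" where
  "dot k c a = (\<Oplus>\<^bsub>regular_module R\<^esub>i\<in>{..<k}. the_elem a i \<odot>\<^bsub>regular_module R\<^esub> the_elem c i)"

lemma reg_rmodule: "rmodule R (regular_module R)"
  by (rule rmodule_regular_module[OF is_cring])

lemma dot_hom:
  assumes "c \<in> carrier (free_mod R k)"
  shows "dot k c \<in> mod_hom R (free_mod R k) (regular_module R)"
proof -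
  interpret reg: rmodule R "regular_module R" by (rule reg_rmodule)
  have "(\<lambda>a. dot k c a) \<in> mod_hom R (free_mod R k) (regular_module R)"
    unfolding dot_def by (rule reg.free_mod_hom) (simp add: free_mod_coord[OF assms])
  then show ?thesis by simp
qed

lemma dot_comm:
  assumes "c \<in> carrier (free_mod R k)" "a \<in> carrier (free_mod R k)"
  shows "dot k c a = dot k a c"
proof -
  interpret reg: rmodule R "regular_module R" by (rule reg_rmodule)
  show ?thesis
    unfolding dot_def
    by (rule reg.M.finsum_cong')
      (simp_all add: free_mod_coord[OF assms(1)] free_mod_coord[OF assms(2)] m_comm)
qed

lemma dot_unit_vec:
  assumes "c \<in> carrier (free_mod R k)" "i < k"
  shows "dot k c (unit_vec R i) = the_elem c i"
proof -
  interpret reg: rmodule R "regular_module R" by (rule reg_rmodule)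
  show ?thesis
    unfolding dot_def by (rule reg.free_mod_hom_unit_vec[OF _ assms(2)]) (simp add: free_mod_coord[OF assms(1)])
qed

lemma form_eqI:
  assumes "\<phi> \<in> mod_hom R (free_mod R k) (regular_module R)" "\<psi> \<in> mod_hom R (free_mod R k) (regular_module R)"
    "\<And>i. i < k \<Longrightarrow> \<phi> (unit_vec R i) = \<psi> (unit_vec R i)" "a \<in> carrier (free_mod R k)"
  shows "\<phi> a = \<psi> a"
proof -
  let ?G = "free_mod R k"
  interpret reg: rmodule R "regular_module R" by (rule reg_rmodule)
  interpret G: rmodule R ?G by (rule rmodule_free_mod)
  note rG = rmodule_free_mod[of k]
  let ?\<delta> = "\<lambda>z. \<phi> z \<ominus>\<^bsub>regular_module R\<^esub> \<psi> z"
  let ?H = "{z \<in> carrier ?G. ?\<delta> z = \<zero>\<^bsub>regular_module R\<^esub>}"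
  note sub = kernel_submodule[OF rG reg_rmodule reg.mod_hom_diff[OF rG assms(1,2)]]
  note pc = mod_hom_closed[OF assms(1)] mod_hom_closed[OF assms(2)]
  have e: "unit_vec R i \<in> ?H" if "i < k" for i
    using assms(3)[OF that] pc(2)[OF unit_vec_carrier[OF that]] unit_vec_carrier[OF that]
    by (simp only: reg.minus_self mem_Collect_eq simp_thms)
  obtain f where f: "a = {f}" "\<forall>i<k. f i \<in> carrier R" "\<forall>i\<ge>k. f i = \<zero>"
    using assms(4) by (rule free_mod_cases)
  have "(\<Oplus>\<^bsub>?G\<^esub>i\<in>{..<k}. f i \<odot>\<^bsub>?G\<^esub> unit_vec R i) \<in> ?H"
    by (rule G.submodule_finsum[OF sub finite_lessThan]) (rule G.submoduleE(4)[OF sub _ e], use f(2) in simp_all)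
  moreover have "(\<Oplus>\<^bsub>?G\<^esub>i\<in>{..<k}. f i \<odot>\<^bsub>?G\<^esub> unit_vec R i) = a"
  proof -
    have "(\<Oplus>\<^bsub>?G\<^esub>i\<in>{..<k}. f i \<odot>\<^bsub>?G\<^esub> unit_vec R i) = {\<lambda>i. if i \<in> {..<k} then f i else \<zero>}"
      using f(2) by (intro free_mod_finsum) auto
    also have "\<dots> = a" unfolding f(1) using f(3) by (auto simp: fun_eq_iff)
    finally show ?thesis .
  qed
  ultimately have "?\<delta> a = \<zero>\<^bsub>regular_module R\<^esub>" by simp
  then show ?thesis using pc(1)[OF assms(4)] pc(2)[OF assms(4)] reg.minus_eq_zero_iff by blast
qed

lemma form_dot:
  assumes "\<phi> \<in> mod_hom R (free_mod R k) (regular_module R)"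
  shows "\<exists>c\<in>carrier (free_mod R k). \<forall>a\<in>carrier (free_mod R k). \<phi> a = dot k c a"
proof -
  let ?c = "{\<lambda>i. if i < k then \<phi> (unit_vec R i) else \<zero>}"
  have c: "?c \<in> carrier (free_mod R k)"
    using mod_hom_closed[OF assms unit_vec_carrier] by (simp add: free_mod_carrier)
  have "\<phi> a = dot k ?c a" if "a \<in> carrier (free_mod R k)" for a
    by (rule form_eqI[OF assms dot_hom[OF c] _ that]) (simp add: dot_unit_vec[OF c])
  then show ?thesis using c by (intro rev_bexI[OF c] ballI)
qed

lemma dot_eqI:
  assumes "g \<in> carrier (free_mod R k)" "g' \<in> carrier (free_mod R k)"
    "\<And>c. c \<in> carrier (free_mod R k) \<Longrightarrow> dot k c g = dot k c g'"
  shows "g = g'"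
proof -
  have *: "the_elem g i = the_elem g' i" if i: "i < k" for i
    using assms(3)[OF unit_vec_carrier[OF i]] dot_comm[OF assms(1) unit_vec_carrier[OF i]]
      dot_comm[OF assms(2) unit_vec_carrier[OF i]] dot_unit_vec[OF assms(1) i] dot_unit_vec[OF assms(2) i]
    by (simp only:)
  obtain f where f: "g = {f}" "\<forall>i\<ge>k. f i = \<zero>" using assms(1) by (rule free_mod_cases)
  obtain f' where f': "g' = {f'}" "\<forall>i\<ge>k. f' i = \<zero>" using assms(2) by (rule free_mod_cases)
  have "f i = f' i" for i using * f f' by (cases "i < k") simp_all
  then show ?thesis using f f' by (simp add: fun_eq_iff)
qed

lemma coordinates_hom:
  assumes "rmodule R N" "\<And>j. j < m \<Longrightarrow> \<phi> j \<in> mod_hom R N (regular_module R)"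
  shows "(\<lambda>x. {\<lambda>j. if j < m then \<phi> j x else \<zero>}) \<in> mod_hom R N (free_mod R m)"
proof (rule mod_homI)
  fix x y assume x: "x \<in> carrier N" and y: "y \<in> carrier N"
  show "{\<lambda>j. if j < m then \<phi> j x else \<zero>} \<in> carrier (free_mod R m)"
    using mod_hom_closed[OF assms(2) x] by (simp add: free_mod_carrier)
  show "{\<lambda>j. if j < m then \<phi> j (x \<oplus>\<^bsub>N\<^esub> y) else \<zero>} =
    {\<lambda>j. if j < m then \<phi> j x else \<zero>} \<oplus>\<^bsub>free_mod R m\<^esub> {\<lambda>j. if j < m then \<phi> j y else \<zero>}"
    using mod_hom_add[OF assms(2) x y] by (simp add: fun_eq_iff)
next
  fix a x assume a: "a \<in> carrier R" and x: "x \<in> carrier N"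
  show "{\<lambda>j. if j < m then \<phi> j (a \<odot>\<^bsub>N\<^esub> x) else \<zero>} =
    a \<odot>\<^bsub>free_mod R m\<^esub> {\<lambda>j. if j < m then \<phi> j x else \<zero>}"
    using mod_hom_smult[OF assms(2) a x] a by (simp add: fun_eq_iff)
qed

text \<open>For a module $N = R^k/K$ this is the dual $N^*$.\<close>

definition perp :: "nat \<Rightarrow> 'a umod \<Rightarrow> 'a umod" where
  "perp k K = free_mod R k\<lparr>carrier := {c \<in> carrier (free_mod R k). \<forall>a\<in>carrier K. dot k c a = \<zero>}\<rparr>"

lemma perp_carrier: "carrier (perp k K) = {c \<in> carrier (free_mod R k). \<forall>a\<in>carrier K. dot k c a = \<zero>}"
  by (simp add: perp_def)

lemma perp_submodule:
  assumes "carrier K \<subseteq> carrier (free_mod R k)"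
  shows "submodule {c \<in> carrier (free_mod R k). \<forall>a\<in>carrier K. dot k c a = \<zero>} R (free_mod R k)"
    (is "submodule ?H R ?G")
proof -
  interpret G: rmodule R ?G by (rule rmodule_free_mod)
  note rG = rmodule_free_mod[of k]
  have a: "dot k a \<in> mod_hom R ?G (regular_module R)" "a \<in> carrier ?G" if "a \<in> carrier K" for a
    using that assms dot_hom by blast+
  have H: "?H = {c \<in> carrier ?G. \<forall>a\<in>carrier K. dot k a c = \<zero>}"
    using dot_comm a(2) by (intro Collect_cong conj_cong refl ball_cong) simp
  show ?thesis
    unfolding H
  proof (rule G.submoduleI')
    show "\<zero>\<^bsub>?G\<^esub> \<in> {c \<in> carrier ?G. \<forall>a\<in>carrier K. dot k a c = \<zero>}"
      using mod_hom_zero[OF rG reg_rmodule a(1)] G.M.zero_closed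
      by (intro CollectI conjI ballI) (simp_all del: free_mod_simps)
    show "x \<oplus>\<^bsub>?G\<^esub> y \<in> {c \<in> carrier ?G. \<forall>a\<in>carrier K. dot k a c = \<zero>}"
      if x: "x \<in> {c \<in> carrier ?G. \<forall>a\<in>carrier K. dot k a c = \<zero>}"
        and y: "y \<in> {c \<in> carrier ?G. \<forall>a\<in>carrier K. dot k a c = \<zero>}" for x y
      using x y mod_hom_add[OF a(1)]
      by (intro CollectI conjI ballI) (simp_all del: free_mod_simps)
    show "b \<odot>\<^bsub>?G\<^esub> x \<in> {c \<in> carrier ?G. \<forall>a\<in>carrier K. dot k a c = \<zero>}"
      if b: "b \<in> carrier R" and x: "x \<in> {c \<in> carrier ?G. \<forall>a\<in>carrier K. dot k a c = \<zero>}" for b x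
      using b x mod_hom_smult[OF a(1) b]
      by (intro CollectI conjI ballI) (simp_all del: free_mod_simps)
  qed auto
qed

end

lemma (in noetherian_local) perp_fin_gen:
  assumes "carrier K \<subseteq> carrier (free_mod R k)"
  shows "rmodule R (perp k K)" "fin_gen R (perp k K)"
proof -
  interpret G: local_module R "free_mod R k"
    by (intro local_module.intro noetherian_local_axioms rmodule_free_mod)
  show "rmodule R (perp k K)" unfolding perp_def by (rule G.restrict_rmodule[OF perp_submodule[OF assms]])
  show "fin_gen R (perp k K)"
    unfolding perp_def
    by (rule G.submodule_fin_gen[OF fg_free_fin_gen[OF fg_free_free_mod[OF one_neq_zero]] perp_submodule[OF assms]])
qed

text \<open>Forms are cocycles of degree 0, and these extend from L to N when Ext^1(Q, R) =
  0.\<close>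

lemma (in res_sequence) form_extends:
  assumes "Van (Suc 0) Q" "\<phi> \<in> mod_hom R L (regular_module R)"
  shows "\<exists>\<psi>\<in>mod_hom R N (regular_module R). \<forall>x\<in>carrier L. \<psi> (i x) = \<phi> x"
proof -
  obtain h where h: "coc 0 N h" "\<And>z. z \<in> carrier L \<Longrightarrow> h (i z) = (\<epsilon> \<circ> \<phi>) z"
    by (rule coc_extends[OF assms(1) form_coc_0[OF assms(2)]]) blast
  obtain \<psi> where \<psi>: "\<psi> \<in> mod_hom R N (regular_module R)" "\<And>z. z \<in> carrier N \<Longrightarrow> \<epsilon> (\<psi> z) = h z"
    by (rule coc_0_form[OF rm(2) h(1)]) blast
  have "\<psi> (i x) = \<phi> x" if x: "x \<in> carrier L" for x
  proof (rule inj_onD[OF aug(2)])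
    note c = mod_hom_closed[OF ex(1) x]
    show "\<epsilon> (\<psi> (i x)) = \<epsilon> (\<phi> x)" using \<psi>(2)[OF c] h(2)[OF x] by simp
    show "\<psi> (i x) \<in> carrier R" "\<phi> x \<in> carrier R"
      using mod_hom_closed[OF \<psi>(1) c] mod_hom_closed[OF assms(2) x] by simp_all
  qed
  then show ?thesis by (intro rev_bexI[OF \<psi>(1)] ballI)
qed

context injective_resolution
begin

text \<open>A presentation N = R^k/K of a module with Ext^s(N, R) = 0 for s > 0. The syzygy K then
  has such a presentation too, so the duals of the successive syzygies can be compared.\<close>

definition acyclic_presentation :: "'a umod \<Rightarrow> nat \<Rightarrow> 'a umod \<Rightarrow> ((nat \<Rightarrow> 'a) set \<Rightarrow> (nat \<Rightarrow> 'a) set) \<Rightarrow> bool" where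
  "acyclic_presentation N k K q \<longleftrightarrow> rmodule R N \<and> fin_gen R N \<and> (\<forall>s. Van (Suc s) N) \<and>
     rmodule R K \<and> fin_gen R K \<and> short_exact R K (free_mod R k) N id q"

lemma acyclic_presentation_exists:
  assumes "rmodule R N" "fin_gen R N" "\<And>s. Van (Suc s) N"
  shows "\<exists>k K q. acyclic_presentation N k K q"
proof -
  obtain k q and K :: "'a umod" where "rmodule R K" "fin_gen R K" "short_exact R K (free_mod R k) N id q"
    using syzygy[OF assms(1,2)] .
  then show ?thesis using assms unfolding acyclic_presentation_def by (intro exI conjI allI)
qed

lemma acyclic_presentation_syzygy:
  assumes "acyclic_presentation N k K q"
  shows "\<exists>k' K' q'. acyclic_presentation K k' K' q'"
proof -
  note a = assms[unfolded acyclic_presentation_def]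
  have S: "res_sequence R n I \<epsilon> d K (free_mod R k) N id q"
    using a by (intro res_sequenceI rmodule_free_mod) simp_all
  have "Van (Suc s) K" for s using res_sequence.Van_left[OF S Van_free_mod] a by simp
  then show ?thesis using a by (intro acyclic_presentation_exists) simp_all
qed

lemma acyclic_presentation_subset: "acyclic_presentation N k K q \<Longrightarrow> carrier K \<subseteq> carrier (free_mod R k)"
  using mod_hom_closed[of id R K "free_mod R k"] by (auto simp: acyclic_presentation_def short_exact_def)

text \<open>The dual of 0 -> K -> R^k -> N -> 0: the outer terms are the duals of N and of K, and
  exactness on the right holds because forms on K extend to R^k by Ext^1(N, R) = 0. The second
  clause makes \<rho> the transpose of q', which \<open>perp_perp\<close> uses.\<close>

lemma dual_sequence:
  assumes "acyclic_presentation N k K q" "acyclic_presentation K k' K' q'"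
  shows "\<exists>\<rho>. short_exact R (perp k K) (free_mod R k) (perp k' K') id \<rho> \<and>
    (\<forall>c\<in>carrier (free_mod R k). \<forall>a\<in>carrier (free_mod R k'). dot k' (\<rho> c) a = dot k c (q' a))"
proof -
  let ?G = "free_mod R k" and ?G' = "free_mod R k'"
  note a = assms(1)[unfolded acyclic_presentation_def] and a' = assms(2)[unfolded acyclic_presentation_def]
  note KG = subsetD[OF acyclic_presentation_subset[OF assms(1)]]
    and KG' = subsetD[OF acyclic_presentation_subset[OF assms(2)]]
  note rG = rmodule_free_mod[of k] and rG' = rmodule_free_mod[of k']
  have S: "res_sequence R n I \<epsilon> d K ?G N id q" using a by (intro res_sequenceI rmodule_free_mod) simp_all
  have idK: "id \<in> mod_hom R K ?G" using a by (simp add: short_exact_def)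
  have q': "q' \<in> mod_hom R ?G' K" "q' ` carrier ?G' = carrier K"
    and ker: "id ` carrier K' = {x \<in> carrier ?G'. q' x = \<zero>\<^bsub>K\<^esub>}"
    using a' by (auto simp: short_exact_def)
  have rK: "rmodule R K" and rK': "rmodule R K'" using a a' by simp_all
  interpret K: rmodule R K by (rule rK)
  interpret G: rmodule R ?G by (rule rG)
  define e where "e j = q' (unit_vec R j)" for j
  have e: "e j \<in> carrier ?G" if "j < k'" for j
    unfolding e_def by (rule KG[OF mod_hom_closed[OF q'(1) unit_vec_carrier[OF that]]])
  \<comment> \<open>The transpose of q': coordinate j pairs c with the image of the j-th unit
    vector.\<close>
  define \<rho> where "\<rho> c = {\<lambda>j. if j < k' then dot k c (e j) else \<zero>}" for c
  have \<rho>: "\<rho> \<in> mod_hom R ?G ?G'"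
  proof -
    have "(\<lambda>c. {\<lambda>j. if j < k' then dot k c (e j) else \<zero>}) \<in> mod_hom R ?G ?G'"
      by (rule coordinates_hom[OF rG])
        (rule mod_hom_cong[OF rG dot_hom[OF e] dot_comm[OF _ e]], assumption+)
    then show ?thesis unfolding \<rho>_def[abs_def] .
  qed
  note \<rho>c = mod_hom_closed[OF \<rho>]
  have q'G: "q' \<in> mod_hom R ?G' ?G" using mod_hom_comp[OF q'(1) idK] by simp
  have dot: "dot k' (\<rho> c) a = dot k c (q' a)" if c: "c \<in> carrier ?G" and a: "a \<in> carrier ?G'" for c a
  proof -
    have "dot k' (\<rho> c) a = (dot k c \<circ> q') a"
    proof (rule form_eqI[OF dot_hom[OF \<rho>c[OF c]] mod_hom_comp[OF q'G dot_hom[OF c]] _ a])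
      fix i assume "i < k'"
      then show "dot k' (\<rho> c) (unit_vec R i) = (dot k c \<circ> q') (unit_vec R i)"
        using dot_unit_vec[OF \<rho>c[OF c]] by (simp add: \<rho>_def e_def)
    qed
    then show ?thesis by simp
  qed
  have dot0: "dot k c \<zero>\<^bsub>?G\<^esub> = \<zero>" if "c \<in> carrier ?G" for c
    using mod_hom_zero[OF rG reg_rmodule dot_hom[OF that]] by (simp del: free_mod_simps)
  have zKG: "\<zero>\<^bsub>K\<^esub> = \<zero>\<^bsub>?G\<^esub>" using mod_hom_zero[OF rK rG idK] by (simp del: free_mod_simps)
  have perp': "\<rho> c \<in> carrier (perp k' K')" if c: "c \<in> carrier ?G" for c
    unfolding perp_carrier
  proof (intro CollectI conjI ballI)
    show "\<rho> c \<in> carrier ?G'" by (rule \<rho>c[OF c])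
    fix b assume b: "b \<in> carrier K'"
    then have "b \<in> {x \<in> carrier ?G'. q' x = \<zero>\<^bsub>K\<^esub>}" unfolding ker[symmetric] by simp
    then show "dot k' (\<rho> c) b = \<zero>" using dot[OF c KG'[OF b]] dot0[OF c] zKG by (simp del: free_mod_simps)
  qed
  have kernel: "carrier (perp k K) = {c \<in> carrier ?G. \<rho> c = \<zero>\<^bsub>?G'\<^esub>}"
    unfolding perp_carrier
  proof (rule Collect_cong, rule conj_cong[OF refl], rule iffI)
    fix c assume c: "c \<in> carrier ?G" "\<forall>a\<in>carrier K. dot k c a = \<zero>"
    have "dot k c (e j) = \<zero>" if "j < k'" for j
      unfolding e_def by (rule bspec[OF c(2) mod_hom_closed[OF q'(1) unit_vec_carrier[OF that]]])
    then show "\<rho> c = \<zero>\<^bsub>?G'\<^esub>" by (simp add: \<rho>_def fun_eq_iff)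
  next
    fix c assume c: "c \<in> carrier ?G" "\<rho> c = \<zero>\<^bsub>?G'\<^esub>"
    show "\<forall>a\<in>carrier K. dot k c a = \<zero>"
    proof
      fix z assume "z \<in> carrier K"
      then have "z \<in> q' ` carrier ?G'" using q'(2) by simp
      then obtain b where b: "b \<in> carrier ?G'" "z = q' b" by auto
      interpret G': rmodule R ?G' by (rule rG')
      have "dot k c z = dot k' \<zero>\<^bsub>?G'\<^esub> b" using dot[OF c(1) b(1)] c(2) b(2) by simp
      also have "\<dots> = dot k' b \<zero>\<^bsub>?G'\<^esub>" by (rule dot_comm[OF G'.M.zero_closed b(1)])
      also have "\<dots> = \<zero>" using mod_hom_zero[OF rG' reg_rmodule dot_hom[OF b(1)]] by (simp del: free_mod_simps)
      finally show "dot k c z = \<zero>" .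
    qed
  qed
  \<comment> \<open>Pairing with d' vanishes on K' and so descends to a form on K. Extended to R^k,
    this form is the pairing with some c, the required preimage.\<close>
  have surj: "\<exists>c\<in>carrier ?G. \<rho> c = d'" if d': "d' \<in> carrier (perp k' K')" for d'
  proof -
    have d'c: "d' \<in> carrier ?G'" and d'0: "\<forall>b\<in>carrier K'. dot k' d' b = \<zero>" using d' by (simp_all add: perp_carrier)
    have "dot k' d' x = \<zero>\<^bsub>regular_module R\<^esub>" if "x \<in> carrier ?G'" "q' x = \<zero>\<^bsub>K\<^esub>" for x
    proof -
      have "x \<in> id ` carrier K'" unfolding ker using that by simp
      then show ?thesis using d'0 by simp
    qed
    from factor_through_surjection[OF rG' rK reg_rmodule q' dot_hom[OF d'c] this]
    obtain \<psi> where \<psi>: "\<psi> \<in> mod_hom R K (regular_module R)" "\<forall>x\<in>carrier ?G'. \<psi> (q' x) = dot k' d' x" by blast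
    have "Van (Suc 0) N" using a by simp
    from res_sequence.form_extends[OF S this \<psi>(1)]
    obtain \<psi>' where \<psi>': "\<psi>' \<in> mod_hom R ?G (regular_module R)" "\<forall>x\<in>carrier K. \<psi>' (id x) = \<psi> x" by blast
    obtain c where c: "c \<in> carrier ?G" "\<forall>x\<in>carrier ?G. \<psi>' x = dot k c x"
      using form_dot[OF \<psi>'(1)] by blast
    have "\<rho> c = d'"
    proof (rule dot_eqI[OF \<rho>c[OF c(1)] d'c])
      fix b assume b: "b \<in> carrier ?G'"
      note qb = mod_hom_closed[OF q'(1) b]
      have "dot k' (\<rho> c) b = dot k' d' b"
        using dot[OF c(1) b] bspec[OF c(2) KG[OF qb]] bspec[OF \<psi>'(2) qb] bspec[OF \<psi>(2) b] by simp
      then show "dot k' b (\<rho> c) = dot k' b d'"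
        using dot_comm[OF b \<rho>c[OF c(1)]] dot_comm[OF b d'c] by simp
    qed
    then show ?thesis using c(1) by blast
  qed
  have "short_exact R (perp k K) ?G (perp k' K') id \<rho>"
    unfolding short_exact_def
  proof (intro conjI)
    show "id \<in> mod_hom R (perp k K) ?G"
      unfolding perp_def
      by (rule G.restrict_inclusion[OF perp_submodule[OF acyclic_presentation_subset[OF assms(1)]]])
    show "\<rho> \<in> mod_hom R ?G (perp k' K')"
      using \<rho> perp' unfolding mod_hom_def by (auto simp: perp_def)
    show "id ` carrier (perp k K) = {c \<in> carrier ?G. \<rho> c = \<zero>\<^bsub>perp k' K'\<^esub>}"
      unfolding image_id id_apply kernel by (simp add: perp_def)
    show "\<rho> ` carrier ?G = carrier (perp k' K')" using perp' surj by (auto simp: image_iff)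
  qed simp
  then show ?thesis using dot by (intro exI[of _ \<rho>] conjI ballI)
qed

end

context top_degree
begin

text \<open>Along the duals of successive syzygies the degree is raised one by one until it exceeds
  r, where every Ext vanishes; m counts the steps still to go.\<close>

lemma Van_perp:
  assumes "r \<le> s + m" "acyclic_presentation N k K q"
  shows "Van (Suc s) (perp k K)"
  using assms
proof (induction m arbitrary: s N k K q)
  case 0
  show ?case
    using 0(1) by (intro Van_above perp_fin_gen acyclic_presentation_subset[OF 0(2)]) simp
next
  case (Suc m)
  obtain k' K' q' where K': "acyclic_presentation K k' K' q'"
    using acyclic_presentation_syzygy[OF Suc.prems(2)] by blast
  obtain \<rho> where "short_exact R (perp k K) (free_mod R k) (perp k' K') id \<rho>"
    using dual_sequence[OF Suc.prems(2) K'] by blast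
  then have S: "res_sequence R n I \<epsilon> d (perp k K) (free_mod R k) (perp k' K') id \<rho>"
    by (intro res_sequenceI rmodule_free_mod perp_fin_gen acyclic_presentation_subset[OF Suc.prems(2)]
        acyclic_presentation_subset[OF K'])
  have "Van (Suc (Suc s)) (perp k' K')" by (rule Suc.IH[OF _ K']) (use Suc.prems(1) in simp)
  then show ?case by (rule res_sequence.Van_left[OF S Van_free_mod])
qed

text \<open>A form on $K^*$ extends to a free module because $\mathrm{Ext}^1(K'^*, R) = 0$, so it is the
  evaluation at an element of \<open>K\<close>.\<close>

lemma perp_perp:
  assumes K: "acyclic_presentation N k K q" and g: "g \<in> carrier (free_mod R k)"
    and perp: "\<And>c. c \<in> carrier (perp k K) \<Longrightarrow> dot k c g = \<zero>"
  shows "g \<in> carrier K"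
proof -
  obtain k1 K1 q1 where K1: "acyclic_presentation K k1 K1 q1"
    using acyclic_presentation_syzygy[OF K] by blast
  obtain k2 K2 q2 where K2: "acyclic_presentation K1 k2 K2 q2"
    using acyclic_presentation_syzygy[OF K1] by blast
  let ?G = "free_mod R k" and ?G1 = "free_mod R k1"
  obtain \<rho> where \<rho>: "short_exact R (perp k K) ?G (perp k1 K1) id \<rho>"
    "\<forall>c\<in>carrier ?G. \<forall>a\<in>carrier ?G1. dot k1 (\<rho> c) a = dot k c (q1 a)"
    using dual_sequence[OF K K1] by blast
  obtain \<rho>1 where \<rho>1: "short_exact R (perp k1 K1) ?G1 (perp k2 K2) id \<rho>1"
    using dual_sequence[OF K1 K2] by blast
  note rP = perp_fin_gen(1)[OF acyclic_presentation_subset[OF K1]]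
  have S1: "res_sequence R n I \<epsilon> d (perp k1 K1) ?G1 (perp k2 K2) id \<rho>1"
    by (intro res_sequenceI rmodule_free_mod rP perp_fin_gen acyclic_presentation_subset[OF K2] \<rho>1)
  have h: "\<rho> \<in> mod_hom R ?G (perp k1 K1)" "\<rho> ` carrier ?G = carrier (perp k1 K1)"
    and ker: "id ` carrier (perp k K) = {c \<in> carrier ?G. \<rho> c = \<zero>\<^bsub>perp k1 K1\<^esub>}"
    using \<rho>(1) by (auto simp: short_exact_def)
  \<comment> \<open>Pairing with g vanishes on the dual of N, so it descends along \<rho> to a form
    l on the dual of K.\<close>
  have "dot k g c = \<zero>\<^bsub>regular_module R\<^esub>" if c: "c \<in> carrier ?G" "\<rho> c = \<zero>\<^bsub>perp k1 K1\<^esub>" for c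
  proof -
    have "c \<in> id ` carrier (perp k K)" unfolding ker using c by simp
    then show ?thesis using perp dot_comm[OF g c(1)] by simp
  qed
  from factor_through_surjection[OF rmodule_free_mod rP reg_rmodule h dot_hom[OF g] this]
  obtain l where l: "l \<in> mod_hom R (perp k1 K1) (regular_module R)" "\<forall>c\<in>carrier ?G. l (\<rho> c) = dot k g c" by blast
  have "Van (Suc 0) (perp k2 K2)" by (rule Van_perp[OF _ K2, of 0 r]) simp
  from res_sequence.form_extends[OF S1 this l(1)]
  obtain l' where l': "l' \<in> mod_hom R ?G1 (regular_module R)" "\<forall>x\<in>carrier (perp k1 K1). l' (id x) = l x" by blast
  obtain g1 where g1: "g1 \<in> carrier ?G1" "\<forall>x\<in>carrier ?G1. l' x = dot k1 g1 x"
    using form_dot[OF l'(1)] by blast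
  have q1: "q1 g1 \<in> carrier K"
    using K1 mod_hom_closed[OF _ g1(1)] by (auto simp: acyclic_presentation_def short_exact_def)
  have "g = q1 g1"
  proof (rule dot_eqI[OF g subsetD[OF acyclic_presentation_subset[OF K] q1]])
    fix c assume c: "c \<in> carrier ?G"
    have \<rho>c: "\<rho> c \<in> carrier (perp k1 K1)" by (rule mod_hom_closed[OF h(1) c])
    then have \<rho>c': "\<rho> c \<in> carrier ?G1" by (simp add: perp_carrier)
    have "dot k c g = l' (\<rho> c)"
      using dot_comm[OF c g] bspec[OF l(2) c] bspec[OF l'(2) \<rho>c] by simp
    also have "\<dots> = dot k1 (\<rho> c) g1" using bspec[OF g1(2) \<rho>c'] dot_comm[OF g1(1) \<rho>c'] by simp
    also have "\<dots> = dot k c (q1 g1)" using \<rho>(2) c g1(1) by blast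
    finally show "dot k c g = dot k c (q1 g1)" .
  qed
  then show ?thesis using q1 by simp
qed

text \<open>The coordinates of i are generators of the dual of M. Injectivity is
  \<open>perp_perp\<close>: a vector on which all forms of M vanish lies in K. As generators are
  used, every form on M extends to the free module, and this gives Ext^1(T, R) = 0; the higher
  degrees follow by shifting from M, and \<open>MCM_of_Van\<close> turns vanishing back into
  depth.\<close>

lemma cosyzygy_exists:
  fixes M :: "'a umod"
  assumes "krull_dim R = enat r" and M: "rmodule R M" "fin_gen R M" "\<And>s. Van (Suc s) M"
  shows "\<exists>m (T :: 'a umod) i p. MCM R T \<and> short_exact R M (free_mod R m) T i p"
proof -
  obtain k K q where P: "acyclic_presentation M k K q" using acyclic_presentation_exists[OF M] by blast
  note a = P[unfolded acyclic_presentation_def]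
  let ?G = "free_mod R k"
  interpret M: local_module R M by (intro local_module.intro noetherian_local_axioms M)
  interpret G: local_module R ?G by (intro local_module.intro noetherian_local_axioms rmodule_free_mod)
  interpret reg: rmodule R "regular_module R" by (rule reg_rmodule)
  note rG = rmodule_free_mod[of k]
  have q: "q \<in> mod_hom R ?G M" "q ` carrier ?G = carrier M"
    and ker: "id ` carrier K = {x \<in> carrier ?G. q x = \<zero>\<^bsub>M\<^esub>}"
    using a by (auto simp: short_exact_def)
  have kerK: "x \<in> carrier K \<longleftrightarrow> x \<in> carrier ?G \<and> q x = \<zero>\<^bsub>M\<^esub>" for x
    using ker by (simp add: set_eq_iff)
  let ?P = "carrier (perp k K)"
  have PG: "?P \<subseteq> carrier ?G" by (auto simp: perp_carrier)
  \<comment> \<open>Finitely many generators y 0, ..., y (m - 1) of the dual of M, which is realized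
    as \<open>perp k K\<close> inside R^k.\<close>
  obtain S where S: "finite S" "S \<subseteq> ?P" "?P \<subseteq> mod_span R ?G S"
    using G.submodule_finite_span[OF fg_free_fin_gen[OF fg_free_free_mod[OF one_neq_zero]] PG] by blast
  have SG: "S \<subseteq> carrier ?G" using S(2) PG by (rule subset_trans)
  obtain y and m :: nat where y: "S = y ` {i. i < m}"
    using finite_imp_nat_seg_image_inj_on[OF S(1)] by blast
  have yP: "y j \<in> ?P" if "j < m" for j using that y S(2) by auto
  have yG: "y j \<in> carrier ?G" if "j < m" for j using yP[OF that] PG by blast
  have "\<exists>\<phi>\<in>mod_hom R M (regular_module R). \<forall>x\<in>carrier ?G. \<phi> (q x) = dot k (y j) x" if j: "j < m" for j
    by (rule factor_through_surjection[OF rG M(1) reg_rmodule q dot_hom[OF yG[OF j]]])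
      (use yP[OF j] kerK in \<open>simp add: perp_carrier\<close>)
  then obtain \<phi> where \<phi>: "\<And>j. j < m \<Longrightarrow> \<phi> j \<in> mod_hom R M (regular_module R)"
    "\<And>j x. j < m \<Longrightarrow> x \<in> carrier ?G \<Longrightarrow> \<phi> j (q x) = dot k (y j) x" by metis
  let ?F = "free_mod R m"
  define i where "i x = {\<lambda>j. if j < m then \<phi> j x else \<zero>}" for x
  have i: "i \<in> mod_hom R M ?F" unfolding i_def[abs_def] by (rule coordinates_hom[OF M(1) \<phi>(1)])
  have span: "dot k c g = \<zero>"
    if g: "g \<in> carrier ?G" "\<And>j. j < m \<Longrightarrow> dot k (y j) g = \<zero>" and c: "c \<in> ?P" for c g
  proof -
    let ?H = "{c \<in> carrier ?G. dot k g c = \<zero>\<^bsub>regular_module R\<^esub>}"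
    have sub: "submodule ?H R ?G" by (rule kernel_submodule[OF rG reg_rmodule dot_hom[OF g(1)]])
    have "y j \<in> ?H" if "j < m" for j using yG[OF that] g(2)[OF that] dot_comm[OF g(1) yG[OF that]] by simp
    then have "S \<subseteq> ?H" unfolding y by auto
    from G.mod_span_least[OF sub this] have "c \<in> ?H" using S(3) c by blast
    then show ?thesis using dot_comm[OF g(1), of c] by simp
  qed
  have inj: "x = \<zero>\<^bsub>M\<^esub>" if x: "x \<in> carrier M" "i x = \<zero>\<^bsub>?F\<^esub>" for x
  proof -
    have "x \<in> q ` carrier ?G" using x(1) q(2) by simp
    then obtain g where g: "g \<in> carrier ?G" "x = q g" by auto
    have "dot k (y j) g = \<zero>" if "j < m" for j
    proof -
      have "(\<lambda>j. if j < m then \<phi> j x else \<zero>) = (\<lambda>_. \<zero>)" using x(2) by (simp add: i_def)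
      from fun_cong[OF this, of j] show ?thesis using \<phi>(2)[OF that g(1)] g(2) that by simp
    qed
    then have "dot k c g = \<zero>" if "c \<in> ?P" for c by (rule span[OF g(1) _ that])
    then have "g \<in> carrier K" by (rule perp_perp[OF P g(1)])
    then show ?thesis using kerK g(2) by simp
  qed
  interpret F: local_module R ?F by (intro local_module.intro noetherian_local_axioms rmodule_free_mod)
  note rF = rmodule_free_mod[of m]
  have injon: "inj_on i (carrier M)"
  proof (rule inj_onI)
    fix x x' assume *: "x \<in> carrier M" "x' \<in> carrier M" "i x = i x'"
    then have "i (x \<ominus>\<^bsub>M\<^esub> x') = \<zero>\<^bsub>?F\<^esub>"
      using mod_hom_minus[OF M(1) rF i *(1,2)] F.minus_self[OF mod_hom_closed[OF i *(2)]] by simp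
    then have "x \<ominus>\<^bsub>M\<^esub> x' = \<zero>\<^bsub>M\<^esub>" using inj *(1,2) by simp
    then show "x = x'" using M.minus_eq_zero_iff *(1,2) by simp
  qed
  have fgF: "fin_gen R ?F" by (rule fg_free_fin_gen[OF fg_free_free_mod[OF one_neq_zero]])
  obtain T :: "'a umod" and p where T: "rmodule R T" "p \<in> mod_hom R ?F T" "p ` carrier ?F = carrier T"
    "\<forall>z\<in>carrier ?F. p z = \<zero>\<^bsub>T\<^esub> \<longleftrightarrow> z \<in> i ` carrier M"
    using F.quotient_exists[OF fgF mod_hom_image_submodule[OF M(1) rF i]] by (elim exE conjE) (rule that; assumption)
  have se: "short_exact R M ?F T i p"
    unfolding short_exact_def
  proof (intro conjI i T injon)
    show "i ` carrier M = {z \<in> carrier ?F. p z = \<zero>\<^bsub>T\<^esub>}"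
    proof (rule Set.set_eqI)
      fix z show "z \<in> i ` carrier M \<longleftrightarrow> z \<in> {z \<in> carrier ?F. p z = \<zero>\<^bsub>T\<^esub>}"
        using bspec[OF T(4), of z] mod_hom_closed[OF i] by (cases "z \<in> carrier ?F") auto
    qed
  qed
  \<comment> \<open>A form on M is given by an element c of \<open>?P\<close>, hence by a
    combination of the generators; the generator y j extends as the j-th coordinate of the free
    module.\<close>
  have extension: "\<exists>\<psi>\<in>mod_hom R ?F (regular_module R). \<forall>x\<in>carrier M. \<psi> (i x) = \<theta> x"
    if \<theta>: "\<theta> \<in> mod_hom R M (regular_module R)" for \<theta>
  proof -
    obtain c where c: "c \<in> carrier ?G" "\<forall>x\<in>carrier ?G. (\<theta> \<circ> q) x = dot k c x"
      using form_dot[OF mod_hom_comp[OF q(1) \<theta>]] by blast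
    have "dot k c x = \<zero>" if x: "x \<in> carrier K" for x
    proof -
      have xk: "x \<in> carrier ?G" "q x = \<zero>\<^bsub>M\<^esub>" using x kerK by auto
      then show ?thesis using bspec[OF c(2) xk(1)] mod_hom_zero[OF M(1) reg_rmodule \<theta>] by simp
    qed
    then have "c \<in> ?P" using c(1) by (simp add: perp_carrier)
    then have "c \<in> mod_span R ?G S" using S(3) by blast
    then have "c \<in> carrier ?G \<and> (\<exists>\<psi>\<in>mod_hom R ?F (regular_module R). \<forall>g\<in>carrier ?G. \<psi> (i (q g)) = dot k g c)"
      using SG
    proof (induction rule: G.mod_span_induct)
      case (base c)
      then obtain j where j: "j < m" "c = y j" unfolding y by auto
      have "(\<lambda>u. the_elem u j) \<in> mod_hom R ?F (regular_module R)"
        by (rule mod_homI) (simp_all add: free_mod_coord)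
      moreover have "the_elem (i (q g)) j = dot k g c" if g: "g \<in> carrier ?G" for g
        using j \<phi>(2)[OF j(1) g] dot_comm[OF g yG[OF j(1)]] by (simp add: i_def)
      ultimately show ?case using yG[OF j(1)] j(2) by (intro conjI bexI[of _ "\<lambda>u. the_elem u j"] ballI) simp_all
    next
      case zero
      have "dot k g \<zero>\<^bsub>?G\<^esub> = \<zero>" if "g \<in> carrier ?G" for g
        using mod_hom_zero[OF rG reg_rmodule dot_hom[OF that]] by (simp del: free_mod_simps)
      then show ?case
        using G.M.zero_closed reg.mod_hom_null[of ?F]
        by (intro conjI bexI[of _ "\<lambda>_. \<zero>"] ballI) (simp_all del: free_mod_simps)
    next
      case (add c c')
      then obtain \<psi> \<psi>' where *: "\<psi> \<in> mod_hom R ?F (regular_module R)" "\<forall>g\<in>carrier ?G. \<psi> (i (q g)) = dot k g c"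
        "\<psi>' \<in> mod_hom R ?F (regular_module R)" "\<forall>g\<in>carrier ?G. \<psi>' (i (q g)) = dot k g c'" by blast
      have cc: "c \<in> carrier ?G" "c' \<in> carrier ?G" using add by blast+
      show ?case
      proof (intro conjI bexI ballI)
        show "c \<oplus>\<^bsub>?G\<^esub> c' \<in> carrier ?G" using cc by (rule G.M.a_closed)
        show "(\<lambda>z. \<psi> z \<oplus>\<^bsub>regular_module R\<^esub> \<psi>' z) \<in> mod_hom R ?F (regular_module R)"
          by (rule reg.mod_hom_plus[OF rF *(1,3)])
        fix g assume g: "g \<in> carrier ?G"
        show "\<psi> (i (q g)) \<oplus>\<^bsub>regular_module R\<^esub> \<psi>' (i (q g)) = dot k g (c \<oplus>\<^bsub>?G\<^esub> c')"
          unfolding mod_hom_add[OF dot_hom[OF g] cc] bspec[OF *(2) g] bspec[OF *(4) g] ..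
      qed
    next
      case (smult b c)
      then obtain \<psi> where *: "\<psi> \<in> mod_hom R ?F (regular_module R)" "\<forall>g\<in>carrier ?G. \<psi> (i (q g)) = dot k g c" by blast
      have cc: "c \<in> carrier ?G" and b: "b \<in> carrier R" using smult by blast+
      show ?case
      proof (intro conjI bexI ballI)
        show "b \<odot>\<^bsub>?G\<^esub> c \<in> carrier ?G" using b cc by (rule G.smult_closed)
        show "(\<lambda>z. b \<odot>\<^bsub>regular_module R\<^esub> \<psi> z) \<in> mod_hom R ?F (regular_module R)"
          by (rule reg.mod_hom_scale[OF rF *(1) b])
        fix g assume g: "g \<in> carrier ?G"
        show "b \<odot>\<^bsub>regular_module R\<^esub> \<psi> (i (q g)) = dot k g (b \<odot>\<^bsub>?G\<^esub> c)"
          unfolding mod_hom_smult[OF dot_hom[OF g] b cc] bspec[OF *(2) g] ..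
      qed
    qed
    then obtain \<psi> where \<psi>: "\<psi> \<in> mod_hom R ?F (regular_module R)" "\<forall>g\<in>carrier ?G. \<psi> (i (q g)) = dot k g c" by blast
    have "\<psi> (i x) = \<theta> x" if x: "x \<in> carrier M" for x
    proof -
      have "x \<in> q ` carrier ?G" using x q(2) by simp
      then obtain g where g: "g \<in> carrier ?G" "x = q g" by auto
      show ?thesis using bspec[OF \<psi>(2) g(1)] bspec[OF c(2) g(1)] dot_comm[OF g(1) c(1)] g(2) by simp
    qed
    then show ?thesis by (intro rev_bexI[OF \<psi>(1)] ballI)
  qed
  have S': "res_sequence R n I \<epsilon> d M ?F T i p" by (rule res_sequenceI[OF M(1) rF T(1) se])
  \<comment> \<open>On the free module the cocycle bounds some g, and g restricts to a form on M.
    Subtracting an extension of this form makes g vanish on M, so that it descends to T.\<close>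
  have V1: "Van (Suc 0) T"
    unfolding Van_def
  proof (intro allI impI)
    fix c assume c: "coc (Suc 0) T c"
    have "cob (Suc 0) ?F (c \<circ> p)" using Van_free_mod coc_comp[OF c T(2)] by (simp add: Van_def)
    then obtain g where g: "g \<in> mod_hom R ?F (I 0)" "\<forall>z\<in>carrier ?F. (c \<circ> p) z = d 0 (g z)" by (auto simp: cob_def)
    have "coc 0 M (g \<circ> i)"
      unfolding coc_def
    proof (intro conjI ballI)
      show "g \<circ> i \<in> mod_hom R M (I 0)" by (rule mod_hom_comp[OF i g(1)])
      fix x assume x: "x \<in> carrier M"
      have "d 0 (g (i x)) = c (p (i x))" using bspec[OF g(2) mod_hom_closed[OF i x]] by simp
      also have "\<dots> = \<zero>\<^bsub>I (Suc 0)\<^esub>"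
        using res_sequence.pi_i[OF S' x] mod_hom_zero[OF T(1) rI coc_hom[OF c]] by simp
      finally show "d 0 ((g \<circ> i) x) = \<zero>\<^bsub>I (Suc 0)\<^esub>" by simp
    qed
    then obtain \<theta> where \<theta>: "\<theta> \<in> mod_hom R M (regular_module R)" "\<And>z. z \<in> carrier M \<Longrightarrow> \<epsilon> (\<theta> z) = (g \<circ> i) z"
      by (rule coc_0_form[OF M(1)]) blast
    obtain \<psi> where \<psi>: "\<psi> \<in> mod_hom R ?F (regular_module R)" "\<forall>x\<in>carrier M. \<psi> (i x) = \<theta> x"
      using extension[OF \<theta>(1)] by blast
    note e = form_coc_0[OF \<psi>(1)]
    let ?h = "\<lambda>z. g z \<ominus>\<^bsub>I 0\<^esub> (\<epsilon> \<circ> \<psi>) z"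
    have h: "?h \<in> mod_hom R ?F (I 0)" by (rule Im.mod_hom_diff[OF rF g(1) coc_hom[OF e]])
    show "cob (Suc 0) T c"
    proof (rule res_sequence.cob_connecting[OF S' h])
      have "?h (i x) = \<zero>\<^bsub>I 0\<^esub>" if x: "x \<in> carrier M" for x
        using bspec[OF \<psi>(2) x] \<theta>(2)[OF x] mod_hom_closed[OF g(1) mod_hom_closed[OF i x]]
        by (simp add: Im.minus_self)
      then show "cob 0 M (?h \<circ> i)" by (simp add: cob_def)
      fix z assume z: "z \<in> carrier ?F"
      have "d 0 (?h z) = d 0 (g z)"
        using mod_hom_minus[OF rI rI diff mod_hom_closed[OF g(1) z] mod_hom_closed[OF coc_hom[OF e] z]]
          coc_d[OF e z] dc[OF mod_hom_closed[OF g(1) z]] by (simp add: Im.minus_eq_iff)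
      then show "c (p z) = d 0 (?h z)" using bspec[OF g(2) z] by simp
    qed
  qed
  have "Van (Suc s) T" for s
  proof (cases s)
    case 0
    then show ?thesis using V1 by simp
  next
    case (Suc j)
    show ?thesis unfolding Suc by (rule res_sequence.Van_right[OF S' M(3) Van_free_mod])
  qed
  then have "MCM R T" by (rule MCM_of_Van[OF assms(1) T(1) fin_gen_image[OF rF T(1-3) fgF]])
  then show ?thesis using se by blast
qed

end

section \<open>Standard triangles with a stably trivial vertex\<close>

text \<open>The diagram behind a standard triangle. Two exact rows with the identity of T on the
  right force Z to be the pushout, so no universal property is carried along.\<close>

locale pushout_diagram =
  X: rmodule R X + Y: rmodule R Y + Z: rmodule R Z + F: rmodule R F + T: rmodule R T
  for R :: "('a, 'r) ring_scheme" (structure) and X :: "('a, 'x) module" and Y :: "('a, 'y) module"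
    and Z :: "('a, 'z) module" and F :: "('a, 'f) module" and T :: "('a, 't) module" +
  fixes i p u v w k
  assumes row1: "short_exact R X F T i p" and row2: "short_exact R Y Z T v w"
    and u: "u \<in> mod_hom R X Y" and k: "k \<in> mod_hom R F Z"
    and square1: "\<And>x. x \<in> carrier X \<Longrightarrow> k (i x) = v (u x)"
    and square2: "\<And>y. y \<in> carrier F \<Longrightarrow> w (k y) = p y"
begin

lemma rm: "rmodule R X" "rmodule R Y" "rmodule R Z" "rmodule R F" "rmodule R T"
  by (rule X.rmodule_axioms Y.rmodule_axioms Z.rmodule_axioms F.rmodule_axioms T.rmodule_axioms)+

lemma rows:
  "i \<in> mod_hom R X F" "p \<in> mod_hom R F T" "inj_on i (carrier X)"
  "i ` carrier X = {x \<in> carrier F. p x = \<zero>\<^bsub>T\<^esub>}" "p ` carrier F = carrier T"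
  "v \<in> mod_hom R Y Z" "w \<in> mod_hom R Z T" "inj_on v (carrier Y)"
  "v ` carrier Y = {x \<in> carrier Z. w x = \<zero>\<^bsub>T\<^esub>}" "w ` carrier Z = carrier T"
  using row1 row2 by (auto simp: short_exact_def)

lemmas closed = mod_hom_closed[OF rows(1)] mod_hom_closed[OF rows(2)] mod_hom_closed[OF rows(6)]
  mod_hom_closed[OF rows(7)] mod_hom_closed[OF u] mod_hom_closed[OF k]

lemma wv: "y \<in> carrier Y \<Longrightarrow> w (v y) = \<zero>\<^bsub>T\<^esub>"
  using rows(9) by blast

sublocale XX: rmodule2 R X X by intro_locales
sublocale XY: rmodule2 R X Y by intro_locales
sublocale YY: rmodule2 R Y Y by intro_locales
sublocale ZZ: rmodule2 R Z Z by intro_locales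
sublocale ZY: rmodule2 R Z Y by intro_locales

text \<open>Put h = s w. As w k h = w, the map 1 - k h takes Z into v Y and defines \<sigma>. On Y
  the map h v lands in i X, say h v = i \<xi>, and \<sigma> v = 1 - u \<xi>, where u \<xi> passes
  through the stably trivial module X.\<close>

lemma stable_retract_if_section:
  assumes "id \<in> triv_maps R X X" "s \<in> mod_hom R T F" "\<And>t. t \<in> carrier T \<Longrightarrow> p (s t) = t"
  shows "\<exists>\<sigma>\<in>mod_hom R Z Y. stably_eq R Y Y (\<sigma> \<circ> v) id"
proof -
  define h where "h = s \<circ> w"
  have h: "h \<in> mod_hom R Z F" unfolding h_def by (rule mod_hom_comp[OF rows(7) assms(2)])
  note hc = mod_hom_closed[OF h]
  have ph: "p (h z) = w z" if "z \<in> carrier Z" for z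
    using assms(3) closed(4)[OF that] by (simp add: h_def)
  let ?e = "\<lambda>z. id z \<ominus>\<^bsub>Z\<^esub> (k \<circ> h) z"
  have e: "?e \<in> mod_hom R Z Z" by (intro Z.mod_hom_diff rm mod_hom_id mod_hom_comp[OF h k])
  have "?e z \<in> v ` carrier Y" if z: "z \<in> carrier Z" for z
  proof -
    note c = closed(6)[OF hc[OF z]]
    have "w (z \<ominus>\<^bsub>Z\<^esub> k (h z)) = \<zero>\<^bsub>T\<^esub>"
      using mod_hom_minus[OF rm(3,5) rows(7) z c] square2[OF hc[OF z]] ph[OF z] closed(4)[OF z]
      by (simp add: T.minus_self)
    then show ?thesis unfolding rows(9) using z c by simp
  qed
  then obtain \<sigma> where \<sigma>: "\<sigma> \<in> mod_hom R Z Y" "\<forall>z\<in>carrier Z. v (\<sigma> z) = ?e z"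
    using factor_through_injection[OF rm(2,3,3) rows(6,8) e] by blast
  have hv: "h \<circ> v \<in> mod_hom R Y F" by (rule mod_hom_comp[OF rows(6) h])
  have "(h \<circ> v) y \<in> i ` carrier X" if y: "y \<in> carrier Y" for y
    unfolding rows(4) using hc[OF closed(3)[OF y]] ph[OF closed(3)[OF y]] wv[OF y] by simp
  then obtain \<xi> where \<xi>: "\<xi> \<in> mod_hom R Y X" "\<forall>y\<in>carrier Y. i (\<xi> y) = (h \<circ> v) y"
    using factor_through_injection[OF rm(1,4,2) rows(1,3) hv] by blast
  have eq: "\<sigma> (v y) = y \<ominus>\<^bsub>Y\<^esub> u (\<xi> y)" if y: "y \<in> carrier Y" for y
  proof (rule inj_onD[OF rows(8)])
    note x = mod_hom_closed[OF \<xi>(1) y]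
    show "\<sigma> (v y) \<in> carrier Y" by (rule mod_hom_closed[OF \<sigma>(1) closed(3)[OF y]])
    show "y \<ominus>\<^bsub>Y\<^esub> u (\<xi> y) \<in> carrier Y" using y closed(5)[OF x] by simp
    have "v (\<sigma> (v y)) = v y \<ominus>\<^bsub>Z\<^esub> k (h (v y))" using \<sigma>(2) closed(3)[OF y] by simp
    also have "h (v y) = i (\<xi> y)" using \<xi>(2) y by simp
    also have "k (i (\<xi> y)) = v (u (\<xi> y))" by (rule square1[OF x])
    also have "v y \<ominus>\<^bsub>Z\<^esub> v (u (\<xi> y)) = v (y \<ominus>\<^bsub>Y\<^esub> u (\<xi> y))"
      by (rule mod_hom_minus[OF rm(2,3) rows(6) y closed(5)[OF x], symmetric])
    finally show "v (\<sigma> (v y)) = v (y \<ominus>\<^bsub>Y\<^esub> u (\<xi> y))" .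
  qed
  have "u \<circ> id \<circ> \<xi> \<in> triv_maps R Y Y"
    by (intro XY.triv_maps_comp_right[OF _ \<xi>(1)] XX.triv_maps_comp_left[OF assms(1) u rm(2)])
  then have "(\<lambda>y. \<zero>\<^bsub>Y\<^esub> \<ominus>\<^bsub>Y\<^esub> (u \<circ> id \<circ> \<xi>) y) \<in> triv_maps R Y Y"
    by (rule YY.triv_maps_diff[OF YY.triv_maps_zero])
  then have "stably_eq R Y Y (\<sigma> \<circ> v) id"
    unfolding stably_eq_def
  proof (rule triv_maps_cong)
    fix y assume y: "y \<in> carrier Y"
    have "u (\<xi> y) \<in> carrier Y" by (rule closed(5)[OF mod_hom_closed[OF \<xi>(1) y]])
    then show "(\<sigma> \<circ> v) y \<ominus>\<^bsub>Y\<^esub> id y = \<zero>\<^bsub>Y\<^esub> \<ominus>\<^bsub>Y\<^esub> (u \<circ> id \<circ> \<xi>) y"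
      using eq[OF y] Y.minus_minus_self[OF y] by simp
  qed
  then show ?thesis using \<sigma>(1) by blast
qed

text \<open>The map (y, f) to v y - k f from the sum of Y and F is onto Z, because w and p have the
  same image. Lifting the vectors of a trivial map one by one lifts the map to a pair of trivial
  maps.\<close>

lemma triv_maps_lift:
  assumes "rmodule R M" "g \<in> triv_maps R M Z"
  shows "\<exists>\<alpha>\<in>triv_maps R M Y. \<exists>\<beta>\<in>triv_maps R M F. \<forall>x\<in>carrier M. g x = v (\<alpha> x) \<ominus>\<^bsub>Z\<^esub> k (\<beta> x)"
proof -
  interpret M: rmodule R M by fact
  interpret MY: rmodule2 R M Y by intro_locales
  interpret MF: rmodule2 R M F by intro_locales
  show ?thesis
    using assms(2)
  proof induction
    case (zero g)
    then show ?case
      using mod_hom_zero[OF rm(2,3) rows(6)] mod_hom_zero[OF rm(4,3) k]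
      by (intro bexI[of _ "\<lambda>_. \<zero>\<^bsub>Y\<^esub>"] bexI[of _ "\<lambda>_. \<zero>\<^bsub>F\<^esub>"] MY.triv_maps_zero MF.triv_maps_zero)
        (auto simp: Z.minus_self)
  next
    case (step g \<phi> z g')
    then obtain \<alpha> \<beta> where ab: "\<alpha> \<in> triv_maps R M Y" "\<beta> \<in> triv_maps R M F"
      "\<forall>x\<in>carrier M. g x = v (\<alpha> x) \<ominus>\<^bsub>Z\<^esub> k (\<beta> x)" by blast
    have z: "z \<in> carrier Z" by fact
    have "w z \<in> p ` carrier F" using closed(4)[OF z] rows(5) by simp
    then obtain f where f: "f \<in> carrier F" "w z = p f" by auto
    have "w (z \<ominus>\<^bsub>Z\<^esub> k f) = \<zero>\<^bsub>T\<^esub>"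
      using mod_hom_minus[OF rm(3,5) rows(7) z closed(6)[OF f(1)]] square2[OF f(1)] f(2) closed(2)[OF f(1)]
      by (simp add: T.minus_self)
    then have "z \<ominus>\<^bsub>Z\<^esub> k f \<in> v ` carrier Y" unfolding rows(9) using z closed(6)[OF f(1)] by simp
    then obtain y where y: "y \<in> carrier Y" "z \<ominus>\<^bsub>Z\<^esub> k f = v y" by auto
    \<comment> \<open>The sign brings z = v y + k f into the difference form v y - k f' of the
      statement.\<close>
    define f' where "f' = \<ominus>\<^bsub>F\<^esub> f"
    have f': "f' \<in> carrier F" using f(1) by (simp add: f'_def)
    have kf: "k f' = \<ominus>\<^bsub>Z\<^esub> k f" unfolding f'_def by (rule mod_hom_neg[OF rm(4,3) k f(1)])
    have zy: "z = v y \<ominus>\<^bsub>Z\<^esub> k f'"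
      using y z closed(6)[OF f(1)] closed(3)[OF y(1)] Z.minus_add_cancel[OF z closed(6)[OF f(1)]]
      by (simp add: kf a_minus_def)
    let ?\<alpha> = "\<lambda>x. \<alpha> x \<oplus>\<^bsub>Y\<^esub> \<phi> x \<odot>\<^bsub>Y\<^esub> y" and ?\<beta> = "\<lambda>x. \<beta> x \<oplus>\<^bsub>F\<^esub> \<phi> x \<odot>\<^bsub>F\<^esub> f'"
    have A: "?\<alpha> \<in> triv_maps R M Y" by (rule triv_maps.step[OF ab(1) step.hyps(2) y(1)]) simp
    have B: "?\<beta> \<in> triv_maps R M F" by (rule triv_maps.step[OF ab(2) step.hyps(2) f']) simp
    have "g' x = v (?\<alpha> x) \<ominus>\<^bsub>Z\<^esub> k (?\<beta> x)" if x: "x \<in> carrier M" for x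
    proof -
      have c: "\<alpha> x \<in> carrier Y" "\<beta> x \<in> carrier F" "\<phi> x \<in> carrier R"
        using mod_hom_closed[OF MY.triv_maps_hom[OF ab(1)] x] mod_hom_closed[OF MF.triv_maps_hom[OF ab(2)] x]
          mod_hom_closed[OF step.hyps(2) x] by auto
      have "g' x = (v (\<alpha> x) \<ominus>\<^bsub>Z\<^esub> k (\<beta> x)) \<oplus>\<^bsub>Z\<^esub> \<phi> x \<odot>\<^bsub>Z\<^esub> (v y \<ominus>\<^bsub>Z\<^esub> k f')"
        using step.hyps(4) x ab(3) zy by simp
      also have "\<dots> = (v (\<alpha> x) \<oplus>\<^bsub>Z\<^esub> \<phi> x \<odot>\<^bsub>Z\<^esub> v y) \<ominus>\<^bsub>Z\<^esub> (k (\<beta> x) \<oplus>\<^bsub>Z\<^esub> \<phi> x \<odot>\<^bsub>Z\<^esub> k f')"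
        using c closed(3)[OF c(1)] closed(3)[OF y(1)] closed(6)[OF c(2)] closed(6)[OF f']
        by (simp add: Z.smult_minus) (simp add: a_minus_def Z.M.minus_add Z.M.a_ac)
      also have "\<dots> = v (?\<alpha> x) \<ominus>\<^bsub>Z\<^esub> k (?\<beta> x)"
        using c y(1) f' by (simp add: mod_hom_add[OF rows(6)] mod_hom_smult[OF rows(6)]
            mod_hom_add[OF k] mod_hom_smult[OF k])
      finally show ?thesis .
    qed
    then show ?case by (intro rev_bexI[OF A] rev_bexI[OF B] ballI)
  qed
qed

text \<open>Lift the identity of Z to v \<alpha> - k \<beta> with trivial \<alpha> and \<beta>. On Y
  the map - \<beta> v is killed by p, hence equals i \<tau>, and the commutative square gives u
  \<tau> = 1 - \<alpha> v with \<alpha> v trivial.\<close>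

lemma stable_retract_if_cone_trivial:
  assumes "id \<in> triv_maps R Z Z"
  shows "\<exists>\<tau>\<in>mod_hom R Y X. stably_eq R Y Y (u \<circ> \<tau>) id"
proof -
  interpret ZF: rmodule2 R Z F by intro_locales
  obtain \<alpha> \<beta> where ab: "\<alpha> \<in> triv_maps R Z Y" "\<beta> \<in> triv_maps R Z F"
    "\<forall>z\<in>carrier Z. id z = v (\<alpha> z) \<ominus>\<^bsub>Z\<^esub> k (\<beta> z)"
    using triv_maps_lift[OF rm(3) assms] by blast
  have a: "\<alpha> \<in> mod_hom R Z Y" and b: "\<beta> \<in> mod_hom R Z F"
    using ZY.triv_maps_hom[OF ab(1)] ZF.triv_maps_hom[OF ab(2)] by auto
  note ac = mod_hom_closed[OF a] and bc = mod_hom_closed[OF b]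
  let ?e = "\<lambda>y. (\<lambda>_. \<zero>\<^bsub>F\<^esub>) y \<ominus>\<^bsub>F\<^esub> (\<beta> \<circ> v) y"
  have e: "?e \<in> mod_hom R Y F"
    by (rule F.mod_hom_diff[OF rm(2) F.mod_hom_null mod_hom_comp[OF rows(6) b]])
  have kb: "k (\<beta> (v y)) = v (\<alpha> (v y)) \<ominus>\<^bsub>Z\<^esub> v y" if y: "y \<in> carrier Y" for y
  proof -
    note c = closed(3)[OF y]
    have "v y = v (\<alpha> (v y)) \<ominus>\<^bsub>Z\<^esub> k (\<beta> (v y))" using ab(3) c by simp
    then have "v y \<oplus>\<^bsub>Z\<^esub> k (\<beta> (v y)) = v (\<alpha> (v y))"
      using Z.eq_minus_iff[OF c closed(3)[OF ac[OF c]] closed(6)[OF bc[OF c]]] by simp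
    then show ?thesis
      using c closed(3)[OF ac[OF c]] closed(6)[OF bc[OF c]] by (subst Z.eq_minus_iff) (auto simp: Z.M.a_comm)
  qed
  have "?e y \<in> i ` carrier X" if y: "y \<in> carrier Y" for y
  proof -
    note c = closed(3)[OF y]
    have "p (\<beta> (v y)) = w (k (\<beta> (v y)))" using square2[OF bc[OF c]] by simp
    also have "\<dots> = \<zero>\<^bsub>T\<^esub>"
      unfolding kb[OF y] using mod_hom_minus[OF rm(3,5) rows(7) closed(3)[OF ac[OF c]] c] wv[OF y] wv[OF ac[OF c]]
      by (simp add: T.minus_self)
    finally have "p (\<zero>\<^bsub>F\<^esub> \<ominus>\<^bsub>F\<^esub> \<beta> (v y)) = \<zero>\<^bsub>T\<^esub>"
      using mod_hom_minus[OF rm(4,5) rows(2) _ bc[OF c], of "\<zero>\<^bsub>F\<^esub>"] mod_hom_zero[OF rm(4,5) rows(2)]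
      by (simp add: T.minus_self)
    then show ?thesis unfolding rows(4) using bc[OF c] by simp
  qed
  then obtain \<tau> where \<tau>: "\<tau> \<in> mod_hom R Y X" "\<forall>y\<in>carrier Y. i (\<tau> y) = ?e y"
    using factor_through_injection[OF rm(1,4,2) rows(1,3) e] by blast
  have eq: "u (\<tau> y) = y \<ominus>\<^bsub>Y\<^esub> \<alpha> (v y)" if y: "y \<in> carrier Y" for y
  proof (rule inj_onD[OF rows(8)])
    note c = closed(3)[OF y] and t = mod_hom_closed[OF \<tau>(1) y]
    show "u (\<tau> y) \<in> carrier Y" by (rule closed(5)[OF t])
    show "y \<ominus>\<^bsub>Y\<^esub> \<alpha> (v y) \<in> carrier Y" using y ac[OF c] by simp
    have "v (u (\<tau> y)) = k (\<zero>\<^bsub>F\<^esub> \<ominus>\<^bsub>F\<^esub> \<beta> (v y))" using square1[OF t] \<tau>(2) y by simp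
    also have "\<dots> = \<zero>\<^bsub>Z\<^esub> \<ominus>\<^bsub>Z\<^esub> k (\<beta> (v y))"
      using mod_hom_minus[OF rm(4,3) k _ bc[OF c], of "\<zero>\<^bsub>F\<^esub>"] mod_hom_zero[OF rm(4,3) k] by simp
    also have "\<dots> = v y \<ominus>\<^bsub>Z\<^esub> v (\<alpha> (v y))"
      unfolding kb[OF y] using c closed(3)[OF ac[OF c]] by (simp add: Z.zero_minus_minus)
    also have "\<dots> = v (y \<ominus>\<^bsub>Y\<^esub> \<alpha> (v y))"
      by (rule mod_hom_minus[OF rm(2,3) rows(6) y ac[OF c], symmetric])
    finally show "v (u (\<tau> y)) = v (y \<ominus>\<^bsub>Y\<^esub> \<alpha> (v y))" .
  qed
  have "\<alpha> \<circ> v \<in> triv_maps R Y Y" by (rule ZY.triv_maps_comp_right[OF ab(1) rows(6)])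
  then have "(\<lambda>y. \<zero>\<^bsub>Y\<^esub> \<ominus>\<^bsub>Y\<^esub> (\<alpha> \<circ> v) y) \<in> triv_maps R Y Y"
    by (rule YY.triv_maps_diff[OF YY.triv_maps_zero])
  then have "stably_eq R Y Y (u \<circ> \<tau>) id"
    unfolding stably_eq_def
  proof (rule triv_maps_cong)
    fix y assume y: "y \<in> carrier Y"
    have "\<alpha> (v y) \<in> carrier Y" by (rule ac[OF closed(3)[OF y]])
    then show "(u \<circ> \<tau>) y \<ominus>\<^bsub>Y\<^esub> id y = \<zero>\<^bsub>Y\<^esub> \<ominus>\<^bsub>Y\<^esub> (\<alpha> \<circ> v) y"
      using eq[OF y] Y.minus_minus_self[OF y] by simp
  qed
  then show ?thesis using \<tau>(1) by blast
qed

end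

section \<open>Splitting and existence of the co-syzygy sequences\<close>

context top_degree
begin

text \<open>Forms on X extend to F because Ext^1(T, R) = 0. The identity of X is a sum of form times
  vector, so it extends to a retraction \<rho> of F onto X, and 1 - i \<rho> induces the
  section.\<close>

lemma cosyzygy_section:
  fixes X F T :: "'a umod"
  assumes "rmodule R X" "rmodule R F" "rmodule R T" "short_exact R X F T i p" "id \<in> triv_maps R X X"
    and V: "Van (Suc 0) T"
  shows "\<exists>s\<in>mod_hom R T F. \<forall>t\<in>carrier T. p (s t) = t"
proof -
  interpret X: rmodule R X by fact
  interpret F: rmodule R F by fact
  interpret T: rmodule R T by fact
  interpret XX: rmodule2 R X X by intro_locales
  interpret FX: rmodule2 R F X by intro_locales
  have S: "res_sequence R n I \<epsilon> d X F T i p" by (rule res_sequenceI[OF assms(1-4)])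
  have i: "i \<in> mod_hom R X F" and p: "p \<in> mod_hom R F T" and
    im: "i ` carrier X = {x \<in> carrier F. p x = \<zero>\<^bsub>T\<^esub>}" and surj: "p ` carrier F = carrier T"
    using assms(4) by (auto simp: short_exact_def)
  have "\<exists>\<rho>\<in>mod_hom R F X. \<forall>x\<in>carrier X. \<rho> (i x) = h x" if "h \<in> triv_maps R X X" for h
    using that
  proof induction
    case (zero h)
    then show ?case by (intro bexI[of _ "\<lambda>_. \<zero>\<^bsub>X\<^esub>"] X.mod_hom_null) simp
  next
    case (step f \<phi> y h)
    then obtain \<rho> where \<rho>: "\<rho> \<in> mod_hom R F X" "\<forall>x\<in>carrier X. \<rho> (i x) = f x" by blast
    obtain \<psi> where \<psi>: "\<psi> \<in> mod_hom R F (regular_module R)" "\<forall>x\<in>carrier X. \<psi> (i x) = \<phi> x"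
      using res_sequence.form_extends[OF S V step.hyps(2)] by blast
    have "(\<lambda>z. \<rho> z \<oplus>\<^bsub>X\<^esub> \<psi> z \<odot>\<^bsub>X\<^esub> y) \<in> mod_hom R F X"
      by (intro X.mod_hom_plus assms(2) \<rho> FX.smult_vector_hom \<psi> step.hyps(3))
    then show ?case
    proof (rule rev_bexI, intro ballI)
      fix x assume x: "x \<in> carrier X"
      show "\<rho> (i x) \<oplus>\<^bsub>X\<^esub> \<psi> (i x) \<odot>\<^bsub>X\<^esub> y = h x"
        using bspec[OF \<rho>(2) x] bspec[OF \<psi>(2) x] bspec[OF step.hyps(4) x] by (simp only:)
    qed
  qed
  from this[OF assms(5)] obtain \<rho> where \<rho>: "\<rho> \<in> mod_hom R F X" "\<forall>x\<in>carrier X. \<rho> (i x) = id x" by blast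
  note rc = mod_hom_closed[OF \<rho>(1)] and ic = mod_hom_closed[OF i] and pc = mod_hom_closed[OF p]
  let ?e = "\<lambda>f. id f \<ominus>\<^bsub>F\<^esub> (i \<circ> \<rho>) f"
  have "?e \<in> mod_hom R F F"
    by (intro F.mod_hom_diff assms mod_hom_id mod_hom_comp[OF \<rho>(1) i])
  moreover have "?e f = \<zero>\<^bsub>F\<^esub>" if f: "f \<in> carrier F" "p f = \<zero>\<^bsub>T\<^esub>" for f
  proof -
    have "f \<in> i ` carrier X" using f im by simp
    then obtain x where "x \<in> carrier X" "f = i x" by auto
    then show ?thesis using \<rho>(2) f by (simp add: F.minus_self)
  qed
  ultimately obtain s where s: "s \<in> mod_hom R T F" "\<forall>f\<in>carrier F. s (p f) = ?e f"
    using factor_through_surjection[OF assms(2,3,2) p surj, of ?e] by blast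
  have "p (s t) = t" if t: "t \<in> carrier T" for t
  proof -
    have "t \<in> p ` carrier F" using t surj by simp
    then obtain f where f: "f \<in> carrier F" "t = p f" by auto
    note ir = ic[OF rc[OF f(1)]]
    have "p (i (\<rho> f)) = \<zero>\<^bsub>T\<^esub>" by (rule res_sequence.pi_i[OF S rc[OF f(1)]])
    then have "p (f \<ominus>\<^bsub>F\<^esub> i (\<rho> f)) = p f"
      using mod_hom_minus[OF assms(2,3) p f(1) ir] pc[OF f(1)] by (simp add: T.minus_eq_iff)
    then show ?thesis using bspec[OF s(2) f(1)] f by simp
  qed
  then show ?thesis by (intro rev_bexI[OF s(1)] ballI)
qed

text \<open>Justifies the choice in \<open>cosyz_seq\<close>. The zero module is treated by hand,
  since \<open>MCM_krull_dim\<close> needs a nonzero maximal Cohen-Macaulay module to identify dim R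
  with r.\<close>

lemma cosyz_seq_valid:
  assumes "MCM R M"
  shows "fg_free R (cosyz_free R M)" "MCM R (cosyz R M)"
    "short_exact R M (cosyz_free R M) (cosyz R M) (cosyz_incl R M) (cosyz_proj R M)"
proof -
  have M: "rmodule R M" "fin_gen R M" using assms by (simp_all add: MCM_def rmodule_def)
  have ex: "\<exists>(F :: 'a umod) (T :: 'a umod) i p. fg_free R F \<and> MCM R T \<and> short_exact R M F T i p"
  proof (cases "carrier M = {\<zero>\<^bsub>M\<^esub>}")
    case False
    then have "krull_dim R = enat r" by (rule MCM_krull_dim[OF assms])
    then obtain m i p and T :: "'a umod" where "MCM R T" "short_exact R M (free_mod R m) T i p"
      using cosyzygy_exists[OF _ M MCM_Van[OF assms]] by blast
    then show ?thesis
      by (intro exI[of _ "free_mod R m"] exI[of _ T] exI[of _ i] exI[of _ p] conjI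
          fg_free_free_mod[OF one_neq_zero])
  next
    case True
    interpret M: rmodule R M by (rule M)
    let ?F = "free_mod R 0"
    interpret F: rmodule R ?F by (rule rmodule_free_mod)
    have F0: "carrier ?F = {\<zero>\<^bsub>?F\<^esub>}" by (auto simp: free_mod_def)
    have "MCM R ?F"
      using F0 rmodule_free_mod[of 0] fg_free_fin_gen[OF fg_free_free_mod[OF one_neq_zero]]
      by (simp add: MCM_def rmodule_def)
    moreover have "short_exact R M ?F ?F (\<lambda>_. \<zero>\<^bsub>?F\<^esub>) id"
      unfolding short_exact_def using True F0 F.mod_hom_null mod_hom_id by (auto simp: inj_on_def)
    ultimately show ?thesis
      by (intro exI[of _ ?F] exI[of _ "\<lambda>_. \<zero>\<^bsub>?F\<^esub>"] exI[of _ id] conjI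
          fg_free_free_mod[OF one_neq_zero])
  qed
  obtain F T i p where s: "cosyz_seq R M = (F, T, i, p)" by (cases "cosyz_seq R M") auto
  have "case cosyz_seq R M of (F, T, i, p) \<Rightarrow> fg_free R F \<and> MCM R T \<and> short_exact R M F T i p"
    unfolding cosyz_seq_def by (rule someI_ex) (use ex in auto)
  then show "fg_free R (cosyz_free R M)" "MCM R (cosyz R M)"
    "short_exact R M (cosyz_free R M) (cosyz R M) (cosyz_incl R M) (cosyz_proj R M)"
    by (simp_all add: s cosyz_free_def cosyz_def cosyz_incl_def cosyz_proj_def)
qed

end

lemma gorenstein_top_degree:
  fixes R :: "('a, 'r) ring_scheme"
  assumes "gorenstein_local_ring R"
  shows "\<exists>n I \<epsilon> d r. top_degree R n I \<epsilon> d r"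
proof -
  have loc: "noetherian_local R" using assms by (simp add: gorenstein_local_ring_def noetherian_local_def)
  obtain n :: nat and I :: "nat \<Rightarrow> 'a umod" and \<epsilon> d where *:
    "\<forall>i. injective_module R (I i)" "\<forall>i>n. carrier (I i) = {\<zero>\<^bsub>I i\<^esub>}"
    "\<epsilon> \<in> mod_hom R (regular_module R) (I 0)" "inj_on \<epsilon> (carrier (regular_module R))"
    "\<epsilon> ` carrier (regular_module R) = {x \<in> carrier (I 0). d 0 x = \<zero>\<^bsub>I (Suc 0)\<^esub>}"
    "\<forall>i. d i \<in> mod_hom R (I i) (I (Suc i)) \<and>
      d i ` carrier (I i) = {x \<in> carrier (I (Suc i)). d (Suc i) x = \<zero>\<^bsub>I (Suc (Suc i))\<^esub>}"
    using conjunct2[OF assms[unfolded gorenstein_local_ring_def]] unfolding finite_injdim_def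
    by (elim exE conjE) (rule that)
  have res: "injective_resolution R n I \<epsilon> d"
    using * by (intro injective_resolution.intro loc injective_resolution_axioms.intro) simp_all
  then interpret injective_resolution R n I \<epsilon> d .
  obtain r where "\<forall>s>r. \<forall>N. rmodule R N \<and> fin_gen R N \<longrightarrow> Van s N" "\<forall>N. residue_module N \<longrightarrow> \<not> Van r N"
    using top_degree_exists by blast
  then have "top_degree R n I \<epsilon> d r" by (intro top_degree.intro res top_degree_axioms.intro) simp_all
  then show ?thesis by blast
qed

section \<open>Stable retracts\<close>

definition stable_retract ::
  "('a, 'r) ring_scheme \<Rightarrow> ('a, 'm) module \<Rightarrow> ('a, 'n) module \<Rightarrow> bool" where
  "stable_retract R X Y \<longleftrightarrow>
     (\<exists>f\<in>mod_hom R X Y. \<exists>g\<in>mod_hom R Y X. stably_eq R X X (g \<circ> f) id)"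

lemma stable_retract_trans:
  assumes "rmodule R X" "rmodule R Y" "rmodule R Z" "stable_retract R X Y" "stable_retract R Y Z"
  shows "stable_retract R X Z"
proof -
  obtain f g where f: "f \<in> mod_hom R X Y" "g \<in> mod_hom R Y X" "stably_eq R X X (g \<circ> f) id"
    using assms(4) unfolding stable_retract_def by (elim bexE) (rule that)
  obtain f' g' where f': "f' \<in> mod_hom R Y Z" "g' \<in> mod_hom R Z Y" "stably_eq R Y Y (g' \<circ> f') id"
    using assms(5) unfolding stable_retract_def by (elim bexE) (rule that)
  interpret XX: rmodule2 R X X using assms by (simp add: rmodule2_def)
  interpret YY: rmodule2 R Y Y using assms by (simp add: rmodule2_def)
  interpret YX: rmodule2 R Y X using assms by (simp add: rmodule2_def)
  note g'f' = mod_hom_comp[OF f'(1,2)]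
  have "stably_eq R Y X (g \<circ> (g' \<circ> f')) (g \<circ> id)"
    by (rule YY.stably_eq_comp_left[OF g'f' mod_hom_id f(2) assms(1) f'(3)])
  then have "stably_eq R X X (g \<circ> (g' \<circ> f') \<circ> f) (g \<circ> id \<circ> f)"
    by (rule YX.stably_eq_comp_right[OF f(1)])
  then have "stably_eq R X X (g \<circ> (g' \<circ> f') \<circ> f) (g \<circ> f)" by simp
  then have "stably_eq R X X (g \<circ> (g' \<circ> f') \<circ> f) id"
    by (rule XX.stably_eq_trans[rotated 3])
      (intro f mod_hom_id mod_hom_comp[OF f(1) mod_hom_comp[OF g'f' f(2)]] mod_hom_comp[OF f(1,2)])+
  then have "stably_eq R X X ((g \<circ> g') \<circ> (f' \<circ> f)) id" by (simp add: o_assoc)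
  then show ?thesis
    unfolding stable_retract_def
    by (intro bexI[OF _ mod_hom_comp[OF f(1) f'(1)]] bexI[OF _ mod_hom_comp[OF f'(2) f(2)]])
qed

lemma stable_retract_trivial:
  assumes "rmodule R X" "rmodule R Y" "stable_retract R X Y" "id \<in> triv_maps R Y Y"
  shows "id \<in> triv_maps R X X"
proof -
  obtain f g where f: "f \<in> mod_hom R X Y" "g \<in> mod_hom R Y X" "stably_eq R X X (g \<circ> f) id"
    using assms(3) unfolding stable_retract_def by (elim bexE) (rule that)
  interpret XX: rmodule2 R X X using assms by (simp add: rmodule2_def)
  interpret YY: rmodule2 R Y Y using assms by (simp add: rmodule2_def)
  interpret YX: rmodule2 R Y X using assms by (simp add: rmodule2_def)
  have "g \<circ> id \<circ> f \<in> triv_maps R X X"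
    by (rule YX.triv_maps_comp_right[OF YY.triv_maps_comp_left[OF assms(4) f(2) assms(1)] f(1)])
  then have t: "g \<circ> f \<in> triv_maps R X X" by simp
  have gf: "g \<circ> f \<in> mod_hom R X X" by (rule mod_hom_comp[OF f(1,2)])
  have z: "stably_eq R X X (g \<circ> f) (\<lambda>_. \<zero>\<^bsub>X\<^esub>)" using XX.stably_eq_zero_iff[OF gf] t by simp
  have s: "stably_eq R X X id (g \<circ> f)" by (rule XX.stably_eq_sym[OF gf mod_hom_id f(3)])
  have "stably_eq R X X id (\<lambda>_. \<zero>\<^bsub>X\<^esub>)"
    by (rule XX.stably_eq_trans[OF mod_hom_id gf rmodule.mod_hom_null[OF assms(1)] s z])
  then show ?thesis using XX.stably_eq_zero_iff[OF mod_hom_id] by simp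
qed

text \<open>The maps i k after p k are stably orthogonal idempotents of M. None of them is stably
  zero: surrounding one with p k and i k gives the square of p k i k, which is stably the identity
  of X k.\<close>

lemma (in local_module) stable_summands_bounded:
  assumes "fin_gen R M"
  shows "\<exists>n. \<forall>(K :: nat set) X i p. finite K \<and>
    (\<forall>k\<in>K. rmodule R (X k :: ('a, 'x) module) \<and> i k \<in> mod_hom R (X k) M \<and> p k \<in> mod_hom R M (X k) \<and>
      stably_eq R (X k) (X k) (p k \<circ> i k) id \<and> id \<notin> triv_maps R (X k) (X k)) \<and>
    (\<forall>j\<in>K. \<forall>k\<in>K. j \<noteq> k \<longrightarrow> p j \<circ> i k \<in> triv_maps R (X k) (X j)) \<longrightarrow> card K \<le> n"
proof -
  obtain n where n: "\<forall>(K :: nat set) f. finite K \<and> (\<forall>i\<in>K. f i \<in> mod_hom R M M) \<and>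
    (\<forall>i\<in>K. stably_eq R M M (f i \<circ> f i) (f i)) \<and>
    (\<forall>i\<in>K. \<forall>j\<in>K. i \<noteq> j \<longrightarrow> stably_eq R M M (f j \<circ> f i) (\<lambda>_. \<zero>\<^bsub>M\<^esub>)) \<and>
    (\<forall>i\<in>K. f i \<notin> triv_maps R M M) \<longrightarrow> card K \<le> n"
    using orthogonal_idempotents_bounded[OF assms] by (rule exE)
  interpret MM: rmodule2 R M M by intro_locales
  note M = rmodule_axioms
  show ?thesis
  proof (intro exI allI impI)
    fix K :: "nat set" and X :: "nat \<Rightarrow> ('a, 'x) module" and i p
    assume *: "finite K \<and>
      (\<forall>k\<in>K. rmodule R (X k) \<and> i k \<in> mod_hom R (X k) M \<and> p k \<in> mod_hom R M (X k) \<and>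
        stably_eq R (X k) (X k) (p k \<circ> i k) id \<and> id \<notin> triv_maps R (X k) (X k)) \<and>
      (\<forall>j\<in>K. \<forall>k\<in>K. j \<noteq> k \<longrightarrow> p j \<circ> i k \<in> triv_maps R (X k) (X j))"
    have X: "rmodule R (X k)" and i: "i k \<in> mod_hom R (X k) M" and p: "p k \<in> mod_hom R M (X k)"
      and pi: "stably_eq R (X k) (X k) (p k \<circ> i k) id" and nt: "id \<notin> triv_maps R (X k) (X k)"
      if "k \<in> K" for k using * that by simp_all
    have orth: "p j \<circ> i k \<in> triv_maps R (X k) (X j)" if "j \<in> K" "k \<in> K" "j \<noteq> k" for j k
      using * that by simp
    have f: "i k \<circ> p k \<in> mod_hom R M M" if "k \<in> K" for k by (rule mod_hom_comp[OF p[OF that] i[OF that]])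
    have idem: "stably_eq R M M ((i k \<circ> p k) \<circ> (i k \<circ> p k)) (i k \<circ> p k)" if k: "k \<in> K" for k
    proof -
      interpret XX: rmodule2 R "X k" "X k" using X[OF k] by (simp add: rmodule2_def)
      interpret XM: rmodule2 R "X k" M using X[OF k] M by (simp add: rmodule2_def)
      have "stably_eq R (X k) M (i k \<circ> (p k \<circ> i k)) (i k \<circ> id)"
        by (rule XX.stably_eq_comp_left[OF mod_hom_comp[OF i[OF k] p[OF k]] mod_hom_id i[OF k] M pi[OF k]])
      then have "stably_eq R M M (i k \<circ> (p k \<circ> i k) \<circ> p k) (i k \<circ> id \<circ> p k)"
        by (rule XM.stably_eq_comp_right[OF p[OF k]])
      then show ?thesis by (simp add: o_assoc)
    qed
    have ort: "stably_eq R M M ((i j \<circ> p j) \<circ> (i k \<circ> p k)) (\<lambda>_. \<zero>\<^bsub>M\<^esub>)"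
      if jk: "k \<in> K" "j \<in> K" "k \<noteq> j" for j k
    proof -
      interpret XJ: rmodule2 R "X k" "X j" using X[OF jk(1)] X[OF jk(2)] by (simp add: rmodule2_def)
      interpret XM: rmodule2 R "X k" M using X[OF jk(1)] M by (simp add: rmodule2_def)
      have "p j \<circ> i k \<in> triv_maps R (X k) (X j)" by (rule orth[OF jk(2,1)]) (use jk(3) in simp)
      then have "i j \<circ> (p j \<circ> i k) \<in> triv_maps R (X k) M" by (rule XJ.triv_maps_comp_left[OF _ i[OF jk(2)] M])
      then have "i j \<circ> (p j \<circ> i k) \<circ> p k \<in> triv_maps R M M" by (rule XM.triv_maps_comp_right[OF _ p[OF jk(1)]])
      then have "(i j \<circ> p j) \<circ> (i k \<circ> p k) \<in> triv_maps R M M" by (simp add: o_assoc)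
      then show ?thesis using MM.stably_eq_zero_iff[OF mod_hom_comp[OF f[OF jk(1)] f[OF jk(2)]]] by simp
    qed
    have ntriv: "i k \<circ> p k \<notin> triv_maps R M M" if k: "k \<in> K" for k
    proof
      assume t: "i k \<circ> p k \<in> triv_maps R M M"
      interpret XX: rmodule2 R "X k" "X k" using X[OF k] by (simp add: rmodule2_def)
      interpret MX: rmodule2 R M "X k" using X[OF k] M by (simp add: rmodule2_def)
      let ?u = "p k \<circ> i k"
      note u = mod_hom_comp[OF i[OF k] p[OF k]]
      have "p k \<circ> (i k \<circ> p k) \<circ> i k \<in> triv_maps R (X k) (X k)"
        by (rule MX.triv_maps_comp_right[OF MM.triv_maps_comp_left[OF t p[OF k] X[OF k]] i[OF k]])
      then have uu: "?u \<circ> ?u \<in> triv_maps R (X k) (X k)" by (simp add: o_assoc)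
      have "stably_eq R (X k) (X k) (?u \<circ> ?u) (id \<circ> id)"
        by (rule stably_eq_comp[OF X[OF k] X[OF k] X[OF k] u mod_hom_id u mod_hom_id pi[OF k] pi[OF k]])
      then have s: "stably_eq R (X k) (X k) id (?u \<circ> ?u)"
        using XX.stably_eq_sym[OF mod_hom_comp[OF u u] mod_hom_id] by simp
      have z: "stably_eq R (X k) (X k) (?u \<circ> ?u) (\<lambda>_. \<zero>\<^bsub>X k\<^esub>)"
        using XX.stably_eq_zero_iff[OF mod_hom_comp[OF u u]] uu by simp
      have "stably_eq R (X k) (X k) id (\<lambda>_. \<zero>\<^bsub>X k\<^esub>)"
        by (rule XX.stably_eq_trans[OF mod_hom_id mod_hom_comp[OF u u] rmodule.mod_hom_null[OF X[OF k]] s z])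
      then show False using XX.stably_eq_zero_iff[OF mod_hom_id] nt[OF k] by simp
    qed
    show "card K \<le> n"
      by (rule n[rule_format, of K "\<lambda>k. i k \<circ> p k"]) (intro conjI ballI impI; (rule f idem ort ntriv)?; use * in simp)
  qed
qed

section \<open>The stable category\<close>

lemma stable_CM_simps [simp]:
  "Obj (stable_CM R) = {M. MCM R M}"
  "Hom (stable_CM R) M N = stable_class R M N ` mod_hom R M N"
  "Ident (stable_CM R) M = stable_class R M M id"
  "Comp (stable_CM R) = stable_comp R"
  "Plus (stable_CM R) = stable_plus R"
  "Null (stable_CM R) M N = stable_class R M N (\<lambda>_. \<zero>\<^bsub>N\<^esub>)"
  "Tri (stable_CM R) = distinguished_triangles R"
  by (simp_all add: stable_CM_def stable_shift_cat_def shift_cat.defs tri_cat.defs)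

lemma stable_shift_cat_simps [simp]:
  "Obj (stable_shift_cat R) = {M. MCM R M}"
  "Hom (stable_shift_cat R) M N = stable_class R M N ` mod_hom R M N"
  "Ident (stable_shift_cat R) M = stable_class R M M id"
  "Comp (stable_shift_cat R) = stable_comp R"
  by (simp_all add: stable_shift_cat_def)

lemma MCM_rmodule: "MCM R M \<Longrightarrow> rmodule R M"
  by (simp add: MCM_def rmodule_def)

context noetherian_local
begin

lemma stable_class_eq_iff:
  fixes M N :: "'a umod"
  assumes "rmodule R M" "rmodule R N" "f \<in> mod_hom R M N" "g \<in> mod_hom R M N"
  shows "stable_class R M N f = stable_class R M N g \<longleftrightarrow> stably_eq R M N f g"
proof -
  interpret MN: rmodule2 R M N using assms by (simp add: rmodule2_def)
  show ?thesis
  proof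
    assume "stable_class R M N f = stable_class R M N g"
    then have "{h \<in> mod_hom R M N. stably_equal R M N f h} = {h \<in> mod_hom R M N. stably_equal R M N g h}"
      by (simp add: stable_class_def)
    moreover have "g \<in> {h \<in> mod_hom R M N. stably_equal R M N g h}"
      using assms MN.stably_eq_refl by (simp add: stably_equal_iff)
    ultimately have "g \<in> {h \<in> mod_hom R M N. stably_equal R M N f h}" by (simp only:)
    then show "stably_eq R M N f g" using assms by (simp add: stably_equal_iff)
  next
    assume fg: "stably_eq R M N f g"
    have "stably_eq R M N f h \<longleftrightarrow> stably_eq R M N g h" if "h \<in> mod_hom R M N" for h
      using MN.stably_eq_trans[OF assms(3,4) that fg] MN.stably_eq_trans[OF assms(4,3) that MN.stably_eq_sym[OF assms(3,4) fg]]
      by blast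
    then show "stable_class R M N f = stable_class R M N g"
      unfolding stable_class_def stably_equal_iff[OF assms(1,2)] by (intro arg_cong2[where f = Pair] refl Collect_cong conj_cong)
  qed
qed

lemma stable_comp_class:
  fixes L M N :: "'a umod"
  assumes "rmodule R L" "rmodule R M" "rmodule R N" "f \<in> mod_hom R L M" "g \<in> mod_hom R M N"
  shows "stable_comp R (stable_class R M N g) (stable_class R L M f) = stable_class R L N (g \<circ> f)"
proof -
  interpret LM: rmodule2 R L M using assms by (simp add: rmodule2_def)
  interpret MN: rmodule2 R M N using assms by (simp add: rmodule2_def)
  interpret LN: rmodule2 R L N using assms by (simp add: rmodule2_def)
  have gf: "g \<circ> f \<in> mod_hom R L N" by (rule mod_hom_comp[OF assms(4,5)])
  have "(\<exists>g'\<in>{g' \<in> mod_hom R M N. stably_eq R M N g g'}. \<exists>f'\<in>{f' \<in> mod_hom R L M. stably_eq R L M f f'}.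
      stably_eq R L N (g' \<circ> f') h) \<longleftrightarrow> stably_eq R L N (g \<circ> f) h" if h: "h \<in> mod_hom R L N" for h
  proof
    assume "\<exists>g'\<in>{g' \<in> mod_hom R M N. stably_eq R M N g g'}. \<exists>f'\<in>{f' \<in> mod_hom R L M. stably_eq R L M f f'}.
      stably_eq R L N (g' \<circ> f') h"
    then obtain g' f' where *: "g' \<in> mod_hom R M N" "stably_eq R M N g g'" "f' \<in> mod_hom R L M"
      "stably_eq R L M f f'" "stably_eq R L N (g' \<circ> f') h" by blast
    have "stably_eq R L N (g \<circ> f) (g' \<circ> f')"
      by (rule stably_eq_comp[OF assms(1-4) *(3) assms(5) *(1,4,2)])
    then show "stably_eq R L N (g \<circ> f) h"
      by (rule LN.stably_eq_trans[OF gf mod_hom_comp[OF *(3,1)] h _ *(5)])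
  next
    assume "stably_eq R L N (g \<circ> f) h"
    then show "\<exists>g'\<in>{g' \<in> mod_hom R M N. stably_eq R M N g g'}. \<exists>f'\<in>{f' \<in> mod_hom R L M. stably_eq R L M f f'}.
      stably_eq R L N (g' \<circ> f') h"
      using assms(4,5) MN.stably_eq_refl[OF assms(5)] LM.stably_eq_refl[OF assms(4)]
      by (intro bexI[of _ g] bexI[of _ f]) simp_all
  qed
  then show ?thesis
    unfolding stable_comp_def stable_class_def prod.case
      stably_equal_iff[OF assms(1,2)] stably_equal_iff[OF assms(2,3)] stably_equal_iff[OF assms(1,3)]
    by (intro arg_cong2[where f = Pair] refl Collect_cong conj_cong)
qed

lemma stable_plus_class:
  fixes M N :: "'a umod"
  assumes "rmodule R M" "rmodule R N" "f \<in> mod_hom R M N" "g \<in> mod_hom R M N"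
  shows "stable_plus R (stable_class R M N f) (stable_class R M N g) = stable_class R M N (\<lambda>x. f x \<oplus>\<^bsub>N\<^esub> g x)"
proof -
  interpret MN: rmodule2 R M N using assms by (simp add: rmodule2_def)
  note fg = MN.N.mod_hom_plus[OF assms(1,3,4)]
  have "(\<exists>f'\<in>{f' \<in> mod_hom R M N. stably_eq R M N f f'}. \<exists>g'\<in>{g' \<in> mod_hom R M N. stably_eq R M N g g'}.
      stably_eq R M N (\<lambda>x. f' x \<oplus>\<^bsub>N\<^esub> g' x) h) \<longleftrightarrow> stably_eq R M N (\<lambda>x. f x \<oplus>\<^bsub>N\<^esub> g x) h"
    if h: "h \<in> mod_hom R M N" for h
  proof
    assume "\<exists>f'\<in>{f' \<in> mod_hom R M N. stably_eq R M N f f'}. \<exists>g'\<in>{g' \<in> mod_hom R M N. stably_eq R M N g g'}.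
      stably_eq R M N (\<lambda>x. f' x \<oplus>\<^bsub>N\<^esub> g' x) h"
    then obtain f' g' where *: "f' \<in> mod_hom R M N" "stably_eq R M N f f'" "g' \<in> mod_hom R M N"
      "stably_eq R M N g g'" "stably_eq R M N (\<lambda>x. f' x \<oplus>\<^bsub>N\<^esub> g' x) h" by blast
    have "stably_eq R M N (\<lambda>x. f x \<oplus>\<^bsub>N\<^esub> g x) (\<lambda>x. f' x \<oplus>\<^bsub>N\<^esub> g' x)"
      by (rule MN.stably_eq_add[OF assms(3,4) *(1,3,2,4)])
    then show "stably_eq R M N (\<lambda>x. f x \<oplus>\<^bsub>N\<^esub> g x) h"
      by (rule MN.stably_eq_trans[OF fg MN.N.mod_hom_plus[OF assms(1) *(1,3)] h _ *(5)])
  next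
    assume "stably_eq R M N (\<lambda>x. f x \<oplus>\<^bsub>N\<^esub> g x) h"
    then show "\<exists>f'\<in>{f' \<in> mod_hom R M N. stably_eq R M N f f'}. \<exists>g'\<in>{g' \<in> mod_hom R M N. stably_eq R M N g g'}.
      stably_eq R M N (\<lambda>x. f' x \<oplus>\<^bsub>N\<^esub> g' x) h"
      using assms(3,4) MN.stably_eq_refl[OF assms(3)] MN.stably_eq_refl[OF assms(4)]
      by (intro bexI[of _ f] bexI[of _ g]) simp_all
  qed
  then show ?thesis
    unfolding stable_plus_def stable_class_def prod.case stably_equal_iff[OF assms(1,2)]
    by (intro arg_cong2[where f = Pair] refl Collect_cong conj_cong)
qed

text \<open>The identity of a zero object equals its zero endomorphism; conversely every map to or
  from Z passes through the identity of Z, which is then stably zero.\<close>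

lemma zero_object_iff:
  "zero_object (stable_CM R) Z \<longleftrightarrow> MCM R Z \<and> id \<in> triv_maps R Z Z"
proof (cases "MCM R Z")
  case True
  note Z = MCM_rmodule[OF True]
  interpret ZZ: rmodule2 R Z Z using Z by (simp add: rmodule2_def)
  show ?thesis
  proof
    assume "zero_object (stable_CM R) Z"
    then have "\<exists>!f. f \<in> Hom (stable_CM R) Z Z" using True by (simp add: zero_object_def)
    moreover have "stable_class R Z Z id \<in> Hom (stable_CM R) Z Z" by (simp add: mod_hom_id)
    moreover have "stable_class R Z Z (\<lambda>_. \<zero>\<^bsub>Z\<^esub>) \<in> Hom (stable_CM R) Z Z"
      unfolding stable_CM_simps by (rule imageI[OF rmodule.mod_hom_null[OF Z]])
    ultimately have "stable_class R Z Z id = stable_class R Z Z (\<lambda>_. \<zero>\<^bsub>Z\<^esub>)" by blast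
    then show "MCM R Z \<and> id \<in> triv_maps R Z Z"
      using True stable_class_eq_iff[OF Z Z mod_hom_id rmodule.mod_hom_null[OF Z]] ZZ.stably_eq_zero_iff[OF mod_hom_id] by simp
  next
    assume t: "MCM R Z \<and> id \<in> triv_maps R Z Z"
    have "(\<exists>!f. f \<in> Hom (stable_CM R) X Z) \<and> (\<exists>!f. f \<in> Hom (stable_CM R) Z X)" if "MCM R X" for X
    proof -
      note X = MCM_rmodule[OF that]
      interpret X: rmodule R X by (rule X)
      interpret XZ: rmodule2 R X Z using X Z by (simp add: rmodule2_def)
      interpret ZX: rmodule2 R Z X using X Z by (simp add: rmodule2_def)
      have "stable_class R X Z f = stable_class R X Z (\<lambda>_. \<zero>\<^bsub>Z\<^esub>)" if f: "f \<in> mod_hom R X Z" for f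
        using ZZ.triv_maps_comp_right[OF conjunct2[OF t] f] XZ.stably_eq_zero_iff[OF f]
          stable_class_eq_iff[OF X Z f rmodule.mod_hom_null[OF Z]] by simp
      moreover have "stable_class R Z X f = stable_class R Z X (\<lambda>_. \<zero>\<^bsub>X\<^esub>)" if f: "f \<in> mod_hom R Z X" for f
        using ZZ.triv_maps_comp_left[OF conjunct2[OF t] f X] ZX.stably_eq_zero_iff[OF f]
          stable_class_eq_iff[OF Z X f X.mod_hom_null] by simp
      ultimately show ?thesis
        unfolding stable_CM_simps
        by (intro conjI ex1I[of _ "stable_class R X Z (\<lambda>_. \<zero>\<^bsub>Z\<^esub>)"]
            ex1I[of _ "stable_class R Z X (\<lambda>_. \<zero>\<^bsub>X\<^esub>)"]
            imageI[OF rmodule.mod_hom_null[OF Z]] imageI[OF X.mod_hom_null]) (elim imageE; simp)+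
    qed
    then show "zero_object (stable_CM R) Z" using t unfolding zero_object_def by simp
  qed
qed (simp add: zero_object_def)

lemma iso_stable_retract:
  assumes "MCM R X" "MCM R Y" "is_iso (stable_shift_cat R) X Y a"
  shows "stable_retract R X Y" "stable_retract R Y X"
proof -
  note X = MCM_rmodule[OF assms(1)] and Y = MCM_rmodule[OF assms(2)]
  obtain f g where f: "f \<in> mod_hom R X Y" "g \<in> mod_hom R Y X"
    and *: "stable_comp R (stable_class R Y X g) (stable_class R X Y f) = stable_class R X X id"
      "stable_comp R (stable_class R X Y f) (stable_class R Y X g) = stable_class R Y Y id"
    using assms(3) unfolding is_iso_def by (auto simp del: id_apply)
  have "stable_class R X X (g \<circ> f) = stable_class R X X id"
    using *(1) unfolding stable_comp_class[OF X Y X f] .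
  then have 1: "stably_eq R X X (g \<circ> f) id"
    by (rule iffD1[OF stable_class_eq_iff[OF X X mod_hom_comp[OF f] mod_hom_id]])
  have "stable_class R Y Y (f \<circ> g) = stable_class R Y Y id"
    using *(2) unfolding stable_comp_class[OF Y X Y f(2,1)] .
  then have 2: "stably_eq R Y Y (f \<circ> g) id"
    by (rule iffD1[OF stable_class_eq_iff[OF Y Y mod_hom_comp[OF f(2,1)] mod_hom_id]])
  show "stable_retract R X Y" "stable_retract R Y X"
    unfolding stable_retract_def using f 1 2 by blast+
qed

end

context top_degree
begin

text \<open>For stably trivial X the co-syzygy row splits by \<open>cosyzygy_section\<close>, and
  the second map of the triangle has a stable left inverse. For stably trivial Z the first map has a
  stable right inverse.\<close>

lemma standard_triangle_retract:
  assumes "(X, Y, Z, u, v, w) \<in> standard_triangles R"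
  shows "MCM R X \<and> MCM R Y \<and> MCM R Z"
    and "id \<in> triv_maps R X X \<Longrightarrow> stable_retract R Y Z"
    and "id \<in> triv_maps R Z Z \<Longrightarrow> stable_retract R Y X"
proof -
  obtain u' v' w' k where M: "MCM R X" "MCM R Y" "MCM R Z" and u: "u' \<in> mod_hom R X Y"
    and se: "short_exact R Y Z (cosyz R X) v' w'" and k: "k \<in> mod_hom R (cosyz_free R X) Z"
    "\<forall>x\<in>carrier X. k (cosyz_incl R X x) = v' (u' x)"
    "\<forall>y\<in>carrier (cosyz_free R X). w' (k y) = cosyz_proj R X y"
    using assms unfolding standard_triangles_def by blast
  show "MCM R X \<and> MCM R Y \<and> MCM R Z" using M by simp
  note c = cosyz_seq_valid[OF M(1)]
  note rm = MCM_rmodule[OF M(1)] MCM_rmodule[OF M(2)] MCM_rmodule[OF M(3)]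
    fg_free_rmodule[OF c(1)] MCM_rmodule[OF c(2)]
  have P: "pushout_diagram R X Y Z (cosyz_free R X) (cosyz R X) (cosyz_incl R X) (cosyz_proj R X) u' v' w' k"
    by (intro pushout_diagram.intro pushout_diagram_axioms.intro rm c(3) se u k(1) bspec[OF k(2)] bspec[OF k(3)])
  have v': "v' \<in> mod_hom R Y Z" using se by (simp add: short_exact_def)
  show "stable_retract R Y Z" if t: "id \<in> triv_maps R X X"
  proof -
    obtain s where s: "s \<in> mod_hom R (cosyz R X) (cosyz_free R X)"
      "\<forall>t\<in>carrier (cosyz R X). cosyz_proj R X (s t) = t"
      using cosyzygy_section[OF rm(1,4,5) c(3) t MCM_Van[OF c(2)]] by (elim bexE) (rule that)
    have "\<exists>\<sigma>\<in>mod_hom R Z Y. stably_eq R Y Y (\<sigma> \<circ> v') id"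
      by (rule pushout_diagram.stable_retract_if_section[OF P t s(1) bspec[OF s(2)]])
    then show ?thesis unfolding stable_retract_def by (rule rev_bexI[OF v'])
  qed
  show "stable_retract R Y X" if t: "id \<in> triv_maps R Z Z"
  proof -
    obtain \<tau> where "\<tau> \<in> mod_hom R Y X" "stably_eq R Y Y (u' \<circ> \<tau>) id"
      using pushout_diagram.stable_retract_if_cone_trivial[OF P t] by (elim bexE) (rule that)
    then show ?thesis unfolding stable_retract_def by (intro rev_bexI[of \<tau>] rev_bexI[OF u])
  qed
qed

text \<open>Stable triviality and stable retracts pass along the isomorphisms of the vertices with a
  standard triangle.\<close>

lemma distinguished_triangle_retract:
  assumes "(X, Y, Z, u, v, w) \<in> distinguished_triangles R"
  shows "id \<in> triv_maps R X X \<Longrightarrow> stable_retract R Y Z"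
    and "id \<in> triv_maps R Z Z \<Longrightarrow> stable_retract R Y X"
proof -
  obtain t where M: "MCM R X" "MCM R Y" "MCM R Z" and t: "t \<in> standard_triangles R"
    "triangle_iso (stable_shift_cat R) t (X, Y, Z, u, v, w)"
    using assms unfolding distinguished_triangles_def Let_def by auto
  obtain X' Y' Z' u' v' w' where t': "t = (X', Y', Z', u', v', w')" by (cases t) auto
  obtain a b c where iso: "is_iso (stable_shift_cat R) X' X a" "is_iso (stable_shift_cat R) Y' Y b"
    "is_iso (stable_shift_cat R) Z' Z c"
    using t(2) unfolding t' triangle_iso_def by auto
  note st = standard_triangle_retract[OF t(1)[unfolded t']]
  have M': "MCM R X'" "MCM R Y'" "MCM R Z'" using st(1) by simp_all
  note rX = iso_stable_retract[OF M'(1) M(1) iso(1)] and rY = iso_stable_retract[OF M'(2) M(2) iso(2)]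
    and rZ = iso_stable_retract[OF M'(3) M(3) iso(3)]
  note m = MCM_rmodule[OF M(1)] MCM_rmodule[OF M(2)] MCM_rmodule[OF M(3)]
  note m' = MCM_rmodule[OF M'(1)] MCM_rmodule[OF M'(2)] MCM_rmodule[OF M'(3)]
  show "stable_retract R Y Z" if "id \<in> triv_maps R X X"
  proof -
    have "stable_retract R Y' Z'" by (rule st(2)[OF stable_retract_trivial[OF m'(1) m(1) rX(1) that]])
    then have "stable_retract R Y' Z" by (rule stable_retract_trans[OF m'(2,3) m(3) _ rZ(1)])
    then show ?thesis by (rule stable_retract_trans[OF m(2) m'(2) m(3) rY(2)])
  qed
  show "stable_retract R Y X" if "id \<in> triv_maps R Z Z"
  proof -
    have "stable_retract R Y' X'" by (rule st(3)[OF stable_retract_trivial[OF m'(3) m(3) rZ(1) that]])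
    then have "stable_retract R Y' X" by (rule stable_retract_trans[OF m'(2,1) m(1) _ rX(1)])
    then show ?thesis by (rule stable_retract_trans[OF m(2) m'(2) m(1) rY(2)])
  qed
qed

end

section \<open>Rigidity\<close>

text \<open>The functor carries the inclusions and projections of a direct sum to the image of E,
  and the retract moves them on to N, where \<open>stable_summands_bounded\<close> counts them. A
  summand outside the kernel has an image that is not stably zero. The bound comes from N alone and
  so is uniform in E and in the decomposition.\<close>

lemma summands_outside_kernel_bounded:
  fixes A :: "('a, 'r) ring_scheme" and B :: "('b, 's) ring_scheme"
    and \<Psi> :: "('a umod, 'a stable_arr, 'b umod, 'b stable_arr) tri_functor"
  assumes "noetherian_local A" "noetherian_local B"
    and \<Psi>: "triangulated_functor (stable_CM A) (stable_CM B) \<Psi>" and N: "MCM B N"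
  shows "\<exists>n. \<forall>E Xs. direct_sum (stable_CM A) Xs E \<and> stable_retract B (fobj \<Psi> E) N \<longrightarrow>
    card {k. k < length Xs \<and> Xs ! k \<notin> functor_ker (stable_CM A) (stable_CM B) \<Psi>} \<le> n"
proof -
  interpret A: noetherian_local A by fact
  interpret B: noetherian_local B by fact
  note rN = MCM_rmodule[OF N]
  interpret N: local_module B N by (intro local_module.intro assms(2) rN)
  note tf = \<Psi>[unfolded triangulated_functor_def stable_CM_simps]
  have Fobj: "MCM B (fobj \<Psi> X)" and Fid: "farr \<Psi> (stable_class A X X id) = stable_class B (fobj \<Psi> X) (fobj \<Psi> X) id"
    if "MCM A X" for X using conjunct1[OF tf] that by simp_all
  have Fhom: "\<exists>g\<in>mod_hom B (fobj \<Psi> X) (fobj \<Psi> Y). farr \<Psi> f = stable_class B (fobj \<Psi> X) (fobj \<Psi> Y) g"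
    if "MCM A X" "MCM A Y" "f \<in> stable_class A X Y ` mod_hom A X Y" for X Y f
  proof -
    have "farr \<Psi> f \<in> stable_class B (fobj \<Psi> X) (fobj \<Psi> Y) ` mod_hom B (fobj \<Psi> X) (fobj \<Psi> Y)"
      by (rule bspec[OF bspec[OF bspec[OF conjunct1[OF conjunct2[OF tf]]]]]) (use that in simp_all)
    then show ?thesis by (elim imageE) (rule bexI)
  qed
  have Fcomp: "farr \<Psi> (stable_comp A g f) = stable_comp B (farr \<Psi> g) (farr \<Psi> f)"
    if "MCM A X" "MCM A Y" "MCM A Z" "f \<in> stable_class A X Y ` mod_hom A X Y"
      "g \<in> stable_class A Y Z ` mod_hom A Y Z" for X Y Z f g
    by (rule bspec[OF bspec[OF bspec[OF bspec[OF bspec[OF conjunct1[OF conjunct2[OF conjunct2[OF tf]]]]]]]])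
      (rule CollectI that)+
  have Fplus: "farr \<Psi> (stable_plus A f g) = stable_plus B (farr \<Psi> f) (farr \<Psi> g)"
    if "MCM A X" "MCM A Y" "f \<in> stable_class A X Y ` mod_hom A X Y"
      "g \<in> stable_class A X Y ` mod_hom A X Y" for X Y f g
    by (rule bspec[OF bspec[OF bspec[OF bspec[OF conjunct1[OF conjunct2[OF conjunct2[OF conjunct2[OF tf]]]]]]]])
      (rule CollectI that)+
  \<comment> \<open>Preservation of zero maps is derived from additivity: the image z of a zero map
    satisfies z + z = z stably, so z is stably trivial.\<close>
  have Fnull: "z \<in> triv_maps B (fobj \<Psi> X) (fobj \<Psi> Y)"
    if X: "MCM A X" and Y: "MCM A Y" and z: "z \<in> mod_hom B (fobj \<Psi> X) (fobj \<Psi> Y)"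
      "farr \<Psi> (stable_class A X Y (\<lambda>_. \<zero>\<^bsub>Y\<^esub>)) = stable_class B (fobj \<Psi> X) (fobj \<Psi> Y) z" for X Y z
  proof -
    note rX = MCM_rmodule[OF X] and rY = MCM_rmodule[OF Y]
    note r = MCM_rmodule[OF Fobj[OF X]] MCM_rmodule[OF Fobj[OF Y]]
    interpret Y: rmodule A Y by (rule rY)
    interpret Z: rmodule2 B "fobj \<Psi> X" "fobj \<Psi> Y" using r by (simp add: rmodule2_def)
    let ?n = "stable_class A X Y (\<lambda>_. \<zero>\<^bsub>Y\<^esub>)"
    have n: "?n \<in> stable_class A X Y ` mod_hom A X Y" by (rule imageI[OF Y.mod_hom_null])
    have "stable_plus A ?n ?n = ?n"
      unfolding A.stable_plus_class[OF rX rY Y.mod_hom_null Y.mod_hom_null] by simp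
    then have "stable_class B (fobj \<Psi> X) (fobj \<Psi> Y) z =
      stable_plus B (stable_class B (fobj \<Psi> X) (fobj \<Psi> Y) z) (stable_class B (fobj \<Psi> X) (fobj \<Psi> Y) z)"
      using Fplus[OF X Y n n] z(2) by simp
    then have e: "stable_class B (fobj \<Psi> X) (fobj \<Psi> Y) z =
      stable_class B (fobj \<Psi> X) (fobj \<Psi> Y) (\<lambda>x. z x \<oplus>\<^bsub>fobj \<Psi> Y\<^esub> z x)"
      unfolding B.stable_plus_class[OF r z(1,1)] .
    have zz: "(\<lambda>x. z x \<oplus>\<^bsub>fobj \<Psi> Y\<^esub> z x) \<in> mod_hom B (fobj \<Psi> X) (fobj \<Psi> Y)"
      by (rule rmodule.mod_hom_plus[OF r(2,1) z(1,1)])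
    have "stably_eq B (fobj \<Psi> X) (fobj \<Psi> Y) (\<lambda>x. z x \<oplus>\<^bsub>fobj \<Psi> Y\<^esub> z x) z"
      by (rule iffD1[OF B.stable_class_eq_iff[OF r zz z(1)] e[symmetric]])
    then show ?thesis
      unfolding stably_eq_def
      by (rule triv_maps_cong) (simp add: rmodule.add_minus_cancel[OF r(2)] mod_hom_closed[OF z(1)])
  qed
  obtain n where n: "\<forall>(K :: nat set) (X :: nat \<Rightarrow> 'b umod) i p. finite K \<and>
    (\<forall>k\<in>K. rmodule B (X k) \<and> i k \<in> mod_hom B (X k) N \<and> p k \<in> mod_hom B N (X k) \<and>
      stably_eq B (X k) (X k) (p k \<circ> i k) id \<and> id \<notin> triv_maps B (X k) (X k)) \<and>
    (\<forall>j\<in>K. \<forall>k\<in>K. j \<noteq> k \<longrightarrow> p j \<circ> i k \<in> triv_maps B (X k) (X j)) \<longrightarrow> card K \<le> n"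
    using N.stable_summands_bounded N by (auto simp: MCM_def)
  show ?thesis
  proof (intro exI allI impI)
    fix E :: "'a umod" and Xs
    assume "direct_sum (stable_CM A) Xs E \<and> stable_retract B (fobj \<Psi> E) N"
    then have ds: "direct_sum (stable_CM A) Xs E" and "stable_retract B (fobj \<Psi> E) N" by simp_all
    from this(2) obtain f g where f: "f \<in> mod_hom B (fobj \<Psi> E) N" "g \<in> mod_hom B N (fobj \<Psi> E)"
      "stably_eq B (fobj \<Psi> E) (fobj \<Psi> E) (g \<circ> f) id" unfolding stable_retract_def by (elim bexE) (rule that)
    note ds' = ds[unfolded direct_sum_def stable_CM_simps]
    have E: "MCM A E" using ds' by simp
    have Xs: "MCM A (Xs ! k)" if "k < length Xs" for k using conjunct1[OF ds'] nth_mem[OF that] by blast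
    obtain \<iota> \<pi> where h: "\<forall>k<length Xs. \<iota> k \<in> stable_class A (Xs ! k) E ` mod_hom A (Xs ! k) E \<and>
        \<pi> k \<in> stable_class A E (Xs ! k) ` mod_hom A E (Xs ! k) \<and>
        stable_comp A (\<pi> k) (\<iota> k) = stable_class A (Xs ! k) (Xs ! k) id"
      and o: "\<forall>j<length Xs. \<forall>k<length Xs. j \<noteq> k \<longrightarrow>
        stable_comp A (\<pi> j) (\<iota> k) = stable_class A (Xs ! k) (Xs ! j) (\<lambda>_. \<zero>\<^bsub>Xs ! j\<^esub>)"
      using conjunct2[OF conjunct2[OF ds']] by (elim exE conjE) (rule that)
    let ?X = "\<lambda>k. fobj \<Psi> (Xs ! k)" and ?E = "fobj \<Psi> E"
    have rX: "rmodule B (?X k)" if "k < length Xs" for k by (rule MCM_rmodule[OF Fobj[OF Xs[OF that]]])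
    have rE: "rmodule B ?E" by (rule MCM_rmodule[OF Fobj[OF E]])
    have "\<exists>a. a \<in> mod_hom B (?X k) ?E \<and> farr \<Psi> (\<iota> k) = stable_class B (?X k) ?E a" if "k < length Xs" for k
      using Fhom[OF Xs[OF that] E] h that by blast
    then obtain i where i: "\<And>k. k < length Xs \<Longrightarrow> i k \<in> mod_hom B (?X k) ?E"
      "\<And>k. k < length Xs \<Longrightarrow> farr \<Psi> (\<iota> k) = stable_class B (?X k) ?E (i k)" by metis
    have "\<exists>a. a \<in> mod_hom B ?E (?X k) \<and> farr \<Psi> (\<pi> k) = stable_class B ?E (?X k) a" if "k < length Xs" for k
      using Fhom[OF E Xs[OF that]] h that by blast
    then obtain p where p: "\<And>k. k < length Xs \<Longrightarrow> p k \<in> mod_hom B ?E (?X k)"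
      "\<And>k. k < length Xs \<Longrightarrow> farr \<Psi> (\<pi> k) = stable_class B ?E (?X k) (p k)" by metis
    have comp: "farr \<Psi> (stable_comp A (\<pi> j) (\<iota> k)) = stable_class B (?X k) (?X j) (p j \<circ> i k)"
      if j: "j < length Xs" and k: "k < length Xs" for j k
    proof -
      have "farr \<Psi> (stable_comp A (\<pi> j) (\<iota> k)) = stable_comp B (farr \<Psi> (\<pi> j)) (farr \<Psi> (\<iota> k))"
        by (rule Fcomp[OF Xs[OF k] E Xs[OF j]]) (use h j k in simp_all)
      also have "\<dots> = stable_class B (?X k) (?X j) (p j \<circ> i k)"
        unfolding i(2)[OF k] p(2)[OF j] by (rule B.stable_comp_class[OF rX[OF k] rE rX[OF j] i(1)[OF k] p(1)[OF j]])
      finally show ?thesis .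
    qed
    have pi: "stably_eq B (?X k) (?X k) (p k \<circ> i k) id" if k: "k < length Xs" for k
    proof -
      have "stable_class B (?X k) (?X k) (p k \<circ> i k) = stable_class B (?X k) (?X k) id"
        using comp[OF k k] h k Fid[OF Xs[OF k]] by simp
      then show ?thesis
        by (rule iffD1[OF B.stable_class_eq_iff[OF rX[OF k] rX[OF k] mod_hom_comp[OF i(1)[OF k] p(1)[OF k]] mod_hom_id]])
    qed
    have orth: "p j \<circ> i k \<in> triv_maps B (?X k) (?X j)" if j: "j < length Xs" and k: "k < length Xs" and "j \<noteq> k" for j k
      by (rule Fnull[OF Xs[OF k] Xs[OF j] mod_hom_comp[OF i(1)[OF k] p(1)[OF j]]])
        (use comp[OF j k] o j k \<open>j \<noteq> k\<close> in simp)
    \<comment> \<open>The composite g f is stably the identity of the image of E, so inserting it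
      does not change the composites of projections and inclusions, which now pass through
      N.\<close>
    have retr: "stably_eq B (?X k) (?X j) ((p j \<circ> g) \<circ> (f \<circ> i k)) (p j \<circ> i k)"
      if j: "j < length Xs" and k: "k < length Xs" for j k
    proof -
      interpret EE: rmodule2 B ?E ?E using rE by (simp add: rmodule2_def)
      interpret EX: rmodule2 B ?E "?X j" using rE rX[OF j] by (simp add: rmodule2_def)
      have "stably_eq B ?E (?X j) (p j \<circ> (g \<circ> f)) (p j \<circ> id)"
        by (rule EE.stably_eq_comp_left[OF mod_hom_comp[OF f(1,2)] mod_hom_id p(1)[OF j] rX[OF j] f(3)])
      then have "stably_eq B (?X k) (?X j) (p j \<circ> (g \<circ> f) \<circ> i k) (p j \<circ> id \<circ> i k)"
        by (rule EX.stably_eq_comp_right[OF i(1)[OF k]])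
      then show ?thesis by (simp add: o_assoc)
    qed
    let ?D = "functor_ker (stable_CM A) (stable_CM B) \<Psi>"
    let ?K = "{k. k < length Xs \<and> Xs ! k \<notin> ?D}"
    have I: "f \<circ> i k \<in> mod_hom B (?X k) N" and P: "p k \<circ> g \<in> mod_hom B N (?X k)" if "k < length Xs" for k
      by (rule mod_hom_comp[OF i(1)[OF that] f(1)] mod_hom_comp[OF f(2) p(1)[OF that]])+
    have PI: "stably_eq B (?X k) (?X k) ((p k \<circ> g) \<circ> (f \<circ> i k)) id" if k: "k < length Xs" for k
    proof -
      interpret XX: rmodule2 B "?X k" "?X k" using rX[OF k] by (simp add: rmodule2_def)
      show ?thesis
        by (rule XX.stably_eq_trans[OF mod_hom_comp[OF I[OF k] P[OF k]] mod_hom_comp[OF i(1)[OF k] p(1)[OF k]]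
              mod_hom_id retr[OF k k] pi[OF k]])
    qed
    have PI0: "(p j \<circ> g) \<circ> (f \<circ> i k) \<in> triv_maps B (?X k) (?X j)"
      if j: "j < length Xs" and k: "k < length Xs" and jk: "j \<noteq> k" for j k
    proof -
      interpret XX: rmodule2 B "?X k" "?X j" using rX[OF k] rX[OF j] by (simp add: rmodule2_def)
      note u = mod_hom_comp[OF I[OF k] P[OF j]] and u' = mod_hom_comp[OF i(1)[OF k] p(1)[OF j]]
      have "stably_eq B (?X k) (?X j) (p j \<circ> i k) (\<lambda>_. \<zero>\<^bsub>?X j\<^esub>)"
        using XX.stably_eq_zero_iff[OF u'] orth[OF j k jk] by simp
      then have "stably_eq B (?X k) (?X j) ((p j \<circ> g) \<circ> (f \<circ> i k)) (\<lambda>_. \<zero>\<^bsub>?X j\<^esub>)"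
        by (rule XX.stably_eq_trans[OF u u' rmodule.mod_hom_null[OF rX[OF j]] retr[OF j k]])
      then show ?thesis using XX.stably_eq_zero_iff[OF u] by simp
    qed
    have nt: "id \<notin> triv_maps B (?X k) (?X k)" if "k < length Xs" "Xs ! k \<notin> ?D" for k
      using that Xs[OF that(1)] Fobj[OF Xs[OF that(1)]] unfolding functor_ker_def B.zero_object_iff by simp
    have "finite ?K \<and>
      (\<forall>k\<in>?K. rmodule B (?X k) \<and> f \<circ> i k \<in> mod_hom B (?X k) N \<and> p k \<circ> g \<in> mod_hom B N (?X k) \<and>
        stably_eq B (?X k) (?X k) ((p k \<circ> g) \<circ> (f \<circ> i k)) id \<and> id \<notin> triv_maps B (?X k) (?X k)) \<and>
      (\<forall>j\<in>?K. \<forall>k\<in>?K. j \<noteq> k \<longrightarrow> (p j \<circ> g) \<circ> (f \<circ> i k) \<in> triv_maps B (?X k) (?X j))"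
    proof (intro conjI ballI impI)
      fix k assume "k \<in> ?K"
      then have k: "k < length Xs" "Xs ! k \<notin> ?D" by simp_all
      show "rmodule B (?X k)" "f \<circ> i k \<in> mod_hom B (?X k) N" "p k \<circ> g \<in> mod_hom B N (?X k)"
        "stably_eq B (?X k) (?X k) ((p k \<circ> g) \<circ> (f \<circ> i k)) id" "id \<notin> triv_maps B (?X k) (?X k)"
        by (rule rX[OF k(1)] I[OF k(1)] P[OF k(1)] PI[OF k(1)] nt[OF k])+
    next
      fix j k assume "j \<in> ?K" "k \<in> ?K" and jk: "j \<noteq> k"
      then have "j < length Xs" "k < length Xs" by simp_all
      then show "(p j \<circ> g) \<circ> (f \<circ> i k) \<in> triv_maps B (?X k) (?X j)" by (rule PI0[OF _ _ jk])
    qed simp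
    then show "card ?K \<le> n" by (rule mp[OF n[THEN spec, THEN spec, THEN spec, THEN spec]])
  qed
qed

text \<open>Positions in the expanded list are counted instead of distinct objects; this keeps the
  multiplicities and matches the index sets of
  \<open>summands_outside_kernel_bounded\<close>.\<close>

lemma decomposition_count:
  "(\<Sum>(X, a)\<leftarrow>ms. if X \<in> D then 0 else a) =
    card {k. k < length (concat (map (\<lambda>(X, a). replicate a X) ms)) \<and>
      concat (map (\<lambda>(X, a). replicate a X) ms) ! k \<notin> D}"
proof -
  have "(\<Sum>(X, a)\<leftarrow>ms. if X \<in> D then 0 else a) =
    length (filter (\<lambda>X. X \<notin> D) (concat (map (\<lambda>(X, a). replicate a X) ms)))"
    by (induction ms) auto
  then show ?thesis unfolding length_filter_conv_card .
qed

text \<open>The second argument of the maximum is the junk value of \<open>alpha\<close> at an object that has no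
  decomposition.\<close>

lemma alpha_le:
  assumes "\<And>ms. decomposition C M ms \<Longrightarrow> (\<Sum>(X, a)\<leftarrow>ms. if X \<in> D then 0 else a) \<le> n"
  shows "alpha C D M \<le> max n (SOME n. False)"
proof (cases "\<exists>ms. decomposition C M ms")
  case True
  then have "\<exists>k ms. decomposition C M ms \<and> k = (\<Sum>(X, a)\<leftarrow>ms. if X \<in> D then 0 else a)" by blast
  then have "\<exists>ms. decomposition C M ms \<and> alpha C D M = (\<Sum>(X, a)\<leftarrow>ms. if X \<in> D then 0 else a)"
    unfolding alpha_def by (rule someI_ex)
  then have "alpha C D M \<le> n" using assms by auto
  then show ?thesis by simp
next
  case False
  then show ?thesis by (simp add: alpha_def)
qed

theorem theorem1p10:
  fixes A :: "('a, 'r) ring_scheme" and B :: "('b, 's) ring_scheme"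
    and \<Psi> :: "('a umod, 'a stable_arr, 'b umod, 'b stable_arr) tri_functor"
  assumes "gorenstein_local_ring A" and "henselian A"
    and "gorenstein_local_ring B"
    and "triangulated_functor (stable_CM A) (stable_CM B) \<Psi>"
    and "proper_thick (stable_CM A) (functor_ker (stable_CM A) (stable_CM B) \<Psi>)"
  shows "rigid_pair (stable_CM A) (functor_ker (stable_CM A) (stable_CM B) \<Psi>)"
proof -
  let ?A = "stable_CM A" and ?B = "stable_CM B"
  let ?D = "functor_ker ?A ?B \<Psi>"
  have A: "noetherian_local A" using assms(1) by (simp add: gorenstein_local_ring_def noetherian_local_def)
  obtain n I \<epsilon> d r where B: "top_degree B n I \<epsilon> d r" using gorenstein_top_degree[OF assms(3)] by blast
  then interpret B: top_degree B n I \<epsilon> d r .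
  have tri: "(fobj \<Psi> X, fobj \<Psi> Y, fobj \<Psi> Z, farr \<Psi> u, farr \<Psi> v, Comp ?B (fshift \<Psi> X) (farr \<Psi> w))
      \<in> distinguished_triangles B" if "(X, Y, Z, u, v, w) \<in> Tri ?A" for X Y Z u v w
  proof -
    have "\<forall>(X, Y, Z, u, v, w)\<in>Tri ?A.
      (fobj \<Psi> X, fobj \<Psi> Y, fobj \<Psi> Z, farr \<Psi> u, farr \<Psi> v, Comp ?B (fshift \<Psi> X) (farr \<Psi> w)) \<in> Tri ?B"
      using assms(4) unfolding triangulated_functor_def by (elim conjE)
    from bspec[OF this that] show ?thesis by simp
  qed
  have ker: "id \<in> triv_maps B (fobj \<Psi> N) (fobj \<Psi> N)" if "N \<in> ?D" for N
    using that unfolding functor_ker_def B.zero_object_iff by simp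
  show ?thesis
    unfolding rigid_pair_def
  proof (intro conjI ballI)
    fix M assume "M \<in> Obj ?A"
    then have "MCM B (fobj \<Psi> M)" using assms(4) by (simp add: triangulated_functor_def)
    \<comment> \<open>The number n depends on the image of M only, so it serves all triangles of
      both collections.\<close>
    from summands_outside_kernel_bounded[OF A B.noetherian_local_axioms assms(4) this]
    obtain n where n: "\<forall>E Xs. direct_sum ?A Xs E \<and> stable_retract B (fobj \<Psi> E) (fobj \<Psi> M) \<longrightarrow>
      card {k. k < length Xs \<and> Xs ! k \<notin> ?D} \<le> n" by (rule exE)
    let ?b = "max n (SOME n. False)"
    have bound: "alpha ?A ?D E \<le> ?b" if r: "stable_retract B (fobj \<Psi> E) (fobj \<Psi> M)" for E
    proof (rule alpha_le)
      fix ms assume "decomposition ?A E ms"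
      then have "direct_sum ?A (concat (map (\<lambda>(X, a). replicate a X) ms)) E" unfolding decomposition_def by (elim conjE)
      then show "(\<Sum>(X, a)\<leftarrow>ms. if X \<in> ?D then 0 else a) \<le> n"
        unfolding decomposition_count using n r by blast
    qed
    have "r0 ?A ?D M \<le> enat ?b"
      unfolding r0_def
    proof (rule SUP_least)
      fix t assume "t \<in> r_triangles ?A ?D M"
      then obtain N E u v w where t: "t = (N, E, M, u, v, w)" "(N, E, M, u, v, w) \<in> Tri ?A" "N \<in> ?D"
        unfolding r_triangles_def by blast
      \<comment> \<open>The first vertex N is sent to zero, so the image of E is a stable retract of
        the image of the third vertex M.\<close>
      have "alpha ?A ?D E \<le> ?b"
        by (rule bound[OF B.distinguished_triangle_retract(1)[OF tri[OF t(2)] ker[OF t(3)]]])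
      then show "enat (alpha_tri ?A ?D t) \<le> enat ?b" unfolding t(1) alpha_tri_def by simp
    qed
    then show "r0 ?A ?D M \<noteq> \<infinity>" by (auto dest: enat_ile)
    have "l0 ?A ?D M \<le> enat ?b"
      unfolding l0_def
    proof (rule SUP_least)
      fix t assume "t \<in> l_triangles ?A ?D M"
      then obtain N E u v w where t: "t = (M, E, N, u, v, w)" "(M, E, N, u, v, w) \<in> Tri ?A" "N \<in> ?D"
        unfolding l_triangles_def by blast
      \<comment> \<open>Here the third vertex N is sent to zero, and the image of E is a stable
        retract of the image of the first vertex M.\<close>
      have "alpha ?A ?D E \<le> ?b"
        by (rule bound[OF B.distinguished_triangle_retract(2)[OF tri[OF t(2)] ker[OF t(3)]]])
      then show "enat (alpha_tri ?A ?D t) \<le> enat ?b" unfolding t(1) alpha_tri_def by simp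
    qed
    then show "l0 ?A ?D M \<noteq> \<infinity>" by (auto dest: enat_ile)
  qed (rule assms(5))
qed

end
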